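(* Let $R$ be a Gorenstein local ring with $\dim R=1$, let $I$ be an ideal containing a regular element, and set $S=\operatorname{End}_R(I)$. Then \[ \lambda_R(\operatorname{Ext}_R^1(I,I)) + \lambda_R(R/I) = \lambda_R(S/R)+\lambda_R\big((I/I^2)\otimes_{R/I} \omega_{R/I}\big). \] In particular, the following are equivalent: (a) $I$ is rigid; (b) $\lambda_R(R/I) - \lambda_R(S/R) = \lambda_R\big((I/I^2)\otimes_{R/I}\omega_{R/I}\big)$; (c) $\lambda_R\big(\operatorname{tr}_R(I)/I\big) = \lambda_R\big((I/I^2)\otimes_R\omega_{R/I}\big)$.
   Context: Local rings are commutative and Noetherian. $\lambda_R(M)$ denotes the length of an $R$-module $M$. An $R$-module $M$ is rigid if $\operatorname{Ext}^1_R(M,M)=0$. The ring $S=\operatorname{End}_R(I)$ is identified with the subring $\{\alpha\in Q(R)\mid \alpha I\subseteq I\}$ of the total ring of fractions $Q(R)$ of $R$; it contains $R$. $\omega_{R/I}=\operatorname{Ext}^1_R(R/I,R)$ is the canonical module of $R/I$. The trace $\operatorname{tr}_R(I)$ is the ideal of $R$ that is the image of the canonical map $I^*\otimes_R I\to R$, $f\otimes x\mapsto f(x)$, where $I^*=\operatorname{Hom}_R(I,R)$. *)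

theory Defs
  imports
    "HOL-Algebra.Module"
    "HOL-Algebra.QuotRing"
    "HOL-Algebra.Ideal_Product"
    "HOL-Algebra.Ring_Divisibility"
    "HOL-Library.Extended_Nat"
    "HOL-Library.Extended_Real"
begin

text \<open>
  A module is a record of type \<open>('a, 'm) module\<close>; its inherited fields \<open>mult\<close> and \<open>one\<close> are
  not part of the module structure and may be \<open>undefined\<close>.
\<close>

section \<open>Linear maps, quotients, free modules, tensor products\<close>

definition ring_module :: "('a, 'r) ring_scheme \<Rightarrow> ('a, 'a) module" where
  "ring_module R = \<lparr>carrier = carrier R, monoid.mult = monoid.mult R, one = one R,
     zero = zero R, add = add R, smult = monoid.mult R\<rparr>"

definition ideal_module :: "('a, 'r) ring_scheme \<Rightarrow> 'a set \<Rightarrow> ('a, 'a) module" where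
  "ideal_module R I = (ring_module R)\<lparr>carrier := I\<rparr>"

definition lin_maps ::
    "('a, 'r) ring_scheme \<Rightarrow> ('a, 'm) module \<Rightarrow> ('a, 'n) module \<Rightarrow> ('m \<Rightarrow> 'n) set" where
  "lin_maps R M N = {f \<in> carrier M \<rightarrow>\<^sub>E carrier N.
     (\<forall>x\<in>carrier M. \<forall>y\<in>carrier M. f (x \<oplus>\<^bsub>M\<^esub> y) = f x \<oplus>\<^bsub>N\<^esub> f y) \<and>
     (\<forall>a\<in>carrier R. \<forall>x\<in>carrier M. f (a \<odot>\<^bsub>M\<^esub> x) = a \<odot>\<^bsub>N\<^esub> f x)}"

definition hom_module ::
    "('a, 'r) ring_scheme \<Rightarrow> ('a, 'm) module \<Rightarrow> ('a, 'n) module \<Rightarrow> ('a, 'm \<Rightarrow> 'n) module" where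
  "hom_module R M N = \<lparr>carrier = lin_maps R M N, monoid.mult = undefined, one = undefined,
     zero = (\<lambda>x\<in>carrier M. \<zero>\<^bsub>N\<^esub>),
     add = (\<lambda>f g. \<lambda>x\<in>carrier M. f x \<oplus>\<^bsub>N\<^esub> g x),
     smult = (\<lambda>a f. \<lambda>x\<in>carrier M. a \<odot>\<^bsub>N\<^esub> f x)\<rparr>"

definition quot_module :: "('a, 'm) module \<Rightarrow> 'm set \<Rightarrow> ('a, 'm set) module" where
  "quot_module M H = \<lparr>carrier = a_rcosets\<^bsub>M\<^esub> H, monoid.mult = undefined, one = undefined,
     zero = H,
     add = set_add M,
     smult = (\<lambda>a X. \<Union>x\<in>X. H +>\<^bsub>M\<^esub> (a \<odot>\<^bsub>M\<^esub> x))\<rparr>"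

definition span_module :: "('a, 'r) ring_scheme \<Rightarrow> ('a, 'm) module \<Rightarrow> 'm set \<Rightarrow> 'm set" where
  "span_module R M A = \<Inter>{H. submodule H R M \<and> A \<subseteq> H}"

definition free_module :: "('a, 'r) ring_scheme \<Rightarrow> 'x set \<Rightarrow> ('a, 'x \<Rightarrow> 'a) module" where
  "free_module R X = \<lparr>carrier = {\<phi>. (\<forall>x\<in>X. \<phi> x \<in> carrier R) \<and> (\<forall>x. x \<notin> X \<longrightarrow> \<phi> x = \<zero>\<^bsub>R\<^esub>) \<and>
        finite {x. \<phi> x \<noteq> \<zero>\<^bsub>R\<^esub>}},
     monoid.mult = undefined, one = undefined,
     zero = (\<lambda>x. \<zero>\<^bsub>R\<^esub>),
     add = (\<lambda>\<phi> \<psi> x. \<phi> x \<oplus>\<^bsub>R\<^esub> \<psi> x),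
     smult = (\<lambda>a \<phi> x. a \<otimes>\<^bsub>R\<^esub> \<phi> x)\<rparr>"

definition free_gen :: "('a, 'r) ring_scheme \<Rightarrow> 'x \<Rightarrow> 'x \<Rightarrow> 'a" where
  "free_gen R x = (\<lambda>y. if y = x then \<one>\<^bsub>R\<^esub> else \<zero>\<^bsub>R\<^esub>)"

text \<open>The linear map from the free module to \<open>P\<close> that sends the generator \<open>x\<close> to \<open>g x\<close>.\<close>

definition free_lift ::
    "('a, 'r) ring_scheme \<Rightarrow> ('a, 'p) module \<Rightarrow> ('x \<Rightarrow> 'p) \<Rightarrow> ('x \<Rightarrow> 'a) \<Rightarrow> 'p" where
  "free_lift R P g \<phi> = (\<Oplus>\<^bsub>P\<^esub>x\<in>{x. \<phi> x \<noteq> \<zero>\<^bsub>R\<^esub>}. \<phi> x \<odot>\<^bsub>P\<^esub> g x)"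

definition tensor_relations ::
    "('a, 'r) ring_scheme \<Rightarrow> ('a, 'm) module \<Rightarrow> ('a, 'n) module \<Rightarrow> ('m \<times> 'n \<Rightarrow> 'a) set" where
  "tensor_relations R M N = (let F = free_module R (carrier M \<times> carrier N); e = free_gen R in
     {e (x \<oplus>\<^bsub>M\<^esub> x', y) \<ominus>\<^bsub>F\<^esub> (e (x, y) \<oplus>\<^bsub>F\<^esub> e (x', y)) | x x' y.
        x \<in> carrier M \<and> x' \<in> carrier M \<and> y \<in> carrier N} \<union>
     {e (x, y \<oplus>\<^bsub>N\<^esub> y') \<ominus>\<^bsub>F\<^esub> (e (x, y) \<oplus>\<^bsub>F\<^esub> e (x, y')) | x y y'.
        x \<in> carrier M \<and> y \<in> carrier N \<and> y' \<in> carrier N} \<union>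
     {e (a \<odot>\<^bsub>M\<^esub> x, y) \<ominus>\<^bsub>F\<^esub> a \<odot>\<^bsub>F\<^esub> e (x, y) | a x y.
        a \<in> carrier R \<and> x \<in> carrier M \<and> y \<in> carrier N} \<union>
     {e (x, a \<odot>\<^bsub>N\<^esub> y) \<ominus>\<^bsub>F\<^esub> a \<odot>\<^bsub>F\<^esub> e (x, y) | a x y.
        a \<in> carrier R \<and> x \<in> carrier M \<and> y \<in> carrier N})"

definition tensor_module ::
    "('a, 'r) ring_scheme \<Rightarrow> ('a, 'm) module \<Rightarrow> ('a, 'n) module \<Rightarrow> ('a, ('m \<times> 'n \<Rightarrow> 'a) set) module"
  where
  "tensor_module R M N = (let F = free_module R (carrier M \<times> carrier N) in
     quot_module F (span_module R F (tensor_relations R M N)))"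

text \<open>
  The map \<open>M \<otimes> N \<rightarrow> P\<close> induced by a bilinear \<open>g\<close>. An element of the tensor product is a coset \<open>X\<close>,
  on which the lift of a bilinear \<open>g\<close> is constant.
\<close>

definition tensor_lift ::
    "('a, 'r) ring_scheme \<Rightarrow> ('a, 'p) module \<Rightarrow> ('m \<times> 'n \<Rightarrow> 'p) \<Rightarrow> ('m \<times> 'n \<Rightarrow> 'a) set \<Rightarrow> 'p" where
  "tensor_lift R P g X = the_elem (free_lift R P g ` X)"


section \<open>Change of rings along the projection onto a quotient ring\<close>

text \<open>
  For an \<open>R\<close>-module \<open>M\<close> with \<open>I M = 0\<close>: the same abelian group as a module over \<open>R Quot I\<close>. Scalars
  are cosets of \<open>I\<close>, and the action does not depend on the chosen representative.
\<close>

definition over_quotient :: "('a, 'm) module \<Rightarrow> ('a set, 'm) module" where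
  "over_quotient M = \<lparr>carrier = carrier M, monoid.mult = monoid.mult M, one = one M,
     zero = zero M, add = add M,
     smult = (\<lambda>X m. (SOME a. a \<in> X) \<odot>\<^bsub>M\<^esub> m)\<rparr>"

definition restrict_scalars :: "('a \<Rightarrow> 'b) \<Rightarrow> ('b, 'm) module \<Rightarrow> ('a, 'm) module" where
  "restrict_scalars h M = \<lparr>carrier = carrier M, monoid.mult = monoid.mult M, one = one M, zero = zero M,
     add = add M, smult = (\<lambda>a m. h a \<odot>\<^bsub>M\<^esub> m)\<rparr>"


section \<open>Length and Krull dimension\<close>

definition module_length :: "('a, 'r) ring_scheme \<Rightarrow> ('a, 'm) module \<Rightarrow> enat" where
  "module_length R M = Sup {enat n | n. \<exists>N :: nat \<Rightarrow> 'm set.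
     (\<forall>i\<le>n. submodule (N i) R M) \<and> (\<forall>i<n. N i \<subset> N (Suc i))}"

definition krull_dim :: "('a, 'r) ring_scheme \<Rightarrow> enat" where
  "krull_dim R = Sup {enat n | n. \<exists>P :: nat \<Rightarrow> 'a set.
     (\<forall>i\<le>n. primeideal (P i) R) \<and> (\<forall>i<n. P i \<subset> P (Suc i))}"


section \<open>Ext and rigid modules\<close>

text \<open>
  For the canonical free cover \<open>0 \<rightarrow> K \<rightarrow> F \<rightarrow> M \<rightarrow> 0\<close>, where \<open>F\<close> is free on the underlying set of \<open>M\<close>,
  \<open>Ext\<^sup>1(M, N)\<close> is the cokernel of the restriction map \<open>Hom(F, N) \<rightarrow> Hom(K, N)\<close>.
\<close>

definition ext1 ::
    "('a, 'r) ring_scheme \<Rightarrow> ('a, 'm) module \<Rightarrow> ('a, 'n) module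
      \<Rightarrow> ('a, (('m \<Rightarrow> 'a) \<Rightarrow> 'n) set) module" where
  "ext1 R M N = (let F = free_module R (carrier M);
       K = {\<phi> \<in> carrier F. free_lift R M (\<lambda>x. x) \<phi> = \<zero>\<^bsub>M\<^esub>} in
     quot_module (hom_module R (F\<lparr>carrier := K\<rparr>) N) ((\<lambda>f. restrict f K) ` lin_maps R F N))"

definition rigid_module :: "('a, 'r) ring_scheme \<Rightarrow> ('a, 'm) module \<Rightarrow> bool" where
  "rigid_module R M \<longleftrightarrow> carrier (ext1 R M M) = {\<zero>\<^bsub>ext1 R M M\<^esub>}"


section \<open>Gorenstein local rings\<close>

definition noetherian_local_ring :: "('a, 'r) ring_scheme \<Rightarrow> bool" where
  "noetherian_local_ring R \<longleftrightarrow> cring R \<and> noetherian_ring R \<and> (\<exists>!m. maximalideal m R)"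

text \<open>
  HOL cannot quantify over all modules \<open>B\<close> on all types. Test modules on the element type of \<open>R\<close>
  suffice: they include \<open>R\<close> itself with all its ideals as submodules, so Baer's criterion applies.
\<close>

definition injective_module :: "('a, 'r) ring_scheme \<Rightarrow> ('a, 'e) module \<Rightarrow> bool" where
  "injective_module R E \<longleftrightarrow> module R E \<and>
     (\<forall>(B :: ('a, 'a) module) A. module R B \<and> submodule A R B \<longrightarrow>
        (\<forall>f \<in> lin_maps R (B\<lparr>carrier := A\<rparr>) E. \<exists>g \<in> lin_maps R B E. \<forall>x\<in>A. g x = f x))"

definition injective_resolution ::
    "('a, 'r) ring_scheme \<Rightarrow> ('a, 'm) module \<Rightarrow> (nat \<Rightarrow> ('a, 'e) module) \<Rightarrow> ('m \<Rightarrow> 'e)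
      \<Rightarrow> (nat \<Rightarrow> 'e \<Rightarrow> 'e) \<Rightarrow> bool" where
  "injective_resolution R M E \<epsilon> d \<longleftrightarrow>
     (\<forall>i. injective_module R (E i)) \<and>
     \<epsilon> \<in> lin_maps R M (E 0) \<and> inj_on \<epsilon> (carrier M) \<and>
     (\<forall>i. d i \<in> lin_maps R (E i) (E (Suc i))) \<and>
     \<epsilon> ` carrier M = {x \<in> carrier (E 0). d 0 x = \<zero>\<^bsub>E (Suc 0)\<^esub>} \<and>
     (\<forall>i. d i ` carrier (E i) =
        {x \<in> carrier (E (Suc i)). d (Suc i) x = \<zero>\<^bsub>E (Suc (Suc i))\<^esub>})"

text \<open>
  The type argument is the type on which the terms of the resolution live. As a hypothesis of a
  theorem with \<open>'e\<close> a free type variable, this says that there is a finite injective resolution on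
  some type, that is, that the injective dimension is finite.
\<close>

definition finite_injective_dim ::
    "'e itself \<Rightarrow> ('a, 'r) ring_scheme \<Rightarrow> ('a, 'm) module \<Rightarrow> bool" where
  "finite_injective_dim T R M \<longleftrightarrow>
     (\<exists>(E :: nat \<Rightarrow> ('a, 'e) module) \<epsilon> d n. injective_resolution R M E \<epsilon> d \<and>
        (\<forall>i>n. carrier (E i) = {\<zero>\<^bsub>E i\<^esub>}))"

definition gorenstein_local_ring :: "'e itself \<Rightarrow> ('a, 'r) ring_scheme \<Rightarrow> bool" where
  "gorenstein_local_ring T R \<longleftrightarrow>
     noetherian_local_ring R \<and> finite_injective_dim T R (ring_module R)"


section \<open>Modules attached to an ideal\<close>

definition regular_element :: "('a, 'r) ring_scheme \<Rightarrow> 'a \<Rightarrow> bool" where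
  "regular_element R x \<longleftrightarrow> x \<in> carrier R \<and> (\<forall>y\<in>carrier R. x \<otimes>\<^bsub>R\<^esub> y = \<zero>\<^bsub>R\<^esub> \<longrightarrow> y = \<zero>\<^bsub>R\<^esub>)"

text \<open>
  \<open>S/R\<close> for \<open>S = End(I)\<close>. When \<open>S\<close> is identified with the elements \<open>\<alpha>\<close> of the total ring of fractions
  such that \<open>\<alpha> I \<subseteq> I\<close>, each \<open>\<alpha>\<close> corresponds to multiplication by \<open>\<alpha>\<close> on \<open>I\<close>, so the subring \<open>R\<close>
  corresponds to the homotheties.
\<close>

definition end_module :: "('a, 'r) ring_scheme \<Rightarrow> 'a set \<Rightarrow> ('a, 'a \<Rightarrow> 'a) module" where
  "end_module R I = hom_module R (ideal_module R I) (ideal_module R I)"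

definition homotheties :: "('a, 'r) ring_scheme \<Rightarrow> 'a set \<Rightarrow> ('a \<Rightarrow> 'a) set" where
  "homotheties R I = (\<lambda>a. \<lambda>x\<in>I. a \<otimes>\<^bsub>R\<^esub> x) ` carrier R"

definition end_mod_base :: "('a, 'r) ring_scheme \<Rightarrow> 'a set \<Rightarrow> ('a, ('a \<Rightarrow> 'a) set) module" where
  "end_mod_base R I = quot_module (end_module R I) (homotheties R I)"

definition residue_module :: "('a, 'r) ring_scheme \<Rightarrow> 'a set \<Rightarrow> ('a, 'a set) module" where
  "residue_module R I = quot_module (ring_module R) I"

definition conormal_module :: "('a, 'r) ring_scheme \<Rightarrow> 'a set \<Rightarrow> ('a, 'a set) module" where
  "conormal_module R I = quot_module (ideal_module R I) (ideal_prod R I I)"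

definition canonical_module ::
    "('a, 'r) ring_scheme \<Rightarrow> 'a set \<Rightarrow> ('a, (('a set \<Rightarrow> 'a) \<Rightarrow> 'a) set) module" where
  "canonical_module R I = ext1 R (residue_module R I) (ring_module R)"

text \<open>\<open>(I/I\<^sup>2) \<otimes>\<^bsub>R/I\<^esub> \<omega>\<^bsub>R/I\<^esub>\<close>, as an \<open>R\<close>-module.\<close>

definition conormal_tensor_canonical ::
    "('a, 'r) ring_scheme \<Rightarrow> 'a set
      \<Rightarrow> ('a, ('a set \<times> (('a set \<Rightarrow> 'a) \<Rightarrow> 'a) set \<Rightarrow> 'a set) set) module" where
  "conormal_tensor_canonical R I = restrict_scalars (\<lambda>a. I +>\<^bsub>R\<^esub> a)
     (tensor_module (R Quot I)
       (over_quotient (conormal_module R I)) (over_quotient (canonical_module R I)))"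

definition trace_ideal :: "('a, 'r) ring_scheme \<Rightarrow> 'a set \<Rightarrow> 'a set" where
  "trace_ideal R I = tensor_lift R (ring_module R) (\<lambda>(f, x). f x) `
     carrier (tensor_module R (hom_module R (ideal_module R I) (ring_module R)) (ideal_module R I))"

end

theory Submission imports Defs begin

text \<open>
  Fix a regular element x of I. All lengths in question turn out to be lengths of subquotients of
  R or of the module of all maps from I to R, and so lengths of intervals of submodules there
  (\<open>len\<close>); they add up along chains (\<open>len_add\<close>) and are carried along linear maps
  (\<open>len_transfer\<close>). Sending a to the map that takes i to ai/x identifies I' = (xR : I)
  with the dual of I. The ring R then becomes xR, and S becomes S' = (xI : I).

  Duality is the main tool. Since R has finite injective dimension and dimension one, shifting
  dimensions along an injective resolution shows that R/yR is injective over itself for every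
  regular element y (\<open>self_injective_of_resolution\<close>). Hence R/J and (yR : J)/yR have the same length
  if y lies in J (\<open>dual_len\<close>), and more generally a finitely generated module killed by y has the
  same length as its module of maps into R/yR (\<open>dual_len_module\<close>).

  Since Ext^1(I, R) vanishes, Ext^1(I, I) is the cokernel of the map from Hom(I, R) to Hom(I, R/I), and
  the kernel of that map is S. So the length of Hom(I, R/I) is that of Ext^1(I, I) plus that of I'/S'
  (\<open>len_ext1_self\<close>, \<open>len_scaled_maps\<close>). By duality I'/xR has the length of R/I, so that I'/S' accounts
  for the difference between the lengths of R/I and of S/R. It remains to see that Hom(I, R/I)
  has the length of the tensor product of the conormal and the canonical module. The canonical
  module is I'/xR (\<open>canonical_module_presentation\<close>), its module of maps into R/xR is R/I, and so by
  the adjunction between tensor products and maps Hom(I/I^2, R/I) is the dual of that tensor product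
  (\<open>tensor_length\<close>). This proves the formula.

  R/I has finite length, so the formula can be solved for the length of Ext^1(I, I), which makes
  (a) and (b) equivalent. For (c), the trace ideal is I I' divided by x, and duality with respect
  to x^2 turns I I' into S'. Hence R/tr(I) and S/R have the same length (\<open>len_trace\<close>), and the left side
  of (b) is the length of tr(I)/I.
\<close>

section \<open>Lengths of intervals of submodules\<close>

lemma enat_le_add_iff: "enat n \<le> a + b \<longleftrightarrow> (\<exists>i j. n = i + j \<and> enat i \<le> a \<and> enat j \<le> b)"
proof
  assume n: "enat n \<le> a + b"
  show "\<exists>i j. n = i + j \<and> enat i \<le> a \<and> enat j \<le> b"
  proof (cases "enat n \<le> a")
    case True
    then show ?thesis by (intro exI[of _ n] exI[of _ 0]) (simp add: zero_enat_def[symmetric])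
  next
    case False
    then obtain k where k: "a = enat k" "k \<le> n" by (cases a) auto
    with n have "enat (n - k) \<le> b" by (cases b) auto
    with k show ?thesis by (intro exI[of _ k] exI[of _ "n - k"]) simp
  qed
next
  assume "\<exists>i j. n = i + j \<and> enat i \<le> a \<and> enat j \<le> b"
  then obtain i j where "n = i + j" "enat i \<le> a" "enat j \<le> b" by blast
  then show "enat n \<le> a + b" using add_mono[of "enat i" a "enat j" b] by simp
qed

lemma enat_leI: 
  assumes "\<And>n. enat n \<le> a \<Longrightarrow> enat n \<le> b" shows "a \<le> b"
proof (cases a)
  case (enat k) then show ?thesis using assms by simp
next
  case infinity
  have "b \<noteq> enat n" for n using assms[of "Suc n"] infinity by auto
  then show ?thesis by (cases b) auto
qed

definition submodule_chain ::
    "('a, 'r) ring_scheme \<Rightarrow> ('a, 'm, 'x) module_scheme \<Rightarrow> 'm set \<Rightarrow> 'm set \<Rightarrow> nat \<Rightarrow> (nat \<Rightarrow> 'm set) \<Rightarrow> bool" where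
  "submodule_chain R M N L n P \<longleftrightarrow>
     (\<forall>i\<le>n. submodule (P i) R M \<and> N \<subseteq> P i \<and> P i \<subseteq> L) \<and> (\<forall>i<n. P i \<subset> P (Suc i))"

text \<open>The length of the module L/N, read off from chains of submodules between N and L, so that
  quotient modules need not be formed.\<close>
definition len ::
    "('a, 'r) ring_scheme \<Rightarrow> ('a, 'm, 'x) module_scheme \<Rightarrow> 'm set \<Rightarrow> 'm set \<Rightarrow> enat" where
  "len R M N L = Sup {enat n | n. \<exists>P. submodule_chain R M N L n P}"

lemma len_ge: "submodule_chain R M N L n P \<Longrightarrow> enat n \<le> len R M N L"
  unfolding len_def by (rule Sup_upper) blast

lemma submodule_chain_shorten: "submodule_chain R M N L n P \<Longrightarrow> m \<le> n \<Longrightarrow> submodule_chain R M N L m P"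
  unfolding submodule_chain_def by auto

lemma le_len_iff:
  assumes "submodule N R M" "N \<subseteq> L"
  shows "enat n \<le> len R M N L \<longleftrightarrow> (\<exists>P. submodule_chain R M N L n P)"
proof
  assume le: "enat n \<le> len R M N L"
  show "\<exists>P. submodule_chain R M N L n P"
  proof (cases n)
    case 0
    with assms have "submodule_chain R M N L n (\<lambda>_. N)" by (simp add: submodule_chain_def)
    then show ?thesis by blast
  next
    case (Suc k)
    then have "enat k < len R M N L" using le by (metis Suc_ile_eq)
    then obtain m P where "k < m" "submodule_chain R M N L m P"
      unfolding len_def less_Sup_iff by auto
    then show ?thesis using submodule_chain_shorten[of R M N L m P n] Suc by auto
  qed
qed (auto intro: len_ge)

lemma len_le_map:
  assumes "\<And>P. submodule P R A \<Longrightarrow> N \<subseteq> P \<Longrightarrow> P \<subseteq> L \<Longrightarrow> submodule (g P) S B \<and> N' \<subseteq> g P \<and> g P \<subseteq> L'"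
    and "\<And>P Q. submodule P R A \<Longrightarrow> submodule Q R A \<Longrightarrow> N \<subseteq> P \<Longrightarrow> P \<subset> Q \<Longrightarrow> Q \<subseteq> L \<Longrightarrow> g P \<subset> g Q"
  shows "len R A N L \<le> len S B N' L'"
  unfolding len_def[of R]
proof (rule Sup_least, clarify)
  fix n P assume P: "submodule_chain R A N L n P"
  have "submodule_chain S B N' L' n (\<lambda>i. g (P i))"
    unfolding submodule_chain_def
  proof (intro conjI allI impI)
    fix i assume i: "i < n"
    have "P i \<subset> P (Suc i)" "submodule (P i) R A" "submodule (P (Suc i)) R A" "N \<subseteq> P i" "P (Suc i) \<subseteq> L"
      using P i by (auto simp: submodule_chain_def)
    then show "g (P i) \<subset> g (P (Suc i))" using assms(2) by blast
  qed (use P assms(1) in \<open>auto simp: submodule_chain_def\<close>)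
  then show "enat n \<le> len S B N' L'" by (rule len_ge)
qed

lemma len_mono:
  assumes "N' \<subseteq> N" "L \<subseteq> L'" shows "len R A N L \<le> len R A N' L'"
  by (rule len_le_map[where g = "\<lambda>P. P"]) (use assms in auto)

lemma len_self: 
  assumes "submodule N R M" shows "len R M N N = 0"
proof -
  have "len R M N N \<le> 0" unfolding len_def
  proof (rule Sup_least, clarify)
    fix n P assume P: "submodule_chain R M N N n P"
    have "n = 0"
    proof (rule ccontr)
      assume "n \<noteq> 0"
      then have "0 < n" "Suc 0 \<le> n" by auto
      then have "N \<subseteq> P 0" "P (Suc 0) \<subseteq> N" "P 0 \<subset> P (Suc 0)" using P unfolding submodule_chain_def by blast+
      then show False by auto
    qed
    then show "enat n \<le> 0" by (simp add: zero_enat_def)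
  qed
  then show ?thesis by simp
qed

lemma len_strict:
  assumes "submodule N R M" "submodule X R M" "submodule Y R M" "N \<subseteq> X" "X \<subset> Y"
  shows "len R M N X + 1 \<le> len R M N Y"
proof -
  have *: "enat (Suc n) \<le> len R M N Y" if "enat n \<le> len R M N X" for n
  proof -
    from that obtain P where P: "submodule_chain R M N X n P"
      using le_len_iff[OF assms(1,4)] by blast
    have P1: "submodule (P i) R M \<and> N \<subseteq> P i \<and> P i \<subseteq> X" if "i \<le> n" for i
      using P that by (simp add: submodule_chain_def)
    have P2: "P i \<subset> P (Suc i)" if "i < n" for i
      using P that by (simp add: submodule_chain_def)
    let ?P = "\<lambda>i. if i \<le> n then P i else Y"
    have "submodule_chain R M N Y (Suc n) ?P"
      unfolding submodule_chain_def
    proof (intro conjI allI impI)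
      fix i assume "i < Suc n"
      then show "?P i \<subset> ?P (Suc i)" using P1[of n] P2[of i] assms(5)
        by (cases "i = n") auto
    next
      fix i
      show "submodule (?P i) R M" "N \<subseteq> ?P i" "?P i \<subseteq> Y" using P1[of i] assms
        by (cases "i \<le> n"; auto)+
    qed
    then show ?thesis by (rule len_ge)
  qed
  show ?thesis
  proof (rule enat_leI)
    fix n assume "enat n \<le> len R M N X + 1"
    then show "enat n \<le> len R M N Y"
    proof (cases n)
      case 0 then show ?thesis by (simp add: zero_enat_def[symmetric])
    next
      case (Suc k)
      then have "enat k \<le> len R M N X" using \<open>enat n \<le> _\<close>
        by (cases "len R M N X") (auto simp: one_enat_def)
      then show ?thesis using * Suc by simp
    qed
  qed
qed

definition cong_mod :: "('a, 'm, 'x) module_scheme \<Rightarrow> 'm set \<Rightarrow> 'm \<Rightarrow> 'm \<Rightarrow> bool" where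
  "cong_mod M N x y \<longleftrightarrow> x \<in> carrier M \<and> y \<in> carrier M \<and> x \<ominus>\<^bsub>M\<^esub> y \<in> N"

lemma (in module) smult_lcomm:
  "\<lbrakk>r \<in> carrier R; s \<in> carrier R; x \<in> carrier M\<rbrakk> \<Longrightarrow> r \<odot>\<^bsub>M\<^esub> (s \<odot>\<^bsub>M\<^esub> x) = s \<odot>\<^bsub>M\<^esub> (r \<odot>\<^bsub>M\<^esub> x)"
  by (simp add: smult_assoc1[symmetric] R.m_comm)
lemma (in module) minus_zero: "\<ominus>\<^bsub>M\<^esub> \<zero>\<^bsub>M\<^esub> = \<zero>\<^bsub>M\<^esub>"
  using M.add.inv_one by (simp add: a_inv_def)
text \<open>With these rules the decision procedure for ring identities also proves identities between
  linear combinations of module elements.\<close>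
lemmas (in module) module_simprules
  [algebra module "zero M" "add M" "a_inv M" "a_minus M" "smult M"] =
  M.a_closed M.zero_closed M.a_inv_closed M.minus_closed smult_closed
  M.a_assoc M.l_zero M.r_zero M.l_neg M.r_neg M.a_comm M.a_lcomm M.minus_eq M.r_neg1 M.r_neg2 M.minus_add M.minus_minus minus_zero
  smult_l_distr smult_r_distr smult_assoc1 smult_l_minus smult_r_minus smult_one smult_l_null smult_r_null smult_lcomm
  R.a_closed R.zero_closed R.a_inv_closed R.minus_closed R.m_closed R.one_closed R.minus_eq

context module begin

lemma submodule_zero: "submodule H R M \<Longrightarrow> \<zero>\<^bsub>M\<^esub> \<in> H"
  using subgroup.one_closed[OF submodule.axioms(1)] by fastforce

lemma submodule_minus: "submodule H R M \<Longrightarrow> x \<in> H \<Longrightarrow> y \<in> H \<Longrightarrow> x \<ominus>\<^bsub>M\<^esub> y \<in> H"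
  using submoduleE(3,5) by (simp add: a_minus_def)

lemma submoduleI2:
  assumes "H \<subseteq> carrier M" "\<zero>\<^bsub>M\<^esub> \<in> H"
    "\<And>a b. a \<in> H \<Longrightarrow> b \<in> H \<Longrightarrow> a \<oplus>\<^bsub>M\<^esub> b \<in> H"
    "\<And>a x. a \<in> carrier R \<Longrightarrow> x \<in> H \<Longrightarrow> a \<odot>\<^bsub>M\<^esub> x \<in> H"
  shows "submodule H R M"
proof (rule submoduleI)
  fix a assume "a \<in> H"
  then have "\<ominus>\<^bsub>M\<^esub> a = (\<ominus>\<^bsub>R\<^esub> \<one>\<^bsub>R\<^esub>) \<odot>\<^bsub>M\<^esub> a" using assms(1) by (auto simp: smult_l_minus)
  then show "\<ominus>\<^bsub>M\<^esub> a \<in> H" using assms(4) \<open>a \<in> H\<close> by simp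
qed (use assms in auto)

lemma zero_submodule: "submodule {\<zero>\<^bsub>M\<^esub>} R M"
  by (rule submoduleI2) auto

lemma submodule_inter: "submodule H R M \<Longrightarrow> submodule K R M \<Longrightarrow> submodule (H \<inter> K) R M"
  by (rule submoduleI2) (auto dest: submoduleE(1,4,5) submodule_zero)

lemma mem_set_add: "x \<in> H <+>\<^bsub>M\<^esub> K \<longleftrightarrow> (\<exists>h\<in>H. \<exists>k\<in>K. x = h \<oplus>\<^bsub>M\<^esub> k)"
  by (auto simp: set_add_def')

lemma submodule_add:
  assumes H: "submodule H R M" and K: "submodule K R M"
  shows "submodule (H <+>\<^bsub>M\<^esub> K) R M"
proof -
  have c: "H \<subseteq> carrier M" "K \<subseteq> carrier M" using assms submoduleE by auto
  show ?thesis
  proof (rule submoduleI2)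
    show "H <+>\<^bsub>M\<^esub> K \<subseteq> carrier M" using c by (auto simp: set_add_def')
    have "\<zero>\<^bsub>M\<^esub> = \<zero>\<^bsub>M\<^esub> \<oplus>\<^bsub>M\<^esub> \<zero>\<^bsub>M\<^esub>" by simp
    then show "\<zero>\<^bsub>M\<^esub> \<in> H <+>\<^bsub>M\<^esub> K" unfolding mem_set_add using submodule_zero assms by blast
  next
    fix a b assume "a \<in> H <+>\<^bsub>M\<^esub> K" "b \<in> H <+>\<^bsub>M\<^esub> K"
    then obtain h k h' k' where *: "h \<in> H" "k \<in> K" "h' \<in> H" "k' \<in> K"
      "a = h \<oplus>\<^bsub>M\<^esub> k" "b = h' \<oplus>\<^bsub>M\<^esub> k'" unfolding mem_set_add by blast
    then have "a \<oplus>\<^bsub>M\<^esub> b = (h \<oplus>\<^bsub>M\<^esub> h') \<oplus>\<^bsub>M\<^esub> (k \<oplus>\<^bsub>M\<^esub> k')"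
      using c by (simp add: subset_iff M.a_ac)
    then show "a \<oplus>\<^bsub>M\<^esub> b \<in> H <+>\<^bsub>M\<^esub> K" unfolding mem_set_add
      using * submoduleE(5)[OF H] submoduleE(5)[OF K] by blast
  next
    fix r a assume r: "r \<in> carrier R" and "a \<in> H <+>\<^bsub>M\<^esub> K"
    then obtain h k where *: "h \<in> H" "k \<in> K" "a = h \<oplus>\<^bsub>M\<^esub> k" unfolding mem_set_add by blast
    then have "r \<odot>\<^bsub>M\<^esub> a = r \<odot>\<^bsub>M\<^esub> h \<oplus>\<^bsub>M\<^esub> r \<odot>\<^bsub>M\<^esub> k"
      using c r by (simp add: subset_iff smult_r_distr)
    then show "r \<odot>\<^bsub>M\<^esub> a \<in> H <+>\<^bsub>M\<^esub> K" unfolding mem_set_add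
      using * r submoduleE(4)[OF H] submoduleE(4)[OF K] by blast
  qed
qed

lemma submodule_add_upper:
  assumes "submodule H R M" "submodule K R M"
  shows "H \<subseteq> H <+>\<^bsub>M\<^esub> K" "K \<subseteq> H <+>\<^bsub>M\<^esub> K"
proof -
  have c: "H \<subseteq> carrier M" "K \<subseteq> carrier M" using assms submoduleE by auto
  have "\<And>x. x \<in> H \<Longrightarrow> x = x \<oplus>\<^bsub>M\<^esub> \<zero>\<^bsub>M\<^esub>" "\<And>x. x \<in> K \<Longrightarrow> x = \<zero>\<^bsub>M\<^esub> \<oplus>\<^bsub>M\<^esub> x" using c by auto
  then show "H \<subseteq> H <+>\<^bsub>M\<^esub> K" "K \<subseteq> H <+>\<^bsub>M\<^esub> K"
    unfolding subset_iff mem_set_add using submodule_zero assms by blast+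
qed

lemma submodule_add_least:
  assumes "H \<subseteq> L" "K \<subseteq> L" "submodule L R M"
  shows "H <+>\<^bsub>M\<^esub> K \<subseteq> L"
  using assms submoduleE(5)[OF assms(3)] by (auto simp: set_add_def')

text \<open>The modular law: comparable submodules with the same intersection with Q and the same sum
  with Q are equal.\<close>
lemma submodule_modular_strict:
  assumes P: "submodule P R M" and P': "submodule P' R M" and Q: "submodule Q R M" and PP: "P \<subset> P'"
  shows "P \<inter> Q \<subset> P' \<inter> Q \<or> P <+>\<^bsub>M\<^esub> Q \<subset> P' <+>\<^bsub>M\<^esub> Q"
proof (rule ccontr)
  assume "\<not> ?thesis"
  moreover have "P <+>\<^bsub>M\<^esub> Q \<subseteq> P' <+>\<^bsub>M\<^esub> Q" using PP by (auto simp: set_add_def')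
  ultimately have 1: "P \<inter> Q = P' \<inter> Q" and 2: "P <+>\<^bsub>M\<^esub> Q = P' <+>\<^bsub>M\<^esub> Q" using PP by auto
  have c: "P' \<subseteq> carrier M" "Q \<subseteq> carrier M" "P \<subseteq> carrier M" using assms submoduleE by auto
  obtain x where x: "x \<in> P'" "x \<notin> P" using PP by blast
  then have "x \<in> P <+>\<^bsub>M\<^esub> Q" using 2 submodule_add_upper[OF P' Q] by blast
  then obtain p q where pq: "p \<in> P" "q \<in> Q" "x = p \<oplus>\<^bsub>M\<^esub> q" unfolding mem_set_add by blast
  have "p \<in> carrier M" "q \<in> carrier M" using pq c by auto
  then have "q = x \<ominus>\<^bsub>M\<^esub> p" unfolding pq(3) by algebra
  then have "q \<in> P'" using submodule_minus[OF P'] x pq PP by blast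
  then have "q \<in> P" using 1 pq by blast
  then show False using x pq submoduleE(5)[OF P] by blast
qed

text \<open>Chains can be concatenated, which gives one inequality. For the other one, a chain is intersected
  with Q and added to Q; by the modular law each of its steps stays strict in at least one of
  the two resulting chains.\<close>
lemma len_add:
  assumes N: "submodule N R M" and Q: "submodule Q R M" and L: "submodule L R M"
    and NQ: "N \<subseteq> Q" and QL: "Q \<subseteq> L"
  shows "len R M N L = len R M N Q + len R M Q L"
proof (rule antisym)
  show "len R M N L \<le> len R M N Q + len R M Q L"
    unfolding len_def[of R M N L]
  proof (rule Sup_least, clarify)
    fix n P assume P: "submodule_chain R M N L n P"
    have sP: "submodule (P k) R M" "N \<subseteq> P k" "P k \<subseteq> L" if "k \<le> n" for k
      using P that by (auto simp: submodule_chain_def)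
    have "enat k \<le> len R M N (P k \<inter> Q) + len R M Q (P k <+>\<^bsub>M\<^esub> Q)" if "k \<le> n" for k
      using that
    proof (induction k)
      case 0 then show ?case by (simp add: zero_enat_def[symmetric])
    next
      case (Suc k)
      have PP: "P k \<subset> P (Suc k)" using P Suc by (auto simp: submodule_chain_def)
      have k: "k \<le> n" using Suc by simp
      have sub: "P k \<inter> Q \<subseteq> P (Suc k) \<inter> Q" "P k <+>\<^bsub>M\<^esub> Q \<subseteq> P (Suc k) <+>\<^bsub>M\<^esub> Q"
        using PP by (auto simp: set_add_def')
      let ?a = "len R M N (P k \<inter> Q)" and ?a' = "len R M N (P (Suc k) \<inter> Q)"
      let ?b = "len R M Q (P k <+>\<^bsub>M\<^esub> Q)" and ?b' = "len R M Q (P (Suc k) <+>\<^bsub>M\<^esub> Q)"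
      have m: "?a \<le> ?a'" "?b \<le> ?b'" by (rule len_mono; use sub in auto)+
      have "?a + 1 \<le> ?a' \<or> ?b + 1 \<le> ?b'"
        using submodule_modular_strict[OF sP(1)[OF k] sP(1)[OF Suc(2)] Q PP]
      proof
        assume "P k \<inter> Q \<subset> P (Suc k) \<inter> Q"
        then have "?a + 1 \<le> ?a'"
          by (intro len_strict N submodule_inter sP Q k Suc(2)) (use sP[OF k] NQ in auto)
        then show ?thesis ..
      next
        assume "P k <+>\<^bsub>M\<^esub> Q \<subset> P (Suc k) <+>\<^bsub>M\<^esub> Q"
        then have "?b + 1 \<le> ?b'"
          by (intro len_strict Q submodule_add sP k Suc(2) submodule_add_upper(2))
        then show ?thesis ..
      qed
      then have st: "?a + ?b + 1 \<le> ?a' + ?b'"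
      proof
        assume "?a + 1 \<le> ?a'"
        from add_mono[OF this m(2)] show ?thesis by (simp add: ac_simps)
      next
        assume "?b + 1 \<le> ?b'"
        from add_mono[OF m(1) this] show ?thesis by (simp add: ac_simps)
      qed
      have "enat (Suc k) = enat k + 1" by (simp add: one_enat_def)
      also have "enat k + 1 \<le> ?a + ?b + 1" using Suc.IH[OF k] by (rule add_right_mono)
      also note st
      finally show ?case .
    qed
    from this[of n] have "enat n \<le> len R M N (P n \<inter> Q) + len R M Q (P n <+>\<^bsub>M\<^esub> Q)" by simp
    also have "\<dots> \<le> len R M N Q + len R M Q L"
      by (intro add_mono len_mono submodule_add_least QL L sP) auto
    finally show "enat n \<le> len R M N Q + len R M Q L" .
  qed
next
  have "enat n \<le> len R M N L" if "enat n \<le> len R M N Q + len R M Q L" for n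
  proof -
    obtain i j where ij: "n = i + j" "enat i \<le> len R M N Q" "enat j \<le> len R M Q L"
      using \<open>enat n \<le> _\<close> enat_le_add_iff by blast
    obtain P where P: "submodule_chain R M N Q i P" using ij le_len_iff[OF N NQ] by blast
    obtain P' where P': "submodule_chain R M Q L j P'" using ij le_len_iff[OF Q QL] by blast
    let ?P = "\<lambda>k. if k < i then P k else P' (k - i)"
    have "submodule_chain R M N L n ?P" unfolding submodule_chain_def
    proof (intro conjI allI impI)
      fix k assume k: "k < n"
      show "?P k \<subset> ?P (Suc k)"
      proof (cases "Suc k = i")
        case True
        then have "P k \<subset> P i" "P i \<subseteq> Q" "Q \<subseteq> P' 0" using P P' by (auto simp: submodule_chain_def)
        then show ?thesis using True by auto
      next
        case False
        then show ?thesis using P P' k ij(1)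
          by (cases "k < i") (auto simp: submodule_chain_def Suc_diff_le)
      qed
    next
      fix k assume "k \<le> n"
      then have *: "k < i \<Longrightarrow> submodule (P k) R M \<and> N \<subseteq> P k \<and> P k \<subseteq> Q"
        "\<not> k < i \<Longrightarrow> submodule (P' (k - i)) R M \<and> Q \<subseteq> P' (k - i) \<and> P' (k - i) \<subseteq> L"
        using P P' ij(1) by (auto simp: submodule_chain_def)
      show "submodule (?P k) R M" "N \<subseteq> ?P k" "?P k \<subseteq> L" using * NQ QL by (cases "k < i"; auto)+
    qed
    then show ?thesis by (rule len_ge)
  qed
  then show "len R M N Q + len R M Q L \<le> len R M N L"
    by (rule enat_leI)
qed

lemma cong_refl: "submodule N R M \<Longrightarrow> x \<in> carrier M \<Longrightarrow> cong_mod M N x x"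
  by (simp add: cong_mod_def a_minus_def M.r_neg submodule_zero)

lemma cong_carr: "cong_mod M N x y \<Longrightarrow> x \<in> carrier M \<and> y \<in> carrier M"
  by (simp add: cong_mod_def)

lemma cong_sym: 
  assumes "submodule N R M" "cong_mod M N x y" shows "cong_mod M N y x"
proof -
  have "y \<ominus>\<^bsub>M\<^esub> x = \<ominus>\<^bsub>M\<^esub> (x \<ominus>\<^bsub>M\<^esub> y)" using assms(2) unfolding cong_mod_def by algebra
  then show ?thesis using assms submoduleE(3) by (simp add: cong_mod_def)
qed

lemma cong_trans: 
  assumes "submodule N R M" "cong_mod M N x y" "cong_mod M N y z" shows "cong_mod M N x z"
proof -
  have "x \<ominus>\<^bsub>M\<^esub> z = (x \<ominus>\<^bsub>M\<^esub> y) \<oplus>\<^bsub>M\<^esub> (y \<ominus>\<^bsub>M\<^esub> z)" using assms(2,3) unfolding cong_mod_def by algebra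
  then show ?thesis using assms submoduleE(5) by (simp add: cong_mod_def)
qed

lemma cong_add: 
  assumes "submodule N R M" "cong_mod M N x y" "cong_mod M N x' y'"
  shows "cong_mod M N (x \<oplus>\<^bsub>M\<^esub> x') (y \<oplus>\<^bsub>M\<^esub> y')"
proof -
  have "(x \<oplus>\<^bsub>M\<^esub> x') \<ominus>\<^bsub>M\<^esub> (y \<oplus>\<^bsub>M\<^esub> y') = (x \<ominus>\<^bsub>M\<^esub> y) \<oplus>\<^bsub>M\<^esub> (x' \<ominus>\<^bsub>M\<^esub> y')" using assms(2,3) unfolding cong_mod_def by algebra
  then show ?thesis using assms submoduleE(5) by (simp add: cong_mod_def)
qed

lemma cong_smult: 
  assumes "submodule N R M" "cong_mod M N x y" "r \<in> carrier R"
  shows "cong_mod M N (r \<odot>\<^bsub>M\<^esub> x) (r \<odot>\<^bsub>M\<^esub> y)"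
proof -
  have "(r \<odot>\<^bsub>M\<^esub> x) \<ominus>\<^bsub>M\<^esub> (r \<odot>\<^bsub>M\<^esub> y) = r \<odot>\<^bsub>M\<^esub> (x \<ominus>\<^bsub>M\<^esub> y)" using assms(2,3) unfolding cong_mod_def by algebra
  then show ?thesis using assms submoduleE(4) by (simp add: cong_mod_def)
qed

lemma cong_zero_iff: "submodule N R M \<Longrightarrow> x \<in> carrier M \<Longrightarrow> cong_mod M N x \<zero>\<^bsub>M\<^esub> \<longleftrightarrow> x \<in> N"
  by (simp add: cong_mod_def a_minus_def minus_zero)

lemma cong_mem:
  assumes "submodule N' R M" "N \<subseteq> N'" "cong_mod M N x y" shows "x \<in> N' \<longleftrightarrow> y \<in> N'"
proof -
  have *: "x = (x \<ominus>\<^bsub>M\<^esub> y) \<oplus>\<^bsub>M\<^esub> y" "y = x \<ominus>\<^bsub>M\<^esub> (x \<ominus>\<^bsub>M\<^esub> y)" using assms(3) unfolding cong_mod_def by algebra+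
  have d: "x \<ominus>\<^bsub>M\<^esub> y \<in> N'" using assms by (auto simp: cong_mod_def)
  show ?thesis
  proof
    assume "x \<in> N'" then show "y \<in> N'" using *(2) submodule_minus[OF assms(1)] d by metis
  next
    assume "y \<in> N'" then show "x \<in> N'" using *(1) submoduleE(5)[OF assms(1)] d by metis
  qed
qed

lemma cong_eq: "cong_mod M {\<zero>\<^bsub>M\<^esub>} x y \<longleftrightarrow> x \<in> carrier M \<and> y \<in> carrier M \<and> x = y"
proof -
  have "x = (x \<ominus>\<^bsub>M\<^esub> y) \<oplus>\<^bsub>M\<^esub> y" if "x \<in> carrier M" "y \<in> carrier M" using that by algebra
  moreover have "x \<ominus>\<^bsub>M\<^esub> x = \<zero>\<^bsub>M\<^esub>" if "x \<in> carrier M" using that by algebra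
  ultimately show ?thesis unfolding cong_mod_def by fastforce
qed

end

text \<open>A lift of a linear map from L to B/N. Maps into quotients are represented by their lifts
  throughout, because a module of cosets lives on another type for each quotient.\<close>
definition linear_mod ::
   "('a, 'r) ring_scheme \<Rightarrow> ('a, 'm, 'x) module_scheme \<Rightarrow> ('a, 'n, 'y) module_scheme \<Rightarrow> 'm set \<Rightarrow> 'n set \<Rightarrow> ('m \<Rightarrow> 'n) \<Rightarrow> bool" where
  "linear_mod R A B L N f \<longleftrightarrow> (\<forall>x\<in>L. f x \<in> carrier B) \<and>
     (\<forall>x\<in>L. \<forall>y\<in>L. cong_mod B N (f (x \<oplus>\<^bsub>A\<^esub> y)) (f x \<oplus>\<^bsub>B\<^esub> f y)) \<and>
     (\<forall>r\<in>carrier R. \<forall>x\<in>L. cong_mod B N (f (r \<odot>\<^bsub>A\<^esub> x)) (r \<odot>\<^bsub>B\<^esub> f x))"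

lemma linear_mod_zero:
  assumes "module R A" "module R B" "submodule L R A" "submodule N R B" "linear_mod R A B L N f"
  shows "f \<zero>\<^bsub>A\<^esub> \<in> N"
proof -
  interpret A: module R A by fact
  interpret B: module R B by fact
  have z: "\<zero>\<^bsub>A\<^esub> \<in> L" using A.submodule_zero assms by blast
  have "cong_mod B N (f (\<zero>\<^bsub>R\<^esub> \<odot>\<^bsub>A\<^esub> \<zero>\<^bsub>A\<^esub>)) (\<zero>\<^bsub>R\<^esub> \<odot>\<^bsub>B\<^esub> f \<zero>\<^bsub>A\<^esub>)"
    using assms(5) z unfolding linear_mod_def by blast
  moreover have "f \<zero>\<^bsub>A\<^esub> \<in> carrier B" using assms(5) z by (simp add: linear_mod_def)
  ultimately show ?thesis using B.cong_zero_iff[OF assms(4)] by simp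
qed

lemma submodule_preimage:
  assumes "module R A" "module R B" "submodule L R A" "submodule N R B" "linear_mod R A B L N f"
    and P: "submodule P R B" "N \<subseteq> P"
  shows "submodule {a \<in> L. f a \<in> P} R A"
proof -
  interpret A: module R A by fact
  interpret B: module R B by fact
  have c: "L \<subseteq> carrier A" using assms A.submoduleE by auto
  show ?thesis
  proof (rule A.submoduleI2)
    show "{a \<in> L. f a \<in> P} \<subseteq> carrier A" using c by auto
    show "\<zero>\<^bsub>A\<^esub> \<in> {a \<in> L. f a \<in> P}"
      using linear_mod_zero[OF assms(1-5)] P A.submodule_zero[OF assms(3)] by auto
  next
    fix a b assume "a \<in> {a \<in> L. f a \<in> P}" "b \<in> {a \<in> L. f a \<in> P}"
    then have *: "a \<in> L" "b \<in> L" "f a \<oplus>\<^bsub>B\<^esub> f b \<in> P" using B.submoduleE(5)[OF P(1)] by auto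
    then have "cong_mod B N (f (a \<oplus>\<^bsub>A\<^esub> b)) (f a \<oplus>\<^bsub>B\<^esub> f b)" using assms(5) by (simp add: linear_mod_def)
    then have "f (a \<oplus>\<^bsub>A\<^esub> b) \<in> P" using B.cong_mem[OF P] * by blast
    then show "a \<oplus>\<^bsub>A\<^esub> b \<in> {a \<in> L. f a \<in> P}" using * A.submoduleE(5)[OF assms(3)] by auto
  next
    fix r b assume r: "r \<in> carrier R" "b \<in> {a \<in> L. f a \<in> P}"
    then have *: "b \<in> L" "r \<odot>\<^bsub>B\<^esub> f b \<in> P" using B.submoduleE(4)[OF P(1)] by auto
    then have "cong_mod B N (f (r \<odot>\<^bsub>A\<^esub> b)) (r \<odot>\<^bsub>B\<^esub> f b)" using assms(5) r by (simp add: linear_mod_def)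
    then have "f (r \<odot>\<^bsub>A\<^esub> b) \<in> P" using B.cong_mem[OF P] * by blast
    then show "r \<odot>\<^bsub>A\<^esub> b \<in> {a \<in> L. f a \<in> P}" using * r A.submoduleE(4)[OF assms(3)] by auto
  qed
qed

lemma submodule_image:
  assumes "module R A" "module R B" "submodule L R A" "submodule N R B" "linear_mod R A B L N f"
    and P: "submodule P R A" "P \<subseteq> L"
  shows "submodule {b \<in> carrier B. \<exists>a\<in>P. cong_mod B N b (f a)} R B"
proof -
  interpret A: module R A by fact
  interpret B: module R B by fact
  have c: "L \<subseteq> carrier A" using assms A.submoduleE by auto
  have fc: "f a \<in> carrier B" if "a \<in> L" for a using that assms(5) by (simp add: linear_mod_def)
  show ?thesis
  proof (rule B.submoduleI2)
    have "cong_mod B N \<zero>\<^bsub>B\<^esub> (f \<zero>\<^bsub>A\<^esub>)"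
      using linear_mod_zero[OF assms(1-5)] fc A.submodule_zero[OF assms(3)]
      B.cong_sym[OF assms(4)] B.cong_zero_iff[OF assms(4)] by blast
    then show "\<zero>\<^bsub>B\<^esub> \<in> {b \<in> carrier B. \<exists>a\<in>P. cong_mod B N b (f a)}" 
      using A.submodule_zero[OF P(1)] by auto
  next
    fix b b' assume "b \<in> {b \<in> carrier B. \<exists>a\<in>P. cong_mod B N b (f a)}" "b' \<in> {b \<in> carrier B. \<exists>a\<in>P. cong_mod B N b (f a)}"
    then obtain a a' where *: "a \<in> P" "a' \<in> P" "cong_mod B N b (f a)" "cong_mod B N b' (f a')" "b \<in> carrier B" "b' \<in> carrier B" by auto
    then have "a \<in> L" "a' \<in> L" using P by auto
    then have "cong_mod B N (f (a \<oplus>\<^bsub>A\<^esub> a')) (f a \<oplus>\<^bsub>B\<^esub> f a')" using assms(5) by (simp add: linear_mod_def)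
    then have "cong_mod B N (b \<oplus>\<^bsub>B\<^esub> b') (f (a \<oplus>\<^bsub>A\<^esub> a'))"
      using B.cong_trans[OF assms(4) B.cong_add[OF assms(4) *(3,4)]] B.cong_sym[OF assms(4)] by blast
    then show "b \<oplus>\<^bsub>B\<^esub> b' \<in> {b \<in> carrier B. \<exists>a\<in>P. cong_mod B N b (f a)}" using * A.submoduleE(5)[OF P(1)] by auto
  next
    fix r b assume r: "r \<in> carrier R" "b \<in> {b \<in> carrier B. \<exists>a\<in>P. cong_mod B N b (f a)}"
    then obtain a where *: "a \<in> P" "cong_mod B N b (f a)" "b \<in> carrier B" by auto
    then have "a \<in> L" using P by auto
    then have "cong_mod B N (f (r \<odot>\<^bsub>A\<^esub> a)) (r \<odot>\<^bsub>B\<^esub> f a)" using assms(5) r by (simp add: linear_mod_def)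
    then have "cong_mod B N (r \<odot>\<^bsub>B\<^esub> b) (f (r \<odot>\<^bsub>A\<^esub> a))"
      using B.cong_trans[OF assms(4) B.cong_smult[OF assms(4) *(2) r(1)]] B.cong_sym[OF assms(4)] by blast
    then show "r \<odot>\<^bsub>B\<^esub> b \<in> {b \<in> carrier B. \<exists>a\<in>P. cong_mod B N b (f a)}" using * r A.submoduleE(4)[OF P(1)] by auto
  qed auto
qed

text \<open>A map onto N'/N with kernel K induces an isomorphism from L/K to N'/N, under which submodules
  correspond by taking images and preimages. The comparisons of lengths that follow are
  instances of this lemma.\<close>
lemma len_transfer:
  assumes A: "module R A" and B: "module R B" and L: "submodule L R A" and N: "submodule N R B"
    and N': "submodule N' R B" "N \<subseteq> N'"
    and f: "linear_mod R A B L N f"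
    and into: "\<And>a. a \<in> L \<Longrightarrow> f a \<in> N'"
    and onto: "\<And>b. b \<in> N' \<Longrightarrow> \<exists>a\<in>L. cong_mod B N b (f a)"
  shows "len R A {a \<in> L. f a \<in> N} L = len R B N N'"
proof (rule antisym)
  interpret A: module R A by fact
  interpret B: module R B by fact
  have fc: "f a \<in> carrier B" if "a \<in> L" for a using that f by (simp add: linear_mod_def)
  have LA: "L \<subseteq> carrier A" using L A.submoduleE by auto
  show "len R B N N' \<le> len R A {a \<in> L. f a \<in> N} L"
  proof (rule len_le_map[where g = "\<lambda>P. {a \<in> L. f a \<in> P}"])
    fix P assume P: "submodule P R B" "N \<subseteq> P" "P \<subseteq> N'"
    show "submodule {a \<in> L. f a \<in> P} R A \<and> {a \<in> L. f a \<in> N} \<subseteq> {a \<in> L. f a \<in> P} \<and> {a \<in> L. f a \<in> P} \<subseteq> L"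
      using submodule_preimage[OF A B L N f P(1,2)] P by auto
  next
    fix P Q assume *: "submodule P R B" "submodule Q R B" "N \<subseteq> P" "P \<subset> Q" "Q \<subseteq> N'"
    obtain q where q: "q \<in> Q" "q \<notin> P" using * by blast
    obtain a where a: "a \<in> L" "cong_mod B N q (f a)" using onto q * by blast
    have "f a \<in> Q" "f a \<notin> P" using B.cong_mem[OF *(1,3) a(2)] B.cong_mem[OF *(2) _ a(2)] q * by auto
    then show "{a \<in> L. f a \<in> P} \<subset> {a \<in> L. f a \<in> Q}" using a * by blast
  qed
  let ?g = "\<lambda>P. {b \<in> carrier B. \<exists>a\<in>P. cong_mod B N b (f a)}"
  show "len R A {a \<in> L. f a \<in> N} L \<le> len R B N N'"
  proof (rule len_le_map[where g = "?g"])
    fix P assume P: "submodule P R A" "{a \<in> L. f a \<in> N} \<subseteq> P" "P \<subseteq> L"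
    have 1: "submodule (?g P) R B" using submodule_image[OF A B L N f P(1,3)] .
    have z: "\<zero>\<^bsub>A\<^esub> \<in> P" "\<zero>\<^bsub>A\<^esub> \<in> L" using A.submodule_zero P(1) L by auto
    have 2: "N \<subseteq> ?g P"
    proof
      fix n assume n: "n \<in> N"
      then have nc: "n \<in> carrier B" using B.submoduleE(1)[OF N] by auto
      have "cong_mod B N n \<zero>\<^bsub>B\<^esub>" using n nc B.cong_zero_iff[OF N] by auto
      moreover have "cong_mod B N \<zero>\<^bsub>B\<^esub> (f \<zero>\<^bsub>A\<^esub>)"
        using linear_mod_zero[OF A B L N f] fc z B.cong_sym[OF N] B.cong_zero_iff[OF N] by blast
      ultimately have "cong_mod B N n (f \<zero>\<^bsub>A\<^esub>)" using B.cong_trans[OF N] by blast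
      then show "n \<in> ?g P" using nc z by auto
    qed
    have 3: "?g P \<subseteq> N'"
    proof
      fix b assume "b \<in> ?g P"
      then obtain a where "a \<in> P" "cong_mod B N b (f a)" by auto
      then show "b \<in> N'" using B.cong_mem[OF N'] into P by blast
    qed
    show "submodule (?g P) R B \<and> N \<subseteq> ?g P \<and> ?g P \<subseteq> N'" using 1 2 3 by blast
  next
    fix P Q assume *: "submodule P R A" "submodule Q R A" "{a \<in> L. f a \<in> N} \<subseteq> P" "P \<subset> Q" "Q \<subseteq> L"
    obtain q where q: "q \<in> Q" "q \<notin> P" using * by blast
    have "f q \<in> ?g Q" using q * fc B.cong_refl[OF N] by blast
    moreover have "f q \<notin> ?g P"
    proof
      assume "f q \<in> ?g P"
      then obtain a where a: "a \<in> P" "cong_mod B N (f q) (f a)" by auto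
      have aL: "a \<in> L" "q \<in> L" using a q * by auto
      have m: "q \<ominus>\<^bsub>A\<^esub> a \<in> L" using aL A.submodule_minus[OF L] by auto
      have qa: "(q \<ominus>\<^bsub>A\<^esub> a) \<oplus>\<^bsub>A\<^esub> a = q" using subsetD[OF LA aL(1)] subsetD[OF LA aL(2)] by algebra
      have "cong_mod B N (f ((q \<ominus>\<^bsub>A\<^esub> a) \<oplus>\<^bsub>A\<^esub> a)) (f (q \<ominus>\<^bsub>A\<^esub> a) \<oplus>\<^bsub>B\<^esub> f a)"
        using f m aL by (simp add: linear_mod_def)
      then have "cong_mod B N (f q) (f (q \<ominus>\<^bsub>A\<^esub> a) \<oplus>\<^bsub>B\<^esub> f a)" unfolding qa .
      then have "cong_mod B N (f (q \<ominus>\<^bsub>A\<^esub> a) \<oplus>\<^bsub>B\<^esub> f a) (f a)"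
        using B.cong_trans[OF N] B.cong_sym[OF N] a by blast
      moreover have "(f (q \<ominus>\<^bsub>A\<^esub> a) \<oplus>\<^bsub>B\<^esub> f a) \<ominus>\<^bsub>B\<^esub> f a = f (q \<ominus>\<^bsub>A\<^esub> a)"
        using fc[OF aL(1)] fc[OF m] by algebra
      ultimately have "f (q \<ominus>\<^bsub>A\<^esub> a) \<in> N" by (simp add: cong_mod_def)
      then have "q \<ominus>\<^bsub>A\<^esub> a \<in> P" using * m by blast
      from A.submoduleE(5)[OF *(1) this a(1)] have "q \<in> P" unfolding qa .
      then show False using q by blast
    qed
    moreover have "?g P \<subseteq> ?g Q" using * by blast
    ultimately show "?g P \<subset> ?g Q" by blast
  qed
qed

lemma (in module) submodule_iff:
  "submodule H R M \<longleftrightarrow> H \<subseteq> carrier M \<and> \<zero>\<^bsub>M\<^esub> \<in> H \<and> (\<forall>a\<in>H. \<forall>b\<in>H. a \<oplus>\<^bsub>M\<^esub> b \<in> H) \<and>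
     (\<forall>a\<in>carrier R. \<forall>x\<in>H. a \<odot>\<^bsub>M\<^esub> x \<in> H)"
  using submoduleI2[of H] submoduleE(1,4,5)[of H] submodule_zero[of H] by blast

lemma (in module) submodule_of_submodule_iff:
  assumes L: "submodule L R M"
  shows "submodule P R (M\<lparr>carrier := L\<rparr>) \<longleftrightarrow> submodule P R M \<and> P \<subseteq> L"
proof -
  interpret L: module R "M\<lparr>carrier := L\<rparr>"
    using submodule.submodule_is_module[OF L] module_axioms by blast
  show ?thesis unfolding submodule_iff L.submodule_iff using submoduleE(1)[OF L] by auto
qed

lemma (in module) len_of_submodule:
  assumes L: "submodule L R M" and "Q \<subseteq> L"
  shows "len R (M\<lparr>carrier := L\<rparr>) N Q = len R M N Q"
proof -
  have "submodule_chain R (M\<lparr>carrier := L\<rparr>) N Q n P \<longleftrightarrow> submodule_chain R M N Q n P" for n P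
    unfolding submodule_chain_def submodule_of_submodule_iff[OF L] using assms by blast
  then show ?thesis by (simp add: len_def)
qed

lemma module_length_eq_len:
  fixes M :: "('a, 'm) module"
  assumes "module R M" shows "module_length R M = len R M {\<zero>\<^bsub>M\<^esub>} (carrier M)"
proof -
  interpret module R M by fact
  have "submodule_chain R M {\<zero>\<^bsub>M\<^esub>} (carrier M) n P \<longleftrightarrow>
    (\<forall>i\<le>n. submodule (P i) R M) \<and> (\<forall>i<n. P i \<subset> P (Suc i))" for n P
    unfolding submodule_chain_def using submoduleE(1) submodule_zero by blast
  then show ?thesis by (simp add: len_def module_length_def)
qed

section \<open>Quotient modules\<close>

context
  fixes R :: "('a, 'r) ring_scheme" and M :: "('a, 'm) module" and H
  assumes M: "module R M" and H: "submodule H R M"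
begin

interpretation module R M by (fact M)

interpretation abelian_subgroup H M
  by (rule abelian_subgroupI3)
     (use submodule.axioms(1)[OF H] M.abelian_group_axioms in \<open>auto simp: additive_subgroup_def\<close>)

lemma mem_coset_iff: "x \<in> carrier M \<Longrightarrow> y \<in> H +>\<^bsub>M\<^esub> x \<longleftrightarrow> cong_mod M H y x"
  using a_rcos_module[of x y] a_elemrcos_carrier[of x y] by (auto simp: cong_mod_def a_minus_def)

lemma coset_eq_iff:
  "x \<in> carrier M \<Longrightarrow> y \<in> carrier M \<Longrightarrow> H +>\<^bsub>M\<^esub> x = H +>\<^bsub>M\<^esub> y \<longleftrightarrow> cong_mod M H x y"
  using mem_coset_iff[of x] mem_coset_iff[of y] cong_refl[OF H] cong_sym[OF H] cong_trans[OF H]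
  by blast

lemma coset_self_iff: "x \<in> carrier M \<Longrightarrow> H +>\<^bsub>M\<^esub> x = H \<longleftrightarrow> x \<in> H"
  using coset_eq_iff[of x "\<zero>\<^bsub>M\<^esub>"] cong_zero_iff[OF H, of x] a_coset_add_zero[of H] a_subset by auto

lemma quot_module_carrier: "carrier (quot_module M H) = (\<lambda>x. H +>\<^bsub>M\<^esub> x) ` carrier M"
  by (auto simp: quot_module_def A_RCOSETS_def' )

lemma quot_module_zero: "\<zero>\<^bsub>quot_module M H\<^esub> = H +>\<^bsub>M\<^esub> \<zero>\<^bsub>M\<^esub>"
  using a_coset_add_zero[of H] a_subset by (simp add: quot_module_def)

lemma quot_module_add:
  "x \<in> carrier M \<Longrightarrow> y \<in> carrier M \<Longrightarrow>
    (H +>\<^bsub>M\<^esub> x) \<oplus>\<^bsub>quot_module M H\<^esub> (H +>\<^bsub>M\<^esub> y) = H +>\<^bsub>M\<^esub> (x \<oplus>\<^bsub>M\<^esub> y)"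
  by (simp add: quot_module_def a_rcos_sum)

lemma quot_module_smult:
  assumes "a \<in> carrier R" "x \<in> carrier M"
  shows "a \<odot>\<^bsub>quot_module M H\<^esub> (H +>\<^bsub>M\<^esub> x) = H +>\<^bsub>M\<^esub> (a \<odot>\<^bsub>M\<^esub> x)"
proof -
  have 1: "H +>\<^bsub>M\<^esub> (a \<odot>\<^bsub>M\<^esub> y) = H +>\<^bsub>M\<^esub> (a \<odot>\<^bsub>M\<^esub> x)" if "y \<in> H +>\<^bsub>M\<^esub> x" for y
  proof -
    have c: "cong_mod M H y x" using that mem_coset_iff[OF assms(2)] by simp
    show ?thesis using coset_eq_iff[of "a \<odot>\<^bsub>M\<^esub> y" "a \<odot>\<^bsub>M\<^esub> x"] cong_smult[OF H c assms(1)] cong_carr[OF c] assms by simp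
  qed
  have 2: "x \<in> H +>\<^bsub>M\<^esub> x" 
    by (rule mem_coset_iff[THEN iffD2, OF assms(2) cong_refl[OF H assms(2)]])
  have "(\<Union>y\<in>H +>\<^bsub>M\<^esub> x. H +>\<^bsub>M\<^esub> (a \<odot>\<^bsub>M\<^esub> y)) = H +>\<^bsub>M\<^esub> (a \<odot>\<^bsub>M\<^esub> x)"
    by (rule UN_constant_eq[OF 2]) (intro ballI 1)
  then show ?thesis by (simp only: quot_module_def module.simps)
qed

lemma quot_module_module: "module R (quot_module M H)"
proof -
  note car = quot_module_carrier
  note ops = quot_module_add quot_module_smult quot_module_zero
  show ?thesis
  proof (rule moduleI)
    show "cring R" by (rule R.is_cring)
    show "abelian_group (quot_module M H)"
    proof (rule abelian_groupI)
      fix X assume "X \<in> carrier (quot_module M H)"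
      then obtain x where x: "x \<in> carrier M" "X = H +>\<^bsub>M\<^esub> x" unfolding car by blast
      have "\<ominus>\<^bsub>M\<^esub> x \<oplus>\<^bsub>M\<^esub> x = \<zero>\<^bsub>M\<^esub>" using x(1) by algebra
      then show "\<exists>y\<in>carrier (quot_module M H). y \<oplus>\<^bsub>quot_module M H\<^esub> X = \<zero>\<^bsub>quot_module M H\<^esub>"
        using x unfolding car by (intro bexI[of _ "H +>\<^bsub>M\<^esub> (\<ominus>\<^bsub>M\<^esub> x)"]) (auto simp: ops)
    qed (unfold car, auto simp: ops M.a_ac)
  qed (unfold car, auto simp: ops smult_l_distr smult_r_distr smult_assoc1)
qed

lemma quot_module_projection: "linear_mod R M (quot_module M H) (carrier M) {\<zero>\<^bsub>quot_module M H\<^esub>} (\<lambda>x. H +>\<^bsub>M\<^esub> x)"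
  unfolding linear_mod_def module.cong_eq[OF quot_module_module]
  by (auto simp: quot_module_carrier quot_module_add quot_module_smult)

lemma len_quot_module:
  "module_length R (quot_module M H) = len R M H (carrier M)"
proof -
  interpret Q: module R "quot_module M H" by (rule quot_module_module)
  have "{x \<in> carrier M. H +>\<^bsub>M\<^esub> x \<in> {\<zero>\<^bsub>quot_module M H\<^esub>}} = H"
    using coset_self_iff submoduleE(1)[OF H] by (auto simp: quot_module_def)
  moreover have "len R M {x \<in> carrier M. H +>\<^bsub>M\<^esub> x \<in> {\<zero>\<^bsub>quot_module M H\<^esub>}} (carrier M)
      = len R (quot_module M H) {\<zero>\<^bsub>quot_module M H\<^esub>} (carrier (quot_module M H))"
    by (rule len_transfer[OF M Q.module_axioms carrier_is_submodule Q.zero_submodule Q.carrier_is_submodule _ quot_module_projection])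
       (use Q.M.zero_closed in \<open>auto simp: quot_module_carrier Q.cong_eq\<close>)
  ultimately show ?thesis using module_length_eq_len[OF Q.module_axioms] by simp
qed

end

section \<open>Modules of maps\<close>

definition map_module :: "'s set \<Rightarrow> ('a, 'n) module \<Rightarrow> ('a, 's \<Rightarrow> 'n) module" where
  "map_module S N = \<lparr>carrier = S \<rightarrow>\<^sub>E carrier N, monoid.mult = undefined, one = undefined,
     zero = (\<lambda>x\<in>S. \<zero>\<^bsub>N\<^esub>),
     add = (\<lambda>f g. \<lambda>x\<in>S. f x \<oplus>\<^bsub>N\<^esub> g x),
     smult = (\<lambda>a f. \<lambda>x\<in>S. a \<odot>\<^bsub>N\<^esub> f x)\<rparr>"

lemma map_module_simps [simp]:
  "carrier (map_module S N) = S \<rightarrow>\<^sub>E carrier N"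
  "\<zero>\<^bsub>map_module S N\<^esub> = (\<lambda>x\<in>S. \<zero>\<^bsub>N\<^esub>)"
  "f \<oplus>\<^bsub>map_module S N\<^esub> g = (\<lambda>x\<in>S. f x \<oplus>\<^bsub>N\<^esub> g x)"
  "a \<odot>\<^bsub>map_module S N\<^esub> f = (\<lambda>x\<in>S. a \<odot>\<^bsub>N\<^esub> f x)"
  by (simp_all add: map_module_def)

lemma PiE_const_mem: "f \<in> S \<rightarrow>\<^sub>E C \<Longrightarrow> x \<in> S \<Longrightarrow> f x \<in> C"
  by (rule PiE_mem)

lemma map_module_module:
  assumes "module R N" shows "module R (map_module S N)"
proof -
  interpret module R N by fact
  let ?F = "map_module S N"
  note mem = PiE_const_mem[of _ S "carrier N"]
  show ?thesis
  proof (rule moduleI)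
    show "abelian_group ?F"
    proof (rule abelian_groupI)
      fix f assume f: "f \<in> carrier ?F"
      show "\<zero>\<^bsub>?F\<^esub> \<oplus>\<^bsub>?F\<^esub> f = f"
        using f by (intro PiE_ext[of _ S "\<lambda>_. carrier N"]) (auto simp: mem)
      show "\<exists>y\<in>carrier ?F. y \<oplus>\<^bsub>?F\<^esub> f = \<zero>\<^bsub>?F\<^esub>"
        by (rule bexI[of _ "\<lambda>x\<in>S. \<ominus>\<^bsub>N\<^esub> f x"])
           (use f in \<open>auto simp: mem M.l_neg intro!: restrict_ext\<close>)
    next
      fix f g h assume "f \<in> carrier ?F" "g \<in> carrier ?F" "h \<in> carrier ?F"
      then show "f \<oplus>\<^bsub>?F\<^esub> g \<oplus>\<^bsub>?F\<^esub> h = f \<oplus>\<^bsub>?F\<^esub> (g \<oplus>\<^bsub>?F\<^esub> h)"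
        by (auto simp: mem M.a_assoc intro!: restrict_ext)
    next
      fix f g assume "f \<in> carrier ?F" "g \<in> carrier ?F"
      then show "f \<oplus>\<^bsub>?F\<^esub> g = g \<oplus>\<^bsub>?F\<^esub> f"
        by (auto simp: mem M.a_comm intro!: restrict_ext)
    qed (auto simp: mem)
  next
    fix f assume f: "f \<in> carrier ?F"
    show "\<one>\<^bsub>R\<^esub> \<odot>\<^bsub>?F\<^esub> f = f"
      using f by (intro PiE_ext[of _ S "\<lambda>_. carrier N"]) (auto simp: mem)
  next
    fix a b f assume "a \<in> carrier R" "b \<in> carrier R" "f \<in> carrier ?F"
    then show "(a \<oplus>\<^bsub>R\<^esub> b) \<odot>\<^bsub>?F\<^esub> f = a \<odot>\<^bsub>?F\<^esub> f \<oplus>\<^bsub>?F\<^esub> b \<odot>\<^bsub>?F\<^esub> f"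
      "(a \<otimes>\<^bsub>R\<^esub> b) \<odot>\<^bsub>?F\<^esub> f = a \<odot>\<^bsub>?F\<^esub> (b \<odot>\<^bsub>?F\<^esub> f)"
      by (auto simp: mem smult_l_distr smult_assoc1 intro!: restrict_ext)
  next
    fix a f g assume "a \<in> carrier R" "f \<in> carrier ?F" "g \<in> carrier ?F"
    then show "a \<odot>\<^bsub>?F\<^esub> (f \<oplus>\<^bsub>?F\<^esub> g) = a \<odot>\<^bsub>?F\<^esub> f \<oplus>\<^bsub>?F\<^esub> a \<odot>\<^bsub>?F\<^esub> g"
      by (auto simp: mem smult_r_distr intro!: restrict_ext)
  qed (auto simp: mem R.is_cring)
qed

lemma hom_module_eq: "hom_module R M N = (map_module (carrier M) N)\<lparr>carrier := lin_maps R M N\<rparr>"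
  by (simp add: hom_module_def map_module_def)

lemma lin_maps_iff:
  "f \<in> lin_maps R M N \<longleftrightarrow> f \<in> carrier M \<rightarrow>\<^sub>E carrier N \<and>
     (\<forall>x\<in>carrier M. \<forall>y\<in>carrier M. f (x \<oplus>\<^bsub>M\<^esub> y) = f x \<oplus>\<^bsub>N\<^esub> f y) \<and>
     (\<forall>a\<in>carrier R. \<forall>x\<in>carrier M. f (a \<odot>\<^bsub>M\<^esub> x) = a \<odot>\<^bsub>N\<^esub> f x)"
  by (simp add: lin_maps_def)

lemma lin_maps_submodule:
  assumes "module R M" "module R N"
  shows "submodule (lin_maps R M N) R (map_module (carrier M) N)"
proof -
  interpret M: module R M by fact
  interpret N: module R N by fact
  interpret X: module R "map_module (carrier M) N" by (rule map_module_module) fact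
  show ?thesis
    by (rule X.submoduleI2)
       (auto simp: lin_maps_iff PiE_const_mem[of _ "carrier M" "carrier N"] N.smult_r_distr N.M.a_ac N.smult_lcomm)
qed

lemma hom_module_module:
  assumes "module R M" "module R N" shows "module R (hom_module R M N)"
  unfolding hom_module_eq
  by (rule submodule.submodule_is_module[OF lin_maps_submodule[OF assms] map_module_module[OF assms(2)]])

section \<open>Generated submodules\<close>

lemma span_submodule:
  assumes "module R M" "A \<subseteq> carrier M" shows "submodule (span_module R M A) R M"
proof -
  interpret module R M by fact
  show ?thesis
  proof (rule submoduleI2)
    show "span_module R M A \<subseteq> carrier M" using carrier_is_submodule assms by (auto simp: span_module_def)
  qed (auto simp: span_module_def submodule_zero intro: submoduleE(4,5))
qed

lemma span_superset: "A \<subseteq> span_module R M A"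
  by (auto simp: span_module_def)

lemma span_least: "submodule H R M \<Longrightarrow> A \<subseteq> H \<Longrightarrow> span_module R M A \<subseteq> H"
  by (auto simp: span_module_def)

section \<open>Restriction of scalars\<close>

lemma restrict_scalars_simps [simp]:
  "carrier (restrict_scalars h M) = carrier M" "\<zero>\<^bsub>restrict_scalars h M\<^esub> = \<zero>\<^bsub>M\<^esub>"
  "x \<oplus>\<^bsub>restrict_scalars h M\<^esub> y = x \<oplus>\<^bsub>M\<^esub> y" "a \<odot>\<^bsub>restrict_scalars h M\<^esub> x = h a \<odot>\<^bsub>M\<^esub> x"
  by (simp_all add: restrict_scalars_def)

lemma restrict_scalars_id: "restrict_scalars (\<lambda>a. a) M = M"
  by (simp add: restrict_scalars_def)

lemma restrict_scalars_module:
  assumes "cring R" "h \<in> ring_hom R B" "module B M" shows "module R (restrict_scalars h M)"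
proof -
  interpret R: cring R by fact
  interpret M: module B M by fact
  have h: "\<And>a. a \<in> carrier R \<Longrightarrow> h a \<in> carrier B" using assms(2) by (simp add: ring_hom_memE)
  show ?thesis
  proof (rule moduleI)
    show "abelian_group (restrict_scalars h M)"
    proof (rule abelian_groupI)
      fix x assume "x \<in> carrier (restrict_scalars h M)"
      then show "\<exists>y\<in>carrier (restrict_scalars h M). y \<oplus>\<^bsub>restrict_scalars h M\<^esub> x = \<zero>\<^bsub>restrict_scalars h M\<^esub>"
        by (intro bexI[of _ "\<ominus>\<^bsub>M\<^esub> x"]) (auto simp: M.M.l_neg)
    qed (auto simp: M.M.a_ac)
  qed (use ring_hom_memE[OF assms(2)] in \<open>auto simp: assms(1) M.smult_l_distr M.smult_r_distr M.smult_assoc1\<close>)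
qed

lemma restrict_scalars_submodule_iff:
  assumes "cring R" "h \<in> ring_hom R B" "h ` carrier R = carrier B" "module B M"
  shows "submodule P R (restrict_scalars h M) \<longleftrightarrow> submodule P B M"
proof -
  interpret M: module B M by fact
  interpret N: module R "restrict_scalars h M" by (rule restrict_scalars_module; fact)
  show ?thesis unfolding M.submodule_iff N.submodule_iff assms(3)[symmetric] by auto
qed

lemma len_restrict_scalars:
  assumes "cring R" "h \<in> ring_hom R B" "h ` carrier R = carrier B" "module B M"
  shows "len R (restrict_scalars h M) N L = len B M N L"
  by (simp add: len_def submodule_chain_def restrict_scalars_submodule_iff[OF assms])

lemma module_length_restrict_scalars:
  assumes "cring R" "h \<in> ring_hom R B" "h ` carrier R = carrier B" "module B M"
  shows "module_length R (restrict_scalars h M) = module_length B M"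
  by (simp add: module_length_def restrict_scalars_submodule_iff[OF assms])

section \<open>Modules over a quotient ring\<close>

lemma over_quotient_simps [simp]:
  "carrier (over_quotient M) = carrier M" "\<zero>\<^bsub>over_quotient M\<^esub> = \<zero>\<^bsub>M\<^esub>"
  "x \<oplus>\<^bsub>over_quotient M\<^esub> y = x \<oplus>\<^bsub>M\<^esub> y"
  by (simp_all add: over_quotient_def)

lemma over_quotient_smult:
  assumes "module R M" "ideal I R" and kill: "\<And>a x. a \<in> I \<Longrightarrow> x \<in> carrier M \<Longrightarrow> a \<odot>\<^bsub>M\<^esub> x = \<zero>\<^bsub>M\<^esub>"
    and a: "a \<in> carrier R" and x: "x \<in> carrier M"
  shows "(I +>\<^bsub>R\<^esub> a) \<odot>\<^bsub>over_quotient M\<^esub> x = a \<odot>\<^bsub>M\<^esub> x"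
proof -
  interpret M: module R M by fact
  interpret I: ideal I R by fact
  define b where "b = (SOME b. b \<in> I +>\<^bsub>R\<^esub> a)"
  have "a \<in> I +>\<^bsub>R\<^esub> a" using a I.a_rcos_self by blast
  then have "b \<in> I +>\<^bsub>R\<^esub> a" unfolding b_def by (rule someI)
  then have bc: "b \<in> carrier R" by (rule I.a_elemrcos_carrier[OF a])
  then have "b \<ominus>\<^bsub>R\<^esub> a \<in> I"
    unfolding a_minus_def using \<open>b \<in> I +>\<^bsub>R\<^esub> a\<close> I.a_rcos_module[OF a] by blast
  then have z: "(b \<ominus>\<^bsub>R\<^esub> a) \<odot>\<^bsub>M\<^esub> x = \<zero>\<^bsub>M\<^esub>" using kill x by blast
  have e: "b \<odot>\<^bsub>M\<^esub> x = (b \<ominus>\<^bsub>R\<^esub> a) \<odot>\<^bsub>M\<^esub> x \<oplus>\<^bsub>M\<^esub> a \<odot>\<^bsub>M\<^esub> x" using a x bc by algebra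
  have "b \<odot>\<^bsub>M\<^esub> x = a \<odot>\<^bsub>M\<^esub> x" unfolding e z using a x by (intro M.M.l_zero M.smult_closed)
  then show ?thesis by (simp add: over_quotient_def b_def)
qed

lemma over_quotient_module:
  assumes "module R M" "ideal I R" and kill: "\<And>a x. a \<in> I \<Longrightarrow> x \<in> carrier M \<Longrightarrow> a \<odot>\<^bsub>M\<^esub> x = \<zero>\<^bsub>M\<^esub>"
  shows "module (R Quot I) (over_quotient M)"
proof -
  interpret M: module R M by fact
  interpret I: ideal I R by fact
  have hom: "(\<lambda>a. I +>\<^bsub>R\<^esub> a) \<in> ring_hom R (R Quot I)" by (rule I.rcos_ring_hom)
  have car: "carrier (R Quot I) = (\<lambda>a. I +>\<^bsub>R\<^esub> a) ` carrier R"
    by (auto simp: FactRing_def A_RCOSETS_def')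
  note sm = over_quotient_smult[OF assms]
  note h = ring_hom_memE(2-)[OF hom, symmetric]
  show ?thesis
  proof (rule moduleI)
    show "cring (R Quot I)" by (rule I.quotient_is_cring[OF M.R.is_cring])
    show "abelian_group (over_quotient M)"
    proof (rule abelian_groupI)
      fix x assume "x \<in> carrier (over_quotient M)"
      then show "\<exists>y\<in>carrier (over_quotient M). y \<oplus>\<^bsub>over_quotient M\<^esub> x = \<zero>\<^bsub>over_quotient M\<^esub>"
        by (intro bexI[of _ "\<ominus>\<^bsub>M\<^esub> x"]) (auto simp: M.M.l_neg)
    qed (auto simp: M.M.a_ac)
  qed (unfold car, auto simp: sm h M.smult_l_distr M.smult_r_distr M.smult_assoc1)
qed

section \<open>Adjoining an element to a submodule\<close>

definition adjoin ::
    "('a, 'r) ring_scheme \<Rightarrow> ('a, 'm, 'x) module_scheme \<Rightarrow> 'm set \<Rightarrow> 'm \<Rightarrow> 'm set" where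
  "adjoin R M J t = {j \<oplus>\<^bsub>M\<^esub> r \<odot>\<^bsub>M\<^esub> t | j r. j \<in> J \<and> r \<in> carrier R}"

lemma (in module) adjoin_submodule:
  assumes J: "submodule J R M" and t: "t \<in> carrier M"
  shows "submodule (adjoin R M J t) R M" "J \<subseteq> adjoin R M J t" "t \<in> adjoin R M J t"
proof -
  note c = subsetD[OF submoduleE(1)[OF J]]
  show "submodule (adjoin R M J t) R M"
  proof (rule submoduleI2)
    show "adjoin R M J t \<subseteq> carrier M" unfolding adjoin_def using c t by auto
    have "\<zero>\<^bsub>M\<^esub> = \<zero>\<^bsub>M\<^esub> \<oplus>\<^bsub>M\<^esub> \<zero>\<^bsub>R\<^esub> \<odot>\<^bsub>M\<^esub> t" using t by simp
    then show "\<zero>\<^bsub>M\<^esub> \<in> adjoin R M J t" unfolding adjoin_def using submodule_zero[OF J] by blast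
  next
    fix a b assume "a \<in> adjoin R M J t" "b \<in> adjoin R M J t"
    then obtain j r k s where *: "j \<in> J" "r \<in> carrier R" "k \<in> J" "s \<in> carrier R"
      "a = j \<oplus>\<^bsub>M\<^esub> r \<odot>\<^bsub>M\<^esub> t" "b = k \<oplus>\<^bsub>M\<^esub> s \<odot>\<^bsub>M\<^esub> t" unfolding adjoin_def by blast
    have "a \<oplus>\<^bsub>M\<^esub> b = (j \<oplus>\<^bsub>M\<^esub> k) \<oplus>\<^bsub>M\<^esub> (r \<oplus>\<^bsub>R\<^esub> s) \<odot>\<^bsub>M\<^esub> t"
      unfolding *(5,6) using c[OF *(1)] c[OF *(3)] *(2,4) t by algebra
    then show "a \<oplus>\<^bsub>M\<^esub> b \<in> adjoin R M J t" unfolding adjoin_def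
      using submoduleE(5)[OF J *(1,3)] R.a_closed[OF *(2,4)] by blast
  next
    fix a b assume a: "a \<in> carrier R" and "b \<in> adjoin R M J t"
    then obtain k s where *: "k \<in> J" "s \<in> carrier R" "b = k \<oplus>\<^bsub>M\<^esub> s \<odot>\<^bsub>M\<^esub> t" unfolding adjoin_def by blast
    have "a \<odot>\<^bsub>M\<^esub> b = a \<odot>\<^bsub>M\<^esub> k \<oplus>\<^bsub>M\<^esub> (a \<otimes>\<^bsub>R\<^esub> s) \<odot>\<^bsub>M\<^esub> t"
      unfolding *(3) using c[OF *(1)] *(2) a t by algebra
    then show "a \<odot>\<^bsub>M\<^esub> b \<in> adjoin R M J t" unfolding adjoin_def
      using submoduleE(4)[OF J a *(1)] R.m_closed[OF a *(2)] by blast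
  qed
  have "j = j \<oplus>\<^bsub>M\<^esub> \<zero>\<^bsub>R\<^esub> \<odot>\<^bsub>M\<^esub> t" if "j \<in> J" for j using c[OF that] t by simp
  then show "J \<subseteq> adjoin R M J t" unfolding adjoin_def by blast
  have "t = \<zero>\<^bsub>M\<^esub> \<oplus>\<^bsub>M\<^esub> \<one>\<^bsub>R\<^esub> \<odot>\<^bsub>M\<^esub> t" using t by simp
  then show "t \<in> adjoin R M J t" unfolding adjoin_def using submodule_zero[OF J] by blast
qed

text \<open>The submodule generated by J and t is the quotient of the direct sum of J and R by the pairs
  (a t, - a) with a t in J, so that the value at t may be chosen freely subject to those pairs.\<close>
lemma linear_mod_extend:
  assumes A: "module R A" and B: "module R B" and J: "submodule J R A" and N: "submodule N R B"
    and f: "linear_mod R A B J N f" and t: "t \<in> carrier A" and z: "z \<in> carrier B"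
    and compat: "\<And>a. a \<in> carrier R \<Longrightarrow> a \<odot>\<^bsub>A\<^esub> t \<in> J \<Longrightarrow> cong_mod B N (f (a \<odot>\<^bsub>A\<^esub> t)) (a \<odot>\<^bsub>B\<^esub> z)"
  obtains g where "linear_mod R A B (adjoin R A J t) N g"
    "\<And>j r. j \<in> J \<Longrightarrow> r \<in> carrier R \<Longrightarrow> cong_mod B N (g (j \<oplus>\<^bsub>A\<^esub> r \<odot>\<^bsub>A\<^esub> t)) (f j \<oplus>\<^bsub>B\<^esub> r \<odot>\<^bsub>B\<^esub> z)"
proof -
  interpret A: module R A by fact
  interpret B: module R B by fact
  note c = subsetD[OF A.submoduleE(1)[OF J]]
  have fc: "f j \<in> carrier B" if "j \<in> J" for j using f that by (simp add: linear_mod_def)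
  define p where "p k = (SOME p. fst p \<in> J \<and> snd p \<in> carrier R \<and> k = fst p \<oplus>\<^bsub>A\<^esub> snd p \<odot>\<^bsub>A\<^esub> t)" for k
  define g where "g k = f (fst (p k)) \<oplus>\<^bsub>B\<^esub> snd (p k) \<odot>\<^bsub>B\<^esub> z" for k
  have g: "cong_mod B N (g (j \<oplus>\<^bsub>A\<^esub> r \<odot>\<^bsub>A\<^esub> t)) (f j \<oplus>\<^bsub>B\<^esub> r \<odot>\<^bsub>B\<^esub> z)" if j: "j \<in> J" and r: "r \<in> carrier R" for j r
  proof -
    define k where "k = j \<oplus>\<^bsub>A\<^esub> r \<odot>\<^bsub>A\<^esub> t"
    obtain i s where p: "p k = (i, s)" by (cases "p k")
    have "fst (p k) \<in> J \<and> snd (p k) \<in> carrier R \<and> k = fst (p k) \<oplus>\<^bsub>A\<^esub> snd (p k) \<odot>\<^bsub>A\<^esub> t"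
      unfolding p_def by (rule someI[of _ "(j, r)"]) (use j r k_def in auto)
    then have i: "i \<in> J" "s \<in> carrier R" "k = i \<oplus>\<^bsub>A\<^esub> s \<odot>\<^bsub>A\<^esub> t" using p by auto
    have e: "(r \<ominus>\<^bsub>R\<^esub> s) \<odot>\<^bsub>A\<^esub> t = i \<ominus>\<^bsub>A\<^esub> j"
    proof -
      have "(r \<ominus>\<^bsub>R\<^esub> s) \<odot>\<^bsub>A\<^esub> t = (j \<oplus>\<^bsub>A\<^esub> r \<odot>\<^bsub>A\<^esub> t) \<ominus>\<^bsub>A\<^esub> j \<ominus>\<^bsub>A\<^esub> s \<odot>\<^bsub>A\<^esub> t"
        using r i(2) t c[OF j] by algebra
      also have "j \<oplus>\<^bsub>A\<^esub> r \<odot>\<^bsub>A\<^esub> t = i \<oplus>\<^bsub>A\<^esub> s \<odot>\<^bsub>A\<^esub> t" using i(3) k_def by simp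
      also have "(i \<oplus>\<^bsub>A\<^esub> s \<odot>\<^bsub>A\<^esub> t) \<ominus>\<^bsub>A\<^esub> j \<ominus>\<^bsub>A\<^esub> s \<odot>\<^bsub>A\<^esub> t = i \<ominus>\<^bsub>A\<^esub> j"
        using r i(2) t c[OF j] c[OF i(1)] by algebra
      finally show ?thesis .
    qed
    have rs: "r \<ominus>\<^bsub>R\<^esub> s \<in> carrier R" using r i by simp
    have rsJ: "(r \<ominus>\<^bsub>R\<^esub> s) \<odot>\<^bsub>A\<^esub> t \<in> J" unfolding e using A.submodule_minus[OF J] i j by simp
    have "j \<oplus>\<^bsub>A\<^esub> (r \<ominus>\<^bsub>R\<^esub> s) \<odot>\<^bsub>A\<^esub> t = i" unfolding e using c[OF j] c[OF i(1)] by algebra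
    then have "cong_mod B N (f i) (f j \<oplus>\<^bsub>B\<^esub> f ((r \<ominus>\<^bsub>R\<^esub> s) \<odot>\<^bsub>A\<^esub> t))"
      using f j rsJ unfolding linear_mod_def by metis
    moreover have "cong_mod B N (f j \<oplus>\<^bsub>B\<^esub> f ((r \<ominus>\<^bsub>R\<^esub> s) \<odot>\<^bsub>A\<^esub> t)) (f j \<oplus>\<^bsub>B\<^esub> (r \<ominus>\<^bsub>R\<^esub> s) \<odot>\<^bsub>B\<^esub> z)"
      by (rule B.cong_add[OF N B.cong_refl[OF N fc[OF j]] compat[OF rs rsJ]])
    ultimately have "cong_mod B N (f i) (f j \<oplus>\<^bsub>B\<^esub> (r \<ominus>\<^bsub>R\<^esub> s) \<odot>\<^bsub>B\<^esub> z)" by (rule B.cong_trans[OF N])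
    moreover have "s \<odot>\<^bsub>B\<^esub> z \<in> carrier B" using i z by simp
    ultimately have "cong_mod B N (f i \<oplus>\<^bsub>B\<^esub> s \<odot>\<^bsub>B\<^esub> z) ((f j \<oplus>\<^bsub>B\<^esub> (r \<ominus>\<^bsub>R\<^esub> s) \<odot>\<^bsub>B\<^esub> z) \<oplus>\<^bsub>B\<^esub> s \<odot>\<^bsub>B\<^esub> z)"
      by (intro B.cong_add[OF N] B.cong_refl[OF N])
    also have "(f j \<oplus>\<^bsub>B\<^esub> (r \<ominus>\<^bsub>R\<^esub> s) \<odot>\<^bsub>B\<^esub> z) \<oplus>\<^bsub>B\<^esub> s \<odot>\<^bsub>B\<^esub> z = f j \<oplus>\<^bsub>B\<^esub> r \<odot>\<^bsub>B\<^esub> z"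
      using fc[OF j] r i(2) z by algebra
    finally show ?thesis by (simp add: g_def p k_def[symmetric])
  qed
  have "linear_mod R A B (adjoin R A J t) N g"
    unfolding linear_mod_def
  proof (intro conjI ballI)
    fix k assume "k \<in> adjoin R A J t"
    then obtain j r where *: "j \<in> J" "r \<in> carrier R" "k = j \<oplus>\<^bsub>A\<^esub> r \<odot>\<^bsub>A\<^esub> t" unfolding adjoin_def by blast
    show "g k \<in> carrier B" using B.cong_carr[OF g[OF *(1,2)]] *(3) by simp
  next
    fix k l assume "k \<in> adjoin R A J t" "l \<in> adjoin R A J t"
    then obtain i r j s where *: "i \<in> J" "r \<in> carrier R" "k = i \<oplus>\<^bsub>A\<^esub> r \<odot>\<^bsub>A\<^esub> t"
      "j \<in> J" "s \<in> carrier R" "l = j \<oplus>\<^bsub>A\<^esub> s \<odot>\<^bsub>A\<^esub> t" unfolding adjoin_def by blast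
    have kl: "k \<oplus>\<^bsub>A\<^esub> l = (i \<oplus>\<^bsub>A\<^esub> j) \<oplus>\<^bsub>A\<^esub> (r \<oplus>\<^bsub>R\<^esub> s) \<odot>\<^bsub>A\<^esub> t"
      unfolding *(3,6) using c[OF *(1)] c[OF *(4)] *(2,5) t by algebra
    have ij: "i \<oplus>\<^bsub>A\<^esub> j \<in> J" using A.submoduleE(5)[OF J] * by blast
    have "cong_mod B N (g (k \<oplus>\<^bsub>A\<^esub> l)) (f (i \<oplus>\<^bsub>A\<^esub> j) \<oplus>\<^bsub>B\<^esub> (r \<oplus>\<^bsub>R\<^esub> s) \<odot>\<^bsub>B\<^esub> z)"
      unfolding kl using g[OF ij A.R.a_closed[OF *(2,5)]] .
    moreover have "cong_mod B N (f (i \<oplus>\<^bsub>A\<^esub> j) \<oplus>\<^bsub>B\<^esub> (r \<oplus>\<^bsub>R\<^esub> s) \<odot>\<^bsub>B\<^esub> z) ((f i \<oplus>\<^bsub>B\<^esub> f j) \<oplus>\<^bsub>B\<^esub> (r \<oplus>\<^bsub>R\<^esub> s) \<odot>\<^bsub>B\<^esub> z)"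
      by (intro B.cong_add[OF N] B.cong_refl[OF N]) (use f * z in \<open>auto simp: linear_mod_def\<close>)
    ultimately have 1: "cong_mod B N (g (k \<oplus>\<^bsub>A\<^esub> l)) ((f i \<oplus>\<^bsub>B\<^esub> f j) \<oplus>\<^bsub>B\<^esub> (r \<oplus>\<^bsub>R\<^esub> s) \<odot>\<^bsub>B\<^esub> z)"
      by (rule B.cong_trans[OF N])
    have 2: "(f i \<oplus>\<^bsub>B\<^esub> f j) \<oplus>\<^bsub>B\<^esub> (r \<oplus>\<^bsub>R\<^esub> s) \<odot>\<^bsub>B\<^esub> z = (f i \<oplus>\<^bsub>B\<^esub> r \<odot>\<^bsub>B\<^esub> z) \<oplus>\<^bsub>B\<^esub> (f j \<oplus>\<^bsub>B\<^esub> s \<odot>\<^bsub>B\<^esub> z)"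
      using fc[OF *(1)] fc[OF *(4)] *(2,5) z by algebra
    show "cong_mod B N (g (k \<oplus>\<^bsub>A\<^esub> l)) (g k \<oplus>\<^bsub>B\<^esub> g l)"
      by (rule B.cong_trans[OF N 1[unfolded 2]], rule B.cong_sym[OF N], unfold *(3,6))
         (intro B.cong_add[OF N] g *)
  next
    fix a k assume a: "a \<in> carrier R" and "k \<in> adjoin R A J t"
    then obtain j r where *: "j \<in> J" "r \<in> carrier R" "k = j \<oplus>\<^bsub>A\<^esub> r \<odot>\<^bsub>A\<^esub> t" unfolding adjoin_def by blast
    have ak: "a \<odot>\<^bsub>A\<^esub> k = a \<odot>\<^bsub>A\<^esub> j \<oplus>\<^bsub>A\<^esub> (a \<otimes>\<^bsub>R\<^esub> r) \<odot>\<^bsub>A\<^esub> t"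
      unfolding *(3) using c[OF *(1)] *(2) a t by algebra
    have aj: "a \<odot>\<^bsub>A\<^esub> j \<in> J" using A.submoduleE(4)[OF J] a * by blast
    have "cong_mod B N (g (a \<odot>\<^bsub>A\<^esub> k)) (f (a \<odot>\<^bsub>A\<^esub> j) \<oplus>\<^bsub>B\<^esub> (a \<otimes>\<^bsub>R\<^esub> r) \<odot>\<^bsub>B\<^esub> z)"
      unfolding ak using g[OF aj A.R.m_closed[OF a *(2)]] .
    moreover have "cong_mod B N (f (a \<odot>\<^bsub>A\<^esub> j) \<oplus>\<^bsub>B\<^esub> (a \<otimes>\<^bsub>R\<^esub> r) \<odot>\<^bsub>B\<^esub> z) (a \<odot>\<^bsub>B\<^esub> f j \<oplus>\<^bsub>B\<^esub> (a \<otimes>\<^bsub>R\<^esub> r) \<odot>\<^bsub>B\<^esub> z)"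
      by (intro B.cong_add[OF N] B.cong_refl[OF N]) (use f * a z in \<open>auto simp: linear_mod_def\<close>)
    ultimately have 1: "cong_mod B N (g (a \<odot>\<^bsub>A\<^esub> k)) (a \<odot>\<^bsub>B\<^esub> f j \<oplus>\<^bsub>B\<^esub> (a \<otimes>\<^bsub>R\<^esub> r) \<odot>\<^bsub>B\<^esub> z)"
      by (rule B.cong_trans[OF N])
    have 2: "a \<odot>\<^bsub>B\<^esub> f j \<oplus>\<^bsub>B\<^esub> (a \<otimes>\<^bsub>R\<^esub> r) \<odot>\<^bsub>B\<^esub> z = a \<odot>\<^bsub>B\<^esub> (f j \<oplus>\<^bsub>B\<^esub> r \<odot>\<^bsub>B\<^esub> z)"
      using fc[OF *(1)] *(2) a z by algebra
    show "cong_mod B N (g (a \<odot>\<^bsub>A\<^esub> k)) (a \<odot>\<^bsub>B\<^esub> g k)"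
      by (rule B.cong_trans[OF N 1[unfolded 2]], rule B.cong_sym[OF N], unfold *(3))
         (intro B.cong_smult[OF N] g * a)
  qed
  with g that show ?thesis by blast
qed

section \<open>Ideals as submodules\<close>

lemma ring_module_simps [simp]:
  "carrier (ring_module R) = carrier R" "\<zero>\<^bsub>ring_module R\<^esub> = \<zero>\<^bsub>R\<^esub>"
  "x \<oplus>\<^bsub>ring_module R\<^esub> y = x \<oplus>\<^bsub>R\<^esub> y" "a \<odot>\<^bsub>ring_module R\<^esub> x = a \<otimes>\<^bsub>R\<^esub> x"
  "x \<ominus>\<^bsub>ring_module R\<^esub> y = x \<ominus>\<^bsub>R\<^esub> y"
  by (simp_all add: ring_module_def a_minus_def a_inv_def m_inv_def)

definition colon :: "('a, 'r) ring_scheme \<Rightarrow> 'a set \<Rightarrow> 'a set \<Rightarrow> 'a set" where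
  "colon R A J = {a \<in> carrier R. \<forall>j\<in>J. a \<otimes>\<^bsub>R\<^esub> j \<in> A}"

abbreviation ilen :: "('a, 'r) ring_scheme \<Rightarrow> 'a set \<Rightarrow> 'a set \<Rightarrow> enat" where
  "ilen R \<equiv> len R (ring_module R)"

context cring begin

lemma ring_module_module: "module R (ring_module R)"
proof (rule moduleI)
  show "abelian_group (ring_module R)"
    by (rule abelian_groupI) (auto simp: a_ac intro: bexI[of _ "\<ominus> _"] l_neg)
qed (auto simp: l_distr r_distr m_assoc is_cring)

interpretation rm: module R "ring_module R" by (rule ring_module_module)

lemma ideal_iff_submodule: "ideal J R \<longleftrightarrow> submodule J R (ring_module R)"
proof
  assume "ideal J R"
  then interpret J: ideal J R .
  show "submodule J R (ring_module R)"
    by (rule rm.submoduleI2) (auto intro: J.I_l_closed)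
next
  assume J: "submodule J R (ring_module R)"
  note e = rm.submoduleE[OF J]
  have c: "\<And>j. j \<in> J \<Longrightarrow> j \<in> carrier R" using e(1) by auto
  show "ideal J R"
  proof (rule idealI)
    show "subgroup J (add_monoid R)"
      using submodule.axioms(1)[OF J] by (simp add: ring_module_def subgroup_def m_inv_def)
    fix a x assume "a \<in> J" "x \<in> carrier R"
    then show "x \<otimes> a \<in> J" using e(4)[of x a] by simp
    then show "a \<otimes> x \<in> J" using m_comm[of a x] c \<open>a \<in> J\<close> \<open>x \<in> carrier R\<close> by simp
  qed (rule ring_axioms)
qed

lemma idealI2:
  assumes "J \<subseteq> carrier R" "\<zero> \<in> J" "\<And>a b. a \<in> J \<Longrightarrow> b \<in> J \<Longrightarrow> a \<oplus> b \<in> J"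
    "\<And>a b. a \<in> carrier R \<Longrightarrow> b \<in> J \<Longrightarrow> a \<otimes> b \<in> J"
  shows "ideal J R"
  unfolding ideal_iff_submodule by (rule rm.submoduleI2) (use assms in auto)

lemma idealE:
  assumes "ideal J R"
  shows "J \<subseteq> carrier R" "\<zero> \<in> J" "\<And>a b. a \<in> J \<Longrightarrow> b \<in> J \<Longrightarrow> a \<oplus> b \<in> J"
    "\<And>a b. a \<in> J \<Longrightarrow> b \<in> J \<Longrightarrow> a \<ominus> b \<in> J"
    "\<And>a b. a \<in> carrier R \<Longrightarrow> b \<in> J \<Longrightarrow> a \<otimes> b \<in> J"
  using rm.submoduleE(1,4,5)[OF assms[unfolded ideal_iff_submodule]]
    rm.submodule_zero[OF assms[unfolded ideal_iff_submodule]]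
    rm.submodule_minus[OF assms[unfolded ideal_iff_submodule]] by auto

lemma ideal_diff_mem_iff:
  assumes "ideal J R" "a \<in> carrier R" "b \<in> carrier R" "a \<ominus> b \<in> J" shows "a \<in> J \<longleftrightarrow> b \<in> J"
  using rm.cong_mem[of J J a b] assms by (simp add: cong_mod_def ideal_iff_submodule)

lemma carrier_ideal: "ideal (carrier R) R" by (rule idealI2) auto

lemma colon_ideal:
  assumes "ideal A R" "J \<subseteq> carrier R" shows "ideal (colon R A J) R"
proof (rule idealI2)
  note A = idealE[OF assms(1)]
  have J: "\<And>j. j \<in> J \<Longrightarrow> j \<in> carrier R" using assms(2) by auto
  show "colon R A J \<subseteq> carrier R" by (auto simp: colon_def)
  show "\<zero> \<in> colon R A J" using A J by (auto simp: colon_def)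
  show "a \<oplus> b \<in> colon R A J" if "a \<in> colon R A J" "b \<in> colon R A J" for a b
    using that A J by (auto simp: colon_def l_distr)
  show "a \<otimes> b \<in> colon R A J" if "a \<in> carrier R" "b \<in> colon R A J" for a b
    using that A J by (auto simp: colon_def m_assoc)
qed

lemma mem_cgen_iff: "a \<in> PIdl x \<longleftrightarrow> (\<exists>r\<in>carrier R. a = r \<otimes> x)"
  by (auto simp: cgenideal_def)

lemma cgen_mem: "r \<in> carrier R \<Longrightarrow> r \<otimes> x \<in> PIdl x" "x \<in> carrier R \<Longrightarrow> r \<in> carrier R \<Longrightarrow> x \<otimes> r \<in> PIdl x"
  by (auto simp: mem_cgen_iff m_comm)

lemma cgen_subset: "ideal J R \<Longrightarrow> x \<in> J \<Longrightarrow> PIdl x \<subseteq> J"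
  using idealE(5) by (auto simp: mem_cgen_iff)

lemma regular_cancel:
  assumes "regular_element R x" "a \<in> carrier R" "b \<in> carrier R" "x \<otimes> a = x \<otimes> b"
  shows "a = b"
proof -
  have x: "x \<in> carrier R" using assms(1) by (simp add: regular_element_def)
  have "x \<otimes> (a \<ominus> b) = x \<otimes> a \<ominus> x \<otimes> b" using x assms(2,3) by algebra
  also have "\<dots> = x \<otimes> b \<ominus> x \<otimes> b" unfolding assms(4) ..
  also have "\<dots> = \<zero>" using x assms(3) by algebra
  finally have "a \<ominus> b = \<zero>" using assms by (simp add: regular_element_def)
  then show ?thesis using assms(2,3) by simp
qed

lemma regular_mult:
  assumes x: "regular_element R x" and y: "regular_element R y" shows "regular_element R (x \<otimes> y)"
proof -
  have c: "x \<in> carrier R" "y \<in> carrier R" using assms by (auto simp: regular_element_def)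
  have "z = \<zero>" if "z \<in> carrier R" "x \<otimes> y \<otimes> z = \<zero>" for z
  proof -
    have "x \<otimes> (y \<otimes> z) = \<zero>" using that(2) m_assoc[OF c that(1)] by simp
    then have "y \<otimes> z = \<zero>" using x c that(1) unfolding regular_element_def by blast
    then show ?thesis using y that(1) unfolding regular_element_def by blast
  qed
  then show ?thesis using c by (simp add: regular_element_def)
qed

abbreviation iadjoin :: "'a set \<Rightarrow> 'a \<Rightarrow> 'a set" where
  "iadjoin \<equiv> adjoin R (ring_module R)"

lemma iadjoin:
  assumes J: "ideal J R" and t: "t \<in> carrier R"
  shows "ideal (iadjoin J t) R" "J \<subseteq> iadjoin J t" "t \<in> iadjoin J t"
  using rm.adjoin_submodule[of J t] assms by (auto simp: ideal_iff_submodule)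

lemma iadjoin_iff:
  assumes J: "ideal J R" and t: "t \<in> carrier R" and k: "k \<in> carrier R"
  shows "k \<in> iadjoin J t \<longleftrightarrow> (\<exists>r\<in>carrier R. k \<ominus> r \<otimes> t \<in> J)"
proof
  assume "k \<in> iadjoin J t"
  then obtain j r where *: "j \<in> J" "r \<in> carrier R" "k = j \<oplus> r \<otimes> t" by (auto simp: adjoin_def)
  have "j \<in> carrier R" using idealE(1)[OF J] * by auto
  then have "k \<ominus> r \<otimes> t = j" unfolding *(3) using *(2) t by algebra
  then show "\<exists>r\<in>carrier R. k \<ominus> r \<otimes> t \<in> J" using * by metis
next
  assume "\<exists>r\<in>carrier R. k \<ominus> r \<otimes> t \<in> J"
  then obtain r where *: "r \<in> carrier R" "k \<ominus> r \<otimes> t \<in> J" by auto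
  have "k = (k \<ominus> r \<otimes> t) \<oplus> r \<otimes> t" using * k t by algebra
  then show "k \<in> iadjoin J t" unfolding adjoin_def ring_module_simps using * by blast
qed

lemma ilen_mult_transfer:
  assumes "t \<in> carrier R" "ideal L R" "ideal N R" "ideal N' R" "N \<subseteq> N'"
    "\<And>a. a \<in> L \<Longrightarrow> a \<otimes> t \<in> N'"
    "\<And>b. b \<in> N' \<Longrightarrow> \<exists>a\<in>L. b \<ominus> a \<otimes> t \<in> N"
  shows "ilen R {a \<in> L. a \<otimes> t \<in> N} L = ilen R N N'"
proof -
  have L: "L \<subseteq> carrier R" "N' \<subseteq> carrier R" using idealE assms by auto
  have N: "submodule N R (ring_module R)" using assms by (simp add: ideal_iff_submodule)
  have *: "a \<otimes> t \<in> carrier R" "r \<otimes> (a \<otimes> t) \<in> carrier R" if "a \<in> L" "r \<in> carrier R" for a r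
    using that L assms(1) by auto
  have lin: "linear_mod R (ring_module R) (ring_module R) L N (\<lambda>a. a \<otimes> t)"
    unfolding linear_mod_def
  proof (intro conjI ballI)
    fix a b assume a: "a \<in> L" "b \<in> L"
    have ac: "a \<in> carrier R" "b \<in> carrier R" using a L by auto
    then show "a \<otimes> t \<in> carrier (ring_module R)" using assms(1) by simp
    have "(a \<oplus> b) \<otimes> t = a \<otimes> t \<oplus> b \<otimes> t" using ac assms(1) by (simp add: l_distr)
    then show "cong_mod (ring_module R) N ((a \<oplus>\<^bsub>ring_module R\<^esub> b) \<otimes> t) (a \<otimes> t \<oplus>\<^bsub>ring_module R\<^esub> b \<otimes> t)"
      using rm.cong_refl[OF N, of "a \<otimes> t \<oplus> b \<otimes> t"] ac assms(1) by simp
  next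
    fix r a assume a: "r \<in> carrier R" "a \<in> L"
    have ac: "a \<in> carrier R" using a L by auto
    have "(r \<otimes> a) \<otimes> t = r \<otimes> (a \<otimes> t)" using ac a assms(1) by (simp add: m_assoc)
    then show "cong_mod (ring_module R) N ((r \<odot>\<^bsub>ring_module R\<^esub> a) \<otimes> t) (r \<odot>\<^bsub>ring_module R\<^esub> (a \<otimes> t))"
      using rm.cong_refl[OF N, of "r \<otimes> (a \<otimes> t)"] ac a assms(1) by simp
  qed
  show ?thesis
  proof (rule len_transfer[OF ring_module_module ring_module_module _ N _ _ lin])
    fix b assume b: "b \<in> N'"
    from assms(7)[OF b] obtain a where "a \<in> L" "b \<ominus> a \<otimes> t \<in> N" by blast
    then show "\<exists>a\<in>L. cong_mod (ring_module R) N b (a \<otimes> t)"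
      using L b assms(1) by (intro bexI[of _ a]) (auto simp: cong_mod_def)
  qed (use assms(2,4)[unfolded ideal_iff_submodule] assms(5,6) in blast)+
qed

lemma ilen_add:
  assumes "ideal A R" "ideal B R" "ideal C R" "A \<subseteq> B" "B \<subseteq> C"
  shows "ilen R A C = ilen R A B + ilen R B C"
  by (rule rm.len_add) (use assms[unfolded ideal_iff_submodule] in blast)+

lemma ilen_self: "ideal A R \<Longrightarrow> ilen R A A = 0"
  by (rule len_self) (simp add: ideal_iff_submodule)

lemma ilen_zeroD:
  assumes "ideal A R" "ideal B R" "A \<subseteq> B" "ilen R A B = 0" shows "A = B"
proof (rule ccontr)
  assume "A \<noteq> B"
  then have "A \<subset> B" using assms by auto
  then have "ilen R A A + 1 \<le> ilen R A B"
    by (intro len_strict) (use assms[unfolded ideal_iff_submodule] in blast)+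
  then have "(1::enat) \<le> 0" using assms(4) ilen_self[OF assms(1)] by simp
  then show False by simp
qed

end

section \<open>Local rings of dimension one\<close>

locale noetherian_cring = cring R + noetherian_ring R for R (structure)
begin

lemma noeth_max:
  assumes "S \<noteq> {}" "\<And>J. J \<in> S \<Longrightarrow> ideal J R"
  shows "\<exists>J\<in>S. \<forall>K\<in>S. J \<subseteq> K \<longrightarrow> K = J"
proof (rule subset_Zorn_nonempty[OF assms(1)])
  fix C assume C: "C \<noteq> {}" "subset.chain S C"
  then have "subset.chain {J. ideal J R} C" using assms(2) by (auto simp: subset.chain_def)
  then have "\<Union>C \<in> C" by (rule ideal_chain_is_trivial[OF C(1)])
  then show "\<Union>C \<in> S" using C(2) by (auto simp: subset.chain_def)
qed

lemma noeth_induct [consumes 1, case_names step]: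
  assumes "ideal J R"
    and step: "\<And>J. ideal J R \<Longrightarrow> (\<And>K. ideal K R \<Longrightarrow> J \<subset> K \<Longrightarrow> P K) \<Longrightarrow> P J"
  shows "P J"
proof (rule ccontr)
  assume "\<not> P J"
  then have "{J. ideal J R \<and> \<not> P J} \<noteq> {}" using assms(1) by auto
  from noeth_max[OF this] obtain K where K0: "ideal K R \<and> \<not> P K" 
    and mx0: "\<forall>L\<in>{J. ideal J R \<and> \<not> P J}. K \<subseteq> L \<longrightarrow> L = K" by auto
  then have K: "ideal K R" "\<not> P K" by auto
  have mx: "L = K" if "ideal L R" "\<not> P L" "K \<subseteq> L" for L using mx0 that by simp
  have "P K" by (rule step[OF K(1)]) (use mx in blast)
  then show False using K by simp
qed

lemma ex_maximalideal:
  assumes "ideal J R" "J \<noteq> carrier R" shows "\<exists>K. maximalideal K R \<and> J \<subseteq> K"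
proof -
  let ?S = "{K. ideal K R \<and> J \<subseteq> K \<and> K \<noteq> carrier R}"
  have "?S \<noteq> {}" using assms by blast
  moreover have "\<And>K. K \<in> ?S \<Longrightarrow> ideal K R" by blast
  ultimately have "\<exists>K\<in>?S. \<forall>L\<in>?S. K \<subseteq> L \<longrightarrow> L = K" by (rule noeth_max)
  then obtain K where K0: "K \<in> ?S" and mx0: "\<forall>L\<in>?S. K \<subseteq> L \<longrightarrow> L = K" by (rule bexE)
  have K: "ideal K R" "J \<subseteq> K" "K \<noteq> carrier R" using K0 by auto
  have mx: "L = K" if "ideal L R" "J \<subseteq> L" "L \<noteq> carrier R" "K \<subseteq> L" for L
    using mx0[rule_format, of L] that by simp
  have "maximalideal K R"
    by (rule maximalidealI[OF K(1) K(3)[symmetric]]) (use mx K(2) in blast)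
  then show ?thesis using K by blast
qed

end

text \<open>The last condition is what dimension one gives: a prime that contains a regular element is not
  minimal.\<close>
locale noetherian_local_dim1 = noetherian_cring R for R (structure) +
  fixes \<mm>
  assumes maxideal: "maximalideal \<mm> R"
    and maxideal_unique: "\<And>J. maximalideal J R \<Longrightarrow> J = \<mm>"
    and prime_regular: "\<And>P x. primeideal P R \<Longrightarrow> regular_element R x \<Longrightarrow> x \<in> P \<Longrightarrow> P = \<mm>"
begin

interpretation rm: module R "ring_module R" by (rule ring_module_module)

lemma m_ideal: "ideal \<mm> R" using maxideal by (simp add: maximalideal_def)

lemma m_proper: "\<mm> \<noteq> carrier R" "\<one> \<notin> \<mm>"
proof -
  show 1: "\<mm> \<noteq> carrier R" using maximalideal.I_notcarr[OF maxideal] by auto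
  then show "\<one> \<notin> \<mm>" using ideal.one_imp_carrier[OF m_ideal] by auto
qed

lemma proper_le_m: "ideal J R \<Longrightarrow> J \<noteq> carrier R \<Longrightarrow> J \<subseteq> \<mm>"
  using ex_maximalideal maxideal_unique by blast

text \<open>An ideal that is maximal among the (J : t) with t outside J is prime. It contains the regular
  element y, hence is the maximal ideal. Adjoining such elements t one after the other filters
  R/J by copies of the residue field.\<close>
lemma socle:
  assumes J: "ideal J R" "J \<noteq> carrier R" and y: "regular_element R y" "y \<in> J"
  obtains t where "t \<in> carrier R" "t \<notin> J" "\<And>a. a \<in> carrier R \<Longrightarrow> a \<otimes> t \<in> J \<longleftrightarrow> a \<in> \<mm>"
proof -
  let ?c = "\<lambda>t. colon R J {t}"
  have ci: "ideal (?c t) R" if "t \<in> carrier R" for t by (rule colon_ideal) (use J that in auto)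
  let ?S = "?c ` (carrier R - J)"
  have "?S \<noteq> {}" using idealE(1)[OF J(1)] J(2) by auto
  moreover have "\<And>K. K \<in> ?S \<Longrightarrow> ideal K R" using ci by blast
  ultimately have "\<exists>K\<in>?S. \<forall>L\<in>?S. K \<subseteq> L \<longrightarrow> L = K" by (rule noeth_max)
  then obtain K where K0: "K \<in> ?S" and mx0: "\<forall>L\<in>?S. K \<subseteq> L \<longrightarrow> L = K" by (rule bexE)
  then obtain t where Kt: "K = ?c t" and t: "t \<in> carrier R" "t \<notin> J" by blast
  have mx: "?c s = ?c t" if "s \<in> carrier R" "s \<notin> J" "?c t \<subseteq> ?c s" for s
    using mx0[rule_format, of "?c s"] that Kt by simp
  have "primeideal (?c t) R"
  proof (rule primeidealI[OF ci[OF t(1)] is_cring])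
    have "\<one> \<notin> ?c t" using t by (simp add: colon_def)
    then show "carrier R \<noteq> ?c t" by auto
    fix a b assume ab: "a \<in> carrier R" "b \<in> carrier R" "a \<otimes> b \<in> ?c t"
    show "a \<in> ?c t \<or> b \<in> ?c t"
    proof (rule disjCI)
      assume "b \<notin> ?c t"
      then have bt: "b \<otimes> t \<notin> J" using ab by (simp add: colon_def)
      have "?c t \<subseteq> ?c (b \<otimes> t)"
      proof
        fix r assume "r \<in> ?c t"
        then have r: "r \<in> carrier R" "r \<otimes> t \<in> J" by (auto simp: colon_def)
        have "r \<otimes> (b \<otimes> t) = b \<otimes> (r \<otimes> t)" using r ab t by algebra
        then show "r \<in> ?c (b \<otimes> t)" using r idealE(5)[OF J(1) ab(2)] by (simp add: colon_def)
      qed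
      then have "?c (b \<otimes> t) = ?c t" using mx[of "b \<otimes> t"] bt ab t by auto
      moreover have "a \<in> ?c (b \<otimes> t)" using ab t by (simp add: colon_def m_assoc)
      ultimately show "a \<in> ?c t" by simp
    qed
  qed
  moreover have "y \<in> ?c t" using y idealE(5)[OF J(1) t(1) y(2)] t m_comm[of y t] by (simp add: colon_def regular_element_def)
  ultimately have "?c t = \<mm>" using prime_regular y by blast
  then show ?thesis using that[of t] t by (auto simp: colon_def)
qed

lemma len_m: "ilen R \<mm> (carrier R) = 1"
proof (rule antisym)
  have "ilen R \<mm> \<mm> + 1 \<le> ilen R \<mm> (carrier R)"
    by (rule len_strict) (use m_ideal m_proper carrier_ideal idealE(1) in \<open>auto simp: ideal_iff_submodule[symmetric]\<close>)
  then show "1 \<le> ilen R \<mm> (carrier R)" by (simp add: ilen_self m_ideal)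
  show "ilen R \<mm> (carrier R) \<le> 1"
    unfolding len_def
  proof (rule Sup_least, clarify)
    fix n P assume P: "submodule_chain R (ring_module R) \<mm> (carrier R) n P"
    have "n \<le> 1"
    proof (rule ccontr)
      assume "\<not> n \<le> 1"
      then have n: "0 < n" "Suc 0 < n" "Suc 0 \<le> n" "Suc (Suc 0) \<le> n" "0 \<le> n" by auto
      have P1: "\<And>i. i \<le> n \<Longrightarrow> ideal (P i) R \<and> \<mm> \<subseteq> P i \<and> P i \<subseteq> carrier R"
        and P2: "\<And>i. i < n \<Longrightarrow> P i \<subset> P (Suc i)"
        using P by (auto simp: submodule_chain_def ideal_iff_submodule)
      have "P (Suc 0) = \<mm> \<or> P (Suc 0) = carrier R"
        using maximalideal.I_maximal[OF maxideal] P1[OF n(3)] by blast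
      then show False using P1[OF n(5)] P2[OF n(1)] P2[OF n(2)] P1[OF n(4)] by blast
    qed
    then show "enat n \<le> 1" by (simp add: one_enat_def)
  qed
qed

lemma socle_step:
  assumes J: "ideal J R" and t: "t \<in> carrier R" and tm: "\<And>a. a \<in> carrier R \<Longrightarrow> a \<otimes> t \<in> J \<longleftrightarrow> a \<in> \<mm>"
  shows "ilen R J (iadjoin J t) = 1"
proof -
  have "{a \<in> carrier R. a \<otimes> t \<in> J} = \<mm>" using tm idealE(1)[OF m_ideal] by auto
  moreover have "ilen R {a \<in> carrier R. a \<otimes> t \<in> J} (carrier R) = ilen R J (iadjoin J t)"
  proof (rule ilen_mult_transfer[OF t carrier_ideal J iadjoin(1,2)[OF J t]])
    show "a \<otimes> t \<in> iadjoin J t" if "a \<in> carrier R" for a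
      using idealE(5)[OF iadjoin(1)[OF J t] that iadjoin(3)[OF J t]] .
    show "\<exists>a\<in>carrier R. b \<ominus> a \<otimes> t \<in> J" if "b \<in> iadjoin J t" for b
      using iadjoin_iff[OF J t, of b] that idealE(1)[OF iadjoin(1)[OF J t]] by auto
  qed
  ultimately show ?thesis using len_m by simp
qed

lemma ilen_finite:
  assumes J: "ideal J R" and y: "regular_element R y" "y \<in> J"
  shows "ilen R J (carrier R) \<noteq> \<infinity>"
  using assms
proof (induction J rule: noeth_induct)
  case (step J)
  show ?case
  proof (cases "J = carrier R")
    case True
    then show ?thesis using ilen_self[OF carrier_ideal] by simp
  next
    case False
    obtain t where t: "t \<in> carrier R" "t \<notin> J" "\<And>a. a \<in> carrier R \<Longrightarrow> a \<otimes> t \<in> J \<longleftrightarrow> a \<in> \<mm>"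
      using socle[OF step(1) False step(3,4)] by blast
    note J' = iadjoin[OF step(1) t(1)]
    have "J \<subset> iadjoin J t" using J' t by blast
    then have "ilen R (iadjoin J t) (carrier R) \<noteq> \<infinity>" using step.IH[OF J'(1)] step by blast
    moreover have "ilen R J (carrier R) = ilen R J (iadjoin J t) + ilen R (iadjoin J t) (carrier R)"
      by (rule ilen_add[OF step(1) J'(1) carrier_ideal J'(2) idealE(1)[OF J'(1)]])
    ultimately show ?thesis using socle_step[OF step(1) t(1,3)] by (metis plus_eq_infty_iff_enat infinity_ne_i1)
  qed
qed

end

section \<open>Duality for ideals\<close>

lemma enat_add_self: "a = b + a \<Longrightarrow> a \<noteq> \<infinity> \<Longrightarrow> b = (0::enat)"
  by (cases a; cases b) (auto simp: zero_enat_def)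

lemma (in cring) linear_mod_ring_iff:
  assumes "L \<subseteq> carrier R"
  shows "linear_mod R (ring_module R) (ring_module R) L N f \<longleftrightarrow> (\<forall>x\<in>L. f x \<in> carrier R) \<and>
     (\<forall>x\<in>L. \<forall>y\<in>L. f (x \<oplus> y) \<in> carrier R \<and> f (x \<oplus> y) \<ominus> (f x \<oplus> f y) \<in> N) \<and>
     (\<forall>r\<in>carrier R. \<forall>x\<in>L. f (r \<otimes> x) \<in> carrier R \<and> f (r \<otimes> x) \<ominus> r \<otimes> f x \<in> N)"
  unfolding linear_mod_def cong_mod_def by auto

lemma (in module) linear_mod_smult:
  assumes N: "submodule N R M" and z: "z \<in> carrier M" and L: "L \<subseteq> carrier R"
  shows "linear_mod R (ring_module R) M L N (\<lambda>a. a \<odot>\<^bsub>M\<^esub> z)"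
  unfolding linear_mod_def
proof (intro conjI ballI)
  fix a b assume "a \<in> L" "b \<in> L"
  then have c: "a \<in> carrier R" "b \<in> carrier R" using L by auto
  then show "a \<odot>\<^bsub>M\<^esub> z \<in> carrier M" using z by simp
  show "cong_mod M N ((a \<oplus>\<^bsub>ring_module R\<^esub> b) \<odot>\<^bsub>M\<^esub> z) (a \<odot>\<^bsub>M\<^esub> z \<oplus>\<^bsub>M\<^esub> b \<odot>\<^bsub>M\<^esub> z)"
    unfolding ring_module_simps smult_l_distr[OF c z]
    by (rule cong_refl[OF N]) (use c z in simp)
next
  fix r a assume r: "r \<in> carrier R" and "a \<in> L"
  then have c: "a \<in> carrier R" using L by auto
  show "cong_mod M N ((r \<odot>\<^bsub>ring_module R\<^esub> a) \<odot>\<^bsub>M\<^esub> z) (r \<odot>\<^bsub>M\<^esub> (a \<odot>\<^bsub>M\<^esub> z))"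
    unfolding ring_module_simps smult_assoc1[OF r c z]
    by (rule cong_refl[OF N]) (use r c z in simp)
qed

text \<open>The last condition says that R/yR is an injective module over itself, in the form of Baer's
  criterion: f is a lift of a map from J/yR to R/yR, and it has to be multiplication by an
  element.\<close>
locale gorenstein_dim1 = noetherian_local_dim1 +
  assumes self_injective: "\<And>y J f. regular_element R y \<Longrightarrow> ideal J R \<Longrightarrow> y \<in> J \<Longrightarrow>
      linear_mod R (ring_module R) (ring_module R) J (PIdl y) f \<Longrightarrow> f y \<in> PIdl y \<Longrightarrow>
      \<exists>c\<in>carrier R. \<forall>j\<in>J. f j \<ominus> c \<otimes> j \<in> PIdl y"
begin

interpretation rm: module R "ring_module R" by (rule ring_module_module)

lemma regular_carrier: "regular_element R y \<Longrightarrow> y \<in> carrier R"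
  by (simp add: regular_element_def)

lemma principal: "regular_element R y \<Longrightarrow> ideal (PIdl y) R" "regular_element R y \<Longrightarrow> y \<in> PIdl y"
  using cgenideal_ideal cgenideal_self regular_carrier by auto

text \<open>The dual of the lemma on J and J + Rt: multiplication by t maps (yR : J)/(yR : J + Rt) to the
  socle (yR : m)/yR of R/yR. To see that it is onto, take b in (yR : m) and consider the map that
  vanishes on J and sends t to b; by self-injectivity it is multiplication by some c, and then
  ct is congruent to b.\<close>
lemma dual_socle_step:
  assumes y: "regular_element R y" and J: "ideal J R" "y \<in> J"
    and t: "t \<in> carrier R" and tm: "\<And>a. a \<in> carrier R \<Longrightarrow> a \<otimes> t \<in> J \<longleftrightarrow> a \<in> \<mm>"
  shows "ilen R (colon R (PIdl y) (iadjoin J t)) (colon R (PIdl y) J) = ilen R (PIdl y) (colon R (PIdl y) \<mm>)"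
proof -
  let ?Y = "PIdl y"
  note Y = principal[OF y]
  note Jc = idealE(1)[OF J(1)]
  have mc: "\<mm> \<subseteq> carrier R" using idealE(1)[OF m_ideal] .
  note AJ = iadjoin[OF J(1) t]
  have "{a \<in> colon R ?Y J. a \<otimes> t \<in> ?Y} = colon R ?Y (iadjoin J t)"
  proof (intro equalityI subsetI)
    fix a assume "a \<in> {a \<in> colon R ?Y J. a \<otimes> t \<in> ?Y}"
    then have a: "a \<in> carrier R" "\<And>j. j \<in> J \<Longrightarrow> a \<otimes> j \<in> ?Y" "a \<otimes> t \<in> ?Y" by (auto simp: colon_def)
    have "a \<otimes> k \<in> ?Y" if k: "k \<in> iadjoin J t" for k
    proof -
      obtain j r where *: "j \<in> J" "r \<in> carrier R" "k = j \<oplus> r \<otimes> t" using k by (auto simp: adjoin_def)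
      have "a \<otimes> k = a \<otimes> j \<oplus> r \<otimes> (a \<otimes> t)"
        unfolding *(3) using a(1) *(2) t subsetD[OF Jc *(1)] by algebra
      then show ?thesis using idealE(3,5)[OF Y(1)] a *(1,2) by simp
    qed
    then show "a \<in> colon R ?Y (iadjoin J t)" using a by (simp add: colon_def)
  qed (use AJ in \<open>auto simp: colon_def\<close>)
  moreover have "ilen R {a \<in> colon R ?Y J. a \<otimes> t \<in> ?Y} (colon R ?Y J) = ilen R ?Y (colon R ?Y \<mm>)"
  proof (rule ilen_mult_transfer[OF t colon_ideal[OF Y(1) Jc] Y(1) colon_ideal[OF Y(1) mc]])
    show "?Y \<subseteq> colon R ?Y \<mm>"
      by (rule cgen_subset[OF colon_ideal[OF Y(1) mc]])
         (use mc regular_carrier[OF y] in \<open>auto simp: colon_def intro: cgen_mem\<close>)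
  next
    fix a assume "a \<in> colon R ?Y J"
    then have a: "a \<in> carrier R" "\<And>j. j \<in> J \<Longrightarrow> a \<otimes> j \<in> ?Y" by (auto simp: colon_def)
    have "(a \<otimes> t) \<otimes> b \<in> ?Y" if b: "b \<in> \<mm>" for b
    proof -
      have bc: "b \<in> carrier R" using b mc by auto
      have "(a \<otimes> t) \<otimes> b = a \<otimes> (b \<otimes> t)" using a(1) bc t by algebra
      then show ?thesis using a(2) tm[OF bc] b by simp
    qed
    then show "a \<otimes> t \<in> colon R ?Y \<mm>" using a t by (simp add: colon_def)
  next
    fix b assume "b \<in> colon R ?Y \<mm>"
    then have b: "b \<in> carrier R" "\<And>a. a \<in> \<mm> \<Longrightarrow> b \<otimes> a \<in> ?Y" by (auto simp: colon_def)
    have sY: "submodule ?Y R (ring_module R)" and sJ: "submodule J R (ring_module R)"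
      using Y J by (simp_all add: ideal_iff_submodule)
    have f0: "linear_mod R (ring_module R) (ring_module R) J ?Y (\<lambda>a. a \<odot>\<^bsub>ring_module R\<^esub> \<zero>)"
      by (rule rm.linear_mod_smult[OF sY _ Jc]) simp
    obtain g where g: "linear_mod R (ring_module R) (ring_module R) (iadjoin J t) ?Y g"
      "\<And>j r. j \<in> J \<Longrightarrow> r \<in> carrier R \<Longrightarrow> cong_mod (ring_module R) ?Y (g (j \<oplus> r \<otimes> t)) (j \<otimes> \<zero> \<oplus> r \<otimes> b)"
    proof (rule linear_mod_extend[OF ring_module_module ring_module_module sJ sY f0])
      fix a assume a: "a \<in> carrier R" "a \<odot>\<^bsub>ring_module R\<^esub> t \<in> J"
      have "a \<otimes> b \<in> ?Y" using b(2)[of a] tm a m_comm[OF a(1) b(1)] by simp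
      then have "cong_mod (ring_module R) ?Y (a \<otimes> b) \<zero>" using rm.cong_zero_iff[OF sY] a b by simp
      then show "cong_mod (ring_module R) ?Y ((a \<odot>\<^bsub>ring_module R\<^esub> t) \<odot>\<^bsub>ring_module R\<^esub> \<zero>) (a \<odot>\<^bsub>ring_module R\<^esub> b)"
        using rm.cong_sym[OF sY] a t by simp
    qed (use b t in simp_all)
    have g2: "g (j \<oplus> r \<otimes> t) \<ominus> r \<otimes> b \<in> ?Y" "g (j \<oplus> r \<otimes> t) \<in> carrier R" if "j \<in> J" "r \<in> carrier R" for j r
      using g(2)[OF that] subsetD[OF Jc that(1)] that(2) b(1) by (simp_all add: cong_mod_def)
    have gJ: "g j \<in> ?Y" "g j \<in> carrier R" if "j \<in> J" for j
    proof -
      have jj: "j \<oplus> \<zero> \<otimes> t = j" "\<zero> \<otimes> b = \<zero>" using subsetD[OF Jc that] t b(1) by simp_all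
      show gc: "g j \<in> carrier R" using g2(2)[OF that zero_closed] unfolding jj .
      then have "g j \<ominus> \<zero> = g j" by (simp add: a_minus_def)
      then show "g j \<in> ?Y" using g2(1)[OF that zero_closed] unfolding jj by simp
    qed
    have gt: "g t \<ominus> b \<in> ?Y" "g t \<in> carrier R"
      using g2[OF idealE(2)[OF J(1)] one_closed] t b(1) by simp_all
    obtain c where c: "c \<in> carrier R" "\<And>k. k \<in> iadjoin J t \<Longrightarrow> g k \<ominus> c \<otimes> k \<in> ?Y"
      using self_injective[OF y AJ(1) _ g(1)] gJ J(2) AJ(2) by blast
    have "c \<otimes> j \<in> ?Y" if j: "j \<in> J" for j
    proof -
      have "g j \<ominus> c \<otimes> j \<in> ?Y" using c j AJ by blast
      then show ?thesis using ideal_diff_mem_iff[OF Y(1), of "g j" "c \<otimes> j"] gJ[OF j] c subsetD[OF Jc j] by simp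
    qed
    then have "c \<in> colon R ?Y J" using c by (simp add: colon_def)
    moreover have "b \<ominus> c \<otimes> t \<in> ?Y"
    proof -
      have "b \<ominus> c \<otimes> t = (g t \<ominus> c \<otimes> t) \<ominus> (g t \<ominus> b)" using b(1) c(1) t gt(2) by algebra
      then show ?thesis using idealE(4)[OF Y(1) c(2)[OF AJ(3)] gt(1)] by simp
    qed
    ultimately show "\<exists>a\<in>colon R ?Y J. b \<ominus> a \<otimes> t \<in> ?Y" by blast
  qed
  ultimately show ?thesis by simp
qed

lemma colon_antimono: "J \<subseteq> K \<Longrightarrow> colon R A K \<subseteq> colon R A J"
  by (auto simp: colon_def)

lemma colon_carrier: "ideal A R \<Longrightarrow> colon R A (carrier R) = A"
proof (intro equalityI subsetI)
  fix a assume "ideal A R" and a: "a \<in> colon R A (carrier R)"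
  have "a \<in> carrier R" using a by (simp add: colon_def)
  moreover have "a \<otimes> \<one> \<in> A" using a one_closed unfolding colon_def by blast
  ultimately show "a \<in> A" by simp
next
  fix a assume A: "ideal A R" and a: "a \<in> A"
  then have "a \<in> carrier R" using idealE(1) by blast
  then show "a \<in> colon R A (carrier R)" using idealE(5)[OF A _ a] m_comm[of a] by (simp add: colon_def)
qed

lemma colon_principal: "regular_element R y \<Longrightarrow> colon R (PIdl y) (PIdl y) = carrier R"
  using idealE(5)[OF principal(1)] by (auto simp: colon_def)

lemma principal_le_colon:
  assumes "regular_element R y" "J \<subseteq> carrier R" shows "PIdl y \<subseteq> colon R (PIdl y) J"
  by (rule cgen_subset[OF colon_ideal[OF principal(1)[OF assms(1)] assms(2)]])
     (use assms regular_carrier in \<open>auto simp: colon_def intro: cgen_mem\<close>)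

text \<open>In the filtration of R/J by socle elements, each step of length one becomes a copy of the socle
  of R/yR on the dual side.\<close>
lemma dual_len_aux:
  assumes "ideal J R" "regular_element R y" "y \<in> J"
  shows "ilen R (PIdl y) (colon R (PIdl y) J) = ilen R (PIdl y) (colon R (PIdl y) \<mm>) * ilen R J (carrier R)"
  using assms
proof (induction J rule: noeth_induct)
  case (step J)
  note y = step(3) and J = step(1) and yJ = step(4)
  note Y = principal[OF y]
  show ?case
  proof (cases "J = carrier R")
    case True
    then show ?thesis using ilen_self[OF carrier_ideal] ilen_self[OF Y(1)] colon_carrier[OF Y(1)] by simp
  next
    case False
    obtain t where t: "t \<in> carrier R" "t \<notin> J" "\<And>a. a \<in> carrier R \<Longrightarrow> a \<otimes> t \<in> J \<longleftrightarrow> a \<in> \<mm>"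
      using socle[OF J False y yJ] by blast
    note J' = iadjoin[OF J t(1)]
    note Jc = idealE(1)[OF J] and J'c = idealE(1)[OF J'(1)]
    let ?r = "ilen R (PIdl y) (colon R (PIdl y) \<mm>)"
    have "J \<subset> iadjoin J t" using J' t by blast
    then have IH: "ilen R (PIdl y) (colon R (PIdl y) (iadjoin J t)) = ?r * ilen R (iadjoin J t) (carrier R)"
      using step.IH[OF J'(1)] y yJ by blast
    have "ilen R J (carrier R) = ilen R J (iadjoin J t) + ilen R (iadjoin J t) (carrier R)"
      by (rule ilen_add[OF J J'(1) carrier_ideal J'(2) J'c])
    then have 1: "ilen R J (carrier R) = 1 + ilen R (iadjoin J t) (carrier R)"
      using socle_step[OF J t(1,3)] by simp
    have "ilen R (PIdl y) (colon R (PIdl y) J) = ilen R (PIdl y) (colon R (PIdl y) (iadjoin J t))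
        + ilen R (colon R (PIdl y) (iadjoin J t)) (colon R (PIdl y) J)"
      by (intro ilen_add Y(1) colon_ideal principal_le_colon[OF y J'c] colon_antimono J' Jc J'c)
    also have "\<dots> = ?r * ilen R (iadjoin J t) (carrier R) + ?r"
      unfolding IH using dual_socle_step[OF y J yJ t(1,3)] by simp
    finally show ?thesis unfolding 1 by (simp add: distrib_left ac_simps)
  qed
qed

text \<open>For J = yR the colon ideal is R, and the auxiliary formula then says that the length of R/yR is
  multiplied by the length of its socle. As the former is finite and positive, the socle has
  length one.\<close>
lemma dual_len:
  assumes J: "ideal J R" and y: "regular_element R y" "y \<in> J"
  shows "ilen R (PIdl y) (colon R (PIdl y) J) = ilen R J (carrier R)"
proof (cases "PIdl y = carrier R")
  case True
  then have "J = carrier R" using cgen_subset[OF J y(2)] idealE(1)[OF J] by auto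
  moreover have "colon R (PIdl y) J = carrier R" using True idealE(1)[OF J] by (auto simp: colon_def)
  ultimately show ?thesis using True by simp
next
  case False
  note Y = principal[OF y(1)]
  let ?r = "ilen R (PIdl y) (colon R (PIdl y) \<mm>)"
  let ?l = "ilen R (PIdl y) (carrier R)"
  have "?l = ?r * ?l" using dual_len_aux[OF Y(1) y(1) Y(2)] colon_principal[OF y(1)] by simp
  moreover have "?l \<noteq> 0" using ilen_zeroD[OF Y(1) carrier_ideal idealE(1)[OF Y(1)]] False by blast
  moreover have "?l \<noteq> \<infinity>" by (rule ilen_finite[OF Y(1) y(1) Y(2)])
  ultimately have "?r = 1" by (cases ?l; cases ?r) (auto simp: one_enat_def zero_enat_def)
  then show ?thesis using dual_len_aux[OF J y] by simp
qed

text \<open>J is contained in its double colon ideal, and both have the same colon ideal, hence the same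
  colength.\<close>
lemma double_colon:
  assumes J: "ideal J R" and y: "regular_element R y" "y \<in> J"
  shows "colon R (PIdl y) (colon R (PIdl y) J) = J"
proof -
  let ?Y = "PIdl y" and ?L = "colon R (PIdl y) J"
  let ?K = "colon R ?Y ?L"
  note Y = principal[OF y(1)]
  note Jc = idealE(1)[OF J]
  have L: "ideal ?L R" by (rule colon_ideal[OF Y(1) Jc])
  have K: "ideal ?K R" by (rule colon_ideal[OF Y(1) idealE(1)[OF L]])
  have sub: "A \<subseteq> colon R ?Y (colon R ?Y A)" if "A \<subseteq> carrier R" for A
  proof
    fix a assume a: "a \<in> A"
    then have ac: "a \<in> carrier R" using that by blast
    have "a \<otimes> l \<in> ?Y" if "l \<in> colon R ?Y A" for l
    proof -
      have "l \<otimes> a \<in> ?Y" "l \<in> carrier R" using that a by (auto simp: colon_def)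
      then show ?thesis using m_comm[of a l] ac by simp
    qed
    then show "a \<in> colon R ?Y (colon R ?Y A)" using ac by (simp add: colon_def)
  qed
  have JK: "J \<subseteq> ?K" using sub[OF Jc] .
  have "colon R ?Y ?K = ?L"
    using colon_antimono[OF JK] sub[OF idealE(1)[OF L]] by blast
  then have eq: "ilen R ?K (carrier R) = ilen R J (carrier R)"
    using dual_len[OF J y] dual_len[OF K y(1) subsetD[OF JK y(2)]] by simp
  have "ilen R J (carrier R) = ilen R J ?K + ilen R ?K (carrier R)"
    by (rule ilen_add[OF J K carrier_ideal JK idealE(1)[OF K]])
  then have "ilen R J ?K = 0"
    unfolding eq by (rule enat_add_self) (rule ilen_finite[OF J y])
  then show ?thesis using ilen_zeroD[OF J K JK] by simp
qed

end

section \<open>Self-injectivity from a finite injective resolution\<close>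

text \<open>For a submodule Z of E, this is the vanishing of Ext^1(R/J, Z) for all ideals J that contain a
  regular element.\<close>
definition extends_from_ideals ::
    "('a, 'r) ring_scheme \<Rightarrow> ('a, 'e) module \<Rightarrow> 'e set \<Rightarrow> bool" where
  "extends_from_ideals R E Z \<longleftrightarrow> (\<forall>J f. ideal J R \<longrightarrow> (\<exists>y\<in>J. regular_element R y) \<longrightarrow>
     linear_mod R (ring_module R) E J {\<zero>\<^bsub>E\<^esub>} f \<longrightarrow> f ` J \<subseteq> Z \<longrightarrow>
     (\<exists>z\<in>Z. \<forall>j\<in>J. f j = j \<odot>\<^bsub>E\<^esub> z))"

lemma extends_from_idealsD:
  assumes "extends_from_ideals R E Z" "ideal J R" "y \<in> J" "regular_element R y"
    "linear_mod R (ring_module R) E J {\<zero>\<^bsub>E\<^esub>} f" "\<And>j. j \<in> J \<Longrightarrow> f j \<in> Z"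
  obtains z where "z \<in> Z" "\<And>j. j \<in> J \<Longrightarrow> f j = j \<odot>\<^bsub>E\<^esub> z"
  using assms unfolding extends_from_ideals_def by (metis image_subsetI)

lemma linear_mod_zero_iff:
  assumes "module R E"
  shows "linear_mod R A E L {\<zero>\<^bsub>E\<^esub>} f \<longleftrightarrow> (\<forall>x\<in>L. f x \<in> carrier E) \<and>
     (\<forall>x\<in>L. \<forall>y\<in>L. f (x \<oplus>\<^bsub>A\<^esub> y) = f x \<oplus>\<^bsub>E\<^esub> f y) \<and>
     (\<forall>r\<in>carrier R. \<forall>x\<in>L. f (r \<odot>\<^bsub>A\<^esub> x) = r \<odot>\<^bsub>E\<^esub> f x)"
proof -
  interpret module R E by fact
  show ?thesis unfolding linear_mod_def cong_eq by (auto simp del: M.add.m_closed) (simp_all)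
qed

lemma (in cring) injective_extends:
  fixes E :: "('a, 'e) module"
  assumes "injective_module R E" shows "extends_from_ideals R E (carrier E)"
  unfolding extends_from_ideals_def
proof (intro allI impI)
  fix J f
  assume J: "ideal J R" and f: "linear_mod R (ring_module R) E J {\<zero>\<^bsub>E\<^esub>} f"
  have E: "module R E" using assms by (simp add: injective_module_def)
  interpret E: module R E by fact
  interpret rm: module R "ring_module R" by (rule ring_module_module)
  have Jc: "J \<subseteq> carrier R" using idealE(1)[OF J] .
  note e = rm.submoduleE[OF J[unfolded ideal_iff_submodule]]
  have "restrict f J \<in> lin_maps R ((ring_module R)\<lparr>carrier := J\<rparr>) E"
    using f idealE(3,5)[OF J] unfolding linear_mod_zero_iff[OF E] lin_maps_def by auto
  then obtain g where g: "g \<in> lin_maps R (ring_module R) E" "\<forall>x\<in>J. g x = restrict f J x"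
    using assms J ring_module_module unfolding injective_module_def ideal_iff_submodule by blast
  have "f j = j \<odot>\<^bsub>E\<^esub> g \<one>" if "j \<in> J" for j
  proof -
    have "j \<in> carrier R" using that Jc by auto
    then have "g (j \<odot>\<^bsub>ring_module R\<^esub> \<one>) = j \<odot>\<^bsub>E\<^esub> g \<one>"
      using g(1) one_closed unfolding lin_maps_def ring_module_simps by blast
    then show ?thesis using g(2) that \<open>j \<in> carrier R\<close> by simp
  qed
  moreover have "g \<one> \<in> carrier E" using g(1) unfolding lin_maps_def by auto
  ultimately show "\<exists>z\<in>carrier E. \<forall>j\<in>J. f j = j \<odot>\<^bsub>E\<^esub> z" by blast
qed

text \<open>As y is regular, there is a map from yR that sends y to e; its extension to R sends the unit
  to a solution.\<close>
lemma (in cring) injective_divisible: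
  fixes E :: "('a, 'e) module"
  assumes "injective_module R E" and y: "regular_element R y" and e: "e \<in> carrier E"
  obtains e' where "e' \<in> carrier E" "y \<odot>\<^bsub>E\<^esub> e' = e"
proof -
  have E: "module R E" using assms by (simp add: injective_module_def)
  interpret E: module R E by fact
  have yc: "y \<in> carrier R" using y by (simp add: regular_element_def)
  define q where "q j = (SOME r. r \<in> carrier R \<and> j = r \<otimes> y)" for j
  have q: "q (r \<otimes> y) = r" if "r \<in> carrier R" for r
  proof -
    have "q (r \<otimes> y) \<in> carrier R \<and> r \<otimes> y = q (r \<otimes> y) \<otimes> y"
      unfolding q_def by (rule someI[of _ r]) (use that in simp)
    then show ?thesis using regular_cancel[OF y, of "q (r \<otimes> y)" r] that yc m_comm by metis
  qed
  have "linear_mod R (ring_module R) E (PIdl y) {\<zero>\<^bsub>E\<^esub>} (\<lambda>j. q j \<odot>\<^bsub>E\<^esub> e)"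
    unfolding linear_mod_zero_iff[OF E]
  proof (intro conjI ballI)
    fix a b assume "a \<in> PIdl y" "b \<in> PIdl y"
    then obtain r s where r: "r \<in> carrier R" "a = r \<otimes> y" "s \<in> carrier R" "b = s \<otimes> y" by (auto simp: mem_cgen_iff)
    then show "q a \<odot>\<^bsub>E\<^esub> e \<in> carrier E" using e q by simp
    have "a \<oplus> b = (r \<oplus> s) \<otimes> y" using r yc by (simp add: l_distr)
    then show "q (a \<oplus>\<^bsub>ring_module R\<^esub> b) \<odot>\<^bsub>E\<^esub> e = q a \<odot>\<^bsub>E\<^esub> e \<oplus>\<^bsub>E\<^esub> q b \<odot>\<^bsub>E\<^esub> e"
      using r q[of "r \<oplus> s"] q[of r] q[of s] e by (simp add: E.smult_l_distr)
  next
    fix a b assume a: "a \<in> carrier R" "b \<in> PIdl y"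
    then obtain s where r: "s \<in> carrier R" "b = s \<otimes> y" by (auto simp: mem_cgen_iff)
    have "a \<otimes> b = (a \<otimes> s) \<otimes> y" using r a yc by (simp add: m_assoc)
    then show "q (a \<odot>\<^bsub>ring_module R\<^esub> b) \<odot>\<^bsub>E\<^esub> e = a \<odot>\<^bsub>E\<^esub> (q b \<odot>\<^bsub>E\<^esub> e)"
      using r a q[of "a \<otimes> s"] q[of s] e by (simp add: E.smult_assoc1)
  qed
  moreover have "q j \<odot>\<^bsub>E\<^esub> e \<in> carrier E" if "j \<in> PIdl y" for j
    using that q e by (auto simp: mem_cgen_iff)
  ultimately obtain z where z: "z \<in> carrier E" "\<And>j. j \<in> PIdl y \<Longrightarrow> q j \<odot>\<^bsub>E\<^esub> e = j \<odot>\<^bsub>E\<^esub> z"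
    using extends_from_idealsD[OF injective_extends[OF assms(1)] cgenideal_ideal[OF yc] cgenideal_self[OF yc] y]
    by blast
  have "q (\<one> \<otimes> y) = \<one>" by (rule q) simp
  then have "y \<odot>\<^bsub>E\<^esub> z = e" using z(2)[OF cgenideal_self[OF yc]] yc e by simp
  then show ?thesis using that z by blast
qed

context noetherian_local_dim1 begin

interpretation rm: module R "ring_module R" by (rule ring_module_module)

lemma linear_ext_adjoin:
  fixes E :: "('a, 'e) module"
  assumes E: "module R E" and Z: "submodule Z R E" and J: "ideal J R"
    and f: "linear_mod R (ring_module R) E J {\<zero>\<^bsub>E\<^esub>} f" "\<And>j. j \<in> J \<Longrightarrow> f j \<in> Z"
    and t: "t \<in> carrier R" and z: "z \<in> Z"
    and compat: "\<And>a. a \<in> carrier R \<Longrightarrow> a \<otimes> t \<in> J \<Longrightarrow> f (a \<otimes> t) = a \<odot>\<^bsub>E\<^esub> z"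
  obtains g where "linear_mod R (ring_module R) E (iadjoin J t) {\<zero>\<^bsub>E\<^esub>} g"
    "\<And>k. k \<in> iadjoin J t \<Longrightarrow> g k \<in> Z"
    "\<And>j. j \<in> J \<Longrightarrow> g j = f j" "g t = z"
proof -
  interpret E: module R E by fact
  have zc: "z \<in> carrier E" and Zc: "Z \<subseteq> carrier E" using z E.submoduleE(1)[OF Z] by auto
  obtain g where g: "linear_mod R (ring_module R) E (iadjoin J t) {\<zero>\<^bsub>E\<^esub>} g"
    "\<And>j r. j \<in> J \<Longrightarrow> r \<in> carrier R \<Longrightarrow> cong_mod E {\<zero>\<^bsub>E\<^esub>} (g (j \<oplus> r \<otimes> t)) (f j \<oplus>\<^bsub>E\<^esub> r \<odot>\<^bsub>E\<^esub> z)"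
    by (rule linear_mod_extend[OF ring_module_module E J[unfolded ideal_iff_submodule] E.zero_submodule f(1), of t z])
       (use t zc compat E.cong_eq in auto)
  have g2: "g (j \<oplus> r \<otimes> t) = f j \<oplus>\<^bsub>E\<^esub> r \<odot>\<^bsub>E\<^esub> z" if "j \<in> J" "r \<in> carrier R" for j r
    using g(2)[OF that] E.cong_eq by simp
  have Jc: "\<And>j. j \<in> J \<Longrightarrow> j \<in> carrier R" using idealE(1)[OF J] by auto
  show ?thesis
  proof (rule that[OF g(1)])
    fix k assume "k \<in> iadjoin J t"
    then obtain j r where "j \<in> J" "r \<in> carrier R" "k = j \<oplus> r \<otimes> t" unfolding adjoin_def by auto
    then show "g k \<in> Z" using g2 f(2) z E.submoduleE(4,5)[OF Z] by simp
  next
    fix j assume j: "j \<in> J"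
    then have "j \<oplus> \<zero> \<otimes> t = j" "f j \<in> carrier E" using Jc t f(2) Zc by auto
    then show "g j = f j" using g2[OF j zero_closed] zc by simp
  next
    have "\<zero> \<odot>\<^bsub>ring_module R\<^esub> \<zero> \<in> J" using idealE(2)[OF J] by simp
    have "f (\<zero> \<otimes> t) = \<zero> \<odot>\<^bsub>E\<^esub> z" by (rule compat) (use t idealE(2)[OF J] in auto)
    then have "f \<zero> = \<zero>\<^bsub>E\<^esub>" using t zc by simp
    then show "g t = z" using g2[OF idealE(2)[OF J] one_closed] t zc by simp
  qed
qed

text \<open>Dimension shifting that goes down: Ext^1 vanishes for the kernel Z of d if it vanishes for the
  image of d, provided that Z is divisible by regular elements. Adjoining socle elements to J
  reduces the claim to maps g on the maximal ideal m. Such a map is multiplication by some e in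
  E, and w = d e is killed by m. Let s be a socle element modulo yR. The map on yR + Rs that
  vanishes on yR and sends s to w extends to R, which gives w = s w' with y w' = 0. Because Z is
  divisible, w' lifts to an element e2 of E with y e2 = 0; then s e2 is killed by m, and
  e - s e2 is an element of Z that induces g.\<close>
lemma extends_descend:
  fixes E E' :: "('a, 'e) module"
  assumes E: "module R E" and E': "module R E'"
    and ext: "extends_from_ideals R E (carrier E)"
    and d: "d \<in> lin_maps R E E'"
    and Z: "Z = {e \<in> carrier E. d e = \<zero>\<^bsub>E'\<^esub>}"
    and div: "\<And>y z. regular_element R y \<Longrightarrow> z \<in> Z \<Longrightarrow> \<exists>z'\<in>Z. y \<odot>\<^bsub>E\<^esub> z' = z"
    and ext': "extends_from_ideals R E' (d ` carrier E)"
  shows "extends_from_ideals R E Z"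
proof -
  interpret E: module R E by fact
  interpret E': module R E' by fact
  have dc: "\<And>e. e \<in> carrier E \<Longrightarrow> d e \<in> carrier E'"
    and da: "\<And>x y. x \<in> carrier E \<Longrightarrow> y \<in> carrier E \<Longrightarrow> d (x \<oplus>\<^bsub>E\<^esub> y) = d x \<oplus>\<^bsub>E'\<^esub> d y"
    and ds: "\<And>a x. a \<in> carrier R \<Longrightarrow> x \<in> carrier E \<Longrightarrow> d (a \<odot>\<^bsub>E\<^esub> x) = a \<odot>\<^bsub>E'\<^esub> d x"
    using d unfolding lin_maps_def by auto
  have dm: "d (x \<ominus>\<^bsub>E\<^esub> y) = d x \<ominus>\<^bsub>E'\<^esub> d y" if xy: "x \<in> carrier E" "y \<in> carrier E" for x y
  proof -
    have "x \<ominus>\<^bsub>E\<^esub> y = x \<oplus>\<^bsub>E\<^esub> (\<ominus> \<one>) \<odot>\<^bsub>E\<^esub> y" using xy by (simp add: a_minus_def E.smult_l_minus)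
    then show ?thesis using xy by (simp add: da ds a_minus_def dc E'.smult_l_minus)
  qed
  have d0: "d \<zero>\<^bsub>E\<^esub> = \<zero>\<^bsub>E'\<^esub>" using ds[OF zero_closed E.M.zero_closed] dc[OF E.M.zero_closed] by simp
  have sZ: "submodule Z R E" unfolding Z
    by (rule E.submoduleI2) (auto simp: d0 da ds)
  have sZ': "submodule (d ` carrier E) R E'"
  proof (rule E'.submoduleI2)
    show "\<zero>\<^bsub>E'\<^esub> \<in> d ` carrier E" using d0 E.M.zero_closed by (metis imageI)
  qed (auto simp: dc da[symmetric] ds[symmetric])
  note Zc = E.submoduleE(1)[OF sZ]
  note cm = subsetD[OF idealE(1)[OF m_ideal]]
  have key: "\<exists>z\<in>Z. \<forall>a\<in>\<mm>. g a = a \<odot>\<^bsub>E\<^esub> z"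
    if y: "regular_element R y" "y \<in> \<mm>" and g: "linear_mod R (ring_module R) E \<mm> {\<zero>\<^bsub>E\<^esub>} g"
      and gZ: "\<And>a. a \<in> \<mm> \<Longrightarrow> g a \<in> Z" for g y
  proof -
    obtain e where e: "e \<in> carrier E" "\<And>a. a \<in> \<mm> \<Longrightarrow> g a = a \<odot>\<^bsub>E\<^esub> e"
      using extends_from_idealsD[OF ext m_ideal y(2,1) g] gZ Zc by blast
    define w where "w = d e"
    have w: "w \<in> d ` carrier E" "w \<in> carrier E'" using e dc w_def by auto
    have aw: "a \<odot>\<^bsub>E'\<^esub> w = \<zero>\<^bsub>E'\<^esub>" if a: "a \<in> \<mm>" for a
      using gZ[OF a] e(2)[OF a] ds[OF cm[OF a] e(1)] unfolding Z w_def by simp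
    have yc: "y \<in> carrier R" using y(2) cm by simp
    have Y: "ideal (PIdl y) R" "y \<in> PIdl y" using cgenideal_ideal[OF yc] cgenideal_self[OF yc] by auto
    have Yp: "PIdl y \<noteq> carrier R" using cgen_subset[OF m_ideal y(2)] m_proper(2) one_closed by blast
    obtain s where s: "s \<in> carrier R" "s \<notin> PIdl y" "\<And>a. a \<in> carrier R \<Longrightarrow> a \<otimes> s \<in> PIdl y \<longleftrightarrow> a \<in> \<mm>"
      using socle[OF Y(1) Yp y(1) Y(2)] by blast
    have f0: "linear_mod R (ring_module R) E' (PIdl y) {\<zero>\<^bsub>E'\<^esub>} (\<lambda>a. a \<odot>\<^bsub>E'\<^esub> \<zero>\<^bsub>E'\<^esub>)"
      by (rule E'.linear_mod_smult[OF E'.zero_submodule E'.M.zero_closed idealE(1)[OF Y(1)]])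
    have Yc: "\<And>j. j \<in> PIdl y \<Longrightarrow> j \<in> carrier R" using idealE(1)[OF Y(1)] by auto
    obtain \<phi> where \<phi>: "linear_mod R (ring_module R) E' (iadjoin (PIdl y) s) {\<zero>\<^bsub>E'\<^esub>} \<phi>"
      "\<And>k. k \<in> iadjoin (PIdl y) s \<Longrightarrow> \<phi> k \<in> d ` carrier E"
      "\<And>j. j \<in> PIdl y \<Longrightarrow> \<phi> j = j \<odot>\<^bsub>E'\<^esub> \<zero>\<^bsub>E'\<^esub>" "\<phi> s = w"
    proof (rule linear_ext_adjoin[OF E' sZ' Y(1) f0 _ s(1) w(1)])
      fix j assume "j \<in> PIdl y"
      then show "j \<odot>\<^bsub>E'\<^esub> \<zero>\<^bsub>E'\<^esub> \<in> d ` carrier E" using Yc E'.submodule_zero[OF sZ'] by simp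
    next
      fix a assume "a \<in> carrier R" "a \<otimes> s \<in> PIdl y"
      then show "a \<otimes> s \<odot>\<^bsub>E'\<^esub> \<zero>\<^bsub>E'\<^esub> = a \<odot>\<^bsub>E'\<^esub> w" using aw s by simp
    qed (rule that)
    note K = iadjoin[OF Y(1) s(1)]
    obtain w' where w': "w' \<in> d ` carrier E" "\<And>k. k \<in> iadjoin (PIdl y) s \<Longrightarrow> \<phi> k = k \<odot>\<^bsub>E'\<^esub> w'"
      using extends_from_idealsD[OF ext' K(1) subsetD[OF K(2) Y(2)] y(1) \<phi>(1) \<phi>(2)] by blast
    have sw: "s \<odot>\<^bsub>E'\<^esub> w' = w" using w'(2)[OF K(3)] \<phi>(4) by simp
    have yw: "y \<odot>\<^bsub>E'\<^esub> w' = \<zero>\<^bsub>E'\<^esub>" using w'(2)[OF subsetD[OF K(2) Y(2)]] \<phi>(3)[OF Y(2)] yc by simp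
    obtain e1 where e1: "e1 \<in> carrier E" "w' = d e1" using w'(1) by blast
    have "y \<odot>\<^bsub>E\<^esub> e1 \<in> Z" unfolding Z using e1 yw ds[OF yc e1(1)] yc by simp
    then obtain z where z: "z \<in> Z" "y \<odot>\<^bsub>E\<^esub> z = y \<odot>\<^bsub>E\<^esub> e1" using div[OF y(1)] by blast
    have zc: "z \<in> carrier E" "d z = \<zero>\<^bsub>E'\<^esub>" using z Z by auto
    define e2 where "e2 = e1 \<ominus>\<^bsub>E\<^esub> z"
    have e2c: "e2 \<in> carrier E" using e1 zc e2_def by simp
    have ye2: "y \<odot>\<^bsub>E\<^esub> e2 = \<zero>\<^bsub>E\<^esub>"
    proof -
      have "y \<odot>\<^bsub>E\<^esub> e2 = y \<odot>\<^bsub>E\<^esub> e1 \<ominus>\<^bsub>E\<^esub> y \<odot>\<^bsub>E\<^esub> z" unfolding e2_def using yc e1(1) zc(1) by algebra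
      also have "\<dots> = \<zero>\<^bsub>E\<^esub>" unfolding z(2) using e1(1) yc by (simp add: E.M.r_neg a_minus_def)
      finally show ?thesis .
    qed
    have de2: "d e2 = w'" unfolding e2_def using dm[OF e1(1) zc(1)] zc(2) dc[OF e1(1)] e1(2)
      by (simp add: a_minus_def E'.minus_zero)
    define z0 where "z0 = e \<ominus>\<^bsub>E\<^esub> s \<odot>\<^bsub>E\<^esub> e2"
    have z0c: "z0 \<in> carrier E" using e s e2c z0_def by simp
    have "d z0 = w \<ominus>\<^bsub>E'\<^esub> s \<odot>\<^bsub>E'\<^esub> w'" unfolding z0_def using dm e s e2c ds de2 w_def by simp
    then have "d z0 = \<zero>\<^bsub>E'\<^esub>" using sw w(2) by (simp add: a_minus_def E'.M.r_neg)
    then have "z0 \<in> Z" using z0c Z by simp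
    moreover have "g a = a \<odot>\<^bsub>E\<^esub> z0" if a: "a \<in> \<mm>" for a
    proof -
      have ac: "a \<in> carrier R" using cm a by simp
      obtain r where r: "r \<in> carrier R" "a \<otimes> s = r \<otimes> y" using s(3)[OF ac] a by (auto simp: mem_cgen_iff)
      have "a \<odot>\<^bsub>E\<^esub> z0 = a \<odot>\<^bsub>E\<^esub> e \<ominus>\<^bsub>E\<^esub> (a \<otimes> s) \<odot>\<^bsub>E\<^esub> e2"
        unfolding z0_def using ac s(1) e(1) e2c by algebra
      also have "(a \<otimes> s) \<odot>\<^bsub>E\<^esub> e2 = \<zero>\<^bsub>E\<^esub>" unfolding r(2) using E.smult_assoc1[OF r(1) yc e2c] ye2 r by simp
      finally show ?thesis using e ac a by (simp add: a_minus_def E.minus_zero)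
    qed
    ultimately show ?thesis by blast
  qed
  have main: "\<exists>z\<in>Z. \<forall>j\<in>J. f j = j \<odot>\<^bsub>E\<^esub> z"
    if "ideal J R" "y \<in> J" "regular_element R y" "linear_mod R (ring_module R) E J {\<zero>\<^bsub>E\<^esub>} f" "\<And>j. j \<in> J \<Longrightarrow> f j \<in> Z"
    for J y f
    using that
  proof (induction J arbitrary: f rule: noeth_induct)
    case (step J)
    note J = step(1) and yJ = step(3) and y = step(4) and f = step(5) and fZ = step(6)
    have Jc: "\<And>j. j \<in> J \<Longrightarrow> j \<in> carrier R" using idealE(1)[OF J] by auto
    have fs: "f (r \<otimes> j) = r \<odot>\<^bsub>E\<^esub> f j" if "r \<in> carrier R" "j \<in> J" for r j
      using f that unfolding linear_mod_zero_iff[OF E] by simp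
    have fa: "f (i \<oplus> j) = f i \<oplus>\<^bsub>E\<^esub> f j" if "i \<in> J" "j \<in> J" for i j
      using f that unfolding linear_mod_zero_iff[OF E] by simp
    show ?case
    proof (cases "J = carrier R")
      case True
      have "f j = j \<odot>\<^bsub>E\<^esub> f \<one>" if j: "j \<in> J" for j
      proof -
        have "f (j \<otimes> \<one>) = j \<odot>\<^bsub>E\<^esub> f \<one>" by (rule fs) (use Jc[OF j] True in auto)
        then show ?thesis unfolding r_one[OF Jc[OF j]] .
      qed
      moreover have "f \<one> \<in> Z" by (rule fZ) (simp add: True)
      ultimately show ?thesis by blast
    next
      case False
      obtain t where t: "t \<in> carrier R" "t \<notin> J" "\<And>a. a \<in> carrier R \<Longrightarrow> a \<otimes> t \<in> J \<longleftrightarrow> a \<in> \<mm>"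
        using socle[OF J False y yJ] by blast
      have tJ: "a \<otimes> t \<in> J" if "a \<in> \<mm>" for a using t(3) that cm by blast
      have ym: "y \<in> \<mm>" using proper_le_m[OF J False] yJ by blast
      have "linear_mod R (ring_module R) E \<mm> {\<zero>\<^bsub>E\<^esub>} (\<lambda>a. f (a \<otimes> t))"
        unfolding linear_mod_zero_iff[OF E]
      proof (intro conjI ballI)
        fix a b assume a: "a \<in> \<mm>" "b \<in> \<mm>"
        show "f (a \<otimes> t) \<in> carrier E" using fZ[OF tJ[OF a(1)]] Zc by blast
        have "(a \<oplus> b) \<otimes> t = a \<otimes> t \<oplus> b \<otimes> t" using a cm t(1) by (simp add: l_distr)
        then show "f ((a \<oplus>\<^bsub>ring_module R\<^esub> b) \<otimes> t) = f (a \<otimes> t) \<oplus>\<^bsub>E\<^esub> f (b \<otimes> t)"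
          using fa[OF tJ tJ] a by simp
      next
        fix r a assume a: "r \<in> carrier R" "a \<in> \<mm>"
        have "(r \<otimes> a) \<otimes> t = r \<otimes> (a \<otimes> t)" using a cm t(1) by (simp add: m_assoc)
        then show "f ((r \<odot>\<^bsub>ring_module R\<^esub> a) \<otimes> t) = r \<odot>\<^bsub>E\<^esub> f (a \<otimes> t)"
          using fs[OF a(1) tJ[OF a(2)]] by simp
      qed
      from key[OF y ym this] obtain z where z: "z \<in> Z" "\<And>a. a \<in> \<mm> \<Longrightarrow> f (a \<otimes> t) = a \<odot>\<^bsub>E\<^esub> z"
        using fZ tJ by blast
      note K = iadjoin[OF J t(1)]
      obtain g where g: "linear_mod R (ring_module R) E (iadjoin J t) {\<zero>\<^bsub>E\<^esub>} g"
        "\<And>k. k \<in> iadjoin J t \<Longrightarrow> g k \<in> Z" "\<And>j. j \<in> J \<Longrightarrow> g j = f j" "g t = z"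
        by (rule linear_ext_adjoin[OF E sZ J f fZ t(1) z(1)]) (use z(2) t(3) in auto)
      have "J \<subset> iadjoin J t" using K t by blast
      then have "\<exists>z\<in>Z. \<forall>j\<in>iadjoin J t. g j = j \<odot>\<^bsub>E\<^esub> z"
        using step.IH[OF K(1) _ _ y g(1,2)] yJ by blast
      then show ?thesis using g(3) K(2) by (metis subsetD)
    qed
  qed
  show ?thesis unfolding extends_from_ideals_def
  proof (intro allI impI)
    fix J f assume *: "ideal J R" "\<exists>y\<in>J. regular_element R y"
      "linear_mod R (ring_module R) E J {\<zero>\<^bsub>E\<^esub>} f" "f ` J \<subseteq> Z"
    then obtain y where "y \<in> J" "regular_element R y" by blast
    then show "\<exists>z\<in>Z. \<forall>j\<in>J. f j = j \<odot>\<^bsub>E\<^esub> z" using main[OF *(1) _ _ *(3)] *(4) by blast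
  qed
qed

end

context noetherian_local_dim1 begin

text \<open>Choose u in E with y u = 1, where R is regarded as a submodule of E. Sending a to a u induces
  an embedding of R/yR into E/R, and E/R is isomorphic to the image of d. So f gives a map from J
  to that image, which by hypothesis is multiplication by some w = d e. The element y e is
  killed by d, hence lies in R, and it is the multiplier c.\<close>
lemma self_injective_of_extends:
  fixes E E' :: "('a, 'e) module"
  assumes E: "injective_module R E" and E': "module R E'"
    and \<epsilon>: "\<epsilon> \<in> lin_maps R (ring_module R) E" "inj_on \<epsilon> (carrier R)"
    and d: "d \<in> lin_maps R E E'"
    and exact: "\<epsilon> ` carrier R = {e \<in> carrier E. d e = \<zero>\<^bsub>E'\<^esub>}"
    and ext: "extends_from_ideals R E' (d ` carrier E)"
    and y: "regular_element R y" and J: "ideal J R" "y \<in> J"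
    and f: "linear_mod R (ring_module R) (ring_module R) J (PIdl y) f" and fy: "f y \<in> PIdl y"
  shows "\<exists>c\<in>carrier R. \<forall>j\<in>J. f j \<ominus> c \<otimes> j \<in> PIdl y"
proof -
  have Em: "module R E" using E by (simp add: injective_module_def)
  interpret E: module R E by fact
  interpret E': module R E' by fact
  have dc: "\<And>e. e \<in> carrier E \<Longrightarrow> d e \<in> carrier E'"
    and da: "\<And>x y. x \<in> carrier E \<Longrightarrow> y \<in> carrier E \<Longrightarrow> d (x \<oplus>\<^bsub>E\<^esub> y) = d x \<oplus>\<^bsub>E'\<^esub> d y"
    and ds: "\<And>a x. a \<in> carrier R \<Longrightarrow> x \<in> carrier E \<Longrightarrow> d (a \<odot>\<^bsub>E\<^esub> x) = a \<odot>\<^bsub>E'\<^esub> d x"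
    using d unfolding lin_maps_def by auto
  have ec: "\<And>a. a \<in> carrier R \<Longrightarrow> \<epsilon> a \<in> carrier E"
    and es: "\<And>a x. a \<in> carrier R \<Longrightarrow> x \<in> carrier R \<Longrightarrow> \<epsilon> (a \<otimes> x) = a \<odot>\<^bsub>E\<^esub> \<epsilon> x"
    and ea: "\<And>a x. a \<in> carrier R \<Longrightarrow> x \<in> carrier R \<Longrightarrow> \<epsilon> (a \<oplus> x) = \<epsilon> a \<oplus>\<^bsub>E\<^esub> \<epsilon> x"
    using \<epsilon>(1) unfolding lin_maps_def by auto
  have de: "\<And>a. a \<in> carrier R \<Longrightarrow> d (\<epsilon> a) = \<zero>\<^bsub>E'\<^esub>" using exact by blast
  have yc: "y \<in> carrier R" using y by (simp add: regular_element_def)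
  have Jc: "\<And>j. j \<in> J \<Longrightarrow> j \<in> carrier R" using idealE(1)[OF J(1)] by auto
  note f = f[unfolded linear_mod_ring_iff[OF idealE(1)[OF J(1)]]]
  have fc: "\<And>j. j \<in> J \<Longrightarrow> f j \<in> carrier R" using f by blast
  obtain u where u: "u \<in> carrier E" "y \<odot>\<^bsub>E\<^esub> u = \<epsilon> \<one>"
    using injective_divisible[OF E y ec[OF one_closed]] by blast
  have Y0: "d (a \<odot>\<^bsub>E\<^esub> u) = \<zero>\<^bsub>E'\<^esub>" if a: "a \<in> PIdl y" for a
  proof -
    obtain b where b: "b \<in> carrier R" "a = b \<otimes> y" using a by (auto simp: mem_cgen_iff)
    then have "a \<odot>\<^bsub>E\<^esub> u = \<epsilon> b" using u yc es[of b \<one>] by (simp add: E.smult_assoc1)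
    then show ?thesis using de b by simp
  qed
  have Ycong: "d (a \<odot>\<^bsub>E\<^esub> u) = d (b \<odot>\<^bsub>E\<^esub> u)" if ab: "a \<in> carrier R" "b \<in> carrier R" "a \<ominus> b \<in> PIdl y" for a b
  proof -
    have "a \<odot>\<^bsub>E\<^esub> u = (a \<ominus> b) \<odot>\<^bsub>E\<^esub> u \<oplus>\<^bsub>E\<^esub> b \<odot>\<^bsub>E\<^esub> u" using ab u(1) by algebra
    then have "d (a \<odot>\<^bsub>E\<^esub> u) = d ((a \<ominus> b) \<odot>\<^bsub>E\<^esub> u) \<oplus>\<^bsub>E'\<^esub> d (b \<odot>\<^bsub>E\<^esub> u)" using ab u(1) da by simp
    then show ?thesis using Y0[OF ab(3)] ab u(1) dc by simp
  qed
  have "linear_mod R (ring_module R) E' J {\<zero>\<^bsub>E'\<^esub>} (\<lambda>j. d (f j \<odot>\<^bsub>E\<^esub> u))"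
    unfolding linear_mod_zero_iff[OF E']
  proof (intro conjI ballI)
    fix i j assume ij: "i \<in> J" "j \<in> J"
    show "d (f i \<odot>\<^bsub>E\<^esub> u) \<in> carrier E'" using fc[OF ij(1)] u dc by simp
    have 1: "d (f (i \<oplus> j) \<odot>\<^bsub>E\<^esub> u) = d ((f i \<oplus> f j) \<odot>\<^bsub>E\<^esub> u)"
      by (rule Ycong) (use f ij in auto)
    show "d (f (i \<oplus>\<^bsub>ring_module R\<^esub> j) \<odot>\<^bsub>E\<^esub> u) = d (f i \<odot>\<^bsub>E\<^esub> u) \<oplus>\<^bsub>E'\<^esub> d (f j \<odot>\<^bsub>E\<^esub> u)"
      unfolding ring_module_simps 1 using fc ij u by (simp add: E.smult_l_distr da)
  next
    fix r j assume ij: "r \<in> carrier R" "j \<in> J"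
    have 1: "d (f (r \<otimes> j) \<odot>\<^bsub>E\<^esub> u) = d ((r \<otimes> f j) \<odot>\<^bsub>E\<^esub> u)"
      by (rule Ycong) (use f ij in auto)
    show "d (f (r \<odot>\<^bsub>ring_module R\<^esub> j) \<odot>\<^bsub>E\<^esub> u) = r \<odot>\<^bsub>E'\<^esub> d (f j \<odot>\<^bsub>E\<^esub> u)"
      unfolding ring_module_simps 1 using fc ij u by (simp add: E.smult_assoc1 ds)
  qed
  moreover have "\<And>j. j \<in> J \<Longrightarrow> d (f j \<odot>\<^bsub>E\<^esub> u) \<in> d ` carrier E" using fc u by simp
  ultimately obtain w where w: "w \<in> d ` carrier E" "\<And>j. j \<in> J \<Longrightarrow> d (f j \<odot>\<^bsub>E\<^esub> u) = j \<odot>\<^bsub>E'\<^esub> w"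
    using extends_from_idealsD[OF ext J(1,2) y] by blast
  obtain e where e: "e \<in> carrier E" "w = d e" using w(1) by blast
  have "d (y \<odot>\<^bsub>E\<^esub> e) = \<zero>\<^bsub>E'\<^esub>" using w(2)[OF J(2)] Y0[OF fy] ds[OF yc e(1)] e(2) by simp
  then have "y \<odot>\<^bsub>E\<^esub> e \<in> \<epsilon> ` carrier R" unfolding exact using yc e by simp
  then obtain c where c: "c \<in> carrier R" "y \<odot>\<^bsub>E\<^esub> e = \<epsilon> c" by blast
  have "f j \<ominus> c \<otimes> j \<in> PIdl y" if j: "j \<in> J" for j
  proof -
    note jc = Jc[OF j] and fj = fc[OF j]
    define v where "v = f j \<odot>\<^bsub>E\<^esub> u \<ominus>\<^bsub>E\<^esub> j \<odot>\<^bsub>E\<^esub> e"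
    have vc: "v \<in> carrier E" using v_def fj u jc e by simp
    have "v \<oplus>\<^bsub>E\<^esub> j \<odot>\<^bsub>E\<^esub> e = f j \<odot>\<^bsub>E\<^esub> u" unfolding v_def using fj u(1) jc e(1) by algebra
    then have "d v \<oplus>\<^bsub>E'\<^esub> j \<odot>\<^bsub>E'\<^esub> w = j \<odot>\<^bsub>E'\<^esub> w"
      using da[OF vc, of "j \<odot>\<^bsub>E\<^esub> e"] ds[OF jc e(1)] e jc w(2)[OF j] by simp
    then have "d v = \<zero>\<^bsub>E'\<^esub>" using dc[OF vc] jc e dc by (metis E'.smult_closed E'.M.add.r_cancel_one)
    then have "v \<in> \<epsilon> ` carrier R" unfolding exact using vc by simp
    then obtain r where r: "r \<in> carrier R" "v = \<epsilon> r" by blast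
    have "\<epsilon> (f j) = f j \<odot>\<^bsub>E\<^esub> (y \<odot>\<^bsub>E\<^esub> u)" using es[OF fj one_closed] u fj by simp
    also have "\<dots> = y \<odot>\<^bsub>E\<^esub> v \<oplus>\<^bsub>E\<^esub> j \<odot>\<^bsub>E\<^esub> (y \<odot>\<^bsub>E\<^esub> e)"
      unfolding v_def using fj u(1) jc e(1) yc by algebra
    also have "\<dots> = \<epsilon> (y \<otimes> r \<oplus> j \<otimes> c)" unfolding c(2) r(2) using es ea jc c r yc by simp
    finally have "f j = y \<otimes> r \<oplus> j \<otimes> c"
      using inj_onD[OF \<epsilon>(2)] fj jc c r yc by simp
    then have "f j \<ominus> c \<otimes> j = r \<otimes> y" using r(1) c(1) jc yc by (simp, algebra)
    then show ?thesis using cgen_mem r by simp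
  qed
  then show ?thesis by (intro bexI[OF _ c(1)] ballI)
qed

lemma extends_from_ideals_zero:
  assumes "module R E" shows "extends_from_ideals R E {\<zero>\<^bsub>E\<^esub>}"
  unfolding extends_from_ideals_def
proof (intro allI impI)
  interpret E: module R E by fact
  fix J f assume J: "ideal J R" and f: "f ` J \<subseteq> {\<zero>\<^bsub>E\<^esub>}"
  have "f j = j \<odot>\<^bsub>E\<^esub> \<zero>\<^bsub>E\<^esub>" if "j \<in> J" for j
  proof -
    have "j \<in> carrier R" "f j = \<zero>\<^bsub>E\<^esub>" using that f idealE(1)[OF J] by auto
    then show ?thesis by simp
  qed
  then show "\<exists>z\<in>{\<zero>\<^bsub>E\<^esub>}. \<forall>j\<in>J. f j = j \<odot>\<^bsub>E\<^esub> z" by blast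
qed

text \<open>Going down along a finite injective resolution of R, all syzygies Z i with i positive have the
  extension property: those beyond the end vanish, and as images of injective modules the
  others are divisible, which is what the descent asks for. The syzygy Z 0 = R is not divisible,
  so the last step is a different one.\<close>
lemma self_injective_of_resolution:
  fixes E :: "nat \<Rightarrow> ('a, 'e) module"
  assumes res: "injective_resolution R (ring_module R) E \<epsilon> d"
    and fin: "\<And>i. i > n \<Longrightarrow> carrier (E i) = {\<zero>\<^bsub>E i\<^esub>}"
  shows "gorenstein_dim1 R \<mm>"
proof -
  have inj: "injective_module R (E i)" and Em: "module R (E i)" and d: "d i \<in> lin_maps R (E i) (E (Suc i))"
    and exact: "d i ` carrier (E i) = {x \<in> carrier (E (Suc i)). d (Suc i) x = \<zero>\<^bsub>E (Suc (Suc i))\<^esub>}" for i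
    using res by (simp_all add: injective_resolution_def injective_module_def)
  define Z where "Z i = {x \<in> carrier (E i). d i x = \<zero>\<^bsub>E (Suc i)\<^esub>}" for i
  have im: "d i ` carrier (E i) = Z (Suc i)" for i using exact Z_def by simp
  have triv: "extends_from_ideals R (E i) (Z i)" if i: "n < i" "0 < i" for i
  proof -
    interpret L: module R "E (i - 1)" by (rule Em)
    have "d (i - 1) \<zero>\<^bsub>E (i - 1)\<^esub> \<in> d (i - 1) ` carrier (E (i - 1))"
      by (rule imageI[OF L.M.zero_closed])
    then have "d (i - 1) \<zero>\<^bsub>E (i - 1)\<^esub> \<in> Z i" unfolding im using i(2) by simp
    moreover have "x = \<zero>\<^bsub>E i\<^esub>" if "x \<in> Z i" for x using that fin[OF i(1)] unfolding Z_def by simp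
    ultimately have "Z i = {\<zero>\<^bsub>E i\<^esub>}" by (metis empty_iff insertI1 subset_singletonD subsetI singletonI)
    then show ?thesis using extends_from_ideals_zero[OF Em, of i] by simp
  qed
  have ext: "extends_from_ideals R (E i) (Z i)" if pos: "Suc 0 \<le> i" for i
  proof (cases "i \<le> Suc n")
    case True
    then show ?thesis
    proof (induction rule: inc_induct)
      case base
      show ?case using triv[of "Suc n"] by simp
    next
      case (step k)
      then obtain l where l: "k = Suc l" using pos step.hyps by (cases k) auto
      interpret L: module R "E l" by (rule Em)
      interpret K: module R "E k" by (rule Em)
      show ?case
      proof (rule extends_descend[OF Em Em injective_extends[OF inj] d Z_def])
        show "extends_from_ideals R (E (Suc k)) (d k ` carrier (E k))" using step.IH im by simp
        fix y z assume y: "regular_element R y" and "z \<in> Z k"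
        then obtain e where e: "e \<in> carrier (E l)" "z = d l e" using im[of l] l by auto
        obtain e' where e': "e' \<in> carrier (E l)" "y \<odot>\<^bsub>E l\<^esub> e' = e"
          using injective_divisible[OF inj y e(1)] by blast
        have "y \<odot>\<^bsub>E k\<^esub> d l e' = z" using d[of l] e e' y l unfolding lin_maps_def regular_element_def by auto
        then show "\<exists>z'\<in>Z k. y \<odot>\<^bsub>E k\<^esub> z' = z" using im[of l] l e' by blast
      qed
    qed
  next
    case False
    show ?thesis using triv[of i] False pos by simp
  qed
  show ?thesis
  proof unfold_locales
    fix y J f
    assume "regular_element R y" "ideal J R" "y \<in> J"
      "linear_mod R (ring_module R) (ring_module R) J (PIdl y) f" "f y \<in> PIdl y"
    moreover have "\<epsilon> \<in> lin_maps R (ring_module R) (E 0)" "inj_on \<epsilon> (carrier R)"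
      "\<epsilon> ` carrier R = {e \<in> carrier (E 0). d 0 e = \<zero>\<^bsub>E (Suc 0)\<^esub>}"
      using res unfolding injective_resolution_def by simp_all
    moreover have "extends_from_ideals R (E (Suc 0)) (d 0 ` carrier (E 0))"
      unfolding im by (rule ext) simp
    ultimately show "\<exists>c\<in>carrier R. \<forall>j\<in>J. f j \<ominus> c \<otimes> j \<in> PIdl y"
      using self_injective_of_extends[OF inj Em _ _ d] by blast
  qed
qed

end

text \<open>An ideal that is maximal among those that avoid all products x^n s with s outside P is prime.
  Since x is regular, the zero ideal avoids them.\<close>
lemma (in noetherian_cring) prime_avoiding_regular:
  assumes P: "primeideal P R" and x: "regular_element R x"
  obtains Q where "primeideal Q R" "Q \<subseteq> P" "x \<notin> Q"
proof -
  interpret P: primeideal P R by fact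
  have xc: "x \<in> carrier R" using x by (simp add: regular_element_def)
  define W where "W = {x [^] (n::nat) \<otimes> s | n s. s \<in> carrier R \<and> s \<notin> P}"
  have pow: "s = \<zero>" if "s \<in> carrier R" "x [^] (n::nat) \<otimes> s = \<zero>" for n s
    using that
  proof (induction n arbitrary: s)
    case (Suc n)
    have "x [^] n \<otimes> (x \<otimes> s) = \<zero>" using Suc.prems xc by (simp add: m_assoc)
    then have "x \<otimes> s = \<zero>" using Suc.IH[of "x \<otimes> s"] Suc.prems xc by simp
    then show ?case using x Suc.prems(1) by (simp add: regular_element_def)
  qed simp
  have one: "\<one> \<notin> P" using P.one_imp_carrier P.I_notcarr by blast
  have Wc: "W \<subseteq> carrier R" using xc by (auto simp: W_def)
  have WW: "v \<otimes> w \<in> W" if vw: "v \<in> W" "w \<in> W" for v w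
  proof -
    obtain n s k t where *: "s \<in> carrier R" "s \<notin> P" "t \<in> carrier R" "t \<notin> P"
      "v = x [^] (n::nat) \<otimes> s" "w = x [^] (k::nat) \<otimes> t" using vw unfolding W_def by blast
    have "x [^] n \<otimes> s \<otimes> (x [^] k \<otimes> t) = (x [^] n \<otimes> x [^] k) \<otimes> (s \<otimes> t)"
      using *(1,3) nat_pow_closed[OF xc, of n] nat_pow_closed[OF xc, of k] by algebra
    then have "v \<otimes> w = x [^] (n + k) \<otimes> (s \<otimes> t)" using * xc by (simp add: nat_pow_mult)
    moreover have "s \<otimes> t \<notin> P" using P.I_prime * by blast
    ultimately show ?thesis using * unfolding W_def by blast
  qed
  have xW: "x \<in> W"
  proof -
    have "x = x [^] (1::nat) \<otimes> \<one>" using xc by simp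
    then show ?thesis unfolding W_def using one by blast
  qed
  have sW: "s \<in> W" if "s \<in> carrier R" "s \<notin> P" for s
  proof -
    have "s = x [^] (0::nat) \<otimes> s" using that by simp
    then show ?thesis unfolding W_def using that by blast
  qed
  let ?S = "{J. ideal J R \<and> J \<inter> W = {}}"
  have "\<zero> \<notin> W"
  proof
    assume "\<zero> \<in> W"
    then obtain n s where "s \<in> carrier R" "s \<notin> P" "x [^] (n::nat) \<otimes> s = \<zero>" unfolding W_def by auto
    then show False using pow P.zero_closed by metis
  qed
  then have "{\<zero>} \<in> ?S" using zeroideal by auto
  then have "?S \<noteq> {}" by blast
  moreover have "\<And>J. J \<in> ?S \<Longrightarrow> ideal J R" by blast
  ultimately have "\<exists>Q\<in>?S. \<forall>L\<in>?S. Q \<subseteq> L \<longrightarrow> L = Q" by (rule noeth_max)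
  then obtain Q where Q0: "Q \<in> ?S" and mx: "\<forall>L\<in>?S. Q \<subseteq> L \<longrightarrow> L = Q" by (rule bexE)
  have Q: "ideal Q R" "Q \<inter> W = {}" using Q0 by auto
  have meets: "\<exists>q\<in>Q. \<exists>r\<in>carrier R. q \<oplus> r \<otimes> a \<in> W" if a: "a \<in> carrier R" "a \<notin> Q" for a
  proof -
    note K = iadjoin[OF Q(1) a(1)]
    have "iadjoin Q a \<inter> W \<noteq> {}"
    proof
      assume "iadjoin Q a \<inter> W = {}"
      then have "iadjoin Q a = Q" using mx K by auto
      then show False using K(3) a(2) by simp
    qed
    then show ?thesis unfolding adjoin_def by auto
  qed
  have "primeideal Q R"
  proof (rule primeidealI[OF Q(1) is_cring])
    show "carrier R \<noteq> Q" using Q(2) xW xc by auto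
    fix a b assume ab: "a \<in> carrier R" "b \<in> carrier R" "a \<otimes> b \<in> Q"
    show "a \<in> Q \<or> b \<in> Q"
    proof (rule ccontr)
      assume "\<not> (a \<in> Q \<or> b \<in> Q)"
      then obtain p r q s where *: "p \<in> Q" "r \<in> carrier R" "p \<oplus> r \<otimes> a \<in> W"
        "q \<in> Q" "s \<in> carrier R" "q \<oplus> s \<otimes> b \<in> W" using meets ab by meson
      have pq: "p \<in> carrier R" "q \<in> carrier R" using * idealE(1)[OF Q(1)] by auto
      have "(p \<oplus> r \<otimes> a) \<otimes> (q \<oplus> s \<otimes> b) = (q \<oplus> s \<otimes> b) \<otimes> p \<oplus> ((r \<otimes> a) \<otimes> q \<oplus> (r \<otimes> s) \<otimes> (a \<otimes> b))"
        using pq *(2,5) ab(1,2) by algebra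
      moreover have "(q \<oplus> s \<otimes> b) \<otimes> p \<oplus> ((r \<otimes> a) \<otimes> q \<oplus> (r \<otimes> s) \<otimes> (a \<otimes> b)) \<in> Q"
        using idealE(5)[OF Q(1) _ *(1), of "q \<oplus> s \<otimes> b"] idealE(5)[OF Q(1) _ *(4), of "r \<otimes> a"]
          idealE(5)[OF Q(1) _ ab(3), of "r \<otimes> s"] pq(2) *(2,5) ab(1,2)
        by (intro idealE(3)[OF Q(1)]) simp_all
      ultimately show False using WW[OF *(3,6)] Q(2) by auto
    qed
  qed
  moreover have "Q \<subseteq> P" using sW Q(2) idealE(1)[OF Q(1)] by blast
  moreover have "x \<notin> Q" using xW Q(2) by auto
  ultimately show ?thesis using that by blast
qed

text \<open>If a prime that contains a regular element x were not maximal, then a smaller prime that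
  avoids x would give a chain of primes of length two.\<close>
lemma gorenstein_dim1I:
  fixes R :: "('a, 'r) ring_scheme"
  assumes G: "gorenstein_local_ring TYPE('e) R" and dim: "krull_dim R = 1"
  shows "\<exists>\<mm>. gorenstein_dim1 R \<mm>"
proof -
  interpret noetherian_cring R
    using G unfolding gorenstein_local_ring_def noetherian_local_ring_def noetherian_cring_def by blast
  obtain \<mm> where m: "maximalideal \<mm> R" "\<And>J. maximalideal J R \<Longrightarrow> J = \<mm>"
    using G unfolding gorenstein_local_ring_def noetherian_local_ring_def by blast
  have pr: "P = \<mm>" if P: "primeideal P R" "regular_element R x" "x \<in> P" for P x
  proof (rule ccontr)
    assume "P \<noteq> \<mm>"
    have "ideal P R" "P \<noteq> carrier R" using P(1) primeideal.I_notcarr primeideal.axioms(1) by blast+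
    then have "P \<subset> \<mm>" using ex_maximalideal m(2) \<open>P \<noteq> \<mm>\<close> by blast
    obtain Q where Q: "primeideal Q R" "Q \<subseteq> P" "x \<notin> Q" using prime_avoiding_regular[OF P(1,2)] by blast
    define C where "C i = (if i = 0 then Q else if i = 1 then P else \<mm>)" for i :: nat
    have mp: "primeideal \<mm> R" by (rule maximalideal_prime[OF m(1)])
    have QP: "Q \<subset> P" using Q P(3) by blast
    have "primeideal (C i) R" for i unfolding C_def using Q(1) P(1) mp by simp
    moreover have "C i \<subset> C (Suc i)" if "i < 2" for i
    proof -
      have "i = 0 \<or> i = 1" using that by linarith
      then show ?thesis using QP \<open>P \<subset> \<mm>\<close> unfolding C_def by (elim disjE) simp_all
    qed
    ultimately have "enat 2 \<in> {enat n |n. \<exists>P. (\<forall>i\<le>n. primeideal (P i) R) \<and> (\<forall>i<n. P i \<subset> P (Suc i))}"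
      by blast
    then have "enat 2 \<le> krull_dim R" unfolding krull_dim_def by (rule Sup_upper)
    then have "enat 2 \<le> enat 1" unfolding dim one_enat_def .
    then show False by simp
  qed
  have "noetherian_local_dim1 R \<mm>"
    by (rule noetherian_local_dim1.intro[OF noetherian_cring_axioms
          noetherian_local_dim1_axioms.intro[OF m pr]])
  then interpret noetherian_local_dim1 R \<mm> .
  have "\<exists>(E :: nat \<Rightarrow> ('a, 'e) module) \<epsilon> d n. injective_resolution R (ring_module R) E \<epsilon> d \<and>
        (\<forall>i>n. carrier (E i) = {\<zero>\<^bsub>E i\<^esub>})"
    using G unfolding gorenstein_local_ring_def finite_injective_dim_def by (rule conjunct2)
  then obtain E :: "nat \<Rightarrow> ('a, 'e) module" and \<epsilon> d n where
    *: "injective_resolution R (ring_module R) E \<epsilon> d \<and> (\<forall>i>n. carrier (E i) = {\<zero>\<^bsub>E i\<^esub>})"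
    by (elim exE)
  have "gorenstein_dim1 R \<mm>"
    by (rule self_injective_of_resolution[OF conjunct1[OF *], of n]) (simp add: *)
  then show ?thesis by (rule exI)
qed

section \<open>Duality for finitely generated modules\<close>

lemma linear_mod_submodule:
  fixes B :: "('a, 'n) module" and A :: "('a, 'm) module"
  assumes A: "module R A" and B: "module R B" and L: "submodule L R A" and N: "submodule N R B"
  shows "submodule {f \<in> L \<rightarrow>\<^sub>E carrier B. linear_mod R A B L N f} R (map_module L B)"
proof -
  interpret A: module R A by fact
  interpret B: module R B by fact
  interpret X: module R "map_module L B" by (rule map_module_module[OF B])
  note Ls = A.submoduleE(4,5)[OF L]
  show ?thesis
  proof (rule X.submoduleI2)
    show "\<zero>\<^bsub>map_module L B\<^esub> \<in> {f \<in> L \<rightarrow>\<^sub>E carrier B. linear_mod R A B L N f}"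
      using Ls B.cong_refl[OF N B.M.zero_closed] by (auto simp: linear_mod_def)
  next
    fix f g assume "f \<in> {f \<in> L \<rightarrow>\<^sub>E carrier B. linear_mod R A B L N f}" "g \<in> {f \<in> L \<rightarrow>\<^sub>E carrier B. linear_mod R A B L N f}"
    then have fg: "f \<in> L \<rightarrow>\<^sub>E carrier B" "g \<in> L \<rightarrow>\<^sub>E carrier B"
      and f: "linear_mod R A B L N f" and g: "linear_mod R A B L N g" by auto
    note fc = PiE_const_mem[OF fg(1)] and gc = PiE_const_mem[OF fg(2)]
    have "linear_mod R A B L N (\<lambda>x\<in>L. f x \<oplus>\<^bsub>B\<^esub> g x)"
      unfolding linear_mod_def
    proof (intro conjI ballI)
      fix x y assume xy: "x \<in> L" "y \<in> L"
      show "(\<lambda>x\<in>L. f x \<oplus>\<^bsub>B\<^esub> g x) x \<in> carrier B" using xy fc gc by simp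
      have "cong_mod B N (f (x \<oplus>\<^bsub>A\<^esub> y) \<oplus>\<^bsub>B\<^esub> g (x \<oplus>\<^bsub>A\<^esub> y)) ((f x \<oplus>\<^bsub>B\<^esub> f y) \<oplus>\<^bsub>B\<^esub> (g x \<oplus>\<^bsub>B\<^esub> g y))"
        using f g xy unfolding linear_mod_def by (intro B.cong_add[OF N]) auto
      moreover have "(f x \<oplus>\<^bsub>B\<^esub> f y) \<oplus>\<^bsub>B\<^esub> (g x \<oplus>\<^bsub>B\<^esub> g y) = (f x \<oplus>\<^bsub>B\<^esub> g x) \<oplus>\<^bsub>B\<^esub> (f y \<oplus>\<^bsub>B\<^esub> g y)"
        using fc[OF xy(1)] fc[OF xy(2)] gc[OF xy(1)] gc[OF xy(2)] by algebra
      ultimately show "cong_mod B N ((\<lambda>x\<in>L. f x \<oplus>\<^bsub>B\<^esub> g x) (x \<oplus>\<^bsub>A\<^esub> y)) ((\<lambda>x\<in>L. f x \<oplus>\<^bsub>B\<^esub> g x) x \<oplus>\<^bsub>B\<^esub> (\<lambda>x\<in>L. f x \<oplus>\<^bsub>B\<^esub> g x) y)"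
        using xy Ls by simp
    next
      fix r x assume rx: "r \<in> carrier R" "x \<in> L"
      have "cong_mod B N (f (r \<odot>\<^bsub>A\<^esub> x) \<oplus>\<^bsub>B\<^esub> g (r \<odot>\<^bsub>A\<^esub> x)) (r \<odot>\<^bsub>B\<^esub> f x \<oplus>\<^bsub>B\<^esub> r \<odot>\<^bsub>B\<^esub> g x)"
        using f g rx unfolding linear_mod_def by (intro B.cong_add[OF N]) auto
      moreover have "r \<odot>\<^bsub>B\<^esub> f x \<oplus>\<^bsub>B\<^esub> r \<odot>\<^bsub>B\<^esub> g x = r \<odot>\<^bsub>B\<^esub> (f x \<oplus>\<^bsub>B\<^esub> g x)"
        using fc[OF rx(2)] gc[OF rx(2)] rx(1) by algebra
      ultimately show "cong_mod B N ((\<lambda>x\<in>L. f x \<oplus>\<^bsub>B\<^esub> g x) (r \<odot>\<^bsub>A\<^esub> x)) (r \<odot>\<^bsub>B\<^esub> (\<lambda>x\<in>L. f x \<oplus>\<^bsub>B\<^esub> g x) x)"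
        using rx Ls by simp
    qed
    then show "f \<oplus>\<^bsub>map_module L B\<^esub> g \<in> {f \<in> L \<rightarrow>\<^sub>E carrier B. linear_mod R A B L N f}"
      using fc gc by simp
  next
    fix a f assume a: "a \<in> carrier R" and "f \<in> {f \<in> L \<rightarrow>\<^sub>E carrier B. linear_mod R A B L N f}"
    then have ff: "f \<in> L \<rightarrow>\<^sub>E carrier B" and f: "linear_mod R A B L N f" by auto
    note fc = PiE_const_mem[OF ff]
    have "linear_mod R A B L N (\<lambda>x\<in>L. a \<odot>\<^bsub>B\<^esub> f x)"
      unfolding linear_mod_def
    proof (intro conjI ballI)
      fix x y assume xy: "x \<in> L" "y \<in> L"
      show "(\<lambda>x\<in>L. a \<odot>\<^bsub>B\<^esub> f x) x \<in> carrier B" using xy fc a by simp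
      have "cong_mod B N (a \<odot>\<^bsub>B\<^esub> f (x \<oplus>\<^bsub>A\<^esub> y)) (a \<odot>\<^bsub>B\<^esub> (f x \<oplus>\<^bsub>B\<^esub> f y))"
        using f xy a unfolding linear_mod_def by (intro B.cong_smult[OF N]) auto
      then show "cong_mod B N ((\<lambda>x\<in>L. a \<odot>\<^bsub>B\<^esub> f x) (x \<oplus>\<^bsub>A\<^esub> y)) ((\<lambda>x\<in>L. a \<odot>\<^bsub>B\<^esub> f x) x \<oplus>\<^bsub>B\<^esub> (\<lambda>x\<in>L. a \<odot>\<^bsub>B\<^esub> f x) y)"
        using xy Ls fc a by (simp add: B.smult_r_distr)
    next
      fix r x assume rx: "r \<in> carrier R" "x \<in> L"
      have "cong_mod B N (a \<odot>\<^bsub>B\<^esub> f (r \<odot>\<^bsub>A\<^esub> x)) (a \<odot>\<^bsub>B\<^esub> (r \<odot>\<^bsub>B\<^esub> f x))"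
        using f rx a unfolding linear_mod_def by (intro B.cong_smult[OF N]) auto
      then show "cong_mod B N ((\<lambda>x\<in>L. a \<odot>\<^bsub>B\<^esub> f x) (r \<odot>\<^bsub>A\<^esub> x)) (r \<odot>\<^bsub>B\<^esub> (\<lambda>x\<in>L. a \<odot>\<^bsub>B\<^esub> f x) x)"
        using rx Ls a B.smult_lcomm[OF a rx(1) fc[OF rx(2)]] by simp
    qed
    then show "a \<odot>\<^bsub>map_module L B\<^esub> f \<in> {f \<in> L \<rightarrow>\<^sub>E carrier B. linear_mod R A B L N f}"
      using fc a by simp
  qed auto
qed

lemma maps_into_submodule:
  fixes B :: "('a, 'n) module"
  assumes B: "module R B" and N: "submodule N R B" and K: "K \<subseteq> L"
  shows "submodule {f \<in> L \<rightarrow>\<^sub>E carrier B. f ` K \<subseteq> N} R (map_module L B)"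
proof -
  interpret B: module R B by fact
  interpret X: module R "map_module L B" by (rule map_module_module[OF B])
  show ?thesis
    by (rule X.submoduleI2)
       (use K B.submodule_zero[OF N] B.submoduleE(4,5)[OF N] in
         \<open>auto simp: PiE_const_mem[of _ L "carrier B"] image_subset_iff subset_iff\<close>)
qed

lemma map_module_minus:
  fixes B :: "('a, 'n) module"
  assumes B: "module R B" and f: "f \<in> L \<rightarrow>\<^sub>E carrier B" and g: "g \<in> L \<rightarrow>\<^sub>E carrier B" and x: "x \<in> L"
  shows "(f \<ominus>\<^bsub>map_module L B\<^esub> g) x = f x \<ominus>\<^bsub>B\<^esub> g x"
proof -
  interpret B: module R B by fact
  interpret X: module R "map_module L B" by (rule map_module_module[OF B])
  have "f \<ominus>\<^bsub>map_module L B\<^esub> g = f \<oplus>\<^bsub>map_module L B\<^esub> (\<ominus>\<^bsub>R\<^esub> \<one>\<^bsub>R\<^esub>) \<odot>\<^bsub>map_module L B\<^esub> g"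
    using g by (simp add: a_minus_def X.smult_l_minus del: map_module_simps(2-))
  moreover have "g x \<in> carrier B" using g x by auto
  ultimately show ?thesis using x by (simp add: a_minus_def B.smult_l_minus)
qed

lemma cong_mod_maps_iff:
  fixes B :: "('a, 'n) module"
  assumes B: "module R B" and N: "submodule N R B"
    and f: "f \<in> L \<rightarrow>\<^sub>E carrier B" and g: "g \<in> L \<rightarrow>\<^sub>E carrier B"
  shows "cong_mod (map_module L B) (L \<rightarrow>\<^sub>E N) f g \<longleftrightarrow> (\<forall>x\<in>L. cong_mod B N (f x) (g x))"
proof -
  interpret B: module R B by fact
  interpret X: module R "map_module L B" by (rule map_module_module[OF B])
  have "f \<ominus>\<^bsub>map_module L B\<^esub> g \<in> carrier (map_module L B)" 
    by (rule X.M.minus_closed) (use f g in simp_all)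
  then have "f \<ominus>\<^bsub>map_module L B\<^esub> g \<in> extensional L" by (simp add: PiE_def)
  then have "f \<ominus>\<^bsub>map_module L B\<^esub> g \<in> L \<rightarrow>\<^sub>E N \<longleftrightarrow> (\<forall>x\<in>L. f x \<ominus>\<^bsub>B\<^esub> g x \<in> N)"
    using map_module_minus[OF B f g] by (simp add: PiE_def Pi_iff)
  then show ?thesis using f g by (auto simp: cong_mod_def)
qed

lemma linear_mod_maps:
  fixes A :: "('a, 'm) module" and B :: "('a, 'n) module"
  assumes B: "module R B" and N: "submodule N R B" and A: "module R A" "submodule K R A"
    and F: "\<And>k. k \<in> K \<Longrightarrow> F k \<in> L \<rightarrow>\<^sub>E carrier B"
    and lin: "\<And>x. x \<in> L \<Longrightarrow> linear_mod R A B K N (\<lambda>k. F k x)"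
  shows "linear_mod R A (map_module L B) K (L \<rightarrow>\<^sub>E N) F"
proof -
  interpret A: module R A by fact
  interpret B: module R B by fact
  interpret X: module R "map_module L B" by (rule map_module_module[OF B])
  note K = A.submoduleE(4,5)[OF A(2)]
  show ?thesis
    unfolding linear_mod_def
  proof (intro conjI ballI)
    fix k l assume kl: "k \<in> K" "l \<in> K"
    show "F k \<in> carrier (map_module L B)" using F[OF kl(1)] by simp
    have s: "F k \<oplus>\<^bsub>map_module L B\<^esub> F l \<in> L \<rightarrow>\<^sub>E carrier B"
      using X.M.a_closed[of "F k" "F l"] F kl by simp
    show "cong_mod (map_module L B) (L \<rightarrow>\<^sub>E N) (F (k \<oplus>\<^bsub>A\<^esub> l)) (F k \<oplus>\<^bsub>map_module L B\<^esub> F l)"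
      unfolding cong_mod_maps_iff[OF B N F[OF K(2)[OF kl]] s]
      using lin kl by (simp add: linear_mod_def)
  next
    fix r k assume rk: "r \<in> carrier R" "k \<in> K"
    have s: "r \<odot>\<^bsub>map_module L B\<^esub> F k \<in> L \<rightarrow>\<^sub>E carrier B"
      using X.smult_closed[OF rk(1), of "F k"] F rk by simp
    show "cong_mod (map_module L B) (L \<rightarrow>\<^sub>E N) (F (r \<odot>\<^bsub>A\<^esub> k)) (r \<odot>\<^bsub>map_module L B\<^esub> F k)"
      unfolding cong_mod_maps_iff[OF B N F[OF K(1)[OF rk]] s]
      using lin rk by (simp add: linear_mod_def)
  qed
qed

lemma maps_into_eq: "N \<subseteq> C \<Longrightarrow> {f \<in> L \<rightarrow>\<^sub>E C. f ` L \<subseteq> N} = L \<rightarrow>\<^sub>E N"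
  by (auto simp: PiE_def Pi_def image_subset_iff)

lemma linear_mod_eval:
  fixes B :: "('a, 'n) module"
  assumes B: "module R B" and N: "submodule N R B" and X: "X \<subseteq> L \<rightarrow>\<^sub>E carrier B" and x: "x \<in> L"
  shows "linear_mod R (map_module L B) B X N (\<lambda>f. f x)"
proof -
  interpret B: module R B by fact
  have c: "f x \<in> carrier B" if "f \<in> X" for f using that X x by auto
  show ?thesis
    unfolding linear_mod_def using x c B.cong_refl[OF N] by simp
qed

text \<open>The lifts of the elements of Hom(N/K, R/Y).\<close>
definition dual_maps ::
    "('a, 'r) ring_scheme \<Rightarrow> ('a, 'm) module \<Rightarrow> 'a set \<Rightarrow> 'm set \<Rightarrow> 'm set \<Rightarrow> ('m \<Rightarrow> 'a) set" where
  "dual_maps R F Y K N = {f \<in> N \<rightarrow>\<^sub>E carrier R. linear_mod R F (ring_module R) N Y f \<and> f ` K \<subseteq> Y}"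

context gorenstein_dim1 begin

interpretation rm: module R "ring_module R" by (rule ring_module_module)

lemma dual_maps_submodule:
  assumes F: "module R F" and N: "submodule N R F" and KN: "K \<subseteq> N" and Y: "ideal Y R"
  shows "submodule (dual_maps R F Y K N) R (map_module N (ring_module R))"
    "submodule (N \<rightarrow>\<^sub>E Y) R (map_module N (ring_module R))"
    "N \<rightarrow>\<^sub>E Y \<subseteq> dual_maps R F Y K N"
proof -
  interpret F: module R F by fact
  interpret X: module R "map_module N (ring_module R)" by (rule map_module_module[OF ring_module_module])
  have sY: "submodule Y R (ring_module R)" using Y by (simp add: ideal_iff_submodule)
  have "dual_maps R F Y K N = {f \<in> N \<rightarrow>\<^sub>E carrier (ring_module R). linear_mod R F (ring_module R) N Y f}
      \<inter> {f \<in> N \<rightarrow>\<^sub>E carrier (ring_module R). f ` K \<subseteq> Y}"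
    by (auto simp: dual_maps_def)
  then show "submodule (dual_maps R F Y K N) R (map_module N (ring_module R))"
    using X.submodule_inter linear_mod_submodule[OF F ring_module_module N sY]
      maps_into_submodule[OF ring_module_module sY KN] by simp
  show "submodule (N \<rightarrow>\<^sub>E Y) R (map_module N (ring_module R))"
    using maps_into_submodule[OF ring_module_module sY order_refl, of N] maps_into_eq[OF idealE(1)[OF Y], of N] by simp
  show "N \<rightarrow>\<^sub>E Y \<subseteq> dual_maps R F Y K N"
  proof
    fix f assume f: "f \<in> N \<rightarrow>\<^sub>E Y"
    have fY: "f x \<in> Y" "f x \<in> carrier R" if "x \<in> N" for x using f that idealE(1)[OF Y] by auto
    have "linear_mod R F (ring_module R) N Y f"
      unfolding linear_mod_def cong_mod_def
      using fY F.submoduleE(4,5)[OF N] idealE(3,4,5)[OF Y] by simp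
    then show "f \<in> dual_maps R F Y K N"
      using f fY KN by (auto simp: dual_maps_def PiE_def)
  qed
qed

lemma dual_extend:
  assumes F: "module R F" and N: "submodule N R F" and K: "submodule K R F" "K \<subseteq> N" and Y: "ideal Y R"
    and f: "f \<in> dual_maps R F Y K N" and g: "g \<in> carrier F" and z: "z \<in> carrier R"
    and compat: "\<And>a. a \<in> carrier R \<Longrightarrow> a \<odot>\<^bsub>F\<^esub> g \<in> N \<Longrightarrow> cong_mod (ring_module R) Y (f (a \<odot>\<^bsub>F\<^esub> g)) (a \<otimes> z)"
  obtains h where "h \<in> dual_maps R F Y K (adjoin R F N g)"
    "\<And>j. j \<in> N \<Longrightarrow> cong_mod (ring_module R) Y (h j) (f j)"
    "cong_mod (ring_module R) Y (h g) z"
proof -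
  interpret F: module R F by fact
  let ?N' = "adjoin R F N g"
  have sY: "submodule Y R (ring_module R)" using Y by (simp add: ideal_iff_submodule)
  have fl: "linear_mod R F (ring_module R) N Y f" and fK: "f ` K \<subseteq> Y" and ff: "f \<in> N \<rightarrow>\<^sub>E carrier R"
    using f by (auto simp: dual_maps_def)
  note N' = F.adjoin_submodule[OF N g]
  obtain h where h: "linear_mod R F (ring_module R) ?N' Y h"
    "\<And>j r. j \<in> N \<Longrightarrow> r \<in> carrier R \<Longrightarrow> cong_mod (ring_module R) Y (h (j \<oplus>\<^bsub>F\<^esub> r \<odot>\<^bsub>F\<^esub> g)) (f j \<oplus> r \<otimes> z)"
    by (rule linear_mod_extend[OF F ring_module_module N sY fl g, of z]) (use z compat in auto)
  have hj: "cong_mod (ring_module R) Y (h j) (f j)" if j: "j \<in> N" for j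
  proof -
    have "j \<oplus>\<^bsub>F\<^esub> \<zero> \<odot>\<^bsub>F\<^esub> g = j" "f j \<oplus> \<zero> \<otimes> z = f j"
      using g z subsetD[OF F.submoduleE(1)[OF N] j] PiE_const_mem[OF ff j] by simp_all
    then show ?thesis using h(2)[OF j zero_closed] by simp
  qed
  have hg: "cong_mod (ring_module R) Y (h g) z"
  proof -
    note z0 = F.submodule_zero[OF N]
    have 1: "\<zero>\<^bsub>F\<^esub> \<oplus>\<^bsub>F\<^esub> \<one> \<odot>\<^bsub>F\<^esub> g = g" "\<one> \<otimes> z = z" using g z by simp_all
    have "cong_mod (ring_module R) Y (h g) (f \<zero>\<^bsub>F\<^esub> \<oplus> z)" using h(2)[OF z0 one_closed] unfolding 1 .
    moreover have "f \<zero>\<^bsub>F\<^esub> \<in> Y" using fK F.submodule_zero[OF K(1)] by blast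
    then have "cong_mod (ring_module R) Y (f \<zero>\<^bsub>F\<^esub> \<oplus> z) (\<zero> \<oplus> z)"
      using rm.cong_add[OF sY, of "f \<zero>\<^bsub>F\<^esub>" \<zero> z z] rm.cong_refl[OF sY] rm.cong_zero_iff[OF sY]
        PiE_const_mem[OF ff z0] z by simp
    ultimately show ?thesis using rm.cong_trans[OF sY] z by simp
  qed
  have rj: "restrict h ?N' j = h j" if "j \<in> ?N'" for j using that by simp
  have "linear_mod R F (ring_module R) ?N' Y (restrict h ?N')"
    using h(1) F.submoduleE(4,5)[OF N'(1)] unfolding linear_mod_def by (simp cong: conj_cong)
  moreover have "restrict h ?N' \<in> ?N' \<rightarrow>\<^sub>E carrier R" using h(1) by (auto simp: linear_mod_def)
  moreover have "restrict h ?N' k \<in> Y" if k: "k \<in> K" for k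
  proof -
    have kN: "k \<in> N" "k \<in> ?N'" using k K(2) N'(2) by auto
    then show ?thesis using rm.cong_mem[OF sY order_refl hj[OF kN(1)]] fK k by auto
  qed
  ultimately have "restrict h ?N' \<in> dual_maps R F Y K ?N'" unfolding dual_maps_def by blast
  then show ?thesis
    by (rule that) (use hj hg N'(2,3) in auto)
qed

text \<open>Write N' = N + Rg and J = (N : g), so that N'/N is isomorphic to R/J. Restriction to N gives an
  exact sequence from Hom(N'/N, R/yR) over Hom(N'/K, R/yR) to Hom(N/K, R/yR). It is onto at the
  right end by self-injectivity, applied to the map a to f(a g) on J, and on the left the
  length is known from the case of cyclic modules.\<close>
lemma dual_len_adjoin:
  assumes F: "module R F" and y: "regular_element R y" and K: "submodule K R F"
    and N: "submodule N R F" and KN: "K \<subseteq> N" and g: "g \<in> carrier F" and yg: "y \<odot>\<^bsub>F\<^esub> g \<in> K"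
    and IH: "len R (map_module N (ring_module R)) (N \<rightarrow>\<^sub>E PIdl y) (dual_maps R F (PIdl y) K N) = len R F K N"
  shows "len R (map_module (adjoin R F N g) (ring_module R)) (adjoin R F N g \<rightarrow>\<^sub>E PIdl y)
      (dual_maps R F (PIdl y) K (adjoin R F N g)) = len R F K (adjoin R F N g)"
proof -
  interpret F: module R F by fact
  let ?Y = "PIdl y" and ?N' = "adjoin R F N g"
  let ?M = "map_module N (ring_module R)" and ?M' = "map_module ?N' (ring_module R)"
  have Mm: "module R ?M" "module R ?M'" by (rule map_module_module[OF ring_module_module])+
  interpret M: module R ?M by (rule Mm)
  interpret M': module R ?M' by (rule Mm)
  note Y = principal[OF y]
  note yc = regular_carrier[OF y]
  have sY: "submodule ?Y R (ring_module R)" using Y by (simp add: ideal_iff_submodule)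
  note N' = F.adjoin_submodule[OF N g]
  have KN': "K \<subseteq> ?N'" using KN N'(2) by blast
  define J where "J = {a \<in> carrier R. a \<odot>\<^bsub>F\<^esub> g \<in> N}"
  note V = dual_maps_submodule[OF F N KN Y(1)]
  note V' = dual_maps_submodule[OF F N'(1) KN' Y(1)]
  have Jlin: "linear_mod R (ring_module R) F (carrier R) N (\<lambda>a. a \<odot>\<^bsub>F\<^esub> g)"
    by (rule F.linear_mod_smult[OF N g order_refl])
  have J: "ideal J R"
    unfolding ideal_iff_submodule J_def
    using submodule_preimage[OF ring_module_module F _ N Jlin N order_refl] carrier_ideal ideal_iff_submodule by simp
  have Jc: "\<And>a. a \<in> J \<Longrightarrow> a \<in> carrier R" and Jg: "\<And>a. a \<in> J \<Longrightarrow> a \<odot>\<^bsub>F\<^esub> g \<in> N" by (auto simp: J_def)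
  have yJ: "y \<in> J" using yc yg KN by (auto simp: J_def)
  \<comment> \<open>the quotient N'/N is R/J\<close>
  have "ilen R {a \<in> carrier R. a \<odot>\<^bsub>F\<^esub> g \<in> N} (carrier R) = len R F N ?N'"
  proof (rule len_transfer[OF ring_module_module F _ N N'(1,2) Jlin])
    show "submodule (carrier R) R (ring_module R)" using carrier_ideal ideal_iff_submodule by simp
    fix a assume "a \<in> carrier R"
    then show "a \<odot>\<^bsub>F\<^esub> g \<in> ?N'" using F.submoduleE(4)[OF N'(1)] N'(3) by blast
  next
    fix b assume "b \<in> ?N'"
    then obtain j r where *: "j \<in> N" "r \<in> carrier R" "b = j \<oplus>\<^bsub>F\<^esub> r \<odot>\<^bsub>F\<^esub> g" unfolding adjoin_def by blast
    have jc: "j \<in> carrier F" using * F.submoduleE(1)[OF N] by auto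
    have "b \<ominus>\<^bsub>F\<^esub> r \<odot>\<^bsub>F\<^esub> g = j" unfolding *(3) using jc *(2) g by algebra
    then have "cong_mod F N b (r \<odot>\<^bsub>F\<^esub> g)" using * jc g by (simp add: cong_mod_def)
    then show "\<exists>a\<in>carrier R. cong_mod F N b (a \<odot>\<^bsub>F\<^esub> g)" using * by blast
  qed
  then have lenN: "len R F K ?N' = len R F K N + ilen R J (carrier R)"
    using F.len_add[OF K N N'(1) KN N'(2)] by (simp add: J_def)
  \<comment> \<open>restriction to N is onto, with kernel X\<close>
  let ?\<rho> = "\<lambda>h. restrict h N"
  define X where "X = {h \<in> dual_maps R F ?Y K ?N'. ?\<rho> h \<in> N \<rightarrow>\<^sub>E ?Y}"
  have V'f: "h \<in> ?N' \<rightarrow>\<^sub>E carrier R" if "h \<in> dual_maps R F ?Y K ?N'" for h using that by (simp add: dual_maps_def)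
  have V'c: "h x \<in> carrier R" if "h \<in> dual_maps R F ?Y K ?N'" "x \<in> ?N'" for h x
    using PiE_const_mem[OF V'f[OF that(1)] that(2)] .
  have \<rho>lin: "linear_mod R ?M' ?M (dual_maps R F ?Y K ?N') (N \<rightarrow>\<^sub>E ?Y) ?\<rho>"
  proof (rule linear_mod_maps[OF ring_module_module sY Mm(2) V'(1)])
    fix h assume "h \<in> dual_maps R F ?Y K ?N'"
    then show "?\<rho> h \<in> N \<rightarrow>\<^sub>E carrier (ring_module R)" using V'c N'(2) by auto
  next
    fix x assume x: "x \<in> N"
    have "linear_mod R ?M' (ring_module R) (dual_maps R F ?Y K ?N') ?Y (\<lambda>h. h x)"
      by (rule linear_mod_eval[OF ring_module_module sY]) (use V'f x N'(2) in auto)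
    then show "linear_mod R ?M' (ring_module R) (dual_maps R F ?Y K ?N') ?Y (\<lambda>h. ?\<rho> h x)" using x by simp
  qed
  have 1: "len R ?M' X (dual_maps R F ?Y K ?N') = len R ?M (N \<rightarrow>\<^sub>E ?Y) (dual_maps R F ?Y K N)"
    unfolding X_def
  proof (rule len_transfer[OF Mm(2,1) V'(1) V(2,1,3) \<rho>lin])
    fix h assume h: "h \<in> dual_maps R F ?Y K ?N'"
    then have "linear_mod R F (ring_module R) ?N' ?Y h" "h ` K \<subseteq> ?Y" by (auto simp: dual_maps_def)
    then show "?\<rho> h \<in> dual_maps R F ?Y K N"
      using N'(2) KN F.submoduleE(4,5)[OF N] V'c[OF h]
      unfolding dual_maps_def linear_mod_def by (auto simp: subset_iff)
  next
    fix f assume f: "f \<in> dual_maps R F ?Y K N"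
    then have fl: "linear_mod R F (ring_module R) N ?Y f" and fK: "f ` K \<subseteq> ?Y" and ff: "f \<in> N \<rightarrow>\<^sub>E carrier R"
      by (auto simp: dual_maps_def)
    have "linear_mod R (ring_module R) (ring_module R) J ?Y (\<lambda>a. f (a \<odot>\<^bsub>F\<^esub> g))"
      unfolding linear_mod_def
    proof (intro conjI ballI)
      fix a b assume ab: "a \<in> J" "b \<in> J"
      show "f (a \<odot>\<^bsub>F\<^esub> g) \<in> carrier (ring_module R)" using PiE_const_mem[OF ff Jg[OF ab(1)]] by simp
      show "cong_mod (ring_module R) ?Y (f ((a \<oplus>\<^bsub>ring_module R\<^esub> b) \<odot>\<^bsub>F\<^esub> g)) (f (a \<odot>\<^bsub>F\<^esub> g) \<oplus>\<^bsub>ring_module R\<^esub> f (b \<odot>\<^bsub>F\<^esub> g))"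
        using fl Jg[OF ab(1)] Jg[OF ab(2)] F.smult_l_distr[OF Jc[OF ab(1)] Jc[OF ab(2)] g]
        by (simp add: linear_mod_def)
    next
      fix r a assume a: "r \<in> carrier R" "a \<in> J"
      show "cong_mod (ring_module R) ?Y (f ((r \<odot>\<^bsub>ring_module R\<^esub> a) \<odot>\<^bsub>F\<^esub> g)) (r \<odot>\<^bsub>ring_module R\<^esub> f (a \<odot>\<^bsub>F\<^esub> g))"
        using fl Jg[OF a(2)] F.smult_assoc1[OF a(1) Jc[OF a(2)] g] a(1)
        by (simp add: linear_mod_def)
    qed
    moreover have "f (y \<odot>\<^bsub>F\<^esub> g) \<in> ?Y" using fK yg by blast
    ultimately obtain c where c: "c \<in> carrier R" "\<And>a. a \<in> J \<Longrightarrow> f (a \<odot>\<^bsub>F\<^esub> g) \<ominus> c \<otimes> a \<in> ?Y"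
      using self_injective[OF y J yJ] by blast
    obtain h where h: "h \<in> dual_maps R F ?Y K ?N'" "\<And>j. j \<in> N \<Longrightarrow> cong_mod (ring_module R) ?Y (h j) (f j)"
    proof (rule dual_extend[OF F N K KN Y(1) f g c(1)])
      fix a assume a: "a \<in> carrier R" "a \<odot>\<^bsub>F\<^esub> g \<in> N"
      then show "cong_mod (ring_module R) ?Y (f (a \<odot>\<^bsub>F\<^esub> g)) (a \<otimes> c)"
        using c(2)[of a] c(1) PiE_const_mem[OF ff a(2)] m_comm[OF a(1) c(1)] by (simp add: J_def cong_mod_def)
    qed (rule that)
    have "?\<rho> h \<in> N \<rightarrow>\<^sub>E carrier R" using V'c[OF h(1)] N'(2) by auto
    then have "cong_mod ?M (N \<rightarrow>\<^sub>E ?Y) f (?\<rho> h)"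
      using cong_mod_maps_iff[OF ring_module_module sY, of f N "?\<rho> h"] ff h(2) rm.cong_sym[OF sY] by simp
    then show "\<exists>h\<in>dual_maps R F ?Y K ?N'. cong_mod ?M (N \<rightarrow>\<^sub>E ?Y) f (?\<rho> h)" using h(1) by blast
  qed
  \<comment> \<open>evaluation at g identifies the kernel with (Y : J)/Y, the dual of R/J\<close>
  have sX: "submodule X R ?M'" unfolding X_def
    by (rule submodule_preimage[OF Mm(2,1) V'(1) V(2) \<rho>lin V(2) order_refl])
  have Xf: "X \<subseteq> ?N' \<rightarrow>\<^sub>E carrier (ring_module R)" using V'f by (auto simp: X_def)
  have XN: "h j \<in> ?Y" if "h \<in> X" "j \<in> N" for h j
  proof -
    have "?\<rho> h \<in> N \<rightarrow>\<^sub>E ?Y" using that by (simp add: X_def)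
    from PiE_const_mem[OF this that(2)] show ?thesis using that(2) by simp
  qed
  have e: "{h \<in> X. h g \<in> ?Y} = ?N' \<rightarrow>\<^sub>E ?Y"
  proof (intro equalityI subsetI)
    fix h assume "h \<in> {h \<in> X. h g \<in> ?Y}"
    then have h: "h \<in> X" "h g \<in> ?Y" by auto
    then have hl: "linear_mod R F (ring_module R) ?N' ?Y h" and hf: "h \<in> ?N' \<rightarrow>\<^sub>E carrier R"
      by (auto simp: X_def dual_maps_def)
    have "h k \<in> ?Y" if k: "k \<in> ?N'" for k
    proof -
      obtain j r where *: "j \<in> N" "r \<in> carrier R" "k = j \<oplus>\<^bsub>F\<^esub> r \<odot>\<^bsub>F\<^esub> g" using k unfolding adjoin_def by blast
      have jr: "j \<in> ?N'" "r \<odot>\<^bsub>F\<^esub> g \<in> ?N'" using * N'(2,3) F.submoduleE(4)[OF N'(1)] by auto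
      have "cong_mod (ring_module R) ?Y (h (r \<odot>\<^bsub>F\<^esub> g)) (r \<otimes> h g)" using hl *(2) N'(3) by (simp add: linear_mod_def)
      then have "h (r \<odot>\<^bsub>F\<^esub> g) \<in> ?Y" using rm.cong_mem[OF sY order_refl] idealE(5)[OF Y(1) *(2) h(2)] by blast
      then have "h j \<oplus> h (r \<odot>\<^bsub>F\<^esub> g) \<in> ?Y" using XN[OF h(1) *(1)] idealE(3)[OF Y(1)] by blast
      moreover have "cong_mod (ring_module R) ?Y (h k) (h j \<oplus> h (r \<odot>\<^bsub>F\<^esub> g))" unfolding *(3) using hl jr by (simp add: linear_mod_def)
      ultimately show ?thesis using rm.cong_mem[OF sY order_refl] by blast
    qed
    then show "h \<in> ?N' \<rightarrow>\<^sub>E ?Y" using hf by (simp add: PiE_def)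
  next
    fix h assume h: "h \<in> ?N' \<rightarrow>\<^sub>E ?Y"
    then have "\<And>x. x \<in> N \<Longrightarrow> h x \<in> ?Y" "h g \<in> ?Y" using N'(2,3) by auto
    then show "h \<in> {h \<in> X. h g \<in> ?Y}" using subsetD[OF V'(3) h] by (simp add: X_def)
  qed
  have elin: "linear_mod R ?M' (ring_module R) X ?Y (\<lambda>h. h g)"
    by (rule linear_mod_eval[OF ring_module_module sY Xf N'(3)])
  have Jsub: "J \<subseteq> carrier R" using Jc by blast
  have "len R ?M' {h \<in> X. h g \<in> ?Y} X = ilen R ?Y (colon R ?Y J)"
  proof (rule len_transfer[OF Mm(2) ring_module_module sX sY _ principal_le_colon[OF y Jsub] elin])
    show "submodule (colon R ?Y J) R (ring_module R)"
      using colon_ideal[OF Y(1) Jsub] ideal_iff_submodule by simp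
  next
    fix h assume h: "h \<in> X"
    then have hl: "linear_mod R F (ring_module R) ?N' ?Y h" and hV: "h \<in> dual_maps R F ?Y K ?N'"
      by (auto simp: X_def dual_maps_def)
    have hg: "h g \<in> carrier R" using V'c[OF hV N'(3)] .
    have "h g \<otimes> a \<in> ?Y" if a: "a \<in> J" for a
    proof -
      have "cong_mod (ring_module R) ?Y (h (a \<odot>\<^bsub>F\<^esub> g)) (a \<otimes> h g)"
        using hl Jc[OF a] N'(3) by (simp add: linear_mod_def)
      then have "a \<otimes> h g \<in> ?Y" using rm.cong_mem[OF sY order_refl] XN[OF h Jg[OF a]] by blast
      then show ?thesis using m_comm[OF hg Jc[OF a]] by simp
    qed
    then show "h g \<in> colon R ?Y J" using hg by (simp add: colon_def)
  next
    fix c assume "c \<in> colon R ?Y J"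
    then have c: "c \<in> carrier R" "\<And>a. a \<in> J \<Longrightarrow> c \<otimes> a \<in> ?Y" by (auto simp: colon_def)
    have z: "(\<lambda>x\<in>N. \<zero>) \<in> N \<rightarrow>\<^sub>E ?Y" using idealE(2)[OF Y(1)] by auto
    obtain h where h: "h \<in> dual_maps R F ?Y K ?N'"
      "\<And>j. j \<in> N \<Longrightarrow> cong_mod (ring_module R) ?Y (h j) ((\<lambda>x\<in>N. \<zero>) j)"
      "cong_mod (ring_module R) ?Y (h g) c"
    proof (rule dual_extend[OF F N K KN Y(1) subsetD[OF V(3) z] g c(1)])
      fix a assume a: "a \<in> carrier R" "a \<odot>\<^bsub>F\<^esub> g \<in> N"
      then have "a \<otimes> c \<in> ?Y" using c(2)[of a] m_comm[OF a(1) c(1)] by (simp add: J_def)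
      then have "cong_mod (ring_module R) ?Y (a \<otimes> c) \<zero>" using rm.cong_zero_iff[OF sY] a c(1) by simp
      then show "cong_mod (ring_module R) ?Y ((\<lambda>x\<in>N. \<zero>) (a \<odot>\<^bsub>F\<^esub> g)) (a \<otimes> c)"
        using a rm.cong_sym[OF sY] by simp
    qed (rule that)
    have "h j \<in> ?Y" if j: "j \<in> N" for j
      using h(2)[OF j] rm.cong_mem[OF sY order_refl, of "h j" \<zero>] idealE(2)[OF Y(1)] j by simp
    then have "h \<in> X" using h(1) by (auto simp: X_def)
    then show "\<exists>h\<in>X. cong_mod (ring_module R) ?Y c (h g)" using h(3) rm.cong_sym[OF sY] by blast
  qed
  then have 2: "len R ?M' (?N' \<rightarrow>\<^sub>E ?Y) X = ilen R J (carrier R)"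
    unfolding e dual_len[OF J y yJ] .
  have "?N' \<rightarrow>\<^sub>E ?Y \<subseteq> X" "X \<subseteq> dual_maps R F ?Y K ?N'" using e by (auto simp: X_def)
  then have "len R ?M' (?N' \<rightarrow>\<^sub>E ?Y) (dual_maps R F ?Y K ?N') = len R ?M' (?N' \<rightarrow>\<^sub>E ?Y) X + len R ?M' X (dual_maps R F ?Y K ?N')"
    by (rule M'.len_add[OF V'(2) sX V'(1)])
  then show ?thesis unfolding 1 2 IH lenN by (simp add: add.commute)
qed

text \<open>Matlis duality over R/yR on the level of lengths, by adjoining the generators in A to K one by
  one.\<close>
lemma dual_len_module:
  assumes F: "module R F" and y: "regular_element R y" and K: "submodule K R F"
    and yF: "\<And>\<phi>. \<phi> \<in> carrier F \<Longrightarrow> y \<odot>\<^bsub>F\<^esub> \<phi> \<in> K"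
    and A: "finite A" "A \<subseteq> carrier F"
    and gen: "\<And>N. submodule N R F \<Longrightarrow> K \<subseteq> N \<Longrightarrow> A \<subseteq> N \<Longrightarrow> N = carrier F"
  shows "len R (map_module (carrier F) (ring_module R)) (carrier F \<rightarrow>\<^sub>E PIdl y)
      (dual_maps R F (PIdl y) K (carrier F)) = len R F K (carrier F)"
proof -
  interpret F: module R F by fact
  note Y = principal[OF y]
  have "\<exists>N. submodule N R F \<and> K \<subseteq> N \<and> A \<subseteq> N \<and>
    len R (map_module N (ring_module R)) (N \<rightarrow>\<^sub>E PIdl y) (dual_maps R F (PIdl y) K N) = len R F K N"
    using A
  proof (induction A rule: finite_induct)
    case empty
    have "dual_maps R F (PIdl y) K K = K \<rightarrow>\<^sub>E PIdl y"
      using dual_maps_submodule(3)[OF F K order_refl Y(1)] by (auto simp: dual_maps_def PiE_def)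
    then have "len R (map_module K (ring_module R)) (K \<rightarrow>\<^sub>E PIdl y) (dual_maps R F (PIdl y) K K) = 0"
      using len_self[OF dual_maps_submodule(2)[OF F K order_refl Y(1)]] by simp
    then show ?case using K len_self[OF K] by (intro exI[of _ K]) simp
  next
    case (insert g A)
    then obtain N where N: "submodule N R F" "K \<subseteq> N" "A \<subseteq> N"
      "len R (map_module N (ring_module R)) (N \<rightarrow>\<^sub>E PIdl y) (dual_maps R F (PIdl y) K N) = len R F K N"
      by auto
    have g: "g \<in> carrier F" using insert.prems by simp
    note N' = F.adjoin_submodule[OF N(1) g]
    show ?case
      by (rule exI[of _ "adjoin R F N g"])
         (use N' N(2,3) dual_len_adjoin[OF F y K N(1,2) g yF[OF g] N(4)] in auto)
  qed
  then obtain N where N: "submodule N R F" "K \<subseteq> N" "A \<subseteq> N"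
    "len R (map_module N (ring_module R)) (N \<rightarrow>\<^sub>E PIdl y) (dual_maps R F (PIdl y) K N) = len R F K N" by blast
  then show ?thesis using gen[OF N(1-3)] by simp
qed

end

lemma (in module) minus_plus_cancel: "x \<in> carrier M \<Longrightarrow> y \<in> carrier M \<Longrightarrow> (x \<ominus>\<^bsub>M\<^esub> y) \<oplus>\<^bsub>M\<^esub> y = x"
  by algebra

lemma linear_cong_submodule:
  fixes A :: "('a, 'm) module" and B :: "('a, 'n) module"
  assumes A: "module R A" and B: "module R B" and L: "submodule L R A" and N: "submodule N R B"
    and f: "linear_mod R A B L N f" and g: "linear_mod R A B L N g"
  shows "submodule {a \<in> L. cong_mod B N (f a) (g a)} R A"
proof -
  interpret A: module R A by fact
  interpret B: module R B by fact
  show ?thesis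
  proof (rule A.submoduleI2)
    show "{a \<in> L. cong_mod B N (f a) (g a)} \<subseteq> carrier A" using A.submoduleE(1)[OF L] by auto
    have z: "f \<zero>\<^bsub>A\<^esub> \<in> N" "g \<zero>\<^bsub>A\<^esub> \<in> N" using linear_mod_zero[OF A B L N] f g by auto
    then have "f \<zero>\<^bsub>A\<^esub> \<in> carrier B" "g \<zero>\<^bsub>A\<^esub> \<in> carrier B" using B.submoduleE(1)[OF N] by auto
    then have "cong_mod B N (f \<zero>\<^bsub>A\<^esub>) (g \<zero>\<^bsub>A\<^esub>)"
      using z B.submodule_minus[OF N] by (simp add: cong_mod_def)
    then show "\<zero>\<^bsub>A\<^esub> \<in> {a \<in> L. cong_mod B N (f a) (g a)}" using A.submodule_zero[OF L] by simp
  next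
    fix a b assume "a \<in> {a \<in> L. cong_mod B N (f a) (g a)}" "b \<in> {a \<in> L. cong_mod B N (f a) (g a)}"
    then have ab: "a \<in> L" "b \<in> L" "cong_mod B N (f a) (g a)" "cong_mod B N (f b) (g b)" by auto
    have "cong_mod B N (f (a \<oplus>\<^bsub>A\<^esub> b)) (f a \<oplus>\<^bsub>B\<^esub> f b)" using f ab by (simp add: linear_mod_def)
    also note B.cong_add[OF N ab(3,4)]
    finally (B.cong_trans[OF N]) have "cong_mod B N (f (a \<oplus>\<^bsub>A\<^esub> b)) (g a \<oplus>\<^bsub>B\<^esub> g b)" .
    moreover have "cong_mod B N (g a \<oplus>\<^bsub>B\<^esub> g b) (g (a \<oplus>\<^bsub>A\<^esub> b))"
      by (rule B.cong_sym[OF N]) (use g ab in \<open>simp add: linear_mod_def\<close>)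
    ultimately have "cong_mod B N (f (a \<oplus>\<^bsub>A\<^esub> b)) (g (a \<oplus>\<^bsub>A\<^esub> b))" by (rule B.cong_trans[OF N])
    then show "a \<oplus>\<^bsub>A\<^esub> b \<in> {a \<in> L. cong_mod B N (f a) (g a)}" using ab A.submoduleE(5)[OF L] by simp
  next
    fix r a assume r: "r \<in> carrier R" and "a \<in> {a \<in> L. cong_mod B N (f a) (g a)}"
    then have ab: "a \<in> L" "cong_mod B N (f a) (g a)" by auto
    have "cong_mod B N (f (r \<odot>\<^bsub>A\<^esub> a)) (r \<odot>\<^bsub>B\<^esub> f a)" using f ab r by (simp add: linear_mod_def)
    also note B.cong_smult[OF N ab(2) r]
    finally (B.cong_trans[OF N]) have "cong_mod B N (f (r \<odot>\<^bsub>A\<^esub> a)) (r \<odot>\<^bsub>B\<^esub> g a)" .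
    moreover have "cong_mod B N (r \<odot>\<^bsub>B\<^esub> g a) (g (r \<odot>\<^bsub>A\<^esub> a))"
      by (rule B.cong_sym[OF N]) (use g ab r in \<open>simp add: linear_mod_def\<close>)
    ultimately have "cong_mod B N (f (r \<odot>\<^bsub>A\<^esub> a)) (g (r \<odot>\<^bsub>A\<^esub> a))" by (rule B.cong_trans[OF N])
    then show "r \<odot>\<^bsub>A\<^esub> a \<in> {a \<in> L. cong_mod B N (f a) (g a)}" using ab r A.submoduleE(4)[OF L] by simp
  qed
qed

section \<open>Free modules\<close>

lemma free_module_simps [simp]:
  "\<zero>\<^bsub>free_module R X\<^esub> = (\<lambda>x. \<zero>\<^bsub>R\<^esub>)"
  "\<phi> \<oplus>\<^bsub>free_module R X\<^esub> \<psi> = (\<lambda>x. \<phi> x \<oplus>\<^bsub>R\<^esub> \<psi> x)"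
  "a \<odot>\<^bsub>free_module R X\<^esub> \<phi> = (\<lambda>x. a \<otimes>\<^bsub>R\<^esub> \<phi> x)"
  by (simp_all add: free_module_def)

lemma free_module_carrier_iff:
  "\<phi> \<in> carrier (free_module R X) \<longleftrightarrow> (\<forall>x\<in>X. \<phi> x \<in> carrier R) \<and> (\<forall>x. x \<notin> X \<longrightarrow> \<phi> x = \<zero>\<^bsub>R\<^esub>) \<and>
     finite {x. \<phi> x \<noteq> \<zero>\<^bsub>R\<^esub>}"
  by (simp add: free_module_def)

context cring begin

lemma free_mem: "\<phi> \<in> carrier (free_module R X) \<Longrightarrow> \<phi> x \<in> carrier R"
  by (cases "x \<in> X") (auto simp: free_module_carrier_iff)

lemma free_support: "\<phi> \<in> carrier (free_module R X) \<Longrightarrow> finite {x. \<phi> x \<noteq> \<zero>} \<and> {x. \<phi> x \<noteq> \<zero>} \<subseteq> X"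
  by (auto simp: free_module_carrier_iff)

lemma free_add_closed:
  assumes "\<phi> \<in> carrier (free_module R X)" "\<psi> \<in> carrier (free_module R X)"
  shows "(\<lambda>x. \<phi> x \<oplus> \<psi> x) \<in> carrier (free_module R X)"
proof -
  have "{x. \<phi> x \<oplus> \<psi> x \<noteq> \<zero>} \<subseteq> {x. \<phi> x \<noteq> \<zero>} \<union> {x. \<psi> x \<noteq> \<zero>}" by auto
  then have "finite {x. \<phi> x \<oplus> \<psi> x \<noteq> \<zero>}"
    by (rule finite_subset) (use free_support[OF assms(1)] free_support[OF assms(2)] in simp)
  then show ?thesis using assms by (simp add: free_module_carrier_iff)
qed

lemma free_smult_closed:
  assumes "a \<in> carrier R" "\<phi> \<in> carrier (free_module R X)"
  shows "(\<lambda>x. a \<otimes> \<phi> x) \<in> carrier (free_module R X)"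
proof -
  have "{x. a \<otimes> \<phi> x \<noteq> \<zero>} \<subseteq> {x. \<phi> x \<noteq> \<zero>}" using assms(1) by auto
  then have "finite {x. a \<otimes> \<phi> x \<noteq> \<zero>}"
    using free_support[OF assms(2)] by (meson finite_subset)
  then show ?thesis using assms by (simp add: free_module_carrier_iff)
qed

lemma free_module_module: "module R (free_module R X)"
proof (rule moduleI)
  show "abelian_group (free_module R X)"
  proof (rule abelian_groupI)
    show "\<zero>\<^bsub>free_module R X\<^esub> \<in> carrier (free_module R X)" by (simp add: free_module_carrier_iff)
    fix \<phi> assume \<phi>: "\<phi> \<in> carrier (free_module R X)"
    show "\<exists>\<psi>\<in>carrier (free_module R X). \<psi> \<oplus>\<^bsub>free_module R X\<^esub> \<phi> = \<zero>\<^bsub>free_module R X\<^esub>"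
    proof (rule bexI)
      show "(\<lambda>x. (\<ominus> \<one>) \<otimes> \<phi> x) \<in> carrier (free_module R X)" by (rule free_smult_closed[OF _ \<phi>]) simp
      have "(\<ominus> \<one>) \<otimes> \<phi> x \<oplus> \<phi> x = \<zero>" for x using free_mem[OF \<phi>, of x] by algebra
      then show "(\<lambda>x. (\<ominus> \<one>) \<otimes> \<phi> x) \<oplus>\<^bsub>free_module R X\<^esub> \<phi> = \<zero>\<^bsub>free_module R X\<^esub>" by simp
    qed
  qed (simp_all add: free_add_closed fun_eq_iff free_mem a_ac)
qed (simp_all add: is_cring free_smult_closed fun_eq_iff free_mem l_distr r_distr m_assoc)

lemma free_gen_mem: "x \<in> X \<Longrightarrow> free_gen R x \<in> carrier (free_module R X)"
  by (auto simp: free_module_carrier_iff free_gen_def)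

lemma free_gen_induct:
  assumes H: "submodule H R (free_module R X)" and gen: "\<And>x. x \<in> X \<Longrightarrow> free_gen R x \<in> H"
  shows "H = carrier (free_module R X)"
proof
  interpret F: module R "free_module R X" by (rule free_module_module)
  show "H \<subseteq> carrier (free_module R X)" by (rule F.submoduleE(1)[OF H])
  have "\<phi> \<in> H" if "finite A" "\<phi> \<in> carrier (free_module R X)" "{x. \<phi> x \<noteq> \<zero>} \<subseteq> A" "A \<subseteq> X" for A \<phi>
    using that
  proof (induction A arbitrary: \<phi> rule: finite_induct)
    case empty
    then have "\<phi> = \<zero>\<^bsub>free_module R X\<^esub>" by (auto simp: fun_eq_iff)
    then show ?case using F.submodule_zero[OF H] by simp
  next
    case (insert a A)
    note \<phi> = insert.prems(1)
    let ?\<psi> = "\<phi>(a := \<zero>)"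
    have aX: "a \<in> X" using insert.prems by simp
    have "{x. ?\<psi> x \<noteq> \<zero>} \<subseteq> {x. \<phi> x \<noteq> \<zero>}" by auto
    then have "finite {x. ?\<psi> x \<noteq> \<zero>}" using free_support[OF \<phi>] finite_subset by blast
    then have \<psi>: "?\<psi> \<in> carrier (free_module R X)" using \<phi> by (auto simp: free_module_carrier_iff)
    have "?\<psi> \<in> H"
      by (rule insert.IH[OF \<psi>]) (use insert.prems in auto)
    moreover have "\<phi> a \<odot>\<^bsub>free_module R X\<^esub> free_gen R a \<in> H"
      using F.submoduleE(4)[OF H] gen[OF aX] free_mem[OF \<phi>] by blast
    ultimately have "?\<psi> \<oplus>\<^bsub>free_module R X\<^esub> \<phi> a \<odot>\<^bsub>free_module R X\<^esub> free_gen R a \<in> H"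
      using F.submoduleE(5)[OF H] by blast
    moreover have "?\<psi> \<oplus>\<^bsub>free_module R X\<^esub> \<phi> a \<odot>\<^bsub>free_module R X\<^esub> free_gen R a = \<phi>"
      using free_mem[OF \<phi>] by (auto simp: fun_eq_iff free_gen_def)
    ultimately show ?case by simp
  qed
  then show "carrier (free_module R X) \<subseteq> H" using free_support by blast
qed

lemma free_lift_eq:
  assumes P: "module R P" and g: "\<And>x. x \<in> X \<Longrightarrow> g x \<in> carrier P"
    and \<phi>: "\<phi> \<in> carrier (free_module R X)" and A: "finite A" "{x. \<phi> x \<noteq> \<zero>} \<subseteq> A" "A \<subseteq> X"
  shows "free_lift R P g \<phi> = (\<Oplus>\<^bsub>P\<^esub>x\<in>A. \<phi> x \<odot>\<^bsub>P\<^esub> g x)"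
proof -
  interpret P: module R P by fact
  show ?thesis unfolding free_lift_def
    by (rule P.M.add.finprod_mono_neutral_cong_left[OF A(1,2)])
       (use A g free_mem[OF \<phi>] in \<open>auto simp: subset_iff\<close>)
qed

lemma free_lift_linear:
  assumes P: "module R P" and g: "\<And>x. x \<in> X \<Longrightarrow> g x \<in> carrier P"
  shows "linear_mod R (free_module R X) P (carrier (free_module R X)) {\<zero>\<^bsub>P\<^esub>} (free_lift R P g)"
    and "\<And>x. x \<in> X \<Longrightarrow> free_lift R P g (free_gen R x) = g x"
proof -
  interpret P: module R P by fact
  note eq = free_lift_eq[OF P, of X g, OF g]
  have Pi: "(\<lambda>x. \<phi> x \<odot>\<^bsub>P\<^esub> g x) \<in> A \<rightarrow> carrier P" if "\<phi> \<in> carrier (free_module R X)" "A \<subseteq> X" for \<phi> A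
    using free_mem[OF that(1)] g that(2) by auto
  show "linear_mod R (free_module R X) P (carrier (free_module R X)) {\<zero>\<^bsub>P\<^esub>} (free_lift R P g)"
    unfolding linear_mod_zero_iff[OF P]
  proof (intro conjI ballI)
    fix \<phi> \<psi> assume \<phi>: "\<phi> \<in> carrier (free_module R X)" and \<psi>: "\<psi> \<in> carrier (free_module R X)"
    let ?A = "{x. \<phi> x \<noteq> \<zero>} \<union> {x. \<psi> x \<noteq> \<zero>}"
    have A: "finite ?A" "?A \<subseteq> X" using free_support[OF \<phi>] free_support[OF \<psi>] by auto
    have 1: "free_lift R P g \<phi> = (\<Oplus>\<^bsub>P\<^esub>x\<in>?A. \<phi> x \<odot>\<^bsub>P\<^esub> g x)" by (rule eq[OF _ \<phi> A(1) _ A(2)]) auto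
    have 2: "free_lift R P g \<psi> = (\<Oplus>\<^bsub>P\<^esub>x\<in>?A. \<psi> x \<odot>\<^bsub>P\<^esub> g x)" by (rule eq[OF _ \<psi> A(1) _ A(2)]) auto
    show "free_lift R P g \<phi> \<in> carrier P" unfolding 1 by (rule P.M.finsum_closed[OF Pi[OF \<phi> A(2)]])
    have "free_lift R P g (\<lambda>x. \<phi> x \<oplus> \<psi> x) = (\<Oplus>\<^bsub>P\<^esub>x\<in>?A. (\<phi> x \<oplus> \<psi> x) \<odot>\<^bsub>P\<^esub> g x)"
      by (rule eq[OF _ free_add_closed[OF \<phi> \<psi>] A(1) _ A(2)]) auto
    also have "\<dots> = (\<Oplus>\<^bsub>P\<^esub>x\<in>?A. \<phi> x \<odot>\<^bsub>P\<^esub> g x \<oplus>\<^bsub>P\<^esub> \<psi> x \<odot>\<^bsub>P\<^esub> g x)"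
      by (rule P.M.finsum_cong') (use free_mem[OF \<phi>] free_mem[OF \<psi>] g A in \<open>auto simp: P.smult_l_distr subset_iff\<close>)
    also have "\<dots> = free_lift R P g \<phi> \<oplus>\<^bsub>P\<^esub> free_lift R P g \<psi>"
      unfolding 1 2 by (rule P.M.finsum_addf[OF Pi[OF \<phi> A(2)] Pi[OF \<psi> A(2)]])
    finally show "free_lift R P g (\<phi> \<oplus>\<^bsub>free_module R X\<^esub> \<psi>) = free_lift R P g \<phi> \<oplus>\<^bsub>P\<^esub> free_lift R P g \<psi>" by simp
  next
    fix a \<phi> assume a: "a \<in> carrier R" and \<phi>: "\<phi> \<in> carrier (free_module R X)"
    let ?A = "{x. \<phi> x \<noteq> \<zero>}"
    have A: "finite ?A" "?A \<subseteq> X" using free_support[OF \<phi>] by auto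
    have 1: "free_lift R P g \<phi> = (\<Oplus>\<^bsub>P\<^esub>x\<in>?A. \<phi> x \<odot>\<^bsub>P\<^esub> g x)" by (rule eq[OF _ \<phi> A(1) _ A(2)]) auto
    have "free_lift R P g (\<lambda>x. a \<otimes> \<phi> x) = (\<Oplus>\<^bsub>P\<^esub>x\<in>?A. (a \<otimes> \<phi> x) \<odot>\<^bsub>P\<^esub> g x)"
      by (rule eq[OF _ free_smult_closed[OF a \<phi>] A(1) _ A(2)]) (use a in auto)
    also have "\<dots> = (\<Oplus>\<^bsub>P\<^esub>x\<in>?A. a \<odot>\<^bsub>P\<^esub> (\<phi> x \<odot>\<^bsub>P\<^esub> g x))"
      by (rule P.M.finsum_cong') (use free_mem[OF \<phi>] g A a in \<open>auto simp: P.smult_assoc1 subset_iff\<close>)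
    also have "\<dots> = a \<odot>\<^bsub>P\<^esub> free_lift R P g \<phi>"
      unfolding 1 by (rule P.finsum_smult_ldistr[OF A(1) a Pi[OF \<phi> A(2)], symmetric])
    finally show "free_lift R P g (a \<odot>\<^bsub>free_module R X\<^esub> \<phi>) = a \<odot>\<^bsub>P\<^esub> free_lift R P g \<phi>" by simp
  qed
  fix x assume x: "x \<in> X"
  have "free_lift R P g (free_gen R x) = (\<Oplus>\<^bsub>P\<^esub>y\<in>{x}. free_gen R x y \<odot>\<^bsub>P\<^esub> g y)"
    by (rule eq[OF _ free_gen_mem[OF x]]) (use x in \<open>auto simp: free_gen_def\<close>)
  also have "\<dots> = g x" using g[OF x] by (simp add: free_gen_def)
  finally show "free_lift R P g (free_gen R x) = g x" .
qed

lemma free_cong: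
  fixes P :: "('a, 'p) module"
  assumes P: "module R P" and N: "submodule N R P"
    and f: "linear_mod R (free_module R X) P (carrier (free_module R X)) N f"
    and g: "linear_mod R (free_module R X) P (carrier (free_module R X)) N g"
    and gen: "\<And>x. x \<in> X \<Longrightarrow> cong_mod P N (f (free_gen R x)) (g (free_gen R x))"
    and \<phi>: "\<phi> \<in> carrier (free_module R X)"
  shows "cong_mod P N (f \<phi>) (g \<phi>)"
proof -
  have "{\<phi> \<in> carrier (free_module R X). cong_mod P N (f \<phi>) (g \<phi>)} = carrier (free_module R X)"
    by (rule free_gen_induct[OF linear_cong_submodule[OF free_module_module P
            module.carrier_is_submodule[OF free_module_module] N f g]])
       (use gen free_gen_mem in auto)
  then show ?thesis using \<phi> by blast
qed

end

section \<open>Tensor products\<close>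

definition tensor_rel :: "('a, 'r) ring_scheme \<Rightarrow> ('a, 'm) module \<Rightarrow> ('a, 'n) module \<Rightarrow> ('m \<times> 'n \<Rightarrow> 'a) set" where
  "tensor_rel R M N = span_module R (free_module R (carrier M \<times> carrier N)) (tensor_relations R M N)"

lemma tensor_module_eq: "tensor_module R M N = quot_module (free_module R (carrier M \<times> carrier N)) (tensor_rel R M N)"
  by (simp add: tensor_module_def tensor_rel_def Let_def)

context
  fixes R :: "('a, 'r) ring_scheme" and M :: "('a, 'm) module" and N :: "('a, 'n) module"
  assumes M: "module R M" and N: "module R N"
begin

interpretation M: module R M by (fact M)
interpretation N: module R N by (fact N)

abbreviation (input) F where "F \<equiv> free_module R (carrier M \<times> carrier N)"

interpretation F: module R "free_module R (carrier M \<times> carrier N)" by (rule M.R.free_module_module)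

lemma tensor_gen_mem: "m \<in> carrier M \<Longrightarrow> n \<in> carrier N \<Longrightarrow> free_gen R (m, n) \<in> carrier F"
  by (rule M.R.free_gen_mem) simp

lemma tensor_relations_carrier: "tensor_relations R M N \<subseteq> carrier F"
proof -
  note g = tensor_gen_mem
  note ops = F.M.minus_closed F.M.a_closed F.smult_closed
  show ?thesis
    unfolding tensor_relations_def Let_def
    by (intro Un_least subsetI; elim CollectE exE conjE; hypsubst; intro ops g M.M.a_closed N.M.a_closed M.smult_closed N.smult_closed; assumption)
qed

lemma tensor_rel_submodule: "submodule (tensor_rel R M N) R F"
  unfolding tensor_rel_def by (rule span_submodule[OF F.module_axioms tensor_relations_carrier])

lemma tensor_rel_least: "submodule H R F \<Longrightarrow> tensor_relations R M N \<subseteq> H \<Longrightarrow> tensor_rel R M N \<subseteq> H"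
  unfolding tensor_rel_def by (rule span_least)

lemma tensor_cong:
  assumes m: "m \<in> carrier M" "m' \<in> carrier M" and n: "n \<in> carrier N" "n' \<in> carrier N" and a: "a \<in> carrier R"
  shows "cong_mod F (tensor_rel R M N) (free_gen R (m \<oplus>\<^bsub>M\<^esub> m', n)) (free_gen R (m, n) \<oplus>\<^bsub>F\<^esub> free_gen R (m', n))"
    and "cong_mod F (tensor_rel R M N) (free_gen R (m, n \<oplus>\<^bsub>N\<^esub> n')) (free_gen R (m, n) \<oplus>\<^bsub>F\<^esub> free_gen R (m, n'))"
    and "cong_mod F (tensor_rel R M N) (free_gen R (a \<odot>\<^bsub>M\<^esub> m, n)) (a \<odot>\<^bsub>F\<^esub> free_gen R (m, n))"
    and "cong_mod F (tensor_rel R M N) (free_gen R (m, a \<odot>\<^bsub>N\<^esub> n)) (a \<odot>\<^bsub>F\<^esub> free_gen R (m, n))"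
proof -
  have *: "cong_mod F (tensor_rel R M N) u v" if "u \<ominus>\<^bsub>F\<^esub> v \<in> tensor_relations R M N" "u \<in> carrier F" "v \<in> carrier F" for u v
    using that span_superset[of "tensor_relations R M N" R F] unfolding cong_mod_def tensor_rel_def by blast
  note cl = tensor_gen_mem F.M.a_closed F.smult_closed M.M.a_closed N.M.a_closed M.smult_closed N.smult_closed m n a
  show "cong_mod F (tensor_rel R M N) (free_gen R (m \<oplus>\<^bsub>M\<^esub> m', n)) (free_gen R (m, n) \<oplus>\<^bsub>F\<^esub> free_gen R (m', n))"
    by (rule *; (intro cl)?) (unfold tensor_relations_def Let_def, use m n a in blast)
  show "cong_mod F (tensor_rel R M N) (free_gen R (m, n \<oplus>\<^bsub>N\<^esub> n')) (free_gen R (m, n) \<oplus>\<^bsub>F\<^esub> free_gen R (m, n'))"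
    by (rule *; (intro cl)?) (unfold tensor_relations_def Let_def, use m n a in blast)
  show "cong_mod F (tensor_rel R M N) (free_gen R (a \<odot>\<^bsub>M\<^esub> m, n)) (a \<odot>\<^bsub>F\<^esub> free_gen R (m, n))"
    by (rule *; (intro cl)?) (unfold tensor_relations_def Let_def, use m n a in blast)
  show "cong_mod F (tensor_rel R M N) (free_gen R (m, a \<odot>\<^bsub>N\<^esub> n)) (a \<odot>\<^bsub>F\<^esub> free_gen R (m, n))"
    by (rule *; (intro cl)?) (unfold tensor_relations_def Let_def, use m n a in blast)
qed

lemma tensor_gen_zero:
  assumes m: "m \<in> carrier M" shows "free_gen R (m, \<zero>\<^bsub>N\<^esub>) \<in> tensor_rel R M N"
proof -
  have "cong_mod F (tensor_rel R M N) (free_gen R (m, \<zero>\<^bsub>R\<^esub> \<odot>\<^bsub>N\<^esub> \<zero>\<^bsub>N\<^esub>)) (\<zero>\<^bsub>R\<^esub> \<odot>\<^bsub>F\<^esub> free_gen R (m, \<zero>\<^bsub>N\<^esub>))"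
    by (rule tensor_cong(4)) (use m in auto)
  note 1 = this
  have g: "free_gen R (m, \<zero>\<^bsub>N\<^esub>) \<in> carrier F" using tensor_gen_mem m by simp
  have "cong_mod F (tensor_rel R M N) (free_gen R (m, \<zero>\<^bsub>N\<^esub>)) \<zero>\<^bsub>F\<^esub>"
    using 1 unfolding F.smult_l_null[OF g] N.smult_r_null[OF M.R.zero_closed] .
  then show ?thesis using F.cong_zero_iff[OF tensor_rel_submodule g] by blast
qed

text \<open>Hence a bilinear map induces a map on the tensor product.\<close>
lemma bilinear_lift_kills:
  fixes P :: "('a, 'p) module"
  assumes P: "module R P"
    and c: "\<And>m n. m \<in> carrier M \<Longrightarrow> n \<in> carrier N \<Longrightarrow> \<beta> (m, n) \<in> carrier P"
    and al: "\<And>m m' n. m \<in> carrier M \<Longrightarrow> m' \<in> carrier M \<Longrightarrow> n \<in> carrier N \<Longrightarrow> \<beta> (m \<oplus>\<^bsub>M\<^esub> m', n) = \<beta> (m, n) \<oplus>\<^bsub>P\<^esub> \<beta> (m', n)"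
    and ar: "\<And>m n n'. m \<in> carrier M \<Longrightarrow> n \<in> carrier N \<Longrightarrow> n' \<in> carrier N \<Longrightarrow> \<beta> (m, n \<oplus>\<^bsub>N\<^esub> n') = \<beta> (m, n) \<oplus>\<^bsub>P\<^esub> \<beta> (m, n')"
    and sl: "\<And>a m n. a \<in> carrier R \<Longrightarrow> m \<in> carrier M \<Longrightarrow> n \<in> carrier N \<Longrightarrow> \<beta> (a \<odot>\<^bsub>M\<^esub> m, n) = a \<odot>\<^bsub>P\<^esub> \<beta> (m, n)"
    and sr: "\<And>a m n. a \<in> carrier R \<Longrightarrow> m \<in> carrier M \<Longrightarrow> n \<in> carrier N \<Longrightarrow> \<beta> (m, a \<odot>\<^bsub>N\<^esub> n) = a \<odot>\<^bsub>P\<^esub> \<beta> (m, n)"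
    and \<phi>: "\<phi> \<in> tensor_rel R M N"
  shows "free_lift R P \<beta> \<phi> = \<zero>\<^bsub>P\<^esub>"
proof -
  interpret P: module R P by fact
  let ?f = "free_lift R P \<beta>"
  have lin: "linear_mod R F P (carrier F) {\<zero>\<^bsub>P\<^esub>} ?f"
    by (rule M.R.free_lift_linear(1)[OF P]) (use c in auto)
  have gen: "?f (free_gen R (m, n)) = \<beta> (m, n)" if "m \<in> carrier M" "n \<in> carrier N" for m n
    by (rule M.R.free_lift_linear(2)[OF P, of "carrier M \<times> carrier N"]) (use c that in auto)
  have lin2: "\<And>x. x \<in> carrier F \<Longrightarrow> ?f x \<in> carrier P"
    "\<And>x y. x \<in> carrier F \<Longrightarrow> y \<in> carrier F \<Longrightarrow> ?f (x \<oplus>\<^bsub>F\<^esub> y) = ?f x \<oplus>\<^bsub>P\<^esub> ?f y"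
    "\<And>r x. r \<in> carrier R \<Longrightarrow> x \<in> carrier F \<Longrightarrow> ?f (r \<odot>\<^bsub>F\<^esub> x) = r \<odot>\<^bsub>P\<^esub> ?f x"
    using lin unfolding linear_mod_zero_iff[OF P] by blast+
  have ker: "submodule {x \<in> carrier F. ?f x \<in> {\<zero>\<^bsub>P\<^esub>}} R F"
    by (rule submodule_preimage[OF F.module_axioms P F.carrier_is_submodule P.zero_submodule lin P.zero_submodule order_refl])
  have diff: "u \<ominus>\<^bsub>F\<^esub> v \<in> {x \<in> carrier F. ?f x \<in> {\<zero>\<^bsub>P\<^esub>}}" if uv: "u \<in> carrier F" "v \<in> carrier F" "?f u = ?f v" for u v
  proof -
    have "(u \<ominus>\<^bsub>F\<^esub> v) \<oplus>\<^bsub>F\<^esub> v = u" by (rule F.minus_plus_cancel[OF uv(1,2)])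
    then have "?f (u \<ominus>\<^bsub>F\<^esub> v) \<oplus>\<^bsub>P\<^esub> ?f v = ?f v" using lin2(2)[OF F.M.minus_closed[OF uv(1,2)] uv(2)] uv(3) by simp
    then have "?f (u \<ominus>\<^bsub>F\<^esub> v) = \<zero>\<^bsub>P\<^esub>"
      using P.M.add.r_cancel_one[OF lin2(1)[OF uv(2)] lin2(1)[OF F.M.minus_closed[OF uv(1,2)]]] by simp
    then show ?thesis using uv F.M.minus_closed by simp
  qed
  note cl = tensor_gen_mem F.M.a_closed F.smult_closed M.M.a_closed N.M.a_closed M.smult_closed N.smult_closed
  have "tensor_relations R M N \<subseteq> {x \<in> carrier F. ?f x \<in> {\<zero>\<^bsub>P\<^esub>}}"
    unfolding tensor_relations_def Let_def
  proof (intro Un_least subsetI; elim CollectE exE conjE; hypsubst; rule diff)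
    fix m m' n assume *: "m \<in> carrier M" "m' \<in> carrier M" "n \<in> carrier N"
    show "free_gen R (m \<oplus>\<^bsub>M\<^esub> m', n) \<in> carrier F" "free_gen R (m, n) \<oplus>\<^bsub>F\<^esub> free_gen R (m', n) \<in> carrier F"
      by (intro cl *)+
    show "?f (free_gen R (m \<oplus>\<^bsub>M\<^esub> m', n)) = ?f (free_gen R (m, n) \<oplus>\<^bsub>F\<^esub> free_gen R (m', n))"
      using lin2(2)[OF cl(1)[OF *(1,3)] cl(1)[OF *(2,3)]] gen al * M.M.a_closed by simp
  next
    fix m n n' assume *: "m \<in> carrier M" "n \<in> carrier N" "n' \<in> carrier N"
    show "free_gen R (m, n \<oplus>\<^bsub>N\<^esub> n') \<in> carrier F" "free_gen R (m, n) \<oplus>\<^bsub>F\<^esub> free_gen R (m, n') \<in> carrier F"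
      by (intro cl *)+
    show "?f (free_gen R (m, n \<oplus>\<^bsub>N\<^esub> n')) = ?f (free_gen R (m, n) \<oplus>\<^bsub>F\<^esub> free_gen R (m, n'))"
      using lin2(2)[OF cl(1)[OF *(1,2)] cl(1)[OF *(1,3)]] gen ar * N.M.a_closed by simp
  next
    fix a m n assume *: "a \<in> carrier R" "m \<in> carrier M" "n \<in> carrier N"
    show "free_gen R (a \<odot>\<^bsub>M\<^esub> m, n) \<in> carrier F" "a \<odot>\<^bsub>F\<^esub> free_gen R (m, n) \<in> carrier F"
      by (intro cl *)+
    show "?f (free_gen R (a \<odot>\<^bsub>M\<^esub> m, n)) = ?f (a \<odot>\<^bsub>F\<^esub> free_gen R (m, n))"
      using lin2(3)[OF *(1) cl(1)[OF *(2,3)]] gen sl * M.smult_closed by simp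
  next
    fix a m n assume *: "a \<in> carrier R" "m \<in> carrier M" "n \<in> carrier N"
    show "free_gen R (m, a \<odot>\<^bsub>N\<^esub> n) \<in> carrier F" "a \<odot>\<^bsub>F\<^esub> free_gen R (m, n) \<in> carrier F"
      by (intro cl *)+
    show "?f (free_gen R (m, a \<odot>\<^bsub>N\<^esub> n)) = ?f (a \<odot>\<^bsub>F\<^esub> free_gen R (m, n))"
      using lin2(3)[OF *(1) cl(1)[OF *(2,3)]] gen sr * N.smult_closed by simp
  qed
  then show ?thesis using tensor_rel_least[OF ker] \<phi> by auto
qed

end

lemma (in module) plus_minus_cancel: "x \<in> carrier M \<Longrightarrow> y \<in> carrier M \<Longrightarrow> (x \<oplus>\<^bsub>M\<^esub> y) \<ominus>\<^bsub>M\<^esub> x = y"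
  by algebra

lemma linear_mod_weaken: "linear_mod R A B L N f \<Longrightarrow> N \<subseteq> N' \<Longrightarrow> linear_mod R A B L N' f"
  unfolding linear_mod_def cong_mod_def by blast

context cring begin

lemma free_lift_add:
  assumes P: "module R P" and g: "\<And>x. x \<in> X \<Longrightarrow> g x \<in> carrier P" "\<And>x. x \<in> X \<Longrightarrow> h x \<in> carrier P"
    and k: "\<And>x. x \<in> X \<Longrightarrow> k x = g x \<oplus>\<^bsub>P\<^esub> h x" and \<phi>: "\<phi> \<in> carrier (free_module R X)"
  shows "free_lift R P k \<phi> = free_lift R P g \<phi> \<oplus>\<^bsub>P\<^esub> free_lift R P h \<phi>"
proof -
  interpret P: module R P by fact
  let ?A = "{x. \<phi> x \<noteq> \<zero>}"
  have A: "finite ?A" "?A \<subseteq> X" using free_support[OF \<phi>] by auto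
  have "free_lift R P k \<phi> = (\<Oplus>\<^bsub>P\<^esub>x\<in>?A. \<phi> x \<odot>\<^bsub>P\<^esub> g x \<oplus>\<^bsub>P\<^esub> \<phi> x \<odot>\<^bsub>P\<^esub> h x)"
    unfolding free_lift_def
    by (rule P.M.finsum_cong') (use free_mem[OF \<phi>] g k A in \<open>auto simp: P.smult_r_distr subset_iff\<close>)
  also have "\<dots> = free_lift R P g \<phi> \<oplus>\<^bsub>P\<^esub> free_lift R P h \<phi>"
    unfolding free_lift_def
    by (rule P.M.finsum_addf) (use free_mem[OF \<phi>] g A in auto)
  finally show ?thesis .
qed

lemma free_lift_smult:
  assumes P: "module R P" and g: "\<And>x. x \<in> X \<Longrightarrow> g x \<in> carrier P" and a: "a \<in> carrier R"
    and k: "\<And>x. x \<in> X \<Longrightarrow> k x = a \<odot>\<^bsub>P\<^esub> g x" and \<phi>: "\<phi> \<in> carrier (free_module R X)"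
  shows "free_lift R P k \<phi> = a \<odot>\<^bsub>P\<^esub> free_lift R P g \<phi>"
proof -
  interpret P: module R P by fact
  let ?A = "{x. \<phi> x \<noteq> \<zero>}"
  have A: "finite ?A" "?A \<subseteq> X" using free_support[OF \<phi>] by auto
  have "free_lift R P k \<phi> = (\<Oplus>\<^bsub>P\<^esub>x\<in>?A. a \<odot>\<^bsub>P\<^esub> (\<phi> x \<odot>\<^bsub>P\<^esub> g x))"
    unfolding free_lift_def
    by (rule P.M.finsum_cong')
       (use free_mem[OF \<phi>] g k A a in \<open>auto simp: subset_iff intro: P.smult_lcomm\<close>)
  also have "\<dots> = a \<odot>\<^bsub>P\<^esub> free_lift R P g \<phi>"
    unfolding free_lift_def
    by (rule P.finsum_smult_ldistr[OF A(1) a, symmetric]) (use free_mem[OF \<phi>] g A in auto)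
  finally show ?thesis .
qed

end

section \<open>First extension modules\<close>

text \<open>The kernel of the canonical cover of M, that is, of the map to M from the free module on its
  elements. Ext^1(M, N) is the cokernel of the restriction to this kernel of maps into N.\<close>
definition ext_relations :: "('a, 'r) ring_scheme \<Rightarrow> ('a, 'm) module \<Rightarrow> ('m \<Rightarrow> 'a) set" where
  "ext_relations R M = {\<phi> \<in> carrier (free_module R (carrier M)). free_lift R M (\<lambda>x. x) \<phi> = \<zero>\<^bsub>M\<^esub>}"

definition ext_maps ::
    "('a, 'r) ring_scheme \<Rightarrow> ('a, 'm) module \<Rightarrow> ('a, 'n) module \<Rightarrow> ('a, ('m \<Rightarrow> 'a) \<Rightarrow> 'n) module" where
  "ext_maps R M N = hom_module R (free_module R (carrier M)\<lparr>carrier := ext_relations R M\<rparr>) N"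

definition ext_trivial_maps ::
    "('a, 'r) ring_scheme \<Rightarrow> ('a, 'm) module \<Rightarrow> ('a, 'n) module \<Rightarrow> (('m \<Rightarrow> 'a) \<Rightarrow> 'n) set" where
  "ext_trivial_maps R M N = (\<lambda>f. restrict f (ext_relations R M)) ` lin_maps R (free_module R (carrier M)) N"

lemma ext1_eq: "ext1 R M N = quot_module (ext_maps R M N) (ext_trivial_maps R M N)"
  by (simp add: ext1_def ext_maps_def ext_trivial_maps_def ext_relations_def Let_def)

lemma ext_maps_simps [simp]:
  "\<zero>\<^bsub>ext_maps R M N\<^esub> = (\<lambda>\<phi>\<in>ext_relations R M. \<zero>\<^bsub>N\<^esub>)"
  "f \<oplus>\<^bsub>ext_maps R M N\<^esub> g = (\<lambda>\<phi>\<in>ext_relations R M. f \<phi> \<oplus>\<^bsub>N\<^esub> g \<phi>)"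
  "a \<odot>\<^bsub>ext_maps R M N\<^esub> f = (\<lambda>\<phi>\<in>ext_relations R M. a \<odot>\<^bsub>N\<^esub> f \<phi>)"
  by (simp_all add: ext_maps_def hom_module_def)

lemma ext_maps_carrier_iff:
  "f \<in> carrier (ext_maps R M N) \<longleftrightarrow> f \<in> ext_relations R M \<rightarrow>\<^sub>E carrier N \<and>
     (\<forall>x\<in>ext_relations R M. \<forall>y\<in>ext_relations R M. f (x \<oplus>\<^bsub>free_module R (carrier M)\<^esub> y) = f x \<oplus>\<^bsub>N\<^esub> f y) \<and>
     (\<forall>a\<in>carrier R. \<forall>x\<in>ext_relations R M. f (a \<odot>\<^bsub>free_module R (carrier M)\<^esub> x) = a \<odot>\<^bsub>N\<^esub> f x)"
  by (simp add: ext_maps_def hom_module_def lin_maps_def free_module_def)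

context
  fixes R :: "('a, 'r) ring_scheme" and M :: "('a, 'm) module"
  assumes M: "module R M"
begin

interpretation M: module R M by (fact M)
interpretation F: module R "free_module R (carrier M)" by (rule M.R.free_module_module)

lemma canonical_cover:
  shows "linear_mod R (free_module R (carrier M)) M (carrier (free_module R (carrier M))) {\<zero>\<^bsub>M\<^esub>} (free_lift R M (\<lambda>x. x))"
    and "m \<in> carrier M \<Longrightarrow> free_lift R M (\<lambda>x. x) (free_gen R m) = m"
  by (rule M.R.free_lift_linear[OF M]; simp)+

lemma ext_relations_submodule: "submodule (ext_relations R M) R (free_module R (carrier M))"
  unfolding ext_relations_def
  using submodule_preimage[OF F.module_axioms M F.carrier_is_submodule M.zero_submodule canonical_cover(1) M.zero_submodule order_refl]
  by simp

lemma ext_relations_closed: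
  "x \<in> ext_relations R M \<Longrightarrow> y \<in> ext_relations R M \<Longrightarrow> x \<oplus>\<^bsub>free_module R (carrier M)\<^esub> y \<in> ext_relations R M"
  "a \<in> carrier R \<Longrightarrow> x \<in> ext_relations R M \<Longrightarrow> a \<odot>\<^bsub>free_module R (carrier M)\<^esub> x \<in> ext_relations R M"
  using F.submoduleE(4,5)[OF ext_relations_submodule] by auto

lemma ext_relations_carrier: "x \<in> ext_relations R M \<Longrightarrow> x \<in> carrier (free_module R (carrier M))"
  by (simp add: ext_relations_def)

lemma ext_maps_module:
  assumes N: "module R N" shows "module R (ext_maps R M N)"
  unfolding ext_maps_def
  by (rule hom_module_module[OF submodule.submodule_is_module[OF ext_relations_submodule F.module_axioms] N])

lemma ext_trivial_maps_submodule:
  assumes N: "module R N" shows "submodule (ext_trivial_maps R M N) R (ext_maps R M N)"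
proof -
  interpret N: module R N by (fact N)
  let ?H = "hom_module R (free_module R (carrier M)) N" and ?r = "\<lambda>f. restrict f (ext_relations R M)"
  interpret H: module R ?H by (rule hom_module_module[OF F.module_axioms N])
  interpret E: module R "ext_maps R M N" by (rule ext_maps_module[OF N])
  note cl = ext_relations_closed and cc = ext_relations_carrier
  have c: "?r f \<in> carrier (ext_maps R M N)" if "f \<in> lin_maps R (free_module R (carrier M)) N" for f
    using that cc cl unfolding ext_maps_carrier_iff lin_maps_iff by (auto simp del: free_module_simps)
  have lin: "linear_mod R ?H (ext_maps R M N) (carrier ?H) {\<zero>\<^bsub>ext_maps R M N\<^esub>} ?r"
    unfolding linear_mod_zero_iff[OF E.module_axioms]
    using c cc by (auto simp: hom_module_def fun_eq_iff)
  have "submodule {b \<in> carrier (ext_maps R M N). \<exists>a\<in>carrier ?H. cong_mod (ext_maps R M N) {\<zero>\<^bsub>ext_maps R M N\<^esub>} b (?r a)} R (ext_maps R M N)"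
    by (rule submodule_image[OF H.module_axioms E.module_axioms H.carrier_is_submodule E.zero_submodule lin H.carrier_is_submodule order_refl])
  moreover have "{b \<in> carrier (ext_maps R M N). \<exists>a\<in>carrier ?H. cong_mod (ext_maps R M N) {\<zero>\<^bsub>ext_maps R M N\<^esub>} b (?r a)} = ext_trivial_maps R M N"
    unfolding ext_trivial_maps_def E.cong_eq using c by (auto simp: hom_module_def)
  ultimately show ?thesis by simp
qed

end

section \<open>An ideal containing a regular element\<close>

locale gorenstein_ideal = gorenstein_dim1 R \<mm> for R (structure) and \<mm> +
  fixes I x
  assumes I: "ideal I R" and xI: "x \<in> I" and regular_x: "regular_element R x"
begin

interpretation rm: module R "ring_module R" by (rule ring_module_module)

text \<open>An element a of I' stands for the map that sends i in I to ai/x. In this way I' is the dual of I,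
  and the ideal X is the copy of R in it.\<close>
abbreviation X where "X \<equiv> PIdl x"
abbreviation I' where "I' \<equiv> colon R X I"

lemmas Xp = principal[OF regular_x]
lemmas Ic = subsetD[OF idealE(1)[OF I]]
lemma xc: "x \<in> carrier R" by (rule regular_carrier[OF regular_x])
lemma I'_ideal: "ideal I' R" by (rule colon_ideal[OF Xp(1) idealE(1)[OF I]])
lemmas I'c = subsetD[OF idealE(1)[OF I'_ideal]]
lemma xI': "x \<in> I'" using principal_le_colon[OF regular_x idealE(1)[OF I]] Xp(2) by blast
lemma double_I: "colon R X I' = I" by (rule double_colon[OF I regular_x xI])
lemma I_I': "i \<in> I \<Longrightarrow> a \<in> I' \<Longrightarrow> i \<otimes> a \<in> X"
  using m_comm[OF Ic I'c] by (simp add: colon_def)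
lemma mem_I: "b \<in> carrier R \<Longrightarrow> (\<And>a. a \<in> I' \<Longrightarrow> b \<otimes> a \<in> X) \<Longrightarrow> b \<in> I"
  using double_I by (auto simp: colon_def)
lemma sX: "submodule X R (ring_module R)" and sI: "submodule I R (ring_module R)" and sI': "submodule I' R (ring_module R)"
  using Xp(1) I I'_ideal by (simp_all add: ideal_iff_submodule)

text \<open>The quotient a/x, for a in X.\<close>
definition xdiv where "xdiv a = (SOME b. b \<in> carrier R \<and> a = x \<otimes> b)"

lemma xdiv: assumes "a \<in> X" shows "xdiv a \<in> carrier R" "x \<otimes> xdiv a = a"
proof -
  obtain r where "r \<in> carrier R" "a = r \<otimes> x" using assms by (auto simp: mem_cgen_iff)
  then have "\<exists>b. b \<in> carrier R \<and> a = x \<otimes> b" using m_comm xc by blast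
  then have "xdiv a \<in> carrier R \<and> a = x \<otimes> xdiv a" unfolding xdiv_def by (rule someI_ex)
  then show "xdiv a \<in> carrier R" "x \<otimes> xdiv a = a" by auto
qed

lemma xdiv_unique: assumes "b \<in> carrier R" "x \<otimes> b = a" shows "xdiv a = b"
proof -
  have "a \<in> X" using assms cgen_mem(2)[OF xc] by blast
  from xdiv[OF this] show ?thesis using regular_cancel[OF regular_x, of "xdiv a" b] assms by simp
qed

lemma xdiv_add: assumes "a \<in> X" "b \<in> X" shows "xdiv (a \<oplus> b) = xdiv a \<oplus> xdiv b"
proof (rule xdiv_unique)
  show "xdiv a \<oplus> xdiv b \<in> carrier R" using xdiv assms by simp
  show "x \<otimes> (xdiv a \<oplus> xdiv b) = a \<oplus> b" using xdiv[OF assms(1)] xdiv[OF assms(2)] xc by (simp add: r_distr)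
qed

lemma xdiv_mult: assumes "a \<in> X" "r \<in> carrier R" shows "xdiv (r \<otimes> a) = r \<otimes> xdiv a"
proof (rule xdiv_unique)
  show "r \<otimes> xdiv a \<in> carrier R" using xdiv assms by simp
  show "x \<otimes> (r \<otimes> xdiv a) = r \<otimes> a" using xdiv[OF assms(1)] xc assms(2) m_lcomm[of x r "xdiv a"] by simp
qed

lemma canonical_module_module: "module R (canonical_module R I)"
proof -
  have M: "module R (residue_module R I)"
    unfolding residue_module_def by (rule quot_module_module[OF ring_module_module sI])
  show ?thesis
    unfolding canonical_module_def ext1_eq
    by (rule quot_module_module[OF ext_maps_module[OF M ring_module_module] ext_trivial_maps_submodule[OF M ring_module_module]])
qed

text \<open>The class of a in I' is the extension given by the map i to ai/x on I. To compare with the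
  presentation of R/I by the free module on all its elements, lift the canonical cover of R/I to
  a map s from the free module to R: the relations are the elements with s in I, and the map on
  relations that belongs to a sends phi to a s(phi)/x. It extends to the free module exactly if
  a is a multiple of x.\<close>
lemma canonical_module_presentation:
  fixes \<omega> defines "\<omega> \<equiv> canonical_module R I"
  obtains q where "q ` I' = carrier \<omega>"
    "\<And>a b. a \<in> I' \<Longrightarrow> b \<in> I' \<Longrightarrow> q (a \<oplus> b) = q a \<oplus>\<^bsub>\<omega>\<^esub> q b"
    "\<And>r a. r \<in> carrier R \<Longrightarrow> a \<in> I' \<Longrightarrow> q (r \<otimes> a) = r \<odot>\<^bsub>\<omega>\<^esub> q a"
    "\<And>a. a \<in> I' \<Longrightarrow> q a = \<zero>\<^bsub>\<omega>\<^esub> \<longleftrightarrow> a \<in> X"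
proof -
  let ?M = "residue_module R I"
  have M: "module R ?M" unfolding residue_module_def by (rule quot_module_module[OF ring_module_module sI])
  interpret M: module R ?M by (rule M)
  let ?F = "free_module R (carrier ?M)" and ?K = "ext_relations R ?M"
  let ?H = "ext_maps R ?M (ring_module R)" and ?B = "ext_trivial_maps R ?M (ring_module R)"
  have \<omega>: "\<omega> = quot_module ?H ?B" unfolding \<omega>_def canonical_module_def ext1_eq ..
  have H: "module R ?H" by (rule ext_maps_module[OF M ring_module_module])
  have B: "submodule ?B R ?H" by (rule ext_trivial_maps_submodule[OF M ring_module_module])
  interpret H: module R ?H by (rule H)
  interpret F: module R ?F by (rule free_module_module)
  let ?c = "\<lambda>a. I +>\<^bsub>ring_module R\<^esub> a"
  have Mcar: "carrier ?M = ?c ` carrier R"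
    unfolding residue_module_def by (simp add: quot_module_carrier[OF ring_module_module sI])
  have ceq: "?c a = ?c b \<longleftrightarrow> a \<ominus> b \<in> I" if "a \<in> carrier R" "b \<in> carrier R" for a b
    using coset_eq_iff[OF ring_module_module sI, of a b] that by (simp add: cong_mod_def)
  have clin: "linear_mod R (ring_module R) ?M (carrier R) {\<zero>\<^bsub>?M\<^esub>} ?c"
    using quot_module_projection[OF ring_module_module sI] unfolding residue_module_def by simp
  have cz: "?c a = \<zero>\<^bsub>?M\<^esub> \<longleftrightarrow> a \<in> I" if "a \<in> carrier R" for a
    using coset_self_iff[OF ring_module_module sI, of a] that unfolding residue_module_def by (simp add: quot_module_def)
  define rep where "rep C = (SOME a. a \<in> carrier R \<and> C = ?c a)" for C
  have rep: "rep C \<in> carrier R" "?c (rep C) = C" if "C \<in> carrier ?M" for C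
  proof -
    have "\<exists>a. a \<in> carrier R \<and> C = ?c a" using that Mcar by blast
    then have "rep C \<in> carrier R \<and> C = ?c (rep C)" unfolding rep_def by (rule someI_ex)
    then show "rep C \<in> carrier R" "?c (rep C) = C" by auto
  qed
  define s where "s = free_lift R (ring_module R) rep"
  have slin: "linear_mod R ?F (ring_module R) (carrier ?F) {\<zero>\<^bsub>ring_module R\<^esub>} s"
    unfolding s_def by (rule free_lift_linear(1)[OF ring_module_module]) (simp add: rep)
  have sgen: "s (free_gen R C) = rep C" if "C \<in> carrier ?M" for C
    unfolding s_def by (rule free_lift_linear(2)[OF ring_module_module _ that]) (simp add: rep)
  have s: "\<And>\<phi>. \<phi> \<in> carrier ?F \<Longrightarrow> s \<phi> \<in> carrier R"
    "\<And>\<phi> \<psi>. \<phi> \<in> carrier ?F \<Longrightarrow> \<psi> \<in> carrier ?F \<Longrightarrow> s (\<phi> \<oplus>\<^bsub>?F\<^esub> \<psi>) = s \<phi> \<oplus> s \<psi>"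
    "\<And>r \<phi>. r \<in> carrier R \<Longrightarrow> \<phi> \<in> carrier ?F \<Longrightarrow> s (r \<odot>\<^bsub>?F\<^esub> \<phi>) = r \<otimes> s \<phi>"
    using slin[unfolded linear_mod_zero_iff[OF ring_module_module]] by (auto simp del: free_module_simps)
  note ccl = clin[unfolded linear_mod_zero_iff[OF M], unfolded ring_module_simps]
  have cslin: "linear_mod R ?F ?M (carrier ?F) {\<zero>\<^bsub>?M\<^esub>} (\<lambda>\<phi>. ?c (s \<phi>))"
    unfolding linear_mod_zero_iff[OF M] using s ccl by (simp del: free_module_simps)
  have cs: "?c (s \<phi>) = free_lift R ?M (\<lambda>x. x) \<phi>" if "\<phi> \<in> carrier ?F" for \<phi>
    using free_cong[OF M M.zero_submodule cslin canonical_cover(1)[OF M] _ that]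
      canonical_cover(2)[OF M] sgen rep free_lift_linear(2)[OF M]
    unfolding M.cong_eq by (simp del: free_module_simps)
  have K_iff: "\<phi> \<in> ?K \<longleftrightarrow> \<phi> \<in> carrier ?F \<and> s \<phi> \<in> I" for \<phi>
    unfolding ext_relations_def by (simp add: cs[symmetric] cz s(1) cong: conj_cong)
  note Kcl = ext_relations_closed[OF M] and Kc = ext_relations_carrier[OF M]
  define h where "h a = (\<lambda>\<phi>\<in>?K. xdiv (a \<otimes> s \<phi>))" for a
  have aX: "a \<otimes> s \<phi> \<in> X" if "a \<in> I'" "\<phi> \<in> ?K" for a \<phi>
    using that K_iff by (simp add: colon_def)
  have hcar: "h a \<in> carrier ?H" if a: "a \<in> I'" for a
    unfolding ext_maps_carrier_iff
  proof (intro conjI ballI)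
    show "h a \<in> ?K \<rightarrow>\<^sub>E carrier (ring_module R)" using aX[OF a] xdiv(1) by (auto simp: h_def)
    fix \<phi> \<psi> assume p: "\<phi> \<in> ?K" "\<psi> \<in> ?K"
    have "a \<otimes> s (\<phi> \<oplus>\<^bsub>?F\<^esub> \<psi>) = a \<otimes> s \<phi> \<oplus> a \<otimes> s \<psi>"
      using s(2)[OF Kc Kc] s(1)[OF Kc] p I'c[OF a] by (simp add: r_distr del: free_module_simps)
    then show "h a (\<phi> \<oplus>\<^bsub>?F\<^esub> \<psi>) = h a \<phi> \<oplus>\<^bsub>ring_module R\<^esub> h a \<psi>"
      using Kcl(1)[OF p] p xdiv_add aX[OF a] by (simp add: h_def del: free_module_simps)
  next
    fix r \<phi> assume p: "r \<in> carrier R" "\<phi> \<in> ?K"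
    have "a \<otimes> s (r \<odot>\<^bsub>?F\<^esub> \<phi>) = r \<otimes> (a \<otimes> s \<phi>)"
      using s(3)[OF p(1) Kc] s(1)[OF Kc] p I'c[OF a] by (simp add: m_lcomm del: free_module_simps)
    then show "h a (r \<odot>\<^bsub>?F\<^esub> \<phi>) = r \<odot>\<^bsub>ring_module R\<^esub> h a \<phi>"
      using Kcl(2)[OF p] p xdiv_mult aX[OF a] by (simp add: h_def del: free_module_simps)
  qed
  have hadd: "h (a \<oplus> b) = h a \<oplus>\<^bsub>?H\<^esub> h b" if "a \<in> I'" "b \<in> I'" for a b
  proof -
    have "xdiv ((a \<oplus> b) \<otimes> s \<phi>) = xdiv (a \<otimes> s \<phi>) \<oplus> xdiv (b \<otimes> s \<phi>)" if p: "\<phi> \<in> ?K" for \<phi>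
      using xdiv_add[OF aX[OF \<open>a \<in> I'\<close> p] aX[OF \<open>b \<in> I'\<close> p]] I'c[OF \<open>a \<in> I'\<close>] I'c[OF \<open>b \<in> I'\<close>] s(1)[OF Kc[OF p]]
      by (simp add: l_distr)
    then show ?thesis by (auto simp: h_def intro!: restrict_ext)
  qed
  have hsm: "h (r \<otimes> a) = r \<odot>\<^bsub>?H\<^esub> h a" if "a \<in> I'" "r \<in> carrier R" for a r
  proof -
    have "xdiv ((r \<otimes> a) \<otimes> s \<phi>) = r \<otimes> xdiv (a \<otimes> s \<phi>)" if p: "\<phi> \<in> ?K" for \<phi>
      using xdiv_mult[OF aX[OF \<open>a \<in> I'\<close> p] \<open>r \<in> carrier R\<close>] I'c[OF \<open>a \<in> I'\<close>] \<open>r \<in> carrier R\<close> s(1)[OF Kc[OF p]]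
      by (simp add: m_assoc)
    then show ?thesis by (auto simp: h_def intro!: restrict_ext)
  qed
  \<comment> \<open>the generator over the class of one; its image u under s need only be congruent to one modulo I\<close>
  define e where "e = free_gen R (?c \<one>)"
  have oneM: "?c \<one> \<in> carrier ?M" unfolding Mcar by simp
  have eF: "e \<in> carrier ?F" unfolding e_def by (rule free_gen_mem[OF oneM])
  define u where "u = s e"
  have u: "u \<in> carrier R" "\<one> \<ominus> u \<in> I"
    using sgen[OF oneM] rep[OF oneM] ceq[of \<one> "rep (?c \<one>)"] by (auto simp: u_def e_def)
  have xe: "r \<odot>\<^bsub>?F\<^esub> e \<in> ?K" if r: "r \<in> I" for r
  proof -
    have "s (r \<odot>\<^bsub>?F\<^esub> e) = r \<otimes> u" using s(3)[OF Ic[OF r] eF] by (simp only: u_def)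
    also have "\<dots> = u \<otimes> r" using m_comm[OF Ic[OF r] u(1)] .
    finally have "s (r \<odot>\<^bsub>?F\<^esub> e) \<in> I" using idealE(5)[OF I u(1) r] by (simp only:)
    then show ?thesis unfolding K_iff using F.smult_closed[OF Ic[OF r] eF] by blast
  qed
  have uX: "a \<in> X" if a: "a \<in> I'" "a \<otimes> u \<in> X" for a
  proof -
    have "a \<otimes> (\<one> \<ominus> u) \<in> X" using a(1) u(2) by (simp add: colon_def)
    moreover have "a = a \<otimes> (\<one> \<ominus> u) \<oplus> a \<otimes> u" using I'c[OF a(1)] u(1) by algebra
    ultimately show ?thesis using idealE(3)[OF Xp(1)] a(2) by metis
  qed
  have hB: "h a \<in> ?B \<longleftrightarrow> a \<in> X" if a: "a \<in> I'" for a
  proof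
    assume "h a \<in> ?B"
    then obtain g where g: "g \<in> lin_maps R ?F (ring_module R)" "h a = restrict g ?K"
      unfolding ext_trivial_maps_def by blast
    have "xdiv (a \<otimes> s (x \<odot>\<^bsub>?F\<^esub> e)) = h a (x \<odot>\<^bsub>?F\<^esub> e)" using xe[OF xI] by (simp only: h_def restrict_apply if_True)
    also have "\<dots> = g (x \<odot>\<^bsub>?F\<^esub> e)" unfolding g(2) using xe[OF xI] by (simp only: restrict_apply if_True)
    also have "\<dots> = x \<otimes> g e" using g(1) eF xc unfolding lin_maps_iff by (simp del: free_module_simps)
    finally have 1: "xdiv (a \<otimes> s (x \<odot>\<^bsub>?F\<^esub> e)) = x \<otimes> g e" .
    have ge: "g e \<in> carrier R" using g(1) eF unfolding lin_maps_iff by auto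
    have 2: "a \<otimes> s (x \<odot>\<^bsub>?F\<^esub> e) = x \<otimes> (a \<otimes> u)"
      using s(3)[OF xc eF] I'c[OF a] u(1) xc unfolding u_def[symmetric] by (simp add: m_lcomm del: free_module_simps)
    have "xdiv (a \<otimes> s (x \<odot>\<^bsub>?F\<^esub> e)) = a \<otimes> u" unfolding 2 by (rule xdiv_unique) (use I'c[OF a] u(1) in auto)
    then have "a \<otimes> u \<in> X" using 1 cgen_mem(2)[OF xc ge] by simp
    then show "a \<in> X" by (rule uX[OF a])
  next
    assume "a \<in> X"
    then obtain c where c: "c \<in> carrier R" "a = x \<otimes> c" using xdiv by metis
    define g where "g = (\<lambda>\<phi>\<in>carrier ?F. c \<otimes> s \<phi>)"
    have "g \<in> lin_maps R ?F (ring_module R)"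
      unfolding lin_maps_iff g_def using s c(1) F.M.a_closed F.smult_closed
      by (simp add: r_distr m_lcomm del: free_module_simps)
    moreover have "h a = restrict g ?K"
      unfolding h_def
    proof (rule restrict_ext)
      fix \<phi> assume p: "\<phi> \<in> ?K"
      have "xdiv (a \<otimes> s \<phi>) = c \<otimes> s \<phi>"
        by (rule xdiv_unique) (use c s(1)[OF Kc[OF p]] xc in \<open>auto simp: m_assoc\<close>)
      then show "xdiv (a \<otimes> s \<phi>) = g \<phi>" using Kc[OF p] by (simp add: g_def)
    qed
    ultimately show "h a \<in> ?B" unfolding ext_trivial_maps_def by blast
  qed
  have surj: "\<exists>a\<in>I'. cong_mod ?H ?B f (h a)" if f: "f \<in> carrier ?H" for f
  proof -
    note f1 = f[unfolded ext_maps_carrier_iff]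
    have fc: "f \<phi> \<in> carrier R" if "\<phi> \<in> ?K" for \<phi> using f1 that by auto
    have fa: "f (\<phi> \<oplus>\<^bsub>?F\<^esub> \<psi>) = f \<phi> \<oplus> f \<psi>" if "\<phi> \<in> ?K" "\<psi> \<in> ?K" for \<phi> \<psi>
      using f1 that by (simp del: free_module_simps)
    have fs: "f (r \<odot>\<^bsub>?F\<^esub> \<phi>) = r \<otimes> f \<phi>" if "r \<in> carrier R" "\<phi> \<in> ?K" for r \<phi>
      using f1 that by (simp del: free_module_simps)
    define a where "a = f (x \<odot>\<^bsub>?F\<^esub> e)"
    have ac: "a \<in> carrier R" unfolding a_def by (rule fc[OF xe[OF xI]])
    have ai: "a \<otimes> i = x \<otimes> f (i \<odot>\<^bsub>?F\<^esub> e)" if i: "i \<in> I" for i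
    proof -
      have "a \<otimes> i = i \<otimes> f (x \<odot>\<^bsub>?F\<^esub> e)" using m_comm[OF ac Ic[OF i]] by (simp only: a_def)
      also have "\<dots> = f (i \<odot>\<^bsub>?F\<^esub> (x \<odot>\<^bsub>?F\<^esub> e))" using fs[OF Ic[OF i] xe[OF xI]] by (simp only:)
      also have "i \<odot>\<^bsub>?F\<^esub> (x \<odot>\<^bsub>?F\<^esub> e) = x \<odot>\<^bsub>?F\<^esub> (i \<odot>\<^bsub>?F\<^esub> e)" by (rule F.smult_lcomm[OF Ic[OF i] xc eF])
      also have "f \<dots> = x \<otimes> f (i \<odot>\<^bsub>?F\<^esub> e)" by (rule fs[OF xc xe[OF i]])
      finally show ?thesis .
    qed
    have aI': "a \<in> I'" unfolding colon_def using ac ai cgen_mem(2)[OF xc fc[OF xe]] by auto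
    \<comment> \<open>subtracting s(phi) e moves every phi into the relations, so f composed with t extends f minus h a\<close>
    define t where "t \<phi> = \<phi> \<oplus>\<^bsub>?F\<^esub> (\<ominus> s \<phi>) \<odot>\<^bsub>?F\<^esub> e" for \<phi>
    have te: "(\<ominus> s \<phi>) \<odot>\<^bsub>?F\<^esub> e \<in> carrier ?F" if p: "\<phi> \<in> carrier ?F" for \<phi>
      by (rule F.smult_closed[OF _ eF]) (use s(1)[OF p] in simp)
    have tF: "t \<phi> \<in> carrier ?F" if p: "\<phi> \<in> carrier ?F" for \<phi>
      unfolding t_def by (rule F.M.a_closed[OF p te[OF p]])
    have st: "s (t \<phi>) \<in> I" if p: "\<phi> \<in> carrier ?F" for \<phi>
    proof -
      have "s (t \<phi>) = s \<phi> \<oplus> s ((\<ominus> s \<phi>) \<odot>\<^bsub>?F\<^esub> e)" unfolding t_def by (rule s(2)[OF p te[OF p]])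
      also have "s ((\<ominus> s \<phi>) \<odot>\<^bsub>?F\<^esub> e) = (\<ominus> s \<phi>) \<otimes> u"
        unfolding u_def by (rule s(3)[OF _ eF]) (use s(1)[OF p] in simp)
      also have "s \<phi> \<oplus> (\<ominus> s \<phi>) \<otimes> u = s \<phi> \<otimes> (\<one> \<ominus> u)" using s(1)[OF p] u(1) by algebra
      finally show ?thesis using idealE(5)[OF I s(1)[OF p] u(2)] by (simp only:)
    qed
    have tK: "t \<phi> \<in> ?K" if "\<phi> \<in> carrier ?F" for \<phi> using K_iff tF st that by blast
    have ta: "t (\<phi> \<oplus>\<^bsub>?F\<^esub> \<psi>) = t \<phi> \<oplus>\<^bsub>?F\<^esub> t \<psi>" if p: "\<phi> \<in> carrier ?F" "\<psi> \<in> carrier ?F" for \<phi> \<psi>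
      unfolding t_def s(2)[OF p] using p s(1)[OF p(1)] s(1)[OF p(2)] eF by algebra
    have ts: "t (r \<odot>\<^bsub>?F\<^esub> \<phi>) = r \<odot>\<^bsub>?F\<^esub> t \<phi>" if p: "r \<in> carrier R" "\<phi> \<in> carrier ?F" for r \<phi>
      unfolding t_def s(3)[OF p] using p s(1)[OF p(2)] eF by algebra
    define g where "g = (\<lambda>\<phi>\<in>carrier ?F. f (t \<phi>))"
    have g: "g \<in> lin_maps R ?F (ring_module R)"
      unfolding lin_maps_iff g_def using fc[OF tK] ta ts fa[OF tK tK] fs[OF _ tK] F.M.a_closed F.smult_closed
      by (simp del: free_module_simps)
    have rB: "restrict g ?K \<in> ?B" unfolding ext_trivial_maps_def by (rule imageI[OF g])
    have rc: "restrict g ?K \<in> carrier ?H" using rB H.submoduleE(1)[OF B] by blast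
    have "f \<phi> = xdiv (a \<otimes> s \<phi>) \<oplus> g \<phi>" if p: "\<phi> \<in> ?K" for \<phi>
    proof -
      note pF = Kc[OF p]
      have sI: "s \<phi> \<in> I" using p K_iff by blast
      have "s \<phi> \<odot>\<^bsub>?F\<^esub> e \<oplus>\<^bsub>?F\<^esub> t \<phi> = \<phi>"
        unfolding t_def using pF s(1)[OF pF] eF by algebra
      then have "f \<phi> = f (s \<phi> \<odot>\<^bsub>?F\<^esub> e) \<oplus> f (t \<phi>)" using fa[OF xe[OF sI] tK[OF pF]] by (simp only:)
      moreover have "xdiv (a \<otimes> s \<phi>) = f (s \<phi> \<odot>\<^bsub>?F\<^esub> e)"
        by (rule xdiv_unique[OF fc[OF xe[OF sI]] ai[OF sI, symmetric]])
      ultimately show ?thesis using pF by (simp only: g_def restrict_apply if_True)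
    qed
    note eq = this
    have "h a \<oplus>\<^bsub>?H\<^esub> restrict g ?K = f"
    proof
      fix \<phi>
      show "(h a \<oplus>\<^bsub>?H\<^esub> restrict g ?K) \<phi> = f \<phi>"
      proof (cases "\<phi> \<in> ?K")
        case True
        show ?thesis unfolding eq[OF True] using True by (simp add: h_def)
      next
        case False
        then show ?thesis using PiE_arb[OF conjunct1[OF f1] False] by simp
      qed
    qed
    then have "f \<ominus>\<^bsub>?H\<^esub> h a = restrict g ?K"
      using H.plus_minus_cancel[OF hcar[OF aI'] rc] by simp
    then have "cong_mod ?H ?B f (h a)" unfolding cong_mod_def using rB f hcar[OF aI'] by simp
    then show ?thesis using aI' by blast
  qed
  let ?q = "\<lambda>a. ?B +>\<^bsub>?H\<^esub> h a"
  have "?q ` I' = carrier \<omega>"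
  proof (intro equalityI subsetI)
    fix w assume "w \<in> ?q ` I'"
    then show "w \<in> carrier \<omega>" unfolding \<omega> quot_module_carrier[OF H B] using hcar by blast
  next
    fix w assume "w \<in> carrier \<omega>"
    then obtain f where f: "f \<in> carrier ?H" "w = ?B +>\<^bsub>?H\<^esub> f" unfolding \<omega> quot_module_carrier[OF H B] by blast
    obtain a where "a \<in> I'" "cong_mod ?H ?B f (h a)" using surj[OF f(1)] by blast
    then show "w \<in> ?q ` I'" using coset_eq_iff[OF H B f(1) hcar] f(2) by blast
  qed
  moreover have "?q (a \<oplus> b) = ?q a \<oplus>\<^bsub>\<omega>\<^esub> ?q b" if "a \<in> I'" "b \<in> I'" for a b
    unfolding \<omega> using quot_module_add[OF H B hcar[OF that(1)] hcar[OF that(2)]] hadd[OF that] by simp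
  moreover have "?q (r \<otimes> a) = r \<odot>\<^bsub>\<omega>\<^esub> ?q a" if "r \<in> carrier R" "a \<in> I'" for r a
    unfolding \<omega> using quot_module_smult[OF H B that(1) hcar[OF that(2)]] hsm[OF that(2,1)] by simp
  moreover have "?q a = \<zero>\<^bsub>\<omega>\<^esub> \<longleftrightarrow> a \<in> X" if "a \<in> I'" for a
    unfolding \<omega> using coset_self_iff[OF H B hcar[OF that]] hB[OF that] by (simp add: quot_module_def)
  ultimately show thesis by (rule that)
qed

end

section \<open>The conormal module and the canonical module\<close>

context gorenstein_ideal begin

interpretation rm: module R "ring_module R" by (rule ring_module_module)

text \<open>The lifts of the elements of Hom(I, R/I), which is the same as Hom(I/I^2, R/I).\<close>
definition conormal_maps where
  "conormal_maps = {u \<in> I \<rightarrow>\<^sub>E carrier R. linear_mod R (ring_module R) (ring_module R) I I u}"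

lemma conormal_maps_submodule:
  "submodule conormal_maps R (map_module I (ring_module R))"
  "submodule (I \<rightarrow>\<^sub>E I) R (map_module I (ring_module R))"
  "I \<rightarrow>\<^sub>E I \<subseteq> conormal_maps"
proof -
  show "submodule conormal_maps R (map_module I (ring_module R))"
    unfolding conormal_maps_def
    using linear_mod_submodule[OF ring_module_module ring_module_module sI sI] by simp
  show "submodule (I \<rightarrow>\<^sub>E I) R (map_module I (ring_module R))"
    using maps_into_submodule[OF ring_module_module sI order_refl, of I] maps_into_eq[OF idealE(1)[OF I], of I] by simp
  show "I \<rightarrow>\<^sub>E I \<subseteq> conormal_maps"
  proof
    fix f assume f: "f \<in> I \<rightarrow>\<^sub>E I"
    have fY: "f y \<in> I" "f y \<in> carrier R" if "y \<in> I" for y using f that Ic by auto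
    have "linear_mod R (ring_module R) (ring_module R) I I f"
      unfolding linear_mod_def cong_mod_def using fY idealE(3,4,5)[OF I] by simp
    then show "f \<in> conormal_maps" using f fY by (auto simp: conormal_maps_def PiE_def)
  qed
qed

lemma conormal_mapsD:
  assumes "u \<in> conormal_maps"
  shows "\<And>i. i \<in> I \<Longrightarrow> u i \<in> carrier R" "u \<in> I \<rightarrow>\<^sub>E carrier R"
    "\<And>i j. i \<in> I \<Longrightarrow> j \<in> I \<Longrightarrow> u (i \<oplus> j) \<ominus> (u i \<oplus> u j) \<in> I"
    "\<And>r i. r \<in> carrier R \<Longrightarrow> i \<in> I \<Longrightarrow> u (r \<otimes> i) \<ominus> r \<otimes> u i \<in> I"
  using assms unfolding conormal_maps_def linear_mod_ring_iff[OF idealE(1)[OF I]] by auto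

text \<open>Because u(ij) is congruent to i u(j) modulo I.\<close>
lemma conormal_maps_square:
  assumes u: "u \<in> conormal_maps" and i: "i \<in> ideal_prod R I I" shows "u i \<in> I"
  using i
proof (induction i rule: ideal_prod.induct)
  case (prod i j)
  have ij: "i \<in> carrier R" "j \<in> I" "i \<otimes> j \<in> I" using prod Ic idealE(5)[OF I] by auto
  have "i \<otimes> u j \<in> I" using idealE(5)[OF I conormal_mapsD(1)[OF u ij(2)] prod(1)] m_comm[OF ij(1) conormal_mapsD(1)[OF u ij(2)]] by simp
  then show ?case
    using ideal_diff_mem_iff[OF I conormal_mapsD(1)[OF u ij(3)] _ conormal_mapsD(4)[OF u ij(1,2)]]
      ij(1) conormal_mapsD(1)[OF u ij(2)] by simp
next
  case (sum s t)
  have st: "s \<in> I" "t \<in> I" "s \<oplus> t \<in> I"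
    using sum.hyps ideal_prod_inter[OF I I] idealE(3)[OF I] by blast+
  show ?case
    using ideal_diff_mem_iff[OF I conormal_mapsD(1)[OF u st(3)] _ conormal_mapsD(3)[OF u st(1,2)]]
      conormal_mapsD(1)[OF u st(1)] conormal_mapsD(1)[OF u st(2)] idealE(3)[OF I sum.IH] by simp
qed

lemma conormal_maps_cong:
  assumes u: "u \<in> conormal_maps" and i: "i \<in> I" and j: "j \<in> I" and ij: "i \<ominus> j \<in> ideal_prod R I I"
  shows "u i \<ominus> u j \<in> I"
proof -
  note c = conormal_mapsD(1)[OF u]
  have d: "i \<ominus> j \<in> I" using idealE(4)[OF I i j] .
  have e: "(i \<ominus> j) \<oplus> j = i" using Ic[OF i] Ic[OF j] by algebra
  have "u ((i \<ominus> j) \<oplus> j) \<ominus> (u (i \<ominus> j) \<oplus> u j) \<in> I" by (rule conormal_mapsD(3)[OF u d j])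
  then have "(u i \<ominus> (u (i \<ominus> j) \<oplus> u j)) \<oplus> u (i \<ominus> j) \<in> I"
    unfolding e using conormal_maps_square[OF u ij] idealE(3)[OF I] by blast
  also have "(u i \<ominus> (u (i \<ominus> j) \<oplus> u j)) \<oplus> u (i \<ominus> j) = u i \<ominus> u j"
    using c[OF i] c[OF j] c[OF d] by algebra
  finally show ?thesis .
qed

text \<open>Over R/xR, the dual of the tensor product of I/I^2 and I'/X is Hom(I/I^2, Hom(I'/X, R/X)), and
  Hom(I'/X, R/X) is R/I: by self-injectivity each such map is a multiplication, and the
  multipliers of the zero map form (X : I') = I. Duality preserves lengths. The ring B is R
  or R/I, since tensor products over both of them occur; it only has to be an image of R.\<close>
lemma tensor_length:
  fixes B :: "('c, 's) ring_scheme" and M :: "('c, 'm) module" and N :: "('c, 'n) module"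
  assumes B: "cring B" and h: "h \<in> ring_hom R B" "h ` carrier R = carrier B"
    and M: "module B M" and N: "module B N"
    and p: "p ` I = carrier M" "\<And>i j. i \<in> I \<Longrightarrow> j \<in> I \<Longrightarrow> p (i \<oplus> j) = p i \<oplus>\<^bsub>M\<^esub> p j"
      "\<And>r i. r \<in> carrier R \<Longrightarrow> i \<in> I \<Longrightarrow> p (r \<otimes> i) = h r \<odot>\<^bsub>M\<^esub> p i"
      "\<And>i j. i \<in> I \<Longrightarrow> j \<in> I \<Longrightarrow> p i = p j \<Longrightarrow> i \<ominus> j \<in> ideal_prod R I I"
    and q: "q ` I' = carrier N" "\<And>a b. a \<in> I' \<Longrightarrow> b \<in> I' \<Longrightarrow> q (a \<oplus> b) = q a \<oplus>\<^bsub>N\<^esub> q b"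
      "\<And>r a. r \<in> carrier R \<Longrightarrow> a \<in> I' \<Longrightarrow> q (r \<otimes> a) = h r \<odot>\<^bsub>N\<^esub> q a"
      "\<And>a. a \<in> I' \<Longrightarrow> q a = \<zero>\<^bsub>N\<^esub> \<longleftrightarrow> a \<in> X"
  shows "module_length R (restrict_scalars h (tensor_module B M N))
    = len R (map_module I (ring_module R)) (I \<rightarrow>\<^sub>E I) conormal_maps"
proof -
  interpret B: cring B by fact
  interpret M: module B M by fact
  interpret N: module B N by fact
  let ?F = "free_module B (carrier M \<times> carrier N)" and ?K = "tensor_rel B M N"
  let ?G = "restrict_scalars h ?F"
  let ?e = "\<lambda>i a. free_gen B (p i, q a)"
  interpret F: module B ?F by (rule B.free_module_module)
  have Gm: "module R ?G" by (rule restrict_scalars_module[OF is_cring h(1) F.module_axioms])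
  interpret G: module R ?G by (rule Gm)
  have sub_iff: "submodule P R ?G \<longleftrightarrow> submodule P B ?F" for P
    by (rule restrict_scalars_submodule_iff[OF is_cring h F.module_axioms])
  have K: "submodule ?K B ?F" by (rule tensor_rel_submodule[OF M N])
  then have KG: "submodule ?K R ?G" by (simp add: sub_iff)
  have hc: "\<And>r. r \<in> carrier R \<Longrightarrow> h r \<in> carrier B" using h(1) by (simp add: ring_hom_memE)
  have pc: "\<And>i. i \<in> I \<Longrightarrow> p i \<in> carrier M" using p(1) by blast
  have qc: "\<And>a. a \<in> I' \<Longrightarrow> q a \<in> carrier N" using q(1) by blast
  have ec: "\<And>i a. i \<in> I \<Longrightarrow> a \<in> I' \<Longrightarrow> ?e i a \<in> carrier ?F" using tensor_gen_mem[OF M N] pc qc by blast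
  have xN: "h r \<odot>\<^bsub>N\<^esub> n = \<zero>\<^bsub>N\<^esub>" if r: "r \<in> I" and n: "n \<in> carrier N" for r n
  proof -
    obtain a where a: "a \<in> I'" "n = q a" using n q(1) by blast
    have "r \<otimes> a \<in> X" "r \<otimes> a \<in> I'" using I_I'[OF r a(1)] idealE(5)[OF I'_ideal Ic[OF r] a(1)] by auto
    then have "q (r \<otimes> a) = \<zero>\<^bsub>N\<^esub>" using q(4) by blast
    then show ?thesis unfolding a(2) q(3)[OF Ic[OF r] a(1)] .
  qed
  note tc = tensor_cong[OF M N]
  have e_add1: "cong_mod ?F ?K (?e (i \<oplus> j) a) (?e i a \<oplus>\<^bsub>?F\<^esub> ?e j a)" if "i \<in> I" "j \<in> I" "a \<in> I'" for i j a
    unfolding p(2)[OF that(1,2)] by (rule tc(1)[OF pc[OF that(1)] pc[OF that(2)] qc[OF that(3)] qc[OF that(3)] B.zero_closed])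
  have e_add2: "cong_mod ?F ?K (?e i (a \<oplus> b)) (?e i a \<oplus>\<^bsub>?F\<^esub> ?e i b)" if "i \<in> I" "a \<in> I'" "b \<in> I'" for i a b
    unfolding q(2)[OF that(2,3)] by (rule tc(2)[OF pc[OF that(1)] pc[OF that(1)] qc[OF that(2)] qc[OF that(3)] B.zero_closed])
  have e_sm1: "cong_mod ?F ?K (?e (r \<otimes> i) a) (h r \<odot>\<^bsub>?F\<^esub> ?e i a)" if "r \<in> carrier R" "i \<in> I" "a \<in> I'" for r i a
    unfolding p(3)[OF that(1,2)] by (rule tc(3)[OF pc[OF that(2)] pc[OF that(2)] qc[OF that(3)] qc[OF that(3)] hc[OF that(1)]])
  have e_sm2: "cong_mod ?F ?K (?e i (r \<otimes> a)) (h r \<odot>\<^bsub>?F\<^esub> ?e i a)" if "r \<in> carrier R" "i \<in> I" "a \<in> I'" for r i a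
    unfolding q(3)[OF that(1,3)] by (rule tc(4)[OF pc[OF that(2)] pc[OF that(2)] qc[OF that(3)] qc[OF that(3)] hc[OF that(1)]])
  have e_X: "?e i a \<in> ?K" if "i \<in> I" "a \<in> X" "a \<in> I'" for i a
    using tensor_gen_zero[OF M N pc[OF that(1)]] q(4)[OF that(3)] that(2) by simp
  have gens: "P = carrier ?F" if P: "submodule P B ?F" and Pe: "\<And>i a. i \<in> I \<Longrightarrow> a \<in> I' \<Longrightarrow> ?e i a \<in> P" for P
  proof (rule B.free_gen_induct[OF P])
    fix z assume "z \<in> carrier M \<times> carrier N"
    then obtain i a where "i \<in> I" "a \<in> I'" "z = (p i, q a)" using p(1) q(1) by blast
    then show "free_gen B z \<in> P" using Pe by blast
  qed
  \<comment> \<open>x kills the tensor product, so that duality over R/xR applies\<close>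
  have xF: "x \<odot>\<^bsub>?G\<^esub> \<phi> \<in> ?K" if \<phi>: "\<phi> \<in> carrier ?G" for \<phi>
  proof -
    have lin: "linear_mod B ?F ?F (carrier ?F) {\<zero>\<^bsub>?F\<^esub>} (\<lambda>\<phi>. h x \<odot>\<^bsub>?F\<^esub> \<phi>)"
      unfolding linear_mod_zero_iff[OF F.module_axioms]
      using hc[OF xc] F.smult_r_distr F.smult_lcomm F.smult_closed by (simp del: free_module_simps)
    have "submodule {\<phi> \<in> carrier ?F. h x \<odot>\<^bsub>?F\<^esub> \<phi> \<in> ?K} B ?F"
      by (rule submodule_preimage[OF F.module_axioms F.module_axioms F.carrier_is_submodule F.zero_submodule lin K])
         (use F.submodule_zero[OF K] in \<open>simp del: free_module_simps\<close>)
    then have "{\<phi> \<in> carrier ?F. h x \<odot>\<^bsub>?F\<^esub> \<phi> \<in> ?K} = carrier ?F"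
    proof (rule gens)
      fix i a assume ia: "i \<in> I" "a \<in> I'"
      have "x \<otimes> a \<in> X" "x \<otimes> a \<in> I'" using I_I'[OF xI ia(2)] idealE(5)[OF I'_ideal xc ia(2)] by auto
      then have "?e i (x \<otimes> a) \<in> ?K" using e_X[OF ia(1)] by blast
      then have "h x \<odot>\<^bsub>?F\<^esub> ?e i a \<in> ?K"
        using F.cong_mem[OF K order_refl e_sm2[OF xc ia]] by blast
      then show "?e i a \<in> {\<phi> \<in> carrier ?F. h x \<odot>\<^bsub>?F\<^esub> \<phi> \<in> ?K}" using ec[OF ia] by blast
    qed
    then have "h x \<odot>\<^bsub>?F\<^esub> \<phi> \<in> ?K" using \<phi> by auto
    then show ?thesis by (simp only: restrict_scalars_simps)
  qed
  obtain A where A: "A \<subseteq> carrier R" "finite A" "I = Idl A" using finetely_gen[OF I] by blast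
  obtain A' where A': "A' \<subseteq> carrier R" "finite A'" "I' = Idl A'" using finetely_gen[OF I'_ideal] by blast
  have AI: "A \<subseteq> I" "A' \<subseteq> I'" using genideal_self A A' by auto
  let ?A = "(\<lambda>(i, a). ?e i a) ` (A \<times> A')"
  have fg: "P = carrier ?G" if P: "submodule P R ?G" "?K \<subseteq> P" "?A \<subseteq> P" for P
  proof -
    have PB: "submodule P B ?F" using P(1) sub_iff by simp
    have 1: "?e i a \<in> P" if i: "i \<in> I" and a: "a \<in> A'" for i a
    proof -
      have aI: "a \<in> I'" using a AI by blast
      have "ideal {i \<in> I. ?e i a \<in> P} R"
      proof (rule idealI2)
        show "{i \<in> I. ?e i a \<in> P} \<subseteq> carrier R" using Ic by blast
        have "cong_mod ?F ?K (?e (\<zero> \<otimes> \<zero>) a) (h \<zero> \<odot>\<^bsub>?F\<^esub> ?e \<zero> a)" by (rule e_sm1[OF zero_closed idealE(2)[OF I] aI])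
        moreover have "h \<zero> = \<zero>\<^bsub>B\<^esub>" using ring_hom_zero[OF h(1) ring_axioms B.ring_axioms] .
        then have "h \<zero> \<odot>\<^bsub>?F\<^esub> ?e \<zero> a \<in> P" using F.smult_l_null[OF ec[OF idealE(2)[OF I] aI]] F.submodule_zero[OF PB] by (simp only:)
        ultimately have "?e (\<zero> \<otimes> \<zero>) a \<in> P" using F.cong_mem[OF PB P(2)] by blast
        then show "\<zero> \<in> {i \<in> I. ?e i a \<in> P}" using idealE(2)[OF I] by simp
      next
        fix i j assume "i \<in> {i \<in> I. ?e i a \<in> P}" "j \<in> {i \<in> I. ?e i a \<in> P}"
        then have ij: "i \<in> I" "j \<in> I" "?e i a \<oplus>\<^bsub>?F\<^esub> ?e j a \<in> P" using F.submoduleE(5)[OF PB] by blast+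
        then have "?e (i \<oplus> j) a \<in> P" using F.cong_mem[OF PB P(2) e_add1[OF ij(1,2) aI]] by blast
        then show "i \<oplus> j \<in> {i \<in> I. ?e i a \<in> P}" using idealE(3)[OF I ij(1,2)] by blast
      next
        fix r j assume r: "r \<in> carrier R" and "j \<in> {i \<in> I. ?e i a \<in> P}"
        then have j: "j \<in> I" "h r \<odot>\<^bsub>?F\<^esub> ?e j a \<in> P" using F.submoduleE(4)[OF PB hc[OF r]] by blast+
        then have "?e (r \<otimes> j) a \<in> P" using F.cong_mem[OF PB P(2) e_sm1[OF r j(1) aI]] by blast
        then show "r \<otimes> j \<in> {i \<in> I. ?e i a \<in> P}" using idealE(5)[OF I r j(1)] by blast
      qed
      then have "Idl A \<subseteq> {i \<in> I. ?e i a \<in> P}" by (rule genideal_minimal) (use P(3) a AI in auto)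
      then show ?thesis using i A(3) by blast
    qed
    have 2: "?e i a \<in> P" if i: "i \<in> I" and a: "a \<in> I'" for i a
    proof -
      have "ideal {a \<in> I'. ?e i a \<in> P} R"
      proof (rule idealI2)
        show "{a \<in> I'. ?e i a \<in> P} \<subseteq> carrier R" using I'c by blast
        show "\<zero> \<in> {a \<in> I'. ?e i a \<in> P}"
          using e_X[OF i idealE(2)[OF Xp(1)] idealE(2)[OF I'_ideal]] P(2) idealE(2)[OF I'_ideal] by blast
      next
        fix b c assume "b \<in> {a \<in> I'. ?e i a \<in> P}" "c \<in> {a \<in> I'. ?e i a \<in> P}"
        then have bc: "b \<in> I'" "c \<in> I'" "?e i b \<oplus>\<^bsub>?F\<^esub> ?e i c \<in> P" using F.submoduleE(5)[OF PB] by blast+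
        then have "?e i (b \<oplus> c) \<in> P" using F.cong_mem[OF PB P(2) e_add2[OF i bc(1,2)]] by blast
        then show "b \<oplus> c \<in> {a \<in> I'. ?e i a \<in> P}" using idealE(3)[OF I'_ideal bc(1,2)] by blast
      next
        fix r b assume r: "r \<in> carrier R" and "b \<in> {a \<in> I'. ?e i a \<in> P}"
        then have b: "b \<in> I'" "h r \<odot>\<^bsub>?F\<^esub> ?e i b \<in> P" using F.submoduleE(4)[OF PB hc[OF r]] by blast+
        then have "?e i (r \<otimes> b) \<in> P" using F.cong_mem[OF PB P(2) e_sm2[OF r i b(1)]] by blast
        then show "r \<otimes> b \<in> {a \<in> I'. ?e i a \<in> P}" using idealE(5)[OF I'_ideal r b(1)] by blast
      qed
      then have "Idl A' \<subseteq> {a \<in> I'. ?e i a \<in> P}" by (rule genideal_minimal) (use 1[OF i] AI in auto)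
      then show ?thesis using a A'(3) by blast
    qed
    show ?thesis using gens[OF PB 2] by simp
  qed
  let ?V = "dual_maps R ?G X ?K (carrier ?G)" and ?MF = "map_module (carrier ?G) (ring_module R)"
  have dual: "len R ?MF (carrier ?G \<rightarrow>\<^sub>E X) ?V = len R ?G ?K (carrier ?G)"
  proof (rule dual_len_module[OF Gm regular_x KG xF _ _ fg])
    show "finite ?A" using A(2) A'(2) by simp
    show "?A \<subseteq> carrier ?G"
    proof
      fix z assume "z \<in> ?A"
      then obtain i a where "i \<in> A" "a \<in> A'" "z = ?e i a" by (elim imageE SigmaE) simp
      then show "z \<in> carrier ?G" using ec[of i a] AI by (simp add: subset_iff)
    qed
  qed
  have MFm: "module R ?MF" and MIm: "module R (map_module I (ring_module R))"
    by (rule map_module_module[OF ring_module_module])+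
  have KGc: "?K \<subseteq> carrier ?G" using G.submoduleE(1)[OF KG] .
  note V = dual_maps_submodule[OF Gm G.carrier_is_submodule KGc Xp(1)]
  \<comment> \<open>sections of the two projections, which turn u into a bilinear map on cosets\<close>
  define ip where "ip m = (SOME i. i \<in> I \<and> p i = m)" for m
  define rq where "rq n = (SOME a. a \<in> I' \<and> q a = n)" for n
  have ip: "ip m \<in> I" "p (ip m) = m" if "m \<in> carrier M" for m
  proof -
    have "m \<in> p ` I" unfolding p(1) by (rule that)
    then have "\<exists>i. i \<in> I \<and> p i = m" by blast
    then have "ip m \<in> I \<and> p (ip m) = m" unfolding ip_def by (rule someI_ex)
    then show "ip m \<in> I" "p (ip m) = m" by auto
  qed
  have rq: "rq n \<in> I'" "q (rq n) = n" if "n \<in> carrier N" for n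
  proof -
    have "n \<in> q ` I'" unfolding q(1) by (rule that)
    then have "\<exists>a. a \<in> I' \<and> q a = n" by blast
    then have "rq n \<in> I' \<and> q (rq n) = n" unfolding rq_def by (rule someI_ex)
    then show "rq n \<in> I'" "q (rq n) = n" by auto
  qed
  have qcong: "cong_mod (ring_module R) X a b" if ab: "a \<in> I'" "b \<in> I'" "q a = q b" for a b
  proof -
    have d: "a \<ominus> b \<in> I'" using idealE(4)[OF I'_ideal ab(1,2)] .
    have "q ((a \<ominus> b) \<oplus> b) = q (a \<ominus> b) \<oplus>\<^bsub>N\<^esub> q b" by (rule q(2)[OF d ab(2)])
    moreover have "(a \<ominus> b) \<oplus> b = a" using I'c[OF ab(1)] I'c[OF ab(2)] by algebra
    ultimately have "q (a \<ominus> b) \<oplus>\<^bsub>N\<^esub> q b = q b" using ab(3) by simp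
    then have "q (a \<ominus> b) = \<zero>\<^bsub>N\<^esub>" using N.M.add.r_cancel_one[OF qc[OF ab(2)] qc[OF d]] by simp
    then show ?thesis using q(4)[OF d] I'c ab by (simp add: cong_mod_def)
  qed
  have rq_lin: "cong_mod (ring_module R) X (rq (n \<oplus>\<^bsub>N\<^esub> n')) (rq n \<oplus> rq n')"
    "r \<in> carrier R \<Longrightarrow> cong_mod (ring_module R) X (rq (h r \<odot>\<^bsub>N\<^esub> n)) (r \<otimes> rq n)" if "n \<in> carrier N" "n' \<in> carrier N" for n n' r
    using that rq q(2,3) hc idealE(3,5)[OF I'_ideal] by (auto intro!: qcong)
  \<comment> \<open>the map that belongs to u under the adjunction sends p i \<otimes> q a to u i \<otimes> a modulo X, which is an element of N\<close>
  define \<beta> where "\<beta> u = (\<lambda>(m, n). h (u (ip m)) \<odot>\<^bsub>N\<^esub> n)" for u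
  define \<gamma> where "\<gamma> u = free_lift B N (\<beta> u)" for u
  have \<beta>c: "\<beta> u z \<in> carrier N" if "u \<in> conormal_maps" "z \<in> carrier M \<times> carrier N" for u z
    using that hc conormal_mapsD(1)[OF that(1)] ip(1) by (auto simp: \<beta>_def)
  have \<gamma>lin: "linear_mod B ?F N (carrier ?F) {\<zero>\<^bsub>N\<^esub>} (\<gamma> u)" if "u \<in> conormal_maps" for u
    unfolding \<gamma>_def by (rule B.free_lift_linear(1)[OF N]) (use \<beta>c that in auto)
  have \<gamma>gen: "\<gamma> u (free_gen B (m, n)) = h (u (ip m)) \<odot>\<^bsub>N\<^esub> n" if "u \<in> conormal_maps" "m \<in> carrier M" "n \<in> carrier N" for u m n
    unfolding \<gamma>_def using B.free_lift_linear(2)[OF N, of "carrier M \<times> carrier N" "\<beta> u" "(m, n)"] \<beta>c that by (auto simp: \<beta>_def)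
  note \<gamma>l = \<gamma>lin[unfolded linear_mod_zero_iff[OF N]]
  have \<gamma>c: "\<gamma> u \<phi> \<in> carrier N" if "u \<in> conormal_maps" "\<phi> \<in> carrier ?F" for u \<phi> using \<gamma>l that by blast
  have hN: "h r \<odot>\<^bsub>N\<^esub> n = h r' \<odot>\<^bsub>N\<^esub> n" if r: "r \<in> carrier R" "r' \<in> carrier R" "r \<ominus> r' \<in> I" and n: "n \<in> carrier N" for r r' n
  proof -
    have "r = (r \<ominus> r') \<oplus> r'" using r by algebra
    then have "h r = h (r \<ominus> r') \<oplus>\<^bsub>B\<^esub> h r'" using ring_hom_add[OF h(1), of "r \<ominus> r'" r'] r by simp
    then have "h r \<odot>\<^bsub>N\<^esub> n = h (r \<ominus> r') \<odot>\<^bsub>N\<^esub> n \<oplus>\<^bsub>N\<^esub> h r' \<odot>\<^bsub>N\<^esub> n"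
      using N.smult_l_distr[OF hc hc n, of "r \<ominus> r'" r'] r by simp
    then show ?thesis using xN[OF r(3) n] hc[OF r(2)] n by simp
  qed
  have \<gamma>K: "\<gamma> u \<phi> = \<zero>\<^bsub>N\<^esub>" if u: "u \<in> conormal_maps" and \<phi>: "\<phi> \<in> ?K" for u \<phi>
    unfolding \<gamma>_def
  proof (rule bilinear_lift_kills[OF M N N _ _ _ _ _ \<phi>])
    note c = conormal_mapsD(1)[OF u]
    fix m n assume m: "m \<in> carrier M" and n: "n \<in> carrier N"
    note ucc = c[OF ip(1)[OF m]]
    show "\<beta> u (m, n) \<in> carrier N" using \<beta>c[OF u] m n by blast
    { fix m' assume m': "m' \<in> carrier M"
      have "ip (m \<oplus>\<^bsub>M\<^esub> m') \<ominus> (ip m \<oplus> ip m') \<in> ideal_prod R I I"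
        using ip m m' p(2) idealE(3)[OF I] by (intro p(4)) auto
      then have "u (ip (m \<oplus>\<^bsub>M\<^esub> m')) \<ominus> u (ip m \<oplus> ip m') \<in> I"
        using conormal_maps_cong[OF u] ip(1) m m' idealE(3)[OF I] by simp
      then have "h (u (ip (m \<oplus>\<^bsub>M\<^esub> m'))) \<odot>\<^bsub>N\<^esub> n = h (u (ip m \<oplus> ip m')) \<odot>\<^bsub>N\<^esub> n"
        using c ip(1) m m' idealE(3)[OF I] n by (intro hN) auto
      also have "\<dots> = h (u (ip m) \<oplus> u (ip m')) \<odot>\<^bsub>N\<^esub> n"
        using c ip(1) m m' idealE(3)[OF I] n conormal_mapsD(3)[OF u] by (intro hN) auto
      also have "\<dots> = h (u (ip m)) \<odot>\<^bsub>N\<^esub> n \<oplus>\<^bsub>N\<^esub> h (u (ip m')) \<odot>\<^bsub>N\<^esub> n"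
        using ring_hom_add[OF h(1) ucc c[OF ip(1)[OF m']]] N.smult_l_distr[OF hc[OF ucc] hc[OF c[OF ip(1)[OF m']]] n] by simp
      finally show "\<beta> u (m \<oplus>\<^bsub>M\<^esub> m', n) = \<beta> u (m, n) \<oplus>\<^bsub>N\<^esub> \<beta> u (m', n)" by (simp add: \<beta>_def) }
    { fix n' assume n': "n' \<in> carrier N"
      show "\<beta> u (m, n \<oplus>\<^bsub>N\<^esub> n') = \<beta> u (m, n) \<oplus>\<^bsub>N\<^esub> \<beta> u (m, n')"
        using N.smult_r_distr[OF hc[OF ucc] n n'] by (simp add: \<beta>_def) }
    { fix b assume b: "b \<in> carrier B"
      show "\<beta> u (m, b \<odot>\<^bsub>N\<^esub> n) = b \<odot>\<^bsub>N\<^esub> \<beta> u (m, n)"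
        using N.smult_lcomm[OF hc[OF ucc] b n] by (simp add: \<beta>_def)
      obtain r where r: "r \<in> carrier R" "b = h r" using b unfolding h(2)[symmetric] by blast
      have ri: "r \<otimes> ip m \<in> I" using idealE(5)[OF I r(1) ip(1)[OF m]] .
      have bm: "b \<odot>\<^bsub>M\<^esub> m \<in> carrier M" using b m by simp
      have "ip (b \<odot>\<^bsub>M\<^esub> m) \<ominus> r \<otimes> ip m \<in> ideal_prod R I I"
        using ip(1)[OF bm] ri ip(2)[OF bm] p(3)[OF r(1) ip(1)[OF m]] ip(2)[OF m] r(2) by (intro p(4)) auto
      then have "u (ip (b \<odot>\<^bsub>M\<^esub> m)) \<ominus> u (r \<otimes> ip m) \<in> I"
        using conormal_maps_cong[OF u ip(1)[OF bm] ri] by simp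
      then have "h (u (ip (b \<odot>\<^bsub>M\<^esub> m))) \<odot>\<^bsub>N\<^esub> n = h (u (r \<otimes> ip m)) \<odot>\<^bsub>N\<^esub> n"
        by (intro hN[OF c[OF ip(1)[OF bm]] c[OF ri] _ n])
      also have "\<dots> = h (r \<otimes> u (ip m)) \<odot>\<^bsub>N\<^esub> n"
        using conormal_mapsD(4)[OF u r(1) ip(1)[OF m]] r(1) ucc by (intro hN[OF c[OF ri] _ _ n]) auto
      also have "\<dots> = b \<odot>\<^bsub>N\<^esub> (h (u (ip m)) \<odot>\<^bsub>N\<^esub> n)"
        using ring_hom_mult[OF h(1) r(1) ucc] N.smult_assoc1[OF b hc[OF ucc] n] r(2) by simp
      finally show "\<beta> u (b \<odot>\<^bsub>M\<^esub> m, n) = b \<odot>\<^bsub>N\<^esub> \<beta> u (m, n)" by (simp add: \<beta>_def) }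
  qed
  define \<Psi> where "\<Psi> u = (\<lambda>\<phi>\<in>carrier ?G. rq (\<gamma> u \<phi>))" for u
  have \<Psi>c: "\<Psi> u \<in> carrier ?G \<rightarrow>\<^sub>E carrier R" if "u \<in> conormal_maps" for u
    using \<gamma>c[OF that] rq(1) I'c by (auto simp: \<Psi>_def)
  have \<Psi>V: "\<Psi> u \<in> ?V" if u: "u \<in> conormal_maps" for u
  proof -
    have "linear_mod R ?G (ring_module R) (carrier ?G) X (\<Psi> u)"
      unfolding linear_mod_def
    proof (intro conjI ballI)
      fix \<phi> \<psi> assume p: "\<phi> \<in> carrier ?G" "\<psi> \<in> carrier ?G"
      then have pF: "\<phi> \<in> carrier ?F" "\<psi> \<in> carrier ?F" by simp_all
      show "\<Psi> u \<phi> \<in> carrier (ring_module R)" using \<Psi>c[OF u] p by auto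
      have "\<gamma> u (\<phi> \<oplus>\<^bsub>?F\<^esub> \<psi>) = \<gamma> u \<phi> \<oplus>\<^bsub>N\<^esub> \<gamma> u \<psi>" using \<gamma>l[OF u] pF by blast
      then show "cong_mod (ring_module R) X (\<Psi> u (\<phi> \<oplus>\<^bsub>?G\<^esub> \<psi>)) (\<Psi> u \<phi> \<oplus>\<^bsub>ring_module R\<^esub> \<Psi> u \<psi>)"
        using rq_lin(1)[OF \<gamma>c[OF u pF(1)] \<gamma>c[OF u pF(2)]] pF F.M.a_closed[OF pF] by (simp add: \<Psi>_def del: free_module_simps)
    next
      fix r \<phi> assume p: "r \<in> carrier R" "\<phi> \<in> carrier ?G"
      then have pF: "\<phi> \<in> carrier ?F" by simp
      have "\<gamma> u (h r \<odot>\<^bsub>?F\<^esub> \<phi>) = h r \<odot>\<^bsub>N\<^esub> \<gamma> u \<phi>" using \<gamma>l[OF u] pF hc[OF p(1)] by blast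
      then show "cong_mod (ring_module R) X (\<Psi> u (r \<odot>\<^bsub>?G\<^esub> \<phi>)) (r \<odot>\<^bsub>ring_module R\<^esub> \<Psi> u \<phi>)"
        using rq_lin(2)[OF \<gamma>c[OF u pF] \<gamma>c[OF u pF] p(1)] pF F.smult_closed[OF hc[OF p(1)] pF] by (simp add: \<Psi>_def del: free_module_simps)
    qed
    moreover have "\<Psi> u \<phi> \<in> X" if "\<phi> \<in> ?K" for \<phi>
      using \<gamma>K[OF u that] rq[OF N.M.zero_closed] q(4) that KGc by (auto simp: \<Psi>_def)
    ultimately show ?thesis using \<Psi>c[OF u] by (auto simp: dual_maps_def)
  qed
  note CM = conormal_maps_submodule
  interpret MI: module R "map_module I (ring_module R)" by (rule MIm)
  have \<Psi>lin: "linear_mod R (map_module I (ring_module R)) ?MF conormal_maps (carrier ?G \<rightarrow>\<^sub>E X) \<Psi>"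
  proof (rule linear_mod_maps[OF ring_module_module sX MIm CM(1)])
    show "\<Psi> u \<in> carrier ?G \<rightarrow>\<^sub>E carrier (ring_module R)" if "u \<in> conormal_maps" for u using \<Psi>c[OF that] by simp
    fix \<phi> assume "\<phi> \<in> carrier ?G"
    then have \<phi>: "\<phi> \<in> carrier ?F" by simp
    show "linear_mod R (map_module I (ring_module R)) (ring_module R) conormal_maps X (\<lambda>u. \<Psi> u \<phi>)"
      unfolding linear_mod_def
    proof (intro conjI ballI)
      fix u v assume uv: "u \<in> conormal_maps" "v \<in> conormal_maps"
      show "\<Psi> u \<phi> \<in> carrier (ring_module R)" using \<Psi>c[OF uv(1)] \<phi> by auto
      let ?w = "u \<oplus>\<^bsub>map_module I (ring_module R)\<^esub> v"
      have w: "?w \<in> conormal_maps" using MI.submoduleE(5)[OF CM(1) uv] .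
      have "\<gamma> ?w \<phi> = \<gamma> u \<phi> \<oplus>\<^bsub>N\<^esub> \<gamma> v \<phi>"
        unfolding \<gamma>_def
      proof (rule B.free_lift_add[OF N _ _ _ \<phi>])
        fix z assume z: "z \<in> carrier M \<times> carrier N"
        then obtain m n where mn: "z = (m, n)" "m \<in> carrier M" "n \<in> carrier N" by blast
        note cu = conormal_mapsD(1)[OF uv(1) ip(1)[OF mn(2)]] and cv = conormal_mapsD(1)[OF uv(2) ip(1)[OF mn(2)]]
        show "\<beta> ?w z = \<beta> u z \<oplus>\<^bsub>N\<^esub> \<beta> v z"
          using mn ip(1)[OF mn(2)] ring_hom_add[OF h(1) cu cv] N.smult_l_distr[OF hc[OF cu] hc[OF cv] mn(3)]
          by (simp add: \<beta>_def)
      qed (use \<beta>c uv in auto)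
      then show "cong_mod (ring_module R) X (\<Psi> ?w \<phi>) (\<Psi> u \<phi> \<oplus>\<^bsub>ring_module R\<^esub> \<Psi> v \<phi>)"
        using rq_lin(1)[OF \<gamma>c[OF uv(1) \<phi>] \<gamma>c[OF uv(2) \<phi>]] \<phi> by (simp add: \<Psi>_def)
    next
      fix r u assume r: "r \<in> carrier R" and u: "u \<in> conormal_maps"
      let ?w = "r \<odot>\<^bsub>map_module I (ring_module R)\<^esub> u"
      have w: "?w \<in> conormal_maps" using MI.submoduleE(4)[OF CM(1) r u] .
      have "\<gamma> ?w \<phi> = h r \<odot>\<^bsub>N\<^esub> \<gamma> u \<phi>"
        unfolding \<gamma>_def
      proof (rule B.free_lift_smult[OF N _ hc[OF r] _ \<phi>])
        fix z assume z: "z \<in> carrier M \<times> carrier N"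
        then obtain m n where mn: "z = (m, n)" "m \<in> carrier M" "n \<in> carrier N" by blast
        note cu = conormal_mapsD(1)[OF u ip(1)[OF mn(2)]]
        show "\<beta> ?w z = h r \<odot>\<^bsub>N\<^esub> \<beta> u z"
          using mn ip(1)[OF mn(2)] ring_hom_mult[OF h(1) r cu] N.smult_assoc1[OF hc[OF r] hc[OF cu] mn(3)]
          by (simp add: \<beta>_def)
      qed (use \<beta>c u in auto)
      then show "cong_mod (ring_module R) X (\<Psi> ?w \<phi>) (r \<odot>\<^bsub>ring_module R\<^esub> \<Psi> u \<phi>)"
        using rq_lin(2)[OF \<gamma>c[OF u \<phi>] \<gamma>c[OF u \<phi>] r] \<phi> by (simp add: \<Psi>_def)
    qed
  qed
  have \<Psi>e: "cong_mod (ring_module R) X (\<Psi> u (?e i a)) (u i \<otimes> a)" if u: "u \<in> conormal_maps" and i: "i \<in> I" and a: "a \<in> I'" for u i a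
  proof -
    note c = conormal_mapsD(1)[OF u]
    have j: "ip (p i) \<in> I" "p (ip (p i)) = p i" using ip[OF pc[OF i]] by auto
    have "u (ip (p i)) \<ominus> u i \<in> I" by (rule conormal_maps_cong[OF u j(1) i p(4)[OF j(1) i j(2)]])
    then have "h (u (ip (p i))) \<odot>\<^bsub>N\<^esub> q a = h (u i) \<odot>\<^bsub>N\<^esub> q a" by (rule hN[OF c[OF j(1)] c[OF i] _ qc[OF a]])
    then have 1: "\<gamma> u (?e i a) = q (u i \<otimes> a)" using \<gamma>gen[OF u pc[OF i] qc[OF a]] q(3)[OF c[OF i] a] by simp
    have ua: "u i \<otimes> a \<in> I'" using idealE(5)[OF I'_ideal c[OF i] a] .
    have "cong_mod (ring_module R) X (rq (q (u i \<otimes> a))) (u i \<otimes> a)"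
      by (rule qcong) (use rq qc[OF ua] ua in auto)
    then show ?thesis using ec[OF i a] by (simp add: \<Psi>_def 1)
  qed
  have ker: "{u \<in> conormal_maps. \<Psi> u \<in> carrier ?G \<rightarrow>\<^sub>E X} = I \<rightarrow>\<^sub>E I"
  proof (intro equalityI subsetI)
    fix u assume "u \<in> {u \<in> conormal_maps. \<Psi> u \<in> carrier ?G \<rightarrow>\<^sub>E X}"
    then have u: "u \<in> conormal_maps" and \<Psi>u: "\<Psi> u \<in> carrier ?G \<rightarrow>\<^sub>E X" by auto
    have "u i \<in> I" if i: "i \<in> I" for i
    proof (rule mem_I[OF conormal_mapsD(1)[OF u i]])
      fix a assume a: "a \<in> I'"
      have "\<Psi> u (?e i a) \<in> X" using PiE_const_mem[OF \<Psi>u] ec[OF i a] by simp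
      then show "u i \<otimes> a \<in> X" using rm.cong_mem[OF sX order_refl \<Psi>e[OF u i a]] by blast
    qed
    then show "u \<in> I \<rightarrow>\<^sub>E I" using conormal_mapsD(2)[OF u] by (simp add: PiE_def Pi_iff)
  next
    fix u assume uI: "u \<in> I \<rightarrow>\<^sub>E I"
    then have u: "u \<in> conormal_maps" using CM(3) by blast
    have "submodule {\<phi> \<in> carrier ?F. \<gamma> u \<phi> \<in> {\<zero>\<^bsub>N\<^esub>}} B ?F"
      by (rule submodule_preimage[OF F.module_axioms N F.carrier_is_submodule N.zero_submodule \<gamma>lin[OF u] N.zero_submodule order_refl])
    then have "{\<phi> \<in> carrier ?F. \<gamma> u \<phi> \<in> {\<zero>\<^bsub>N\<^esub>}} = carrier ?F"
    proof (rule gens)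
      fix i a assume ia: "i \<in> I" "a \<in> I'"
      have "u (ip (p i)) \<in> I" using PiE_const_mem[OF uI] ip(1)[OF pc[OF ia(1)]] by simp
      then show "?e i a \<in> {\<phi> \<in> carrier ?F. \<gamma> u \<phi> \<in> {\<zero>\<^bsub>N\<^esub>}}"
        using \<gamma>gen[OF u pc[OF ia(1)] qc[OF ia(2)]] xN[OF _ qc[OF ia(2)]] ec[OF ia] by simp
    qed
    then have "\<gamma> u \<phi> = \<zero>\<^bsub>N\<^esub>" if "\<phi> \<in> carrier ?F" for \<phi> using that by blast
    then have "\<Psi> u \<in> carrier ?G \<rightarrow>\<^sub>E X" using rq[OF N.M.zero_closed] q(4) by (auto simp: \<Psi>_def)
    then show "u \<in> {u \<in> conormal_maps. \<Psi> u \<in> carrier ?G \<rightarrow>\<^sub>E X}" using u by blast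
  qed
  have onto: "\<exists>u\<in>conormal_maps. cong_mod ?MF (carrier ?G \<rightarrow>\<^sub>E X) f (\<Psi> u)" if f: "f \<in> ?V" for f
  proof -
    have fl: "linear_mod R ?G (ring_module R) (carrier ?G) X f" and fK: "f ` ?K \<subseteq> X" and ff: "f \<in> carrier ?G \<rightarrow>\<^sub>E carrier R"
      using f by (auto simp: dual_maps_def)
    have fc: "f \<phi> \<in> carrier R" if "\<phi> \<in> carrier ?F" for \<phi> using PiE_const_mem[OF ff] that by simp
    have fa: "cong_mod (ring_module R) X (f (\<phi> \<oplus>\<^bsub>?F\<^esub> \<psi>)) (f \<phi> \<oplus> f \<psi>)" if "\<phi> \<in> carrier ?F" "\<psi> \<in> carrier ?F" for \<phi> \<psi>
      using fl that by (simp add: linear_mod_def del: free_module_simps)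
    have fs: "cong_mod (ring_module R) X (f (h r \<odot>\<^bsub>?F\<^esub> \<phi>)) (r \<otimes> f \<phi>)" if "r \<in> carrier R" "\<phi> \<in> carrier ?F" for r \<phi>
      using fl that by (simp add: linear_mod_def del: free_module_simps)
    have fcong: "cong_mod (ring_module R) X (f \<phi>) (f \<psi>)" if c: "cong_mod ?F ?K \<phi> \<psi>" for \<phi> \<psi>
    proof -
      have p: "\<phi> \<in> carrier ?F" "\<psi> \<in> carrier ?F" "\<phi> \<ominus>\<^bsub>?F\<^esub> \<psi> \<in> ?K" using c by (auto simp: cong_mod_def)
      note d = F.M.minus_closed[OF p(1,2)]
      have "cong_mod (ring_module R) X (f \<phi>) (f (\<phi> \<ominus>\<^bsub>?F\<^esub> \<psi>) \<oplus> f \<psi>)"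
        using fa[OF d p(2)] F.minus_plus_cancel[OF p(1,2)] by (simp only:)
      moreover have f0: "cong_mod (ring_module R) X (f (\<phi> \<ominus>\<^bsub>?F\<^esub> \<psi>)) \<zero>"
        using rm.cong_zero_iff[OF sX] fc[OF d] fK p(3) by auto
      then have "cong_mod (ring_module R) X (f (\<phi> \<ominus>\<^bsub>?F\<^esub> \<psi>) \<oplus> f \<psi>) (\<zero> \<oplus> f \<psi>)"
        using rm.cong_add[OF sX f0 rm.cong_refl[OF sX, of "f \<psi>"]] fc[OF p(2)] by simp
      ultimately show ?thesis using rm.cong_trans[OF sX] fc[OF p(2)] by simp
    qed
    \<comment> \<open>for fixed i, f is a multiplication in its second argument, by an element that is unique modulo I\<close>
    have ex: "\<exists>c\<in>carrier R. \<forall>a\<in>I'. cong_mod (ring_module R) X (f (?e i a)) (c \<otimes> a)" if i: "i \<in> I" for i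
    proof -
      have "linear_mod R (ring_module R) (ring_module R) I' X (\<lambda>a. f (?e i a))"
        unfolding linear_mod_def
      proof (intro conjI ballI)
        fix a b assume ab: "a \<in> I'" "b \<in> I'"
        show "f (?e i a) \<in> carrier (ring_module R)" using fc[OF ec[OF i ab(1)]] by simp
        show "cong_mod (ring_module R) X (f (?e i (a \<oplus>\<^bsub>ring_module R\<^esub> b))) (f (?e i a) \<oplus>\<^bsub>ring_module R\<^esub> f (?e i b))"
          using rm.cong_trans[OF sX fcong[OF e_add2[OF i ab]] fa[OF ec[OF i ab(1)] ec[OF i ab(2)]]] by simp
      next
        fix r a assume ra: "r \<in> carrier R" "a \<in> I'"
        show "cong_mod (ring_module R) X (f (?e i (r \<odot>\<^bsub>ring_module R\<^esub> a))) (r \<odot>\<^bsub>ring_module R\<^esub> f (?e i a))"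
          using rm.cong_trans[OF sX fcong[OF e_sm2[OF ra(1) i ra(2)]] fs[OF ra(1) ec[OF i ra(2)]]] by simp
      qed
      moreover have "f (?e i x) \<in> X" using fK e_X[OF i Xp(2) xI'] by blast
      ultimately obtain c where "c \<in> carrier R" "\<forall>a\<in>I'. f (?e i a) \<ominus> c \<otimes> a \<in> X"
        using self_injective[OF regular_x I'_ideal xI'] by blast
      then show ?thesis using fc[OF ec[OF i]] I'c by (intro bexI[of _ c]) (auto simp: cong_mod_def)
    qed
    define u where "u = (\<lambda>i\<in>I. SOME c. c \<in> carrier R \<and> (\<forall>a\<in>I'. cong_mod (ring_module R) X (f (?e i a)) (c \<otimes> a)))"
    have u: "u i \<in> carrier R" "\<And>a. a \<in> I' \<Longrightarrow> cong_mod (ring_module R) X (f (?e i a)) (u i \<otimes> a)" if i: "i \<in> I" for i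
    proof -
      have "\<exists>c. c \<in> carrier R \<and> (\<forall>a\<in>I'. cong_mod (ring_module R) X (f (?e i a)) (c \<otimes> a))" using ex[OF i] by blast
      from someI_ex[OF this] i
      show "u i \<in> carrier R" "\<And>a. a \<in> I' \<Longrightarrow> cong_mod (ring_module R) X (f (?e i a)) (u i \<otimes> a)" by (simp_all add: u_def)
    qed
    have diffI: "b \<ominus> c \<in> I" if bc: "b \<in> carrier R" "c \<in> carrier R" and d: "\<And>a. a \<in> I' \<Longrightarrow> cong_mod (ring_module R) X (b \<otimes> a) (c \<otimes> a)" for b c
    proof (rule mem_I)
      fix a assume a: "a \<in> I'"
      have "(b \<ominus> c) \<otimes> a = b \<otimes> a \<ominus> c \<otimes> a" using bc I'c[OF a] by algebra
      then show "(b \<ominus> c) \<otimes> a \<in> X" using d[OF a] by (simp add: cong_mod_def)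
    qed (use bc in simp)
    have "linear_mod R (ring_module R) (ring_module R) I I u"
      unfolding linear_mod_ring_iff[OF idealE(1)[OF I]]
    proof (intro conjI ballI)
      fix i j assume ij: "i \<in> I" "j \<in> I"
      note s = idealE(3)[OF I ij]
      show "u i \<in> carrier R" "u (i \<oplus> j) \<in> carrier R" using u(1) ij s by auto
      show "u (i \<oplus> j) \<ominus> (u i \<oplus> u j) \<in> I"
      proof (rule diffI)
        fix a assume a: "a \<in> I'"
        note k1 = rm.cong_sym[OF sX u(2)[OF s a]]
        note k2 = rm.cong_trans[OF sX fcong[OF e_add1[OF ij a]] fa[OF ec[OF ij(1) a] ec[OF ij(2) a]]]
        have k3: "cong_mod (ring_module R) X (f (?e i a) \<oplus> f (?e j a)) (u i \<otimes> a \<oplus> u j \<otimes> a)"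
          using rm.cong_add[OF sX u(2)[OF ij(1) a] u(2)[OF ij(2) a]] by simp
        show "cong_mod (ring_module R) X (u (i \<oplus> j) \<otimes> a) ((u i \<oplus> u j) \<otimes> a)"
          using rm.cong_trans[OF sX rm.cong_trans[OF sX k1 k2] k3] l_distr[OF u(1)[OF ij(1)] u(1)[OF ij(2)] I'c[OF a]] by simp
      qed (use u(1) ij s in auto)
    next
      fix r i assume r: "r \<in> carrier R" and i: "i \<in> I"
      note s = idealE(5)[OF I r i]
      show "u (r \<otimes> i) \<in> carrier R" using u(1)[OF s] .
      show "u (r \<otimes> i) \<ominus> r \<otimes> u i \<in> I"
      proof (rule diffI)
        fix a assume a: "a \<in> I'"
        note k1 = rm.cong_sym[OF sX u(2)[OF s a]]
        note k2 = rm.cong_trans[OF sX fcong[OF e_sm1[OF r i a]] fs[OF r ec[OF i a]]]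
        have k3: "cong_mod (ring_module R) X (r \<otimes> f (?e i a)) (r \<otimes> (u i \<otimes> a))"
          using rm.cong_smult[OF sX u(2)[OF i a] r] by simp
        show "cong_mod (ring_module R) X (u (r \<otimes> i) \<otimes> a) (r \<otimes> u i \<otimes> a)"
          using rm.cong_trans[OF sX rm.cong_trans[OF sX k1 k2] k3] m_assoc[OF r u(1)[OF i] I'c[OF a]] by simp
      qed (use u(1) i s r in auto)
    qed
    then have uC: "u \<in> conormal_maps" unfolding conormal_maps_def using u(1) by (auto simp: u_def)
    have \<Psi>ul: "linear_mod R ?G (ring_module R) (carrier ?G) X (\<Psi> u)" using \<Psi>V[OF uC] by (simp add: dual_maps_def)
    have "submodule {\<phi> \<in> carrier ?G. cong_mod (ring_module R) X (f \<phi>) (\<Psi> u \<phi>)} B ?F"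
      using linear_cong_submodule[OF Gm ring_module_module G.carrier_is_submodule sX fl \<Psi>ul] sub_iff by blast
    then have "{\<phi> \<in> carrier ?G. cong_mod (ring_module R) X (f \<phi>) (\<Psi> u \<phi>)} = carrier ?F"
    proof (rule gens)
      fix i a assume ia: "i \<in> I" "a \<in> I'"
      have "cong_mod (ring_module R) X (f (?e i a)) (\<Psi> u (?e i a))"
        by (rule rm.cong_trans[OF sX u(2)[OF ia] rm.cong_sym[OF sX \<Psi>e[OF uC ia]]])
      then show "?e i a \<in> {\<phi> \<in> carrier ?G. cong_mod (ring_module R) X (f \<phi>) (\<Psi> u \<phi>)}" using ec[OF ia] by simp
    qed
    then have all: "cong_mod (ring_module R) X (f \<phi>) (\<Psi> u \<phi>)" if "\<phi> \<in> carrier ?G" for \<phi>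
    proof -
      have "\<phi> \<in> carrier ?F" using that by simp
      then have "\<phi> \<in> {\<phi> \<in> carrier ?G. cong_mod (ring_module R) X (f \<phi>) (\<Psi> u \<phi>)}"
        using \<open>{\<phi> \<in> carrier ?G. cong_mod (ring_module R) X (f \<phi>) (\<Psi> u \<phi>)} = carrier ?F\<close> by (simp only:)
      then show ?thesis by (elim CollectE conjE)
    qed
    have ff': "f \<in> carrier ?G \<rightarrow>\<^sub>E carrier (ring_module R)" "\<Psi> u \<in> carrier ?G \<rightarrow>\<^sub>E carrier (ring_module R)"
      using ff \<Psi>c[OF uC] by simp_all
    have "cong_mod ?MF (carrier ?G \<rightarrow>\<^sub>E X) f (\<Psi> u)"
      using cong_mod_maps_iff[OF ring_module_module sX ff'] all by blast
    then show ?thesis using uC by blast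
  qed
  have "len R (map_module I (ring_module R)) {u \<in> conormal_maps. \<Psi> u \<in> carrier ?G \<rightarrow>\<^sub>E X} conormal_maps
      = len R ?MF (carrier ?G \<rightarrow>\<^sub>E X) ?V"
    by (rule len_transfer[OF MIm MFm CM(1) V(2,1,3) \<Psi>lin \<Psi>V onto])
  then have "len R (map_module I (ring_module R)) (I \<rightarrow>\<^sub>E I) conormal_maps = len R ?G ?K (carrier ?G)"
    unfolding ker dual .
  also have "\<dots> = len B ?F ?K (carrier ?F)" by (simp add: len_restrict_scalars[OF is_cring h F.module_axioms])
  also have "\<dots> = module_length B (tensor_module B M N)"
    unfolding tensor_module_eq by (rule len_quot_module[OF F.module_axioms K, symmetric])
  also have "\<dots> = module_length R (restrict_scalars h (tensor_module B M N))"
    unfolding tensor_module_eq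
    by (rule module_length_restrict_scalars[OF is_cring h quot_module_module[OF F.module_axioms K], symmetric])
  finally show ?thesis by simp
qed

end

lemma ideal_module_eq: "ideal_module R J = (ring_module R)\<lparr>carrier := J\<rparr>"
  by (simp add: ideal_module_def)

lemma ideal_module_simps [simp]:
  "carrier (ideal_module R J) = J" "\<zero>\<^bsub>ideal_module R J\<^esub> = \<zero>\<^bsub>R\<^esub>"
  "a \<oplus>\<^bsub>ideal_module R J\<^esub> b = a \<oplus>\<^bsub>R\<^esub> b" "a \<odot>\<^bsub>ideal_module R J\<^esub> b = a \<otimes>\<^bsub>R\<^esub> b"
  by (simp_all add: ideal_module_def ring_module_def)

lemma (in cring) minus_plus_cancel_ring:
  "a \<in> carrier R \<Longrightarrow> b \<in> carrier R \<Longrightarrow> d \<in> carrier R \<Longrightarrow> d \<oplus> b = a \<Longrightarrow> a \<ominus> b = d"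
  by (erule subst) algebra

lemma PiE_mem_Pi: "f \<in> A \<rightarrow>\<^sub>E B \<Longrightarrow> f \<in> A \<rightarrow> B"
  by (auto simp: PiE_def)

lemma (in cring) ideal_module_module: "ideal J R \<Longrightarrow> module R (ideal_module R J)"
  unfolding ideal_module_eq ideal_iff_submodule
  by (rule submodule.submodule_is_module[OF _ ring_module_module])

lemma (in cring) submodule_ideal_module:
  assumes "ideal J R" shows "submodule P R (ideal_module R J) \<longleftrightarrow> ideal P R \<and> P \<subseteq> J"
  unfolding ideal_module_eq ideal_iff_submodule
  by (rule module.submodule_of_submodule_iff[OF ring_module_module assms[unfolded ideal_iff_submodule]])

lemma (in cring) module_length_ideal_quotient:
  assumes J: "ideal J R" and P: "ideal P R" "P \<subseteq> J"
  shows "module_length R (quot_module (ideal_module R J) P) = ilen R P J"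
proof -
  have "module_length R (quot_module (ideal_module R J) P) = len R (ideal_module R J) P J"
    using len_quot_module[OF ideal_module_module[OF J], of P] submodule_ideal_module[OF J] P by simp
  then show ?thesis
    unfolding ideal_module_eq
    using module.len_of_submodule[OF ring_module_module J[unfolded ideal_iff_submodule] order_refl] by simp
qed

context gorenstein_ideal begin

interpretation rm: module R "ring_module R" by (rule ring_module_module)

abbreviation IM where "IM \<equiv> ideal_module R I"

lemmas IM = ideal_module_module[OF I]

lemma conormal_presentation:
  defines "M \<equiv> conormal_module R I" and "p \<equiv> (\<lambda>i. ideal_prod R I I +>\<^bsub>IM\<^esub> i)"
  shows "module R M" "p ` I = carrier M"
    "\<And>i j. i \<in> I \<Longrightarrow> j \<in> I \<Longrightarrow> p (i \<oplus> j) = p i \<oplus>\<^bsub>M\<^esub> p j"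
    "\<And>r i. r \<in> carrier R \<Longrightarrow> i \<in> I \<Longrightarrow> p (r \<otimes> i) = r \<odot>\<^bsub>M\<^esub> p i"
    "\<And>i j. i \<in> I \<Longrightarrow> j \<in> I \<Longrightarrow> p i = p j \<Longrightarrow> i \<ominus> j \<in> ideal_prod R I I"
    "\<And>i. i \<in> I \<Longrightarrow> p i = \<zero>\<^bsub>M\<^esub> \<longleftrightarrow> i \<in> ideal_prod R I I"
proof -
  have Q: "submodule (ideal_prod R I I) R IM"
    using submodule_ideal_module[OF I] ideal_prod_is_ideal[OF I I] ideal_prod_inter[OF I I] by simp
  have Qi: "ideal (ideal_prod R I I) R" "ideal_prod R I I \<subseteq> I" using ideal_prod_is_ideal[OF I I] ideal_prod_inter[OF I I] by auto
  show "module R M" unfolding M_def conormal_module_def by (rule quot_module_module[OF IM Q])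
  show "p ` I = carrier M" unfolding M_def conormal_module_def p_def quot_module_carrier[OF IM Q] by simp
  show "p (i \<oplus> j) = p i \<oplus>\<^bsub>M\<^esub> p j" if "i \<in> I" "j \<in> I" for i j
    unfolding M_def conormal_module_def p_def using quot_module_add[OF IM Q, of i j] that by simp
  show "p (r \<otimes> i) = r \<odot>\<^bsub>M\<^esub> p i" if "r \<in> carrier R" "i \<in> I" for r i
    unfolding M_def conormal_module_def p_def using quot_module_smult[OF IM Q, of r i] that by simp
  show z: "p i = \<zero>\<^bsub>M\<^esub> \<longleftrightarrow> i \<in> ideal_prod R I I" if "i \<in> I" for i
    unfolding M_def conormal_module_def p_def using coset_self_iff[OF IM Q, of i] that by (simp add: quot_module_def)
  show "i \<ominus> j \<in> ideal_prod R I I" if ij: "i \<in> I" "j \<in> I" "p i = p j" for i j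
  proof -
    have "cong_mod IM (ideal_prod R I I) i j"
      using coset_eq_iff[OF IM Q, of i j] ij by (simp add: p_def)
    then have "i \<ominus>\<^bsub>IM\<^esub> j \<in> ideal_prod R I I" by (simp add: cong_mod_def)
    interpret M: module R IM by (rule IM)
    have "(i \<ominus>\<^bsub>IM\<^esub> j) \<oplus>\<^bsub>IM\<^esub> j = i" by (rule M.minus_plus_cancel) (use ij in auto)
    moreover have "i \<ominus>\<^bsub>IM\<^esub> j \<in> carrier R" using \<open>i \<ominus>\<^bsub>IM\<^esub> j \<in> _\<close> idealE(1)[OF Qi(1)] by auto
    ultimately have "i \<ominus> j = i \<ominus>\<^bsub>IM\<^esub> j"
      by (intro minus_plus_cancel_ring[OF Ic[OF ij(1)] Ic[OF ij(2)]]) simp_all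
    then show ?thesis using \<open>i \<ominus>\<^bsub>IM\<^esub> j \<in> ideal_prod R I I\<close> by simp
  qed
qed

text \<open>The tensor product over R/I and the one over R are both instances of the lemma above, for the
  residue map and for the identity of R.\<close>
lemma conormal_tensor_lengths:
  "module_length R (conormal_tensor_canonical R I) = len R (map_module I (ring_module R)) (I \<rightarrow>\<^sub>E I) conormal_maps"
  "module_length R (tensor_module R (conormal_module R I) (canonical_module R I)) =
     len R (map_module I (ring_module R)) (I \<rightarrow>\<^sub>E I) conormal_maps"
proof -
  let ?M = "conormal_module R I" and ?N = "canonical_module R I"
  let ?p = "\<lambda>i. ideal_prod R I I +>\<^bsub>IM\<^esub> i"
  note p = conormal_presentation
  obtain q where q: "q ` I' = carrier ?N" "\<And>a b. a \<in> I' \<Longrightarrow> b \<in> I' \<Longrightarrow> q (a \<oplus> b) = q a \<oplus>\<^bsub>?N\<^esub> q b"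
     "\<And>r a. r \<in> carrier R \<Longrightarrow> a \<in> I' \<Longrightarrow> q (r \<otimes> a) = r \<odot>\<^bsub>?N\<^esub> q a" "\<And>a. a \<in> I' \<Longrightarrow> q a = \<zero>\<^bsub>?N\<^esub> \<longleftrightarrow> a \<in> X"
    by (rule canonical_module_presentation) (rule that)
  note N = canonical_module_module
  have "module_length R (restrict_scalars (\<lambda>a. a) (tensor_module R ?M ?N))
      = len R (map_module I (ring_module R)) (I \<rightarrow>\<^sub>E I) conormal_maps"
  proof (rule tensor_length[OF is_cring _ _ p(1) N, where p = ?p and q = q])
    show "(\<lambda>a. a) \<in> ring_hom R R" by (simp add: ring_hom_def)
    show "(\<lambda>a. a) ` carrier R = carrier R" by simp
    show "?p ` I = carrier ?M" by (rule p(2))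
    show "q ` I' = carrier ?N" by (rule q(1))
    show "?p (i \<oplus> j) = ?p i \<oplus>\<^bsub>?M\<^esub> ?p j" if "i \<in> I" "j \<in> I" for i j by (rule p(3)[OF that])
    show "?p (r \<otimes> i) = r \<odot>\<^bsub>?M\<^esub> ?p i" if "r \<in> carrier R" "i \<in> I" for r i by (rule p(4)[OF that])
    show "q (a \<oplus> b) = q a \<oplus>\<^bsub>?N\<^esub> q b" if "a \<in> I'" "b \<in> I'" for a b by (rule q(2)[OF that])
    show "q (r \<otimes> a) = r \<odot>\<^bsub>?N\<^esub> q a" if "r \<in> carrier R" "a \<in> I'" for r a by (rule q(3)[OF that])
    show "q a = \<zero>\<^bsub>?N\<^esub> \<longleftrightarrow> a \<in> X" if "a \<in> I'" for a by (rule q(4)[OF that])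
  qed (rule p(5))
  then show "module_length R (tensor_module R ?M ?N) = len R (map_module I (ring_module R)) (I \<rightarrow>\<^sub>E I) conormal_maps"
    by (simp only: restrict_scalars_id)
  interpret I: ideal I R by (rule I)
  let ?h = "\<lambda>a. I +> a"
  have killM: "a \<odot>\<^bsub>?M\<^esub> m = \<zero>\<^bsub>?M\<^esub>" if a: "a \<in> I" and m: "m \<in> carrier ?M" for a m
  proof -
    have "m \<in> ?p ` I" unfolding p(2) by (rule m)
    then obtain i where i: "i \<in> I" "m = ?p i" by blast
    have "a \<otimes> i \<in> ideal_prod R I I" using a i(1) by (rule ideal_prod.prod)
    then have "?p (a \<otimes> i) = \<zero>\<^bsub>?M\<^esub>" using p(6) idealE(5)[OF I Ic[OF a] i(1)] by simp
    then show ?thesis using p(4)[OF Ic[OF a] i(1)] i(2) by simp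
  qed
  have killN: "a \<odot>\<^bsub>?N\<^esub> n = \<zero>\<^bsub>?N\<^esub>" if a: "a \<in> I" and n: "n \<in> carrier ?N" for a n
  proof -
    have "n \<in> q ` I'" unfolding q(1) by (rule n)
    then obtain b where b: "b \<in> I'" "n = q b" by blast
    have "q (a \<otimes> b) = \<zero>\<^bsub>?N\<^esub>" using q(4)[OF idealE(5)[OF I'_ideal Ic[OF a] b(1)]] I_I'[OF a b(1)] by blast
    then show ?thesis using q(3)[OF Ic[OF a] b(1)] b(2) by simp
  qed
  have car: "?h ` carrier R = carrier (R Quot I)" by (auto simp: FactRing_def A_RCOSETS_def')
  have oM: "module (R Quot I) (over_quotient ?M)" by (rule over_quotient_module[OF p(1) I]) (rule killM)
  have oN: "module (R Quot I) (over_quotient ?N)" by (rule over_quotient_module[OF N I]) (rule killN)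
  have sM: "?h r \<odot>\<^bsub>over_quotient ?M\<^esub> m = r \<odot>\<^bsub>?M\<^esub> m" if "r \<in> carrier R" "m \<in> carrier ?M" for r m
    by (rule over_quotient_smult[OF p(1) I _ that]) (rule killM)
  have sN: "?h r \<odot>\<^bsub>over_quotient ?N\<^esub> n = r \<odot>\<^bsub>?N\<^esub> n" if "r \<in> carrier R" "n \<in> carrier ?N" for r n
    by (rule over_quotient_smult[OF N I _ that]) (rule killN)
  show "module_length R (conormal_tensor_canonical R I) = len R (map_module I (ring_module R)) (I \<rightarrow>\<^sub>E I) conormal_maps"
    unfolding conormal_tensor_canonical_def
  proof (rule tensor_length[OF I.quotient_is_cring[OF is_cring] I.rcos_ring_hom car oM oN, where p = ?p and q = q])
    show "?p ` I = carrier (over_quotient ?M)" using p(2) by simp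
    show "q ` I' = carrier (over_quotient ?N)" using q(1) by simp
    show "?p (i \<oplus> j) = ?p i \<oplus>\<^bsub>over_quotient ?M\<^esub> ?p j" if "i \<in> I" "j \<in> I" for i j using p(3)[OF that] by simp
    show "q (a \<oplus> b) = q a \<oplus>\<^bsub>over_quotient ?N\<^esub> q b" if "a \<in> I'" "b \<in> I'" for a b using q(2)[OF that] by simp
    show "?p (r \<otimes> i) = ?h r \<odot>\<^bsub>over_quotient ?M\<^esub> ?p i" if "r \<in> carrier R" "i \<in> I" for r i
    proof -
      have "?p i \<in> carrier ?M" unfolding p(2)[symmetric] using that(2) by (rule imageI)
      then show ?thesis using sM[OF that(1)] p(4)[OF that] by simp
    qed
    show "q (r \<otimes> a) = ?h r \<odot>\<^bsub>over_quotient ?N\<^esub> q a" if "r \<in> carrier R" "a \<in> I'" for r a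
    proof -
      have "q a \<in> carrier ?N" unfolding q(1)[symmetric] using that(2) by (rule imageI)
      then show ?thesis using sN[OF that(1)] q(3)[OF that] by simp
    qed
    show "q a = \<zero>\<^bsub>over_quotient ?N\<^esub> \<longleftrightarrow> a \<in> X" if "a \<in> I'" for a using q(4)[OF that] by simp
  qed (rule p(5))
qed

section \<open>Self-extensions of the ideal\<close>

text \<open>The lifts of those maps from I to R/I that lift to maps from I to R.\<close>
definition scaled_maps where
  "scaled_maps = {u \<in> conormal_maps. \<exists>a\<in>I'. \<forall>i\<in>I. u i \<ominus> xdiv (a \<otimes> i) \<in> I}"

text \<open>The image of S in I', that is xS, if I' is identified with the dual of I as above.\<close>
abbreviation S' where "S' \<equiv> colon R {x \<otimes> i | i. i \<in> I} I"

lemma a_I: "a \<in> I' \<Longrightarrow> i \<in> I \<Longrightarrow> a \<otimes> i \<in> X"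
  by (simp add: colon_def)

lemma xdiv_mult_add:
  assumes a: "a \<in> I'" and i: "i \<in> I" "j \<in> I" shows "xdiv (a \<otimes> (i \<oplus> j)) = xdiv (a \<otimes> i) \<oplus> xdiv (a \<otimes> j)"
  using xdiv_add[OF a_I[OF a i(1)] a_I[OF a i(2)]] I'c[OF a] Ic[OF i(1)] Ic[OF i(2)] by (simp add: r_distr)

lemma xdiv_mult_smult:
  assumes a: "a \<in> I'" and i: "i \<in> I" and r: "r \<in> carrier R" shows "xdiv (a \<otimes> (r \<otimes> i)) = r \<otimes> xdiv (a \<otimes> i)"
  using xdiv_mult[OF a_I[OF a i] r] I'c[OF a] Ic[OF i] r by (simp add: m_lcomm)

text \<open>The connecting map from Hom(I, R/I) to Ext^1(I, I), with kernel the image of Hom(I, R), is onto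
  since Ext^1(I, R) vanishes. Explicitly, let sigma be the canonical cover of I and write e i for
  the generator over i. The connecting map sends u to the restriction to the relations of the
  linear map L u with value u i at e i. Conversely let f be a map on the relations. Then x f
  extends to the free module, as the map that sends phi to f(x phi - sigma(phi) e x). Its
  values w i on the generators are linear modulo X, so by self-injectivity they have the form
  c i + x (u i), and f agrees with L u on the relations because x is regular.\<close>
lemma len_ext1_self:
  shows "submodule scaled_maps R (map_module I (ring_module R))"
    and "module_length R (ext1 R IM IM) = len R (map_module I (ring_module R)) scaled_maps conormal_maps"
proof -
  let ?F = "free_module R I" and ?K = "ext_relations R IM" and ?H = "ext_maps R IM IM" and ?B = "ext_trivial_maps R IM IM"
  let ?MI = "map_module I (ring_module R)"
  have H: "module R ?H" by (rule ext_maps_module[OF IM IM])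
  have B: "submodule ?B R ?H" by (rule ext_trivial_maps_submodule[OF IM IM])
  have MIm: "module R ?MI" by (rule map_module_module[OF ring_module_module])
  interpret H: module R ?H by (rule H)
  interpret F: module R ?F by (rule free_module_module)
  interpret MI: module R ?MI by (rule MIm)
  define \<sigma> where "\<sigma> = free_lift R IM (\<lambda>i. i)"
  note cover = canonical_cover[OF IM, unfolded ideal_module_simps, folded \<sigma>_def]
  note \<sigma>l = cover(1)[unfolded linear_mod_zero_iff[OF IM, unfolded ideal_module_simps]]
  have \<sigma>I: "\<sigma> \<phi> \<in> I" if "\<phi> \<in> carrier ?F" for \<phi> using \<sigma>l that by blast
  have \<sigma>a: "\<sigma> (\<phi> \<oplus>\<^bsub>?F\<^esub> \<psi>) = \<sigma> \<phi> \<oplus> \<sigma> \<psi>" if "\<phi> \<in> carrier ?F" "\<psi> \<in> carrier ?F" for \<phi> \<psi> using \<sigma>l that by blast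
  have \<sigma>s: "\<sigma> (r \<odot>\<^bsub>?F\<^esub> \<phi>) = r \<otimes> \<sigma> \<phi>" if "r \<in> carrier R" "\<phi> \<in> carrier ?F" for r \<phi> using \<sigma>l that by blast
  define e where "e i = free_gen R i" for i :: 'a
  have eF: "e i \<in> carrier ?F" if "i \<in> I" for i unfolding e_def by (rule free_gen_mem[OF that])
  have \<sigma>e: "\<sigma> (e i) = i" if "i \<in> I" for i unfolding e_def by (rule cover(2)[OF that])
  have K_iff: "\<phi> \<in> ?K \<longleftrightarrow> \<phi> \<in> carrier ?F \<and> \<sigma> \<phi> = \<zero>" for \<phi> by (simp add: ext_relations_def \<sigma>_def)
  have Kc: "\<phi> \<in> ?K \<Longrightarrow> \<phi> \<in> carrier ?F" for \<phi> using K_iff by blast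
  note Kcl = ext_relations_closed[OF IM, unfolded ideal_module_simps]
  note H_iff = ext_maps_carrier_iff[of _ R IM IM, unfolded ideal_module_simps]
  define L where "L u = free_lift R (ring_module R) u" for u :: "'a \<Rightarrow> 'a"
  have Llin: "linear_mod R ?F (ring_module R) (carrier ?F) {\<zero>\<^bsub>ring_module R\<^esub>} (L u)" if "u \<in> I \<rightarrow> carrier R" for u
    unfolding L_def by (rule free_lift_linear(1)[OF ring_module_module]) (use that in auto)
  have Le: "L u (e i) = u i" if "u \<in> I \<rightarrow> carrier R" "i \<in> I" for u i
    unfolding L_def e_def by (rule free_lift_linear(2)[OF ring_module_module _ that(2)]) (use that in auto)
  have L: "\<And>\<phi>. \<phi> \<in> carrier ?F \<Longrightarrow> L u \<phi> \<in> carrier R"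
    "\<And>\<phi> \<psi>. \<phi> \<in> carrier ?F \<Longrightarrow> \<psi> \<in> carrier ?F \<Longrightarrow> L u (\<phi> \<oplus>\<^bsub>?F\<^esub> \<psi>) = L u \<phi> \<oplus> L u \<psi>"
    "\<And>r \<phi>. r \<in> carrier R \<Longrightarrow> \<phi> \<in> carrier ?F \<Longrightarrow> L u (r \<odot>\<^bsub>?F\<^esub> \<phi>) = r \<otimes> L u \<phi>"
    if "u \<in> I \<rightarrow> carrier R" for u
    using Llin[OF that, unfolded linear_mod_zero_iff[OF ring_module_module], unfolded ring_module_simps] by blast+
  have gen_eq: "f \<phi> = g \<phi>" if \<phi>: "\<phi> \<in> carrier ?F"
    and f: "linear_mod R ?F (ring_module R) (carrier ?F) {\<zero>\<^bsub>ring_module R\<^esub>} f"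
    and g: "linear_mod R ?F (ring_module R) (carrier ?F) {\<zero>\<^bsub>ring_module R\<^esub>} g"
    and fg: "\<And>i. i \<in> I \<Longrightarrow> f (e i) = g (e i)" for f g \<phi>
  proof -
    have "cong_mod (ring_module R) {\<zero>\<^bsub>ring_module R\<^esub>} (f \<phi>) (g \<phi>)"
    proof (rule free_cong[OF ring_module_module rm.zero_submodule f g _ \<phi>])
      fix i assume i: "i \<in> I"
      have "f (e i) \<in> carrier (ring_module R)" using f eF[OF i] unfolding linear_mod_def by blast
      then show "cong_mod (ring_module R) {\<zero>\<^bsub>ring_module R\<^esub>} (f (free_gen R i)) (g (free_gen R i))"
        using fg[OF i] unfolding rm.cong_eq e_def by simp
    qed
    then show ?thesis unfolding rm.cong_eq by blast
  qed
  note CM = conormal_maps_submodule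
  \<comment> \<open>modulo I, the map L u is u composed with the cover, and hence takes relations into I\<close>
  have LI: "L u \<phi> \<in> I" if u: "u \<in> conormal_maps" and \<phi>: "\<phi> \<in> ?K" for u \<phi>
  proof -
    note c = conormal_mapsD(1)[OF u]
    have cP: "u \<in> I \<rightarrow> carrier R" using c by blast
    have g: "linear_mod R ?F (ring_module R) (carrier ?F) I (\<lambda>\<phi>. u (\<sigma> \<phi>))"
      unfolding linear_mod_def cong_mod_def
      using c \<sigma>I \<sigma>a \<sigma>s conormal_mapsD(3,4)[OF u] F.M.a_closed F.smult_closed idealE(3,5)[OF I]
      by (simp del: free_module_simps)
    have "cong_mod (ring_module R) I (L u \<phi>) (u (\<sigma> \<phi>))"
    proof (rule free_cong[OF ring_module_module sI linear_mod_weaken[OF Llin[OF cP]] g _ Kc[OF \<phi>]])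
      show "{\<zero>\<^bsub>ring_module R\<^esub>} \<subseteq> I" using idealE(2)[OF I] by simp
      fix i assume i: "i \<in> I"
      show "cong_mod (ring_module R) I (L u (free_gen R i)) (u (\<sigma> (free_gen R i)))"
        using Le[OF cP i] \<sigma>e[OF i] rm.cong_refl[OF sI, of "u i"] c[OF i] by (simp add: e_def)
    qed
    moreover have "u (\<sigma> \<phi>) \<in> I"
    proof -
      have "\<zero> \<in> ideal_prod R I I" using idealE(2)[OF ideal_prod_is_ideal[OF I I]] .
      then show ?thesis using conormal_maps_square[OF u] \<phi> K_iff by simp
    qed
    ultimately show ?thesis using rm.cong_mem[OF sI order_refl] by blast
  qed
  define \<Phi> where "\<Phi> u = (\<lambda>\<phi>\<in>?K. L u \<phi>)" for u
  have \<Phi>H: "\<Phi> u \<in> carrier ?H" if u: "u \<in> conormal_maps" for u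
    unfolding H_iff using LI[OF u] L[OF PiE_mem_Pi[OF conormal_mapsD(2)[OF u]]] Kcl Kc
    by (auto simp: \<Phi>_def simp del: free_module_simps)
  have \<Phi>lin: "linear_mod R ?MI ?H conormal_maps {\<zero>\<^bsub>?H\<^esub>} \<Phi>"
    unfolding linear_mod_zero_iff[OF H]
  proof (intro conjI ballI)
    fix u v assume uv: "u \<in> conormal_maps" "v \<in> conormal_maps"
    show "\<Phi> u \<in> carrier ?H" using \<Phi>H uv by simp
    have "L (u \<oplus>\<^bsub>?MI\<^esub> v) \<phi> = L u \<phi> \<oplus> L v \<phi>" if "\<phi> \<in> carrier ?F" for \<phi>
      using free_lift_add[OF ring_module_module, of I u v "u \<oplus>\<^bsub>?MI\<^esub> v", OF _ _ _ that] conormal_mapsD(1)[OF uv(1)] conormal_mapsD(1)[OF uv(2)]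
      by (simp add: L_def)
    then show "\<Phi> (u \<oplus>\<^bsub>?MI\<^esub> v) = \<Phi> u \<oplus>\<^bsub>?H\<^esub> \<Phi> v"
      using Kc by (auto simp: \<Phi>_def intro!: restrict_ext simp del: map_module_simps)
  next
    fix r u assume r: "r \<in> carrier R" and u: "u \<in> conormal_maps"
    have "L (r \<odot>\<^bsub>?MI\<^esub> u) \<phi> = r \<otimes> L u \<phi>" if "\<phi> \<in> carrier ?F" for \<phi>
      using free_lift_smult[OF ring_module_module, of I u r "r \<odot>\<^bsub>?MI\<^esub> u", OF _ r _ that] conormal_mapsD(1)[OF u]
      by (simp add: L_def)
    then show "\<Phi> (r \<odot>\<^bsub>?MI\<^esub> u) = r \<odot>\<^bsub>?H\<^esub> \<Phi> u"
      using Kc by (auto simp: \<Phi>_def intro!: restrict_ext simp del: map_module_simps)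
  qed
  \<comment> \<open>the Koszul relations between x and the elements of I; they detect whether L u extends\<close>
  define \<kappa> where "\<kappa> i = x \<odot>\<^bsub>?F\<^esub> e i \<oplus>\<^bsub>?F\<^esub> (\<ominus> i) \<odot>\<^bsub>?F\<^esub> e x" for i
  have \<kappa>K: "\<kappa> i \<in> ?K" if i: "i \<in> I" for i
  proof -
    have c: "x \<odot>\<^bsub>?F\<^esub> e i \<in> carrier ?F" "(\<ominus> i) \<odot>\<^bsub>?F\<^esub> e x \<in> carrier ?F"
      using F.smult_closed[OF xc eF[OF i]] F.smult_closed[OF _ eF[OF xI], of "\<ominus> i"] Ic[OF i] by auto
    have "\<sigma> (\<kappa> i) = x \<otimes> i \<oplus> (\<ominus> i) \<otimes> x"
      unfolding \<kappa>_def \<sigma>a[OF c] \<sigma>s[OF xc eF[OF i]] using \<sigma>s[OF _ eF[OF xI], of "\<ominus> i"] \<sigma>e[OF i] \<sigma>e[OF xI] Ic[OF i]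
      by (simp del: free_module_simps)
    also have "\<dots> = \<zero>" using xc Ic[OF i] by algebra
    finally show ?thesis unfolding K_iff \<kappa>_def using F.M.a_closed[OF c] by blast
  qed
  have ker: "{u \<in> conormal_maps. \<Phi> u \<in> ?B} = scaled_maps"
  proof (intro equalityI subsetI)
    fix u assume "u \<in> {u \<in> conormal_maps. \<Phi> u \<in> ?B}"
    then have u: "u \<in> conormal_maps" and "\<Phi> u \<in> ?B" by auto
    then obtain g where g: "g \<in> lin_maps R ?F IM" "\<Phi> u = restrict g ?K"
      unfolding ext_trivial_maps_def by auto
    note c = conormal_mapsD(1)[OF u]
    have cP: "u \<in> I \<rightarrow> carrier R" using c by blast
    have gI: "g \<phi> \<in> I" if "\<phi> \<in> carrier ?F" for \<phi> using g(1) that unfolding lin_maps_iff by auto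
    have ga: "g (\<phi> \<oplus>\<^bsub>?F\<^esub> \<psi>) = g \<phi> \<oplus> g \<psi>" if "\<phi> \<in> carrier ?F" "\<psi> \<in> carrier ?F" for \<phi> \<psi>
      using g(1) that unfolding lin_maps_iff by (simp del: free_module_simps)
    have gs: "g (r \<odot>\<^bsub>?F\<^esub> \<phi>) = r \<otimes> g \<phi>" if "r \<in> carrier R" "\<phi> \<in> carrier ?F" for r \<phi>
      using g(1) that unfolding lin_maps_iff by (simp del: free_module_simps)
    define a where "a = u x \<ominus> g (e x)"
    have gx: "g (e x) \<in> carrier R" using Ic[OF gI[OF eF[OF xI]]] .
    have ac: "a \<in> carrier R" unfolding a_def using c[OF xI] gx by simp
    have key: "x \<otimes> (u i \<ominus> g (e i)) = a \<otimes> i" if i: "i \<in> I" for i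
    proof -
      note ic = Ic[OF i] and ui = c[OF i] and ux = c[OF xI] and gi = Ic[OF gI[OF eF[OF i]]]
      have cc: "x \<odot>\<^bsub>?F\<^esub> e i \<in> carrier ?F" "(\<ominus> i) \<odot>\<^bsub>?F\<^esub> e x \<in> carrier ?F" "\<ominus> i \<in> carrier R"
        using F.smult_closed[OF xc eF[OF i]] F.smult_closed[OF _ eF[OF xI], of "\<ominus> i"] ic by auto
      have "L u (\<kappa> i) = g (\<kappa> i)"
        using fun_cong[OF g(2), of "\<kappa> i"] \<kappa>K[OF i] by (simp only: \<Phi>_def restrict_apply if_True)
      also have "L u (\<kappa> i) = x \<otimes> u i \<oplus> (\<ominus> i) \<otimes> u x"
        unfolding \<kappa>_def L(2)[OF cP cc(1,2)] L(3)[OF cP xc eF[OF i]] L(3)[OF cP cc(3) eF[OF xI]]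
          Le[OF cP i] Le[OF cP xI] ..
      also have "g (\<kappa> i) = x \<otimes> g (e i) \<oplus> (\<ominus> i) \<otimes> g (e x)"
        unfolding \<kappa>_def ga[OF cc(1,2)] gs[OF xc eF[OF i]] gs[OF cc(3) eF[OF xI]] ..
      finally have eq: "x \<otimes> u i \<oplus> (\<ominus> i) \<otimes> u x = x \<otimes> g (e i) \<oplus> (\<ominus> i) \<otimes> g (e x)" .
      have "x \<otimes> (u i \<ominus> g (e i)) = (x \<otimes> u i \<oplus> (\<ominus> i) \<otimes> u x) \<ominus> x \<otimes> g (e i) \<oplus> i \<otimes> u x"
        using xc ui gi ic ux by algebra
      also have "\<dots> = (u x \<ominus> g (e x)) \<otimes> i" unfolding eq using xc gi ic ux gx by algebra
      finally show ?thesis by (simp only: a_def)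
    qed
    have "a \<in> I'"
    proof -
      have "a \<otimes> i \<in> X" if i: "i \<in> I" for i
        unfolding key[OF i, symmetric] by (rule cgen_mem(2)[OF xc]) (use c[OF i] Ic[OF gI[OF eF[OF i]]] in simp)
      then show ?thesis using ac by (simp add: colon_def)
    qed
    moreover have "u i \<ominus> xdiv (a \<otimes> i) \<in> I" if i: "i \<in> I" for i
    proof -
      note ui = c[OF i] and gi = Ic[OF gI[OF eF[OF i]]]
      have "xdiv (a \<otimes> i) = u i \<ominus> g (e i)" by (rule xdiv_unique[OF _ key[OF i]]) (use ui gi in simp)
      then have "u i \<ominus> xdiv (a \<otimes> i) = g (e i)" using ui gi by (simp, algebra)
      then show ?thesis using gI[OF eF[OF i]] by simp
    qed
    ultimately show "u \<in> scaled_maps" using u unfolding scaled_maps_def by blast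
  next
    fix u assume "u \<in> scaled_maps"
    then obtain a where u: "u \<in> conormal_maps" and a: "a \<in> I'" and ua: "\<And>i. i \<in> I \<Longrightarrow> u i \<ominus> xdiv (a \<otimes> i) \<in> I"
      unfolding scaled_maps_def by blast
    note c = conormal_mapsD(1)[OF u]
    have cP: "u \<in> I \<rightarrow> carrier R" using c by blast
    define \<delta> where "\<delta> i = xdiv (a \<otimes> i)" for i
    define v where "v i = u i \<ominus> \<delta> i" for i
    have \<delta>c: "\<delta> i \<in> carrier R" if "i \<in> I" for i unfolding \<delta>_def using xdiv(1)[OF a_I[OF a that]] .
    have vI: "v i \<in> I" if "i \<in> I" for i unfolding v_def \<delta>_def using ua[OF that] .
    have vc: "\<And>i. i \<in> I \<Longrightarrow> v i \<in> carrier R" using vI Ic by blast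
    have \<delta>P: "\<delta> \<in> I \<rightarrow> carrier R" and vP: "v \<in> I \<rightarrow> carrier R" using \<delta>c vc by blast+
    have split: "L u \<phi> = L \<delta> \<phi> \<oplus> L v \<phi>" if \<phi>: "\<phi> \<in> carrier ?F" for \<phi>
    proof -
      have "u i = \<delta> i \<oplus> v i" if i: "i \<in> I" for i unfolding v_def using c[OF i] \<delta>c[OF i] by algebra
      then show ?thesis
        using free_lift_add[OF ring_module_module, of I \<delta> v u, OF _ _ _ \<phi>] \<delta>c vc by (simp add: L_def)
    qed
    have L\<delta>: "L \<delta> \<phi> = xdiv (a \<otimes> \<sigma> \<phi>)" if \<phi>: "\<phi> \<in> carrier ?F" for \<phi>
    proof (rule gen_eq[OF \<phi> Llin[OF \<delta>P]])
      show "linear_mod R ?F (ring_module R) (carrier ?F) {\<zero>\<^bsub>ring_module R\<^esub>} (\<lambda>\<phi>. xdiv (a \<otimes> \<sigma> \<phi>))"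
        unfolding linear_mod_zero_iff[OF ring_module_module]
        using \<sigma>I \<sigma>a \<sigma>s xdiv(1)[OF a_I[OF a]] xdiv_mult_add[OF a] xdiv_mult_smult[OF a]
        by (simp del: free_module_simps)
      fix i assume i: "i \<in> I"
      show "L \<delta> (e i) = xdiv (a \<otimes> \<sigma> (e i))" using Le[OF \<delta>P i] \<sigma>e[OF i] by (simp add: \<delta>_def)
    qed
    have xd0: "xdiv \<zero> = \<zero>" by (rule xdiv_unique) (use xc in simp_all)
    have LvI: "L v \<phi> \<in> I" if \<phi>: "\<phi> \<in> carrier ?F" for \<phi>
    proof -
      have "submodule {\<phi> \<in> carrier ?F. L v \<phi> \<in> I} R ?F"
        by (rule submodule_preimage[OF F.module_axioms ring_module_module F.carrier_is_submodule rm.zero_submodule Llin[OF vP] sI])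
           (use idealE(2)[OF I] in simp)
      then have "{\<phi> \<in> carrier ?F. L v \<phi> \<in> I} = carrier ?F"
        by (rule free_gen_induct) (use eF Le[OF vP] vI in \<open>simp add: e_def\<close>)
      then show ?thesis using \<phi> by blast
    qed
    define g where "g = (\<lambda>\<phi>\<in>carrier ?F. L v \<phi>)"
    have "g \<in> lin_maps R ?F IM"
      unfolding lin_maps_iff g_def using LvI L[OF vP] F.M.a_closed F.smult_closed
      by (simp del: free_module_simps)
    moreover have "\<Phi> u = restrict g ?K"
      unfolding \<Phi>_def
    proof (rule restrict_ext)
      fix \<phi> assume \<phi>: "\<phi> \<in> ?K"
      then have "a \<otimes> \<sigma> \<phi> = \<zero>" using K_iff I'c[OF a] by simp
      then show "L u \<phi> = g \<phi>" using split[OF Kc[OF \<phi>]] L\<delta>[OF Kc[OF \<phi>]] xd0 L(1)[OF vP Kc[OF \<phi>]] Kc[OF \<phi>]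
        by (simp add: g_def)
    qed
    ultimately have "\<Phi> u \<in> ?B" unfolding ext_trivial_maps_def by simp
    then show "u \<in> {u \<in> conormal_maps. \<Phi> u \<in> ?B}" using u by simp
  qed
  have B0: "{\<zero>\<^bsub>?H\<^esub>} \<subseteq> ?B" using H.submodule_zero[OF B] by blast
  note \<Phi>B = linear_mod_weaken[OF \<Phi>lin B0]
  show "submodule scaled_maps R ?MI"
    using submodule_preimage[OF MIm H CM(1) B \<Phi>B B order_refl] unfolding ker .
  have onto: "\<exists>u\<in>conormal_maps. cong_mod ?H ?B f (\<Phi> u)" if f: "f \<in> carrier ?H" for f
  proof -
    note f1 = f[unfolded H_iff]
    have fI: "f \<phi> \<in> I" if "\<phi> \<in> ?K" for \<phi> using f1 that by auto
    have fc: "f \<phi> \<in> carrier R" if "\<phi> \<in> ?K" for \<phi> using Ic[OF fI[OF that]] .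
    have fa: "f (\<phi> \<oplus>\<^bsub>?F\<^esub> \<psi>) = f \<phi> \<oplus> f \<psi>" if "\<phi> \<in> ?K" "\<psi> \<in> ?K" for \<phi> \<psi> using f1 that by blast
    have fs: "f (r \<odot>\<^bsub>?F\<^esub> \<phi>) = r \<otimes> f \<phi>" if "r \<in> carrier R" "\<phi> \<in> ?K" for r \<phi> using f1 that by blast
    \<comment> \<open>the values of f at these relations measure how far w and u are from being linear\<close>
    define \<rho> where "\<rho> i j = (e (i \<oplus> j) \<oplus>\<^bsub>?F\<^esub> (\<ominus> \<one>) \<odot>\<^bsub>?F\<^esub> e i) \<oplus>\<^bsub>?F\<^esub> (\<ominus> \<one>) \<odot>\<^bsub>?F\<^esub> e j" for i j
    define \<tau> where "\<tau> r i = e (r \<otimes> i) \<oplus>\<^bsub>?F\<^esub> (\<ominus> r) \<odot>\<^bsub>?F\<^esub> e i" for r i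
    have m1: "\<ominus> \<one> \<in> carrier R" by simp
    have \<rho>v: "\<rho> i j \<in> carrier ?F"
      "\<And>g. (\<And>\<phi> \<psi>. \<phi> \<in> carrier ?F \<Longrightarrow> \<psi> \<in> carrier ?F \<Longrightarrow> g (\<phi> \<oplus>\<^bsub>?F\<^esub> \<psi>) = g \<phi> \<oplus> g \<psi>) \<Longrightarrow>
        (\<And>r \<phi>. r \<in> carrier R \<Longrightarrow> \<phi> \<in> carrier ?F \<Longrightarrow> g (r \<odot>\<^bsub>?F\<^esub> \<phi>) = r \<otimes> g \<phi>) \<Longrightarrow>
        g (\<rho> i j) = (g (e (i \<oplus> j)) \<oplus> (\<ominus> \<one>) \<otimes> g (e i)) \<oplus> (\<ominus> \<one>) \<otimes> g (e j)"
      if ij: "i \<in> I" "j \<in> I" for i j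
    proof -
      note ei = eF[OF ij(1)] and ej = eF[OF ij(2)] and eij = eF[OF idealE(3)[OF I ij]]
      note si = F.smult_closed[OF m1 ei] and sj = F.smult_closed[OF m1 ej]
      show "\<rho> i j \<in> carrier ?F" unfolding \<rho>_def by (rule F.M.a_closed[OF F.M.a_closed[OF eij si] sj])
      fix g :: "('a \<Rightarrow> 'a) \<Rightarrow> 'a"
      assume ga: "\<And>\<phi> \<psi>. \<phi> \<in> carrier ?F \<Longrightarrow> \<psi> \<in> carrier ?F \<Longrightarrow> g (\<phi> \<oplus>\<^bsub>?F\<^esub> \<psi>) = g \<phi> \<oplus> g \<psi>"
        and gs: "\<And>r \<phi>. r \<in> carrier R \<Longrightarrow> \<phi> \<in> carrier ?F \<Longrightarrow> g (r \<odot>\<^bsub>?F\<^esub> \<phi>) = r \<otimes> g \<phi>"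
      show "g (\<rho> i j) = (g (e (i \<oplus> j)) \<oplus> (\<ominus> \<one>) \<otimes> g (e i)) \<oplus> (\<ominus> \<one>) \<otimes> g (e j)"
        unfolding \<rho>_def ga[OF F.M.a_closed[OF eij si] sj] ga[OF eij si] gs[OF m1 ei] gs[OF m1 ej] ..
    qed
    have \<tau>v: "\<tau> r i \<in> carrier ?F"
      "\<And>g. (\<And>\<phi> \<psi>. \<phi> \<in> carrier ?F \<Longrightarrow> \<psi> \<in> carrier ?F \<Longrightarrow> g (\<phi> \<oplus>\<^bsub>?F\<^esub> \<psi>) = g \<phi> \<oplus> g \<psi>) \<Longrightarrow>
        (\<And>r \<phi>. r \<in> carrier R \<Longrightarrow> \<phi> \<in> carrier ?F \<Longrightarrow> g (r \<odot>\<^bsub>?F\<^esub> \<phi>) = r \<otimes> g \<phi>) \<Longrightarrow>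
        g (\<tau> r i) = g (e (r \<otimes> i)) \<oplus> (\<ominus> r) \<otimes> g (e i)"
      if r: "r \<in> carrier R" and i: "i \<in> I" for r i
    proof -
      have mr: "\<ominus> r \<in> carrier R" using r by simp
      note ei = eF[OF i] and eri = eF[OF idealE(5)[OF I r i]]
      note si = F.smult_closed[OF mr ei]
      show "\<tau> r i \<in> carrier ?F" unfolding \<tau>_def by (rule F.M.a_closed[OF eri si])
      fix g :: "('a \<Rightarrow> 'a) \<Rightarrow> 'a"
      assume ga: "\<And>\<phi> \<psi>. \<phi> \<in> carrier ?F \<Longrightarrow> \<psi> \<in> carrier ?F \<Longrightarrow> g (\<phi> \<oplus>\<^bsub>?F\<^esub> \<psi>) = g \<phi> \<oplus> g \<psi>"
        and gs: "\<And>r \<phi>. r \<in> carrier R \<Longrightarrow> \<phi> \<in> carrier ?F \<Longrightarrow> g (r \<odot>\<^bsub>?F\<^esub> \<phi>) = r \<otimes> g \<phi>"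
      show "g (\<tau> r i) = g (e (r \<otimes> i)) \<oplus> (\<ominus> r) \<otimes> g (e i)"
        unfolding \<tau>_def ga[OF eri si] gs[OF mr ei] ..
    qed
    have \<rho>K: "\<rho> i j \<in> ?K" if ij: "i \<in> I" "j \<in> I" for i j
    proof -
      have "\<sigma> (\<rho> i j) = ((i \<oplus> j) \<oplus> (\<ominus> \<one>) \<otimes> i) \<oplus> (\<ominus> \<one>) \<otimes> j"
        using \<rho>v(2)[OF ij, of \<sigma>, OF \<sigma>a \<sigma>s] \<sigma>e[OF ij(1)] \<sigma>e[OF ij(2)] \<sigma>e[OF idealE(3)[OF I ij]] by simp
      also have "\<dots> = \<zero>" using Ic[OF ij(1)] Ic[OF ij(2)] by algebra
      finally show ?thesis unfolding K_iff using \<rho>v(1)[OF ij] by blast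
    qed
    have \<tau>K: "\<tau> r i \<in> ?K" if ri: "r \<in> carrier R" "i \<in> I" for r i
    proof -
      have "\<sigma> (\<tau> r i) = r \<otimes> i \<oplus> (\<ominus> r) \<otimes> i"
        using \<tau>v(2)[OF ri, of \<sigma>, OF \<sigma>a \<sigma>s] \<sigma>e[OF ri(2)] \<sigma>e[OF idealE(5)[OF I ri]] by simp
      also have "\<dots> = \<zero>" using Ic[OF ri(2)] ri(1) by algebra
      finally show ?thesis unfolding K_iff using \<tau>v(1)[OF ri] by blast
    qed
    define t where "t \<phi> = x \<odot>\<^bsub>?F\<^esub> \<phi> \<oplus>\<^bsub>?F\<^esub> (\<ominus> \<sigma> \<phi>) \<odot>\<^bsub>?F\<^esub> e x" for \<phi>
    have te: "t (e i) = \<kappa> i" if "i \<in> I" for i unfolding t_def \<kappa>_def \<sigma>e[OF that] ..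
    have tK: "t \<phi> \<in> ?K" if \<phi>: "\<phi> \<in> carrier ?F" for \<phi>
    proof -
      note s = Ic[OF \<sigma>I[OF \<phi>]]
      have ms: "\<ominus> \<sigma> \<phi> \<in> carrier R" using s by simp
      note c = F.smult_closed[OF xc \<phi>] F.smult_closed[OF ms eF[OF xI]]
      have "\<sigma> (t \<phi>) = x \<otimes> \<sigma> \<phi> \<oplus> (\<ominus> \<sigma> \<phi>) \<otimes> x"
        unfolding t_def \<sigma>a[OF c] \<sigma>s[OF xc \<phi>] \<sigma>s[OF ms eF[OF xI]] \<sigma>e[OF xI] ..
      also have "\<dots> = \<zero>" using xc s by algebra
      finally show ?thesis unfolding K_iff t_def using F.M.a_closed[OF c] by blast
    qed
    have exF: "e x \<in> carrier ?F" by (rule eF[OF xI])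
    have ta: "t (\<phi> \<oplus>\<^bsub>?F\<^esub> \<psi>) = t \<phi> \<oplus>\<^bsub>?F\<^esub> t \<psi>" if p: "\<phi> \<in> carrier ?F" "\<psi> \<in> carrier ?F" for \<phi> \<psi>
      unfolding t_def \<sigma>a[OF p] using p Ic[OF \<sigma>I[OF p(1)]] Ic[OF \<sigma>I[OF p(2)]] exF xc by algebra
    have ts: "t (r \<odot>\<^bsub>?F\<^esub> \<phi>) = r \<odot>\<^bsub>?F\<^esub> t \<phi>" if p: "r \<in> carrier R" "\<phi> \<in> carrier ?F" for r \<phi>
      unfolding t_def \<sigma>s[OF p] using p Ic[OF \<sigma>I[OF p(2)]] exF xc by algebra
    define T where "T \<phi> = f (t \<phi>)" for \<phi>
    have Tc: "T \<phi> \<in> carrier R" if "\<phi> \<in> carrier ?F" for \<phi> unfolding T_def by (rule fc[OF tK[OF that]])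
    have Ta: "T (\<phi> \<oplus>\<^bsub>?F\<^esub> \<psi>) = T \<phi> \<oplus> T \<psi>" if "\<phi> \<in> carrier ?F" "\<psi> \<in> carrier ?F" for \<phi> \<psi>
      unfolding T_def ta[OF that] by (rule fa[OF tK[OF that(1)] tK[OF that(2)]])
    have Ts: "T (r \<odot>\<^bsub>?F\<^esub> \<phi>) = r \<otimes> T \<phi>" if "r \<in> carrier R" "\<phi> \<in> carrier ?F" for r \<phi>
      unfolding T_def ts[OF that] by (rule fs[OF that(1) tK[OF that(2)]])
    have TK: "T \<phi> = x \<otimes> f \<phi>" if \<phi>: "\<phi> \<in> ?K" for \<phi>
    proof -
      have z: "\<sigma> \<phi> = \<zero>" using \<phi> K_iff by blast
      have "t \<phi> = x \<odot>\<^bsub>?F\<^esub> \<phi>" unfolding t_def z using Kc[OF \<phi>] exF xc by (simp del: free_module_simps)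
      then show ?thesis unfolding T_def using fs[OF xc \<phi>] by simp
    qed
    define w where "w i = T (e i)" for i
    have wc: "w i \<in> carrier R" if "i \<in> I" for i unfolding w_def by (rule Tc[OF eF[OF that]])
    have "linear_mod R (ring_module R) (ring_module R) I X w"
      unfolding linear_mod_ring_iff[OF idealE(1)[OF I]]
    proof (intro conjI ballI)
      fix i j assume ij: "i \<in> I" "j \<in> I"
      note s = idealE(3)[OF I ij]
      show "w i \<in> carrier R" "w (i \<oplus> j) \<in> carrier R" using wc ij s by auto
      have "x \<otimes> f (\<rho> i j) = (w (i \<oplus> j) \<oplus> (\<ominus> \<one>) \<otimes> w i) \<oplus> (\<ominus> \<one>) \<otimes> w j"
        unfolding w_def TK[OF \<rho>K[OF ij], symmetric] by (rule \<rho>v(2)[OF ij, of T, OF Ta Ts])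
      also have "\<dots> = w (i \<oplus> j) \<ominus> (w i \<oplus> w j)" using wc[OF ij(1)] wc[OF ij(2)] wc[OF s] by algebra
      finally show "w (i \<oplus> j) \<ominus> (w i \<oplus> w j) \<in> X" using cgen_mem(2)[OF xc fc[OF \<rho>K[OF ij]]] by (simp only:)
    next
      fix r i assume ri: "r \<in> carrier R" "i \<in> I"
      note s = idealE(5)[OF I ri]
      show "w (r \<otimes> i) \<in> carrier R" using wc s by auto
      have "x \<otimes> f (\<tau> r i) = w (r \<otimes> i) \<oplus> (\<ominus> r) \<otimes> w i"
        unfolding w_def TK[OF \<tau>K[OF ri], symmetric] by (rule \<tau>v(2)[OF ri, of T, OF Ta Ts])
      also have "\<dots> = w (r \<otimes> i) \<ominus> r \<otimes> w i" using wc[OF ri(2)] wc[OF s] ri(1) by algebra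
      finally show "w (r \<otimes> i) \<ominus> r \<otimes> w i \<in> X" using cgen_mem(2)[OF xc fc[OF \<tau>K[OF ri]]] by (simp only:)
    qed
    moreover have "w x \<in> X"
    proof -
      have "\<kappa> x = \<zero>\<^bsub>?F\<^esub>" unfolding \<kappa>_def using exF xc by algebra
      then have "w x = f (\<zero> \<odot>\<^bsub>?F\<^esub> \<kappa> x)" unfolding w_def T_def te[OF xI] by (simp del: free_module_simps)
      also have "\<dots> = \<zero>" using fs[OF zero_closed \<kappa>K[OF xI]] fc[OF \<kappa>K[OF xI]] by (simp del: free_module_simps)
      finally show ?thesis using idealE(2)[OF Xp(1)] by simp
    qed
    ultimately obtain c where c: "c \<in> carrier R" "\<And>i. i \<in> I \<Longrightarrow> w i \<ominus> c \<otimes> i \<in> X"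
      using self_injective[OF regular_x I xI] by blast
    define u where "u = (\<lambda>i\<in>I. xdiv (w i \<ominus> c \<otimes> i))"
    have u: "u i \<in> carrier R" "w i = c \<otimes> i \<oplus> x \<otimes> u i" if i: "i \<in> I" for i
    proof -
      have u1: "u i \<in> carrier R" "x \<otimes> u i = w i \<ominus> c \<otimes> i" using xdiv[OF c(2)[OF i]] i by (simp_all add: u_def)
      show "u i \<in> carrier R" by (rule u1)
      show "w i = c \<otimes> i \<oplus> x \<otimes> u i" unfolding u1(2) using wc[OF i] c(1) Ic[OF i] by algebra
    qed
    have uP: "u \<in> I \<rightarrow> carrier R" using u(1) by blast
    note Lu = L[OF uP]
    have TL: "T \<phi> = c \<otimes> \<sigma> \<phi> \<oplus> x \<otimes> L u \<phi>" if \<phi>: "\<phi> \<in> carrier ?F" for \<phi>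
    proof (rule gen_eq[OF \<phi>])
      show "linear_mod R ?F (ring_module R) (carrier ?F) {\<zero>\<^bsub>ring_module R\<^esub>} T"
        unfolding linear_mod_zero_iff[OF ring_module_module] using Tc Ta Ts by (simp del: free_module_simps)
      show "linear_mod R ?F (ring_module R) (carrier ?F) {\<zero>\<^bsub>ring_module R\<^esub>} (\<lambda>\<phi>. c \<otimes> \<sigma> \<phi> \<oplus> x \<otimes> L u \<phi>)"
        unfolding linear_mod_zero_iff[OF ring_module_module]
        unfolding ring_module_simps
      proof (intro conjI ballI)
        fix \<phi> \<psi> assume p: "\<phi> \<in> carrier ?F" "\<psi> \<in> carrier ?F"
        note s = Ic[OF \<sigma>I[OF p(1)]] Ic[OF \<sigma>I[OF p(2)]] Lu(1)[OF p(1)] Lu(1)[OF p(2)]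
        show "c \<otimes> \<sigma> \<phi> \<oplus> x \<otimes> L u \<phi> \<in> carrier R" using c(1) xc s by simp
        show "c \<otimes> \<sigma> (\<phi> \<oplus>\<^bsub>?F\<^esub> \<psi>) \<oplus> x \<otimes> L u (\<phi> \<oplus>\<^bsub>?F\<^esub> \<psi>) = c \<otimes> \<sigma> \<phi> \<oplus> x \<otimes> L u \<phi> \<oplus> (c \<otimes> \<sigma> \<psi> \<oplus> x \<otimes> L u \<psi>)"
          unfolding \<sigma>a[OF p] Lu(2)[OF p] using c(1) xc s by algebra
      next
        fix r \<phi> assume p: "r \<in> carrier R" "\<phi> \<in> carrier ?F"
        note s = Ic[OF \<sigma>I[OF p(2)]] Lu(1)[OF p(2)]
        show "c \<otimes> \<sigma> (r \<odot>\<^bsub>?F\<^esub> \<phi>) \<oplus> x \<otimes> L u (r \<odot>\<^bsub>?F\<^esub> \<phi>) = r \<otimes> (c \<otimes> \<sigma> \<phi> \<oplus> x \<otimes> L u \<phi>)"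
          unfolding \<sigma>s[OF p] Lu(3)[OF p] using c(1) xc s p(1) by algebra
      qed
      fix i assume i: "i \<in> I"
      show "T (e i) = c \<otimes> \<sigma> (e i) \<oplus> x \<otimes> L u (e i)"
        using u(2)[OF i] \<sigma>e[OF i] Le[OF uP i] by (simp add: w_def)
    qed
    have fL: "f \<phi> = L u \<phi>" if \<phi>: "\<phi> \<in> ?K" for \<phi>
    proof -
      have z: "\<sigma> \<phi> = \<zero>" using \<phi> K_iff by blast
      have "x \<otimes> f \<phi> = c \<otimes> \<zero> \<oplus> x \<otimes> L u \<phi>" using TK[OF \<phi>] TL[OF Kc[OF \<phi>]] z by simp
      then have "x \<otimes> f \<phi> = x \<otimes> L u \<phi>" using c(1) xc Lu(1)[OF Kc[OF \<phi>]] by simp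
      then show ?thesis by (rule regular_cancel[OF regular_x fc[OF \<phi>] Lu(1)[OF Kc[OF \<phi>]]])
    qed
    have "linear_mod R (ring_module R) (ring_module R) I I u"
      unfolding linear_mod_ring_iff[OF idealE(1)[OF I]]
    proof (intro conjI ballI)
      fix i j assume ij: "i \<in> I" "j \<in> I"
      note s = idealE(3)[OF I ij]
      show "u i \<in> carrier R" "u (i \<oplus> j) \<in> carrier R" using u(1) ij s by auto
      have "f (\<rho> i j) = (u (i \<oplus> j) \<oplus> (\<ominus> \<one>) \<otimes> u i) \<oplus> (\<ominus> \<one>) \<otimes> u j"
        unfolding fL[OF \<rho>K[OF ij]] using \<rho>v(2)[OF ij, of "L u", OF Lu(2,3)]
          Le[OF uP ij(1)] Le[OF uP ij(2)] Le[OF uP s] by simp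
      also have "\<dots> = u (i \<oplus> j) \<ominus> (u i \<oplus> u j)" using u(1)[OF ij(1)] u(1)[OF ij(2)] u(1)[OF s] by algebra
      finally show "u (i \<oplus> j) \<ominus> (u i \<oplus> u j) \<in> I" using fI[OF \<rho>K[OF ij]] by (simp only:)
    next
      fix r i assume ri: "r \<in> carrier R" "i \<in> I"
      note s = idealE(5)[OF I ri]
      show "u (r \<otimes> i) \<in> carrier R" using u(1) s by auto
      have "f (\<tau> r i) = u (r \<otimes> i) \<oplus> (\<ominus> r) \<otimes> u i"
        unfolding fL[OF \<tau>K[OF ri]] using \<tau>v(2)[OF ri, of "L u", OF Lu(2,3)]
          Le[OF uP ri(2)] Le[OF uP s] by simp
      also have "\<dots> = u (r \<otimes> i) \<ominus> r \<otimes> u i" using u(1)[OF ri(2)] u(1)[OF s] ri(1) by algebra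
      finally show "u (r \<otimes> i) \<ominus> r \<otimes> u i \<in> I" using fI[OF \<tau>K[OF ri]] by (simp only:)
    qed
    then have uC: "u \<in> conormal_maps" unfolding conormal_maps_def using u(1) by (auto simp: u_def)
    have "f = \<Phi> u"
    proof
      fix \<phi>
      show "f \<phi> = \<Phi> u \<phi>"
      proof (cases "\<phi> \<in> ?K")
        case True then show ?thesis using fL[OF True] by (simp add: \<Phi>_def)
      next
        case False then show ?thesis using PiE_arb[OF conjunct1[OF f1] False] by (simp add: \<Phi>_def)
      qed
    qed
    then show ?thesis using uC H.cong_refl[OF B f] by blast
  qed
  have "len R ?MI {u \<in> conormal_maps. \<Phi> u \<in> ?B} conormal_maps = len R ?H ?B (carrier ?H)"
    by (rule len_transfer[OF MIm H CM(1) B H.carrier_is_submodule H.submoduleE(1)[OF B] \<Phi>B \<Phi>H onto])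
  then show "module_length R (ext1 R IM IM) = len R ?MI scaled_maps conormal_maps"
    unfolding ker ext1_eq len_quot_module[OF H B] by simp
qed

end

section \<open>The endomorphism ring\<close>

context gorenstein_ideal begin

interpretation rm: module R "ring_module R" by (rule ring_module_module)

lemma scaled_ideal: "ideal {x \<otimes> i | i. i \<in> I} R"
proof (rule idealI2)
  show "{x \<otimes> i | i. i \<in> I} \<subseteq> carrier R" using xc Ic by auto
  show "\<zero> \<in> {x \<otimes> i | i. i \<in> I}" using idealE(2)[OF I] xc r_null by force
next
  fix a b assume "a \<in> {x \<otimes> i | i. i \<in> I}" "b \<in> {x \<otimes> i | i. i \<in> I}"
  then obtain i j where "i \<in> I" "j \<in> I" "a = x \<otimes> i" "b = x \<otimes> j" by blast
  then have "a \<oplus> b = x \<otimes> (i \<oplus> j)" "i \<oplus> j \<in> I" using xc Ic idealE(3)[OF I] by (auto simp: r_distr)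
  then show "a \<oplus> b \<in> {x \<otimes> i | i. i \<in> I}" by blast
next
  fix r b assume r: "r \<in> carrier R" "b \<in> {x \<otimes> i | i. i \<in> I}"
  then obtain i where "i \<in> I" "b = x \<otimes> i" by blast
  then have "r \<otimes> b = x \<otimes> (r \<otimes> i)" "r \<otimes> i \<in> I" using xc Ic idealE(5)[OF I r(1)] r(1) m_lcomm by auto
  then show "r \<otimes> b \<in> {x \<otimes> i | i. i \<in> I}" by blast
qed

lemma S'_ideal: "ideal S' R" by (rule colon_ideal[OF scaled_ideal idealE(1)[OF I]])

lemma S'_iff: "a \<in> S' \<longleftrightarrow> a \<in> I' \<and> (\<forall>i\<in>I. xdiv (a \<otimes> i) \<in> I)"
proof
  assume a: "a \<in> S'"
  then have ac: "a \<in> carrier R" by (simp add: colon_def)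
  have "a \<otimes> i \<in> X \<and> xdiv (a \<otimes> i) \<in> I" if i: "i \<in> I" for i
  proof -
    obtain j where j: "j \<in> I" "a \<otimes> i = x \<otimes> j" using a i unfolding colon_def by blast
    have "xdiv (a \<otimes> i) = j" by (rule xdiv_unique) (use j Ic in auto)
    moreover have "a \<otimes> i \<in> X" unfolding j(2) by (rule cgen_mem(2)[OF xc Ic[OF j(1)]])
    ultimately show ?thesis using j by simp
  qed
  then show "a \<in> I' \<and> (\<forall>i\<in>I. xdiv (a \<otimes> i) \<in> I)" using ac by (simp add: colon_def)
next
  assume a: "a \<in> I' \<and> (\<forall>i\<in>I. xdiv (a \<otimes> i) \<in> I)"
  have "a \<otimes> i \<in> {x \<otimes> i | i. i \<in> I}" if i: "i \<in> I" for i
    using xdiv(2)[OF a_I[of a i]] a i by force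
  then show "a \<in> S'" using a by (simp add: colon_def)
qed

lemma X_le_S': "X \<subseteq> S'" and S'_le_I': "S' \<subseteq> I'"
proof -
  show "S' \<subseteq> I'" using S'_iff by blast
  have "x \<in> S'" using xc by (auto simp: colon_def)
  then show "X \<subseteq> S'" by (rule cgen_subset[OF S'_ideal])
qed

lemma xdiv_map_linear:
  assumes a: "a \<in> I'"
  shows "\<And>i. i \<in> I \<Longrightarrow> xdiv (a \<otimes> i) \<in> carrier R"
  using xdiv(1)[OF a_I[OF a]] .

lemma xdiv_in_scalar:
  "i \<in> I \<Longrightarrow> linear_mod R (ring_module R) (ring_module R) I' {\<zero>\<^bsub>ring_module R\<^esub>} (\<lambda>a. xdiv (a \<otimes> i))"
  unfolding linear_mod_zero_iff[OF ring_module_module]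
proof (intro conjI ballI)
  fix a b assume i: "i \<in> I" and ab: "a \<in> I'" "b \<in> I'"
  show "xdiv (a \<otimes> i) \<in> carrier (ring_module R)" using xdiv_map_linear[OF ab(1) i] by simp
  have "(a \<oplus> b) \<otimes> i = a \<otimes> i \<oplus> b \<otimes> i" using I'c[OF ab(1)] I'c[OF ab(2)] Ic[OF i] by (simp add: l_distr)
  then show "xdiv ((a \<oplus>\<^bsub>ring_module R\<^esub> b) \<otimes> i) = xdiv (a \<otimes> i) \<oplus>\<^bsub>ring_module R\<^esub> xdiv (b \<otimes> i)"
    using xdiv_add[OF a_I[OF ab(1) i] a_I[OF ab(2) i]] by simp
next
  fix r a assume i: "i \<in> I" and r: "r \<in> carrier R" and a: "a \<in> I'"
  have "(r \<otimes> a) \<otimes> i = r \<otimes> (a \<otimes> i)" using I'c[OF a] Ic[OF i] r by (simp add: m_assoc)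
  then show "xdiv ((r \<odot>\<^bsub>ring_module R\<^esub> a) \<otimes> i) = r \<odot>\<^bsub>ring_module R\<^esub> xdiv (a \<otimes> i)"
    using xdiv_mult[OF a_I[OF a i] r] by simp
qed

lemma maps_into_I_scaled: "I \<rightarrow>\<^sub>E I \<subseteq> scaled_maps"
proof
  fix u assume u: "u \<in> I \<rightarrow>\<^sub>E I"
  have uc: "u \<in> conormal_maps" using conormal_maps_submodule(3) u by blast
  have x0: "xdiv (\<zero> \<otimes> i) = \<zero>" if "i \<in> I" for i
    by (rule xdiv_unique) (use xc Ic[OF that] in simp_all)
  have "u i \<ominus> xdiv (\<zero> \<otimes> i) \<in> I" if i: "i \<in> I" for i
    using x0[OF i] idealE(4)[OF I PiE_const_mem[OF u i] idealE(2)[OF I]] by (simp only:)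
  then show "u \<in> scaled_maps" using uc idealE(2)[OF I'_ideal] unfolding scaled_maps_def by blast
qed

text \<open>Sending a to the map i to ai/x identifies I'/S', which is the dual of I modulo S, with the scaled
  maps modulo the maps into I.\<close>
lemma len_scaled_maps: "len R (map_module I (ring_module R)) (I \<rightarrow>\<^sub>E I) scaled_maps = ilen R S' I'"
proof -
  let ?MI = "map_module I (ring_module R)"
  have MIm: "module R ?MI" by (rule map_module_module[OF ring_module_module])
  interpret MI: module R ?MI by (rule MIm)
  let ?f = "\<lambda>a. \<lambda>i\<in>I. xdiv (a \<otimes> i)"
  have z: "{\<zero>\<^bsub>ring_module R\<^esub>} \<subseteq> I" using idealE(2)[OF I] by simp
  have lin: "linear_mod R (ring_module R) ?MI I' (I \<rightarrow>\<^sub>E I) ?f"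
  proof (rule linear_mod_maps[OF ring_module_module sI ring_module_module sI'])
    show "?f a \<in> I \<rightarrow>\<^sub>E carrier (ring_module R)" if "a \<in> I'" for a using xdiv_map_linear[OF that] by simp
    show "linear_mod R (ring_module R) (ring_module R) I' I (\<lambda>a. ?f a i)" if "i \<in> I" for i
      using linear_mod_weaken[OF xdiv_in_scalar[OF that] z] that by simp
  qed
  have into: "?f a \<in> scaled_maps" if a: "a \<in> I'" for a
  proof -
    note c = xdiv_map_linear[OF a]
    have "linear_mod R (ring_module R) (ring_module R) I I (?f a)"
      unfolding linear_mod_ring_iff[OF idealE(1)[OF I]]
    proof (intro conjI ballI)
      fix i j assume ij: "i \<in> I" "j \<in> I"
      note s = idealE(3)[OF I ij]
      show "?f a i \<in> carrier R" "?f a (i \<oplus> j) \<in> carrier R" using c ij s by auto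
      have "?f a (i \<oplus> j) \<ominus> (?f a i \<oplus> ?f a j) = \<zero>"
        using xdiv_mult_add[OF a ij] ij s c by (simp add: r_neg a_minus_def)
      then show "?f a (i \<oplus> j) \<ominus> (?f a i \<oplus> ?f a j) \<in> I" using idealE(2)[OF I] by (simp only:)
    next
      fix r i assume r: "r \<in> carrier R" and i: "i \<in> I"
      note s = idealE(5)[OF I r i]
      show "?f a (r \<otimes> i) \<in> carrier R" using c s by auto
      have "?f a (r \<otimes> i) \<ominus> r \<otimes> ?f a i = \<zero>"
        using xdiv_mult_smult[OF a i r] i s c r by (simp add: r_neg a_minus_def)
      then show "?f a (r \<otimes> i) \<ominus> r \<otimes> ?f a i \<in> I" using idealE(2)[OF I] by (simp only:)
    qed
    then have "?f a \<in> conormal_maps" using c by (simp add: conormal_maps_def)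
    moreover have "?f a i \<ominus> xdiv (a \<otimes> i) \<in> I" if i: "i \<in> I" for i
      using c[OF i] i idealE(2)[OF I] by (simp add: r_neg a_minus_def)
    ultimately show ?thesis using a unfolding scaled_maps_def by blast
  qed
  have onto: "\<exists>a\<in>I'. cong_mod ?MI (I \<rightarrow>\<^sub>E I) u (?f a)" if u: "u \<in> scaled_maps" for u
  proof -
    obtain a where uc: "u \<in> conormal_maps" and a: "a \<in> I'" "\<And>i. i \<in> I \<Longrightarrow> u i \<ominus> xdiv (a \<otimes> i) \<in> I"
      using u unfolding scaled_maps_def by blast
    have f: "u \<in> I \<rightarrow>\<^sub>E carrier (ring_module R)" "?f a \<in> I \<rightarrow>\<^sub>E carrier (ring_module R)"
      using conormal_mapsD(2)[OF uc] xdiv_map_linear[OF a(1)] by auto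
    have "cong_mod ?MI (I \<rightarrow>\<^sub>E I) u (?f a)"
      unfolding cong_mod_maps_iff[OF ring_module_module sI f]
      using a(2) conormal_mapsD(1)[OF uc] xdiv_map_linear[OF a(1)] by (simp add: cong_mod_def)
    then show ?thesis using a(1) by blast
  qed
  have ker: "{a \<in> I'. ?f a \<in> I \<rightarrow>\<^sub>E I} = S'"
    unfolding set_eq_iff S'_iff by (auto simp: PiE_def Pi_iff)
  have "ilen R {a \<in> I'. ?f a \<in> I \<rightarrow>\<^sub>E I} I' = len R ?MI (I \<rightarrow>\<^sub>E I) scaled_maps"
    by (rule len_transfer[OF ring_module_module MIm sI' conormal_maps_submodule(2) len_ext1_self(1) maps_into_I_scaled lin into onto])
  then show ?thesis unfolding ker by simp
qed

text \<open>An endomorphism f of I satisfies f(x) i = x f(i), so it is determined by f(x), which lies in S';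
  it is a homothety exactly if f(x) is a multiple of x.\<close>
lemma len_end_mod_base: "module_length R (end_mod_base R I) = ilen R X S'"
proof -
  let ?E = "hom_module R IM IM" and ?h = "homotheties R I"
  have E: "module R ?E" by (rule hom_module_module[OF IM IM])
  interpret E: module R ?E by (rule E)
  have Esimps: "f \<oplus>\<^bsub>?E\<^esub> g = (\<lambda>i\<in>I. f i \<oplus> g i)" "a \<odot>\<^bsub>?E\<^esub> f = (\<lambda>i\<in>I. a \<otimes> f i)" "carrier ?E = lin_maps R IM IM" "\<zero>\<^bsub>?E\<^esub> = (\<lambda>i\<in>I. \<zero>)" for f g a
    by (simp_all add: hom_module_def)
  let ?s = "\<lambda>a. \<lambda>i\<in>I. xdiv (a \<otimes> i)"
  have sS': "submodule S' R (ring_module R)" using S'_ideal by (simp add: ideal_iff_submodule)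
  have into: "?s a \<in> carrier ?E" if "a \<in> S'" for a
  proof -
    have a: "a \<in> I'" "\<And>i. i \<in> I \<Longrightarrow> xdiv (a \<otimes> i) \<in> I" using that S'_iff by auto
    show ?thesis unfolding Esimps lin_maps_iff
      using a xdiv_mult_add[OF a(1)] xdiv_mult_smult[OF a(1)] idealE(3,5)[OF I] by simp
  qed
  have lin: "linear_mod R (ring_module R) ?E S' {\<zero>\<^bsub>?E\<^esub>} ?s"
    unfolding linear_mod_zero_iff[OF E]
  proof (intro conjI ballI)
    fix a b assume ab: "a \<in> S'" "b \<in> S'"
    show "?s a \<in> carrier ?E" using into ab by blast
    have ab': "a \<in> I'" "b \<in> I'" using ab S'_iff by auto
    show "?s (a \<oplus>\<^bsub>ring_module R\<^esub> b) = ?s a \<oplus>\<^bsub>?E\<^esub> ?s b"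
      unfolding Esimps using xdiv_in_scalar[unfolded linear_mod_zero_iff[OF ring_module_module]] ab'
      by (auto intro!: restrict_ext)
  next
    fix r a assume ab: "r \<in> carrier R" "a \<in> S'"
    have ab': "a \<in> I'" using ab S'_iff by auto
    show "?s (r \<odot>\<^bsub>ring_module R\<^esub> a) = r \<odot>\<^bsub>?E\<^esub> ?s a"
      unfolding Esimps using xdiv_in_scalar[unfolded linear_mod_zero_iff[OF ring_module_module]] ab' ab(1)
      by (auto intro!: restrict_ext)
  qed
  have hom: "(\<lambda>i\<in>I. c \<otimes> i) = ?s (x \<otimes> c)" if c: "c \<in> carrier R" for c
  proof (rule restrict_ext)
    fix i assume i: "i \<in> I"
    show "c \<otimes> i = xdiv (x \<otimes> c \<otimes> i)"
      by (rule xdiv_unique[symmetric]) (use c Ic[OF i] xc in \<open>simp_all add: m_assoc\<close>)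
  qed
  have hX: "?h = ?s ` X"
    unfolding homotheties_def using hom xdiv cgen_mem(2)[OF xc] by (auto simp: image_iff) metis+
  have hE: "submodule ?h R ?E"
  proof -
    have "submodule {b \<in> carrier ?E. \<exists>a\<in>X. cong_mod ?E {\<zero>\<^bsub>?E\<^esub>} b (?s a)} R ?E"
      by (rule submodule_image[OF ring_module_module E sS' E.zero_submodule lin sX X_le_S'])
    moreover have "{b \<in> carrier ?E. \<exists>a\<in>X. cong_mod ?E {\<zero>\<^bsub>?E\<^esub>} b (?s a)} = ?h"
      unfolding E.cong_eq hX using into X_le_S' by (auto simp: subset_iff)
    ultimately show ?thesis by simp
  qed
  have z: "{\<zero>\<^bsub>?E\<^esub>} \<subseteq> ?h" using E.submodule_zero[OF hE] by simp
  have ker: "{a \<in> S'. ?s a \<in> ?h} = X"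
  proof (intro equalityI subsetI)
    fix a assume "a \<in> {a \<in> S'. ?s a \<in> ?h}"
    then have m: "a \<in> S' \<and> ?s a \<in> ?s ` X" unfolding hX by (rule CollectD)
    then have a: "a \<in> S'" by (rule conjunct1)
    from conjunct2[OF m] obtain b where b: "?s a = ?s b" "b \<in> X" by (rule imageE)
    have aI: "a \<in> I'" "b \<in> I'" using subsetD[OF S'_le_I' a] subsetD[OF S'_le_I' subsetD[OF X_le_S' b(2)]] .
    have "xdiv (a \<otimes> x) = xdiv (b \<otimes> x)" using fun_cong[OF b(1), of x] xI by (simp only: restrict_apply if_True)
    then have "a \<otimes> x = b \<otimes> x" using xdiv(2)[OF a_I[OF aI(1) xI]] xdiv(2)[OF a_I[OF aI(2) xI]] by metis
    then have "x \<otimes> a = x \<otimes> b" using m_comm[OF xc I'c[OF aI(1)]] m_comm[OF xc I'c[OF aI(2)]] by simp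
    then have "a = b" by (rule regular_cancel[OF regular_x I'c[OF aI(1)] I'c[OF aI(2)]])
    then show "a \<in> X" using b(2) by (rule ssubst)
  next
    fix a assume a: "a \<in> X"
    have "?s a \<in> ?h" unfolding hX by (rule imageI[OF a])
    then show "a \<in> {a \<in> S'. ?s a \<in> ?h}" using subsetD[OF X_le_S' a] by (intro CollectI conjI)
  qed
  have onto: "\<exists>a\<in>S'. cong_mod ?E ?h f (?s a)" if f: "f \<in> carrier ?E" for f
  proof -
    have fI: "f i \<in> I" if "i \<in> I" for i using f that unfolding Esimps lin_maps_iff by auto
    have fs: "f (r \<otimes> i) = r \<otimes> f i" if "r \<in> carrier R" "i \<in> I" for r i using f that unfolding Esimps lin_maps_iff by auto
    have fx: "f x \<otimes> i = x \<otimes> f i" if i: "i \<in> I" for i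
    proof -
      have "f x \<otimes> i = f (i \<otimes> x)" using fs[OF Ic[OF i] xI] m_comm[OF Ic[OF i] Ic[OF fI[OF xI]]] by simp
      also have "i \<otimes> x = x \<otimes> i" by (rule m_comm[OF Ic[OF i] xc])
      finally show ?thesis using fs[OF xc i] by simp
    qed
    have xd: "xdiv (f x \<otimes> i) = f i" if i: "i \<in> I" for i
      by (rule xdiv_unique[OF Ic[OF fI[OF i]]]) (simp add: fx[OF i])
    have fS: "f x \<in> S'" unfolding colon_def using fx fI Ic[OF fI[OF xI]] by blast
    have sf: "?s (f x) = f"
    proof
      fix i show "?s (f x) i = f i"
      proof (cases "i \<in> I")
        case False
        have "f \<in> I \<rightarrow>\<^sub>E I" using f unfolding Esimps lin_maps_iff by simp
        then have "f i = undefined" using False by (rule PiE_arb)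
        then show ?thesis using False by (simp only: restrict_apply if_False)
      qed (simp add: xd)
    qed
    show ?thesis
    proof (rule bexI[OF _ fS])
      show "cong_mod ?E ?h f (?s (f x))" unfolding sf by (rule E.cong_refl[OF hE f])
    qed
  qed
  have "ilen R {a \<in> S'. ?s a \<in> ?h} S' = len R ?E ?h (carrier ?E)"
    by (rule len_transfer[OF ring_module_module E sS' hE E.carrier_is_submodule E.submoduleE(1)[OF hE] linear_mod_weaken[OF lin z] into onto])
  then show ?thesis
    unfolding ker end_mod_base_def end_module_def len_quot_module[OF E hE] by simp
qed

lemma len_residue: "module_length R (residue_module R I) = ilen R I (carrier R)"
  unfolding residue_module_def using len_quot_module[OF ring_module_module sI] by simp

section \<open>The trace ideal\<close>

text \<open>The ideal I I' is x times the trace ideal, because I' is x times the dual of I.\<close>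
abbreviation P where "P \<equiv> ideal_prod R I I'"

definition tr where "tr = {a \<in> carrier R. a \<otimes> x \<in> P}"

lemma P_ideal: "ideal P R" by (rule ideal_prod_is_ideal[OF I I'_ideal])

lemma P_le_X: "P \<subseteq> X"
proof
  fix a assume "a \<in> P"
  then show "a \<in> X" by (induction rule: ideal_prod.induct) (auto intro: I_I' idealE(3)[OF Xp(1)])
qed

lemma tr_ideal: "ideal tr R"
proof (rule idealI2)
  show "a \<oplus> b \<in> tr" if "a \<in> tr" "b \<in> tr" for a b
    using that idealE(3)[OF P_ideal] xc by (simp add: tr_def l_distr)
  show "a \<otimes> b \<in> tr" if "a \<in> carrier R" "b \<in> tr" for a b
    using that idealE(5)[OF P_ideal] xc by (simp add: tr_def m_assoc)
qed (use xc idealE(2)[OF P_ideal] in \<open>auto simp: tr_def\<close>)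

lemma I_le_tr: "I \<subseteq> tr"
proof
  fix i assume i: "i \<in> I"
  show "i \<in> tr" using ideal_prod.prod[OF i xI'] Ic[OF i] by (simp add: tr_def)
qed

text \<open>For f in the dual of I, the element f(x) lies in I', and f(i) x = i f(x) lies in I I'. Conversely
  ia is x times the value at i of the map that belongs to a.\<close>
lemma trace_ideal_eq: "trace_ideal R I = tr"
proof -
  let ?D = "hom_module R IM (ring_module R)"
  have D: "module R ?D" by (rule hom_module_module[OF IM ring_module_module])
  have Dsimps: "f \<oplus>\<^bsub>?D\<^esub> g = (\<lambda>i\<in>I. f i \<oplus> g i)" "a \<odot>\<^bsub>?D\<^esub> f = (\<lambda>i\<in>I. a \<otimes> f i)" "carrier ?D = lin_maps R IM (ring_module R)" for f g a
    by (simp_all add: hom_module_def)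
  let ?F = "free_module R (carrier ?D \<times> I)" and ?K = "tensor_rel R ?D IM" and ?g = "\<lambda>(f :: 'a \<Rightarrow> 'a, i :: 'a). f i"
  interpret F: module R ?F by (rule free_module_module)
  have Dl: "f i \<in> carrier R" "f (i \<oplus> j) = f i \<oplus> f j" "r \<in> carrier R \<Longrightarrow> f (r \<otimes> i) = r \<otimes> f i"
    if "f \<in> carrier ?D" "i \<in> I" "j \<in> I" for f i j r
    using that unfolding Dsimps lin_maps_iff by auto
  have gc: "?g z \<in> carrier (ring_module R)" if "z \<in> carrier ?D \<times> I" for z
    using that Dl(1) by auto
  define ev where "ev = free_lift R (ring_module R) ?g"
  have evl: "linear_mod R ?F (ring_module R) (carrier ?F) {\<zero>\<^bsub>ring_module R\<^esub>} ev"
    unfolding ev_def by (rule free_lift_linear(1)[OF ring_module_module gc])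
  have eve: "ev (free_gen R (f, i)) = f i" if "f \<in> carrier ?D" "i \<in> I" for f i
  proof -
    have z: "(f, i) \<in> carrier ?D \<times> I" using that by simp
    have "ev (free_gen R (f, i)) = ?g (f, i)"
      unfolding ev_def by (rule free_lift_linear(2)[OF ring_module_module _ z]) (rule gc)
    then show ?thesis by simp
  qed
  have K: "submodule ?K R ?F" using tensor_rel_submodule[OF D IM] by simp
  have evK: "ev \<phi> = \<zero>" if "\<phi> \<in> ?K" for \<phi>
  proof -
    have "free_lift R (ring_module R) ?g \<phi> = \<zero>\<^bsub>ring_module R\<^esub>"
      by (rule bilinear_lift_kills[OF D IM ring_module_module _ _ _ _ _ that])
         (use Dl idealE(3,5)[OF I] in \<open>auto simp: Dsimps(1,2)\<close>)
    then show ?thesis by (simp add: ev_def)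
  qed
  note evl1 = evl[unfolded linear_mod_zero_iff[OF ring_module_module]]
  have evc: "ev \<phi> \<in> carrier R" if "\<phi> \<in> carrier ?F" for \<phi> using evl1 that by simp
  have const: "ev \<psi> = ev \<phi>" if \<phi>: "\<phi> \<in> carrier ?F" and \<psi>: "\<psi> \<in> ?K +>\<^bsub>?F\<^esub> \<phi>" for \<phi> \<psi>
  proof -
    have "cong_mod ?F ?K \<psi> \<phi>" using mem_coset_iff[OF F.module_axioms K \<phi>] \<psi> by blast
    then have p: "\<psi> \<in> carrier ?F" "\<psi> \<ominus>\<^bsub>?F\<^esub> \<phi> \<in> ?K" by (auto simp: cong_mod_def)
    have "ev ((\<psi> \<ominus>\<^bsub>?F\<^esub> \<phi>) \<oplus>\<^bsub>?F\<^esub> \<phi>) = ev (\<psi> \<ominus>\<^bsub>?F\<^esub> \<phi>) \<oplus> ev \<phi>"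
      using evl1 F.M.minus_closed[OF p(1) \<phi>] \<phi> by (simp del: free_module_simps)
    then show ?thesis unfolding F.minus_plus_cancel[OF p(1) \<phi>] evK[OF p(2)] using evc[OF \<phi>] by simp
  qed
  have lift: "tensor_lift R (ring_module R) ?g (?K +>\<^bsub>?F\<^esub> \<phi>) = ev \<phi>" if \<phi>: "\<phi> \<in> carrier ?F" for \<phi>
  proof -
    have "\<phi> \<in> ?K +>\<^bsub>?F\<^esub> \<phi>" by (rule mem_coset_iff[OF F.module_axioms K \<phi>, THEN iffD2, OF F.cong_refl[OF K \<phi>]])
    then have "ev ` (?K +>\<^bsub>?F\<^esub> \<phi>) = {ev \<phi>}" using const[OF \<phi>] by blast
    then show ?thesis unfolding tensor_lift_def ev_def[symmetric] by simp
  qed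
  have "trace_ideal R I = tensor_lift R (ring_module R) ?g ` ((\<lambda>\<phi>. ?K +>\<^bsub>?F\<^esub> \<phi>) ` carrier ?F)"
    unfolding trace_ideal_def tensor_module_eq ideal_module_simps quot_module_carrier[OF F.module_axioms K] ..
  also have "\<dots> = ev ` carrier ?F" using lift by (force simp: image_image)
  finally have tr_eq: "trace_ideal R I = ev ` carrier ?F" .
  have str: "submodule tr R (ring_module R)" using tr_ideal by (simp add: ideal_iff_submodule)
  have "{\<phi> \<in> carrier ?F. ev \<phi> \<in> tr} = carrier ?F"
  proof (rule free_gen_induct)
    show "submodule {\<phi> \<in> carrier ?F. ev \<phi> \<in> tr} R ?F"
      by (rule submodule_preimage[OF F.module_axioms ring_module_module F.carrier_is_submodule rm.zero_submodule evl str])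
         (use idealE(2)[OF tr_ideal] in simp)
    fix z assume z: "z \<in> carrier ?D \<times> I"
    then obtain f i where fi: "z = (f, i)" "f \<in> carrier ?D" "i \<in> I" by blast
    have fI': "f x \<in> I'"
    proof -
      have "f x \<otimes> j \<in> X" if j: "j \<in> I" for j
      proof -
        have "f x \<otimes> j = j \<otimes> f x" by (rule m_comm[OF Dl(1)[OF fi(2) xI xI] Ic[OF j]])
        also have "\<dots> = f (j \<otimes> x)" using Dl(3)[OF fi(2) xI xI Ic[OF j]] by simp
        also have "j \<otimes> x = x \<otimes> j" by (rule m_comm[OF Ic[OF j] xc])
        also have "f \<dots> = x \<otimes> f j" using Dl(3)[OF fi(2) j j xc] by simp
        finally show ?thesis using cgen_mem(2)[OF xc Dl(1)[OF fi(2) j j]] by simp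
      qed
      then show ?thesis using Dl(1)[OF fi(2) xI xI] by (simp add: colon_def)
    qed
    have "f i \<otimes> x = x \<otimes> f i" by (rule m_comm[OF Dl(1)[OF fi(2,3,3)] xc])
    also have "\<dots> = f (x \<otimes> i)" using Dl(3)[OF fi(2,3,3) xc] by simp
    also have "x \<otimes> i = i \<otimes> x" by (rule m_comm[OF xc Ic[OF fi(3)]])
    also have "f \<dots> = i \<otimes> f x" using Dl(3)[OF fi(2) xI xI Ic[OF fi(3)]] by simp
    finally have "f i \<in> tr" using ideal_prod.prod[OF fi(3) fI'] Dl(1)[OF fi(2,3,3)] by (simp add: tr_def)
    then show "free_gen R z \<in> {\<phi> \<in> carrier ?F. ev \<phi> \<in> tr}"
      using free_gen_mem[OF z] eve[OF fi(2,3)] fi(1) by simp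
  qed
  then have sub1: "ev ` carrier ?F \<subseteq> tr" by blast
  have E0: "submodule (ev ` carrier ?F) R (ring_module R)"
  proof -
    have "submodule {b \<in> carrier (ring_module R). \<exists>a\<in>carrier ?F. cong_mod (ring_module R) {\<zero>\<^bsub>ring_module R\<^esub>} b (ev a)} R (ring_module R)"
      by (rule submodule_image[OF F.module_axioms ring_module_module F.carrier_is_submodule rm.zero_submodule evl F.carrier_is_submodule order_refl])
    moreover have "{b \<in> carrier (ring_module R). \<exists>a\<in>carrier ?F. cong_mod (ring_module R) {\<zero>\<^bsub>ring_module R\<^esub>} b (ev a)} = ev ` carrier ?F"
      unfolding rm.cong_eq using evc by auto
    ultimately show ?thesis by simp
  qed
  have claim: "p \<in> X \<and> xdiv p \<in> ev ` carrier ?F" if "p \<in> P" for p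
    using that
  proof (induction rule: ideal_prod.induct)
    case (prod i b)
    let ?f = "\<lambda>i\<in>I. xdiv (b \<otimes> i)"
    have f: "?f \<in> carrier ?D"
      unfolding Dsimps lin_maps_iff
      using xdiv_map_linear[OF prod(2)] xdiv_mult_add[OF prod(2)] xdiv_mult_smult[OF prod(2)] idealE(3,5)[OF I] by simp
    have "ev (free_gen R (?f, i)) = xdiv (b \<otimes> i)" using eve[OF f prod(1)] prod(1) by simp
    moreover have "free_gen R (?f, i) \<in> carrier ?F" by (rule free_gen_mem) (use f prod(1) in simp)
    ultimately have "xdiv (b \<otimes> i) \<in> ev ` carrier ?F" by (metis imageI)
    then show ?case using m_comm[OF Ic[OF prod(1)] I'c[OF prod(2)]] I_I'[OF prod] by simp
  next
    case (sum s t)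
    then show ?case using xdiv_add[of s t] idealE(3)[OF Xp(1)] rm.submoduleE(5)[OF E0, of "xdiv s" "xdiv t"] by simp
  qed
  have "tr \<subseteq> ev ` carrier ?F"
  proof
    fix a assume "a \<in> tr"
    then have a: "a \<in> carrier R" "a \<otimes> x \<in> P" by (auto simp: tr_def)
    have "xdiv (a \<otimes> x) = a" by (rule xdiv_unique[OF a(1) m_comm[OF xc a(1)]])
    then show "a \<in> ev ` carrier ?F" using claim[OF a(2)] by simp
  qed
  then show ?thesis using sub1 tr_eq by blast
qed

text \<open>Duality for the ideal I I' with respect to x^2: the colon ideal (x^2R : I I') is S', because
  (X : I') = I. So R/I I' and S'/x^2R have the same length. Removing from both the length of R/xR
  leaves those of R/tr and of S'/xR.\<close>
lemma len_trace: "ilen R tr (carrier R) = ilen R X S'"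
proof -
  let ?y = "x \<otimes> x" and ?Y = "PIdl (x \<otimes> x)"
  have yreg: "regular_element R ?y" by (rule regular_mult[OF regular_x regular_x])
  have yP: "?y \<in> P" by (rule ideal_prod.prod[OF xI xI'])
  note Y = principal[OF yreg]
  have Pc: "\<And>p. p \<in> P \<Longrightarrow> p \<in> carrier R" using idealE(1)[OF P_ideal] by blast
  have YX: "?Y \<subseteq> X" by (rule cgen_subset[OF Xp(1) cgen_mem(2)[OF xc xc]])
  have Y_iff: "a \<otimes> x \<in> ?Y \<longleftrightarrow> a \<in> X" if a: "a \<in> carrier R" for a
  proof
    assume "a \<otimes> x \<in> ?Y"
    then obtain r where r: "r \<in> carrier R" "a \<otimes> x = r \<otimes> (x \<otimes> x)" by (auto simp: mem_cgen_iff)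
    have "x \<otimes> a = x \<otimes> (r \<otimes> x)" using r a xc m_comm[OF xc a] m_lcomm[of x r x] by simp
    then have "a = r \<otimes> x" by (rule regular_cancel[OF regular_x a m_closed[OF r(1) xc]])
    then show "a \<in> X" using cgen_mem(1)[OF r(1)] by simp
  next
    assume "a \<in> X"
    then obtain r where r: "r \<in> carrier R" "a = r \<otimes> x" by (auto simp: mem_cgen_iff)
    then have "a \<otimes> x = r \<otimes> (x \<otimes> x)" using xc by (simp add: m_assoc)
    then show "a \<otimes> x \<in> ?Y" using cgen_mem(1)[OF r(1)] by simp
  qed
  have colonP: "colon R ?Y P = S'"
  proof (intro equalityI subsetI)
    fix a assume "a \<in> colon R ?Y P"
    then have a: "a \<in> carrier R" "\<And>p. p \<in> P \<Longrightarrow> a \<otimes> p \<in> ?Y" by (auto simp: colon_def)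
    have "a \<otimes> i \<in> {x \<otimes> i | i. i \<in> I}" if i: "i \<in> I" for i
    proof -
      note ic = Ic[OF i]
      have "(a \<otimes> i) \<otimes> x \<in> ?Y" using a(2)[OF ideal_prod.prod[OF i xI']] a(1) ic xc by (simp add: m_assoc)
      then have "a \<otimes> i \<in> X" using Y_iff[of "a \<otimes> i"] a(1) ic by simp
      then obtain r where r: "r \<in> carrier R" "a \<otimes> i = r \<otimes> x" by (auto simp: mem_cgen_iff)
      have "r \<in> I"
      proof (rule mem_I[OF r(1)])
        fix b assume b: "b \<in> I'"
        have "(r \<otimes> b) \<otimes> x = (r \<otimes> x) \<otimes> b" using r(1) I'c[OF b] xc by algebra
        also have "\<dots> = a \<otimes> (i \<otimes> b)" unfolding r(2)[symmetric] using a(1) ic I'c[OF b] by (simp add: m_assoc)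
        finally have "(r \<otimes> b) \<otimes> x \<in> ?Y" using a(2)[OF ideal_prod.prod[OF i b]] by simp
        then show "r \<otimes> b \<in> X" using Y_iff[of "r \<otimes> b"] r(1) I'c[OF b] by simp
      qed
      moreover have "a \<otimes> i = x \<otimes> r" unfolding r(2) by (rule m_comm[OF r(1) xc])
      ultimately show ?thesis by blast
    qed
    then show "a \<in> S'" using a(1) by (simp add: colon_def)
  next
    fix a assume "a \<in> S'"
    then have a: "a \<in> carrier R" "\<And>i. i \<in> I \<Longrightarrow> \<exists>j\<in>I. a \<otimes> i = x \<otimes> j" by (auto simp: colon_def)
    have "a \<otimes> p \<in> ?Y" if "p \<in> P" for p
      using that
    proof (induction rule: ideal_prod.induct)
      case (prod i b)
      obtain j where j: "j \<in> I" "a \<otimes> i = x \<otimes> j" using a(2)[OF prod(1)] by blast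
      have "a \<otimes> (i \<otimes> b) = (a \<otimes> i) \<otimes> b" using a(1) Ic[OF prod(1)] I'c[OF prod(2)] by (simp add: m_assoc)
      also have "\<dots> = (j \<otimes> b) \<otimes> x" unfolding j(2) using xc Ic[OF j(1)] I'c[OF prod(2)] by algebra
      finally show ?case using Y_iff[of "j \<otimes> b"] I_I'[OF j(1) prod(2)] Ic[OF j(1)] I'c[OF prod(2)] by simp
    next
      case (sum s t)
      then show ?case using idealE(3)[OF Y(1)] a(1) Pc by (simp add: r_distr)
    qed
    then show "a \<in> colon R ?Y P" using a(1) by (simp add: colon_def)
  qed
  have 1: "ilen R tr (carrier R) = ilen R P X"
    unfolding tr_def
  proof (rule ilen_mult_transfer[OF xc carrier_ideal P_ideal Xp(1) P_le_X])
    show "a \<otimes> x \<in> X" if "a \<in> carrier R" for a by (rule cgen_mem(1)[OF that])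
    fix b assume "b \<in> X"
    then obtain r where r: "r \<in> carrier R" "b = r \<otimes> x" by (auto simp: mem_cgen_iff)
    then have "b \<ominus> r \<otimes> x = \<zero>" using xc by (simp add: r_neg a_minus_def)
    then show "\<exists>a\<in>carrier R. b \<ominus> a \<otimes> x \<in> P" using idealE(2)[OF P_ideal] r(1) by force
  qed
  have 2: "ilen R X (carrier R) = ilen R ?Y X"
  proof -
    have "{a \<in> carrier R. a \<otimes> x \<in> ?Y} = X" using Y_iff idealE(1)[OF Xp(1)] by blast
    moreover have "ilen R {a \<in> carrier R. a \<otimes> x \<in> ?Y} (carrier R) = ilen R ?Y X"
    proof (rule ilen_mult_transfer[OF xc carrier_ideal Y(1) Xp(1) YX])
      show "a \<otimes> x \<in> X" if "a \<in> carrier R" for a by (rule cgen_mem(1)[OF that])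
      fix b assume "b \<in> X"
      then obtain r where r: "r \<in> carrier R" "b = r \<otimes> x" by (auto simp: mem_cgen_iff)
      then have "b \<ominus> r \<otimes> x = \<zero>" using xc by (simp add: r_neg a_minus_def)
      then show "\<exists>a\<in>carrier R. b \<ominus> a \<otimes> x \<in> ?Y" using idealE(2)[OF Y(1)] r(1) by force
    qed
    ultimately show ?thesis by simp
  qed
  have "ilen R ?Y S' = ilen R P (carrier R)" using dual_len[OF P_ideal yreg yP] unfolding colonP .
  moreover have "ilen R ?Y S' = ilen R ?Y X + ilen R X S'" by (rule ilen_add[OF Y(1) Xp(1) S'_ideal YX X_le_S'])
  moreover have "ilen R P (carrier R) = ilen R P X + ilen R X (carrier R)"
    by (rule ilen_add[OF P_ideal Xp(1) carrier_ideal P_le_X idealE(1)[OF Xp(1)]])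
  moreover have "ilen R X (carrier R) \<noteq> \<infinity>" by (rule ilen_finite[OF Xp(1) regular_x Xp(2)])
  ultimately have "ilen R X (carrier R) + ilen R X S' = ilen R X (carrier R) + ilen R P X"
    using 2 by (simp add: add.commute)
  then have "ilen R X S' = ilen R P X"
    using \<open>ilen R X (carrier R) \<noteq> \<infinity>\<close> by (simp add: enat_add_left_cancel)
  then show ?thesis using 1 by simp
qed

section \<open>The length formula\<close>

text \<open>The two intervals from the maps into I to the conormal maps and from X to I' are cut at the
  scaled maps and at S'. The upper piece of the second one has the same length as the lower
  piece of the first one.\<close>
lemma length_formula:
  "module_length R (ext1 R IM IM) + module_length R (residue_module R I)
    = module_length R (end_mod_base R I) + module_length R (conormal_tensor_canonical R I)"
proof -
  let ?MI = "map_module I (ring_module R)"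
  have MIm: "module R ?MI" by (rule map_module_module[OF ring_module_module])
  interpret MI: module R ?MI by (rule MIm)
  have "scaled_maps \<subseteq> conormal_maps" by (auto simp: scaled_maps_def)
  then have "len R ?MI (I \<rightarrow>\<^sub>E I) conormal_maps = len R ?MI (I \<rightarrow>\<^sub>E I) scaled_maps + len R ?MI scaled_maps conormal_maps"
    by (rule MI.len_add[OF conormal_maps_submodule(2) len_ext1_self(1) conormal_maps_submodule(1) maps_into_I_scaled])
  then have 1: "module_length R (conormal_tensor_canonical R I) = ilen R S' I' + module_length R (ext1 R IM IM)"
    unfolding conormal_tensor_lengths(1) len_scaled_maps len_ext1_self(2) .
  have "ilen R I (carrier R) = ilen R X I'" by (rule dual_len[OF I regular_x xI, symmetric])
  also have "\<dots> = ilen R X S' + ilen R S' I'" by (rule ilen_add[OF Xp(1) S'_ideal I'_ideal X_le_S' S'_le_I'])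
  finally have 2: "module_length R (residue_module R I) = module_length R (end_mod_base R I) + ilen R S' I'"
    unfolding len_residue len_end_mod_base .
  show ?thesis unfolding 1 2 by (simp add: ac_simps)
qed

text \<open>R/I is cut at the trace ideal, and the upper piece has the length of S/R.\<close>
lemma trace_length:
  "module_length R (residue_module R I)
    = module_length R (quot_module (ideal_module R (trace_ideal R I)) I) + module_length R (end_mod_base R I)"
  unfolding len_residue len_end_mod_base trace_ideal_eq module_length_ideal_quotient[OF tr_ideal I I_le_tr] len_trace[symmetric]
  by (rule ilen_add[OF I tr_ideal carrier_ideal I_le_tr idealE(1)[OF tr_ideal]])

lemma residue_length_finite: "module_length R (residue_module R I) \<noteq> \<infinity>"
  unfolding len_residue by (rule ilen_finite[OF I regular_x xI])

end

lemma module_length_zero_iff: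
  fixes M :: "('a, 'm) module"
  assumes M: "module R M" shows "module_length R M = 0 \<longleftrightarrow> carrier M = {\<zero>\<^bsub>M\<^esub>}"
proof
  interpret module R M by (rule M)
  show "carrier M = {\<zero>\<^bsub>M\<^esub>}" if 0: "module_length R M = 0"
  proof (rule ccontr)
    assume "carrier M \<noteq> {\<zero>\<^bsub>M\<^esub>}"
    then have "{\<zero>\<^bsub>M\<^esub>} \<subset> carrier M" using M.zero_closed by blast
    then have "len R M {\<zero>\<^bsub>M\<^esub>} {\<zero>\<^bsub>M\<^esub>} + 1 \<le> len R M {\<zero>\<^bsub>M\<^esub>} (carrier M)"
      by (intro len_strict zero_submodule carrier_is_submodule order_refl)
    then have "len R M {\<zero>\<^bsub>M\<^esub>} {\<zero>\<^bsub>M\<^esub>} + 1 \<le> 0" using 0 module_length_eq_len[OF M] by simp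
    then show False by simp
  qed
  show "module_length R M = 0" if "carrier M = {\<zero>\<^bsub>M\<^esub>}"
    using len_self[OF zero_submodule] module_length_eq_len[OF M] that by simp
qed

lemma length_cancel:
  fixes e r s c t :: enat
  assumes "e + r = s + c" "r = t + s" "r \<noteq> \<infinity>"
  shows "e = 0 \<longleftrightarrow> t = c" and "ereal_of_enat r - ereal_of_enat s = ereal_of_enat c \<longleftrightarrow> t = c"
  using assms by (cases e; cases r; cases s; cases c; cases t; auto simp: zero_enat_def)+

context gorenstein_ideal begin

lemma length_formula_and_equivalences:
  shows "module_length R (ext1 R (ideal_module R I) (ideal_module R I))
           + module_length R (residue_module R I)
         = module_length R (end_mod_base R I)
           + module_length R (conormal_tensor_canonical R I)
    \<and> (rigid_module R (ideal_module R I) \<longleftrightarrow>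
         ereal_of_enat (module_length R (residue_module R I))
           - ereal_of_enat (module_length R (end_mod_base R I))
         = ereal_of_enat (module_length R (conormal_tensor_canonical R I)))
    \<and> (ereal_of_enat (module_length R (residue_module R I))
           - ereal_of_enat (module_length R (end_mod_base R I))
         = ereal_of_enat (module_length R (conormal_tensor_canonical R I)) \<longleftrightarrow>
       module_length R (quot_module (ideal_module R (trace_ideal R I)) I)
         = module_length R (tensor_module R (conormal_module R I) (canonical_module R I)))"
proof -
  let ?e = "module_length R (ext1 R IM IM)" and ?r = "module_length R (residue_module R I)"
    and ?s = "module_length R (end_mod_base R I)" and ?c = "module_length R (conormal_tensor_canonical R I)"
    and ?t = "module_length R (quot_module (ideal_module R (trace_ideal R I)) I)"
  have formula: "?e + ?r = ?s + ?c" by (rule length_formula)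
  have trace: "?r = ?t + ?s" by (rule trace_length)
  note cancel = length_cancel[OF formula trace residue_length_finite]
  have E: "module R (ext1 R IM IM)"
    unfolding ext1_eq by (rule quot_module_module[OF ext_maps_module[OF IM IM] ext_trivial_maps_submodule[OF IM IM]])
  have rigid: "rigid_module R IM \<longleftrightarrow> ?e = 0"
    unfolding rigid_module_def module_length_zero_iff[OF E] ..
  have tens: "module_length R (tensor_module R (conormal_module R I) (canonical_module R I)) = ?c"
    unfolding conormal_tensor_lengths ..
  show ?thesis
    unfolding rigid tens cancel using formula by (intro conjI refl iffI) (assumption | rule sym, assumption)+
qed

end

theorem proposition5p6:
  fixes R :: "('a, 'r) ring_scheme" and I :: "'a set"
  assumes "gorenstein_local_ring TYPE('e) R"
    and "krull_dim R = 1"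
    and "ideal I R"
    and "\<exists>x\<in>I. regular_element R x"
  shows "module_length R (ext1 R (ideal_module R I) (ideal_module R I))
           + module_length R (residue_module R I)
         = module_length R (end_mod_base R I)
           + module_length R (conormal_tensor_canonical R I)
    \<and> (rigid_module R (ideal_module R I) \<longleftrightarrow>
         ereal_of_enat (module_length R (residue_module R I))
           - ereal_of_enat (module_length R (end_mod_base R I))
         = ereal_of_enat (module_length R (conormal_tensor_canonical R I)))
    \<and> (ereal_of_enat (module_length R (residue_module R I))
           - ereal_of_enat (module_length R (end_mod_base R I))
         = ereal_of_enat (module_length R (conormal_tensor_canonical R I)) \<longleftrightarrow>
       module_length R (quot_module (ideal_module R (trace_ideal R I)) I)
         = module_length R (tensor_module R (conormal_module R I) (canonical_module R I)))"
proof -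
  obtain \<mm> where "gorenstein_dim1 R \<mm>" using gorenstein_dim1I[OF assms(1,2)] by blast
  moreover obtain x where "x \<in> I" "regular_element R x" using assms(4) by blast
  ultimately have "gorenstein_ideal R \<mm> I x"
    using assms(3) by (intro gorenstein_ideal.intro gorenstein_ideal_axioms.intro)
  then show ?thesis by (rule gorenstein_ideal.length_formula_and_equivalences)
qed

end
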